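(* Let $\theta\in\mathbb{R}$ and $x>0$. Let $\mathcal{H}^\theta=(\mathcal{H}^{\theta,a})_{a>0}$ be the height process with parameter $\theta$, i.e. a family of continuous processes such that $\mathcal{H}^{\theta,a}$ is a Brownian motion with drift $-2\theta$ reflected in $[0,a]$ and started at $0$, and $\pi_{a,b}(\mathcal{H}^{\theta,a})=\mathcal{H}^{\theta,b}$ for all $a>b>0$. Let $Z^\theta=(Z^\theta_r,r\ge 0)$ be defined by $Z^\theta_r=L^{\theta,a}_r(T^{\theta,a}_x)$ for any $a\ge r$, $a>0$, where $L^{\theta,a}_r(t)$ is the local time of $\mathcal{H}^{\theta,a}$ at level $r$ up to time $t$ and $T^{\theta,a}_x=\inf\{t\ge 0:\ L^{\theta,a}_0(t)>x\}$. Then $Z^\theta$ is a continuous state branching process with branching mechanism $\psi_\theta(u)=2u^2+4\theta u$.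
   Context: Reflected Brownian motion. For $\theta\in\mathbb{R}$, $a>0$, the Brownian motion with drift $-2\theta$ reflected in $[0,a]$ and started at $0$ is the unique $[0,a]$-valued continuous solution of $dY_t=d\beta_t-2\theta\,dt+\frac12 dL_0(t)-\frac12 dL_a(t)$, $Y_0=0$, where $\beta$ is a standard Brownian motion and $L_r(t)$ is the local time of $Y$ at level $r$ up to time $t$. Local times are normalized as occupation densities with respect to Lebesgue measure: $\int_0^t g(Y_s)\,ds=\int_0^a g(r)L_r(t)\,dr$ for non-negative measurable $g$, with the version continuous in $(r,t)\in[0,a]\times[0,\infty)$. Projection. For $a>b>0$ and a continuous $\varphi:\mathbb{R}_+\to[0,a]$, set $C_\varphi(t)=\inf\{r\ge0:\int_0^r\mathbf 1_{\{\varphi(s)\le b\}}ds>t\}$ and $\pi_{a,b}(\varphi)=\varphi\circ C_\varphi$ (conventions: $\inf\emptyset=\infty$, $\varphi(\infty)=b$). A family $\mathcal{H}^\theta$ as in the claim exists as a projective limit, because $\pi_{a,b}$ maps the law of reflected Brownian motion in $[0,a]$ with drift $-2\theta$ to that in $[0,b]$. The compatibility relation $\pi_{a,b}(\mathcal{H}^{\theta,a})=\mathcal{H}^{\theta,b}$ implies $L^{\theta,a}_r(T^{\theta,a}_x)=L^{\theta,b}_r(T^{\theta,b}_x)$ for $a\ge b\ge r$, so $Z^\theta_r$ does not depend on the choice of $a\ge r$; note $Z^\theta_0=x$. Continuous state branching process (CB). A CB with branching mechanism $\psi_\theta$ is a continuous Markov process $(Z_r,r\ge0)$ with values in $\mathbb{R}_+$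 whose transition kernels satisfy, for all $r\ge 0$, $\lambda\ge0$, $z\ge0$, $\mathbb{E}[e^{-\lambda Z_r}\mid Z_0=z]=e^{-z\,u^\theta(\lambda,r)}$, where $u=u^\theta(\lambda,\cdot)$ is the unique non-negative solution of $u'(r)+\psi_\theta(u(r))=0$, $r\ge0$, $u(0)=\lambda$. *)

theory Defs
  imports "HOL-Probability.Probability"
begin

definition brownian_motion :: "'w measure \<Rightarrow> (real \<Rightarrow> 'w \<Rightarrow> real) \<Rightarrow> bool" where
  "brownian_motion M \<beta> \<longleftrightarrow>
     prob_space M \<and>
     (\<forall>t\<ge>0. \<beta> t \<in> borel_measurable M) \<and>
     (AE \<omega> in M. \<beta> 0 \<omega> = 0) \<and>
     (AE \<omega> in M. continuous_on {0..} (\<lambda>t. \<beta> t \<omega>)) \<and>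
     (\<forall>s t. 0 \<le> s \<and> s < t \<longrightarrow>
        distributed M lborel (\<lambda>\<omega>. \<beta> t \<omega> - \<beta> s \<omega>) (normal_density 0 (sqrt (t - s)))) \<and>
     (\<forall>(n::nat) (\<tau>::nat \<Rightarrow> real). 0 \<le> \<tau> 0 \<and> (\<forall>i<n. \<tau> i < \<tau> (Suc i)) \<longrightarrow>
        prob_space.indep_vars M (\<lambda>_. borel)
          (\<lambda>i \<omega>. \<beta> (\<tau> (Suc i)) \<omega> - \<beta> (\<tau> i) \<omega>) {..<n})"

text \<open>
  Time and level parameters are real numbers; only the values at times in \<open>{0..}\<close> and levels
  in \<open>{0..a}\<close> are ever constrained or used.  Local times are defined path by path, as jointly
  continuous occupation densities.  Such a density is unique on \<open>{0..a} \<times> {0..}\<close>; for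
  paths that have none (a null event below) the value is 0.
\<close>

definition is_local_time :: "real \<Rightarrow> (real \<Rightarrow> real) \<Rightarrow> (real \<Rightarrow> real \<Rightarrow> real) \<Rightarrow> bool" where
  "is_local_time a \<phi> l \<longleftrightarrow>
     continuous_on ({0..a} \<times> {0..}) (\<lambda>(r, t). l r t) \<and>
     (\<forall>r\<in>{0..a}. \<forall>t\<ge>0. 0 \<le> l r t) \<and>
     (\<forall>t\<ge>0. \<forall>g :: real \<Rightarrow> ennreal. g \<in> borel_measurable borel \<longrightarrow>
        (\<integral>\<^sup>+ s\<in>{0..t}. g (\<phi> s) \<partial>lborel) =
        (\<integral>\<^sup>+ r\<in>{0..a}. g r * ennreal (l r t) \<partial>lborel))"

definition local_time :: "real \<Rightarrow> (real \<Rightarrow> real) \<Rightarrow> real \<Rightarrow> real \<Rightarrow> real" where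
  "local_time a \<phi> r t =
     (if \<exists>l. is_local_time a \<phi> l then (SOME l. is_local_time a \<phi> l) r t else 0)"

text \<open>
  The solution of
  \<open>dY = d\<beta> - 2 \<theta> dt + 1/2 dL\<^sub>0 - 1/2 dL\<^sub>a\<close>, \<open>Y\<^sub>0 = 0\<close>.
  No filtration is needed: the occupation formula and joint continuity force the
  local times at 0 and \<open>a\<close> to be nondecreasing and to grow only while \<open>Y = 0\<close>, respectively
  \<open>Y = a\<close>.  So \<open>Y\<close> solves a two-sided Skorokhod problem and is a nonanticipating
  functional of \<open>\<beta>\<close>.
\<close>

definition reflected_brownian_motion ::
    "'w measure \<Rightarrow> real \<Rightarrow> real \<Rightarrow> (real \<Rightarrow> 'w \<Rightarrow> real) \<Rightarrow> bool" where
  "reflected_brownian_motion M \<theta> a Y \<longleftrightarrow>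
     (\<forall>t\<ge>0. Y t \<in> borel_measurable M) \<and>
     (\<forall>\<omega>\<in>space M. continuous_on {0..} (\<lambda>t. Y t \<omega>)) \<and>
     (\<forall>\<omega>\<in>space M. \<forall>t\<ge>0. Y t \<omega> \<in> {0..a}) \<and>
     (\<forall>\<omega>\<in>space M. Y 0 \<omega> = 0) \<and>
     (\<exists>\<beta>. brownian_motion M \<beta> \<and>
        (AE \<omega> in M. (\<exists>l. is_local_time a (\<lambda>s. Y s \<omega>) l) \<and>
           (\<forall>t\<ge>0. Y t \<omega> = \<beta> t \<omega> - 2 * \<theta> * t
              + 1/2 * local_time a (\<lambda>s. Y s \<omega>) 0 t
              - 1/2 * local_time a (\<lambda>s. Y s \<omega>) a t)))"

definition clock_below :: "real \<Rightarrow> (real \<Rightarrow> real) \<Rightarrow> real \<Rightarrow> ereal" where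
  "clock_below b \<phi> t =
     (INF r\<in>{r. 0 \<le> r \<and> t < (LINT s:{0..r}|lborel. indicator {..b} (\<phi> s))}. ereal r)"

text \<open>
  The projection \<open>\<pi>\<^bsub>a,b\<^esub>\<close>; the bound \<open>a\<close> only restricts its domain.  The value at an
  infinite clock time is \<open>b\<close>.
\<close>

definition path_proj :: "real \<Rightarrow> (real \<Rightarrow> real) \<Rightarrow> real \<Rightarrow> real" where
  "path_proj b \<phi> t =
     (if clock_below b \<phi> t = \<infinity> then b else \<phi> (real_of_ereal (clock_below b \<phi> t)))"

definition height_process ::
    "'w measure \<Rightarrow> real \<Rightarrow> (real \<Rightarrow> real \<Rightarrow> 'w \<Rightarrow> real) \<Rightarrow> bool" where
  "height_process M \<theta> H \<longleftrightarrow>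
     (\<forall>a>0. reflected_brownian_motion M \<theta> a (H a)) \<and>
     (AE \<omega> in M. \<forall>a b t. 0 < b \<and> b < a \<and> 0 \<le> t \<longrightarrow>
        path_proj b (\<lambda>s. H a s \<omega>) t = H b t \<omega>)"

definition inverse_local_time :: "real \<Rightarrow> (real \<Rightarrow> real) \<Rightarrow> real \<Rightarrow> ereal" where
  "inverse_local_time a \<phi> x = (INF t\<in>{t. 0 \<le> t \<and> x < local_time a \<phi> 0 t}. ereal t)"

text \<open>
  \<open>L\<^sub>r(T\<^sub>x)\<close>.  For reflected Brownian motion \<open>T\<^sub>x\<close> is almost surely finite; on the null event
  where it is infinite, \<open>real_of_ereal\<close> replaces it by 0.
\<close>

definition local_time_at_inverse :: "real \<Rightarrow> (real \<Rightarrow> real) \<Rightarrow> real \<Rightarrow> real \<Rightarrow> real" where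
  "local_time_at_inverse a \<phi> x r =
     local_time a \<phi> r (real_of_ereal (inverse_local_time a \<phi> x))"

abbreviation borel_nonneg :: "real measure" where
  "borel_nonneg \<equiv> restrict_space borel {0..}"

definition transition_semigroup :: "(real \<Rightarrow> real \<Rightarrow> real measure) \<Rightarrow> bool" where
  "transition_semigroup K \<longleftrightarrow>
     (\<forall>r\<ge>0. K r \<in> borel_nonneg \<rightarrow>\<^sub>M prob_algebra borel_nonneg) \<and>
     (\<forall>z\<ge>0. K 0 z = return borel_nonneg z) \<and>
     (\<forall>r\<ge>0. \<forall>s\<ge>0. \<forall>z\<ge>0. K (r + s) z = K r z \<bind> K s)"

definition natural_filtration :: "'w measure \<Rightarrow> (real \<Rightarrow> 'w \<Rightarrow> real) \<Rightarrow> real \<Rightarrow> 'w measure" where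
  "natural_filtration M Z s =
     sigma (space M) (\<Union>v\<in>{0..s}. {Z v -` B \<inter> space M | B. B \<in> sets borel})"

definition markov_process ::
    "'w measure \<Rightarrow> (real \<Rightarrow> real \<Rightarrow> real measure) \<Rightarrow> (real \<Rightarrow> 'w \<Rightarrow> real) \<Rightarrow> bool" where
  "markov_process M K Z \<longleftrightarrow>
     prob_space M \<and>
     transition_semigroup K \<and>
     (\<forall>r\<ge>0. Z r \<in> M \<rightarrow>\<^sub>M borel_nonneg) \<and>
     (\<forall>s\<ge>0. \<forall>r\<ge>0. \<forall>B\<in>sets borel_nonneg.
        AE \<omega> in M. real_cond_exp M (natural_filtration M Z s) (\<lambda>\<omega>. indicator B (Z (s + r) \<omega>)) \<omega>
          = measure (K r (Z s \<omega>)) B)"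

definition cb_ode_solution :: "(real \<Rightarrow> real) \<Rightarrow> real \<Rightarrow> (real \<Rightarrow> real) \<Rightarrow> bool" where
  "cb_ode_solution \<psi> q u \<longleftrightarrow>
     u 0 = q \<and>
     (\<forall>r\<ge>0. 0 \<le> u r \<and> (u has_real_derivative - \<psi> (u r)) (at r within {0..}))"

text \<open>
  The value at \<open>r\<close> of the unique solution.  The description is applied to the value because the
  solution is unique only on \<open>{0..}\<close>, not as a function on all reals.
\<close>

definition cb_exponent :: "(real \<Rightarrow> real) \<Rightarrow> real \<Rightarrow> real \<Rightarrow> real" where
  "cb_exponent \<psi> q r = (THE v. \<exists>u. cb_ode_solution \<psi> q u \<and> v = u r)"

definition cb_process ::
    "'w measure \<Rightarrow> (real \<Rightarrow> real) \<Rightarrow> (real \<Rightarrow> 'w \<Rightarrow> real) \<Rightarrow> bool" where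
  "cb_process M \<psi> Z \<longleftrightarrow>
     (AE \<omega> in M. continuous_on {0..} (\<lambda>r. Z r \<omega>)) \<and>
     (\<exists>K. markov_process M K Z \<and>
        (\<forall>r\<ge>0. \<forall>q\<ge>0. \<forall>z\<ge>0.
           (\<integral>y. exp (- q * y) \<partial>K r z) = exp (- z * cb_exponent \<psi> q r)))"

end

theory Submission
  imports Defs
begin

text \<open>Let \<open>Y\<close> be Brownian motion with drift \<open>- 2 \<theta>\<close> reflected in \<open>{0..a}\<close>, let \<open>v(r) = \<integral>\<^sub>r\<^sup>a g\<close>, \<open>h(r) = 2 \<integral>\<^sub>r\<^sup>a v\<close> and
  \<open>f = \<psi>\<^sub>\<theta>(v) - v'\<close>. By Ito's formula \<open>exp (h(Y\<^sub>t) - h(0) + v(0) L\<^sub>0(t) - \<integral>\<^sub>0\<^sup>t f(Y))\<close> is the stochastic exponential of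
  \<open>- 2 \<integral> v(Y) d\<beta>\<close>, a martingale; as \<open>Y = 0\<close> at the time \<open>T\<^sub>x\<close>, optional stopping there gives
  \<open>E exp (- \<integral> f(r) Z\<^sub>r dr) = exp (- x v(0))\<close>. Letting \<open>f\<close> tend to a sum of point masses turns \<open>v\<close> into the solution of
  \<open>v' = \<psi>\<^sub>\<theta>(v)\<close> with jumps, that is, into the exponent of the finite dimensional laws of a continuous
  state branching process, and these determine the Markov property by uniqueness of Laplace
  transforms. Stochastic integrals are avoided: along a dyadic grid the exponential martingale is
  exact for the Gaussian increments of \<open>\<beta>\<close>, and only almost sure limits along the grids are taken.\<close>

section \<open>Local times of paths\<close>

text \<open>The normalisation \<open>v a = 0\<close> removes the local time at \<open>a\<close> from
  Ito's formula: since h' = - 2 v, the two pushes of the reflection contribute - v(0) dL_0 and v(a)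
  dL_a. Only \<open>v 0 * L 0\<close> survives, and stopping at \<open>T\<^sub>x\<close> freezes it
  at \<open>v 0 * x\<close>. As v is bounded, the discrete exponentials are bounded in L2 up to a
  fixed time, which lets their means pass to the limit. Three obstacles shape the rest. Local times
  are given only path by path through the occupation formula, so their measurability, adaptedness
  and behaviour under projection are all extracted from that formula. Finiteness of
  \<open>T\<^sub>x\<close> has to be proved; it follows from the same exponential, with g chosen so
  that f is bounded below by a positive constant. Finally the bound \<open>a r\<close> may be a
  different real at every level, so almost sure statements are first proved for countably many
  heights and then carried to all others by the projections.\<close>

lemma continuous_le_of_nn_integral_le:
  fixes p q :: "real \<Rightarrow> real"
  assumes a: "0 < a" and p: "continuous_on {0..a} p" and q: "continuous_on {0..a} q"
    and q0: "\<And>r. r \<in> {0..a} \<Longrightarrow> 0 \<le> q r"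
    and r0: "r0 \<in> {0..a}" and \<eta>: "0 < \<eta>"
    and le: "\<And>c d. c < d \<Longrightarrow> {c..d} \<subseteq> {0..a} \<Longrightarrow> {c..d} \<subseteq> {r0-\<eta><..<r0+\<eta>} \<Longrightarrow>
       (\<integral>\<^sup>+ r\<in>{c..d}. ennreal (p r) \<partial>lborel) \<le> (\<integral>\<^sup>+ r\<in>{c..d}. ennreal (q r) \<partial>lborel)"
  shows "p r0 \<le> q r0"
proof (rule ccontr)
  assume "\<not> p r0 \<le> q r0"
  define \<delta> where "\<delta> = (p r0 - q r0) / 2"
  have \<delta>: "0 < \<delta>" using \<open>\<not> p r0 \<le> q r0\<close> by (simp add: \<delta>_def)
  have "continuous_on {0..a} (\<lambda>r. p r - q r)"
    by (intro continuous_intros p q)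
  then obtain e where e: "0 < e"
    and e2: "\<And>r. r \<in> {0..a} \<Longrightarrow> dist r r0 < e \<Longrightarrow> dist (p r - q r) (p r0 - q r0) < \<delta>"
    using r0 \<delta> unfolding continuous_on_iff by meson
  define m where "m = min e \<eta> / 2"
  \<comment> \<open>Clipping to \<open>{0..a}\<close> makes the interval one-sided when
    \<open>r0\<close> is an end point, but never degenerate.\<close>
  define c where "c = max 0 (r0 - m)"
  define d where "d = min a (r0 + m)"
  have m: "0 < m" "m < e" "m < \<eta>" using e \<eta> by (auto simp: m_def)
  have cd: "c < d" "{c..d} \<subseteq> {0..a}" "{c..d} \<subseteq> {r0-\<eta><..<r0+\<eta>}"
    using m a r0 by (auto simp: c_def d_def)
  have pq: "q r + \<delta> \<le> p r" if "r \<in> {c..d}" for r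
  proof -
    have "r \<in> {0..a}" "dist r r0 < e" using that cd m by (auto simp: c_def d_def dist_real_def)
    from e2[OF this] have "\<bar>p r - q r - (p r0 - q r0)\<bar> < \<delta>" by (simp add: dist_real_def)
    then show ?thesis unfolding \<delta>_def abs_less_iff by (simp add: field_simps)
  qed
  have qc: "continuous_on {c..d} q" using q cd(2) continuous_on_subset by blast
  have qb: "(\<integral>\<^sup>+ r\<in>{c..d}. ennreal (q r) \<partial>lborel) = ennreal (integral {c..d} q)"
    using cd(2) q0 by (intro nn_integral_has_integral_lebesgue' integrable_integral
        integrable_continuous_real qc) (auto)
  have qm: "(\<lambda>r. ennreal (q r) * indicator {c..d} r) \<in> borel_measurable lborel"
    using borel_measurable_continuous_on_indicator[OF _ qc]
    by (subst ennreal_indicator[symmetric], subst ennreal_mult''[symmetric]) (auto simp: mult.commute)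
  have "(\<integral>\<^sup>+ r\<in>{c..d}. ennreal (q r) \<partial>lborel) + ennreal \<delta> * ennreal (d - c)
      = (\<integral>\<^sup>+ r. ennreal (q r) * indicator {c..d} r + ennreal \<delta> * indicator {c..d} r \<partial>lborel)"
    using cd qm by (subst nn_integral_add) (auto simp: nn_integral_cmult_indicator)
  also have "\<dots> \<le> (\<integral>\<^sup>+ r\<in>{c..d}. ennreal (p r) \<partial>lborel)"
  proof (intro nn_integral_mono)
    fix r
    show "ennreal (q r) * indicator {c..d} r + ennreal \<delta> * indicator {c..d} r \<le> ennreal (p r) * indicator {c..d} r"
      using pq[of r] q0[of r] cd \<delta> by (auto simp: indicator_def ennreal_plus[symmetric] simp del: ennreal_plus intro!: ennreal_leI)
  qed
  also have "\<dots> \<le> (\<integral>\<^sup>+ r\<in>{c..d}. ennreal (q r) \<partial>lborel)" by (rule le[OF cd])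
  finally have "ennreal (integral {c..d} q) + ennreal (\<delta> * (d - c)) \<le> ennreal (integral {c..d} q)"
    using cd \<delta> by (simp add: qb ennreal_mult)
  moreover have "0 \<le> integral {c..d} q" using cd q0 by (intro integral_nonneg integrable_continuous_real qc) auto
  moreover have "0 < \<delta> * (d - c)" using cd \<delta> by simp
  ultimately show False by (simp add: ennreal_plus[symmetric] del: ennreal_plus)
qed

lemma local_timeD:
  assumes "is_local_time a \<phi> l"
  shows "continuous_on ({0..a} \<times> {0..}) (\<lambda>(r, t). l r t)"
    and "r \<in> {0..a} \<Longrightarrow> 0 \<le> t \<Longrightarrow> 0 \<le> l r t"
    and "0 \<le> t \<Longrightarrow> g \<in> borel_measurable borel \<Longrightarrow> (\<integral>\<^sup>+ s\<in>{0..t}. g (\<phi> s) \<partial>lborel) =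
        (\<integral>\<^sup>+ r\<in>{0..a}. g r * ennreal (l r t) \<partial>lborel)"
    and "0 \<le> t \<Longrightarrow> continuous_on {0..a} (\<lambda>r. l r t)"
    and "r \<in> {0..a} \<Longrightarrow> continuous_on {0..} (l r)"
proof -
  show c: "continuous_on ({0..a} \<times> {0..}) (\<lambda>(r, t). l r t)"
    and "r \<in> {0..a} \<Longrightarrow> 0 \<le> t \<Longrightarrow> 0 \<le> l r t"
    using assms unfolding is_local_time_def by auto
  show "(\<integral>\<^sup>+ s\<in>{0..t}. g (\<phi> s) \<partial>lborel) = (\<integral>\<^sup>+ r\<in>{0..a}. g r * ennreal (l r t) \<partial>lborel)"
    if "0 \<le> t" "g \<in> borel_measurable borel" for g :: "real \<Rightarrow> ennreal"
    using assms that unfolding is_local_time_def by auto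
  show "continuous_on {0..a} (\<lambda>r. l r t)" if "0 \<le> t"
    using continuous_on_compose2[OF c, of "{0..a}" "\<lambda>r. (r, t)"] that
    by (simp add: continuous_on_Pair image_subset_iff)
  show "continuous_on {0..} (l r)" if "r \<in> {0..a}"
    using continuous_on_compose2[OF c, of "{0..}" "\<lambda>t. (r, t)"] that
    by (simp add: continuous_on_Pair image_subset_iff)
qed

text \<open>A local time is known only through occupation integrals, so a comparison at one level is
  read off from the occupation of small intervals around it. Monotonicity in time, uniqueness and
  flatness are all instances: only the visits close to \<open>r0\<close> have to be
  compared.\<close>

lemma local_time_le:
  assumes a: "0 < a" and l: "is_local_time a \<phi> l" and k: "is_local_time a \<phi> k"
    and r0: "r0 \<in> {0..a}" and st: "0 \<le> s" "0 \<le> t" and \<eta>: "0 < \<eta>"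
    and le: "\<And>u. \<phi> u \<in> {r0-\<eta><..<r0+\<eta>} \<Longrightarrow> u \<in> {0..s} \<Longrightarrow> u \<in> {0..t}"
  shows "l r0 s \<le> k r0 t"
proof (rule continuous_le_of_nn_integral_le[OF a _ _ _ r0 \<eta>])
  show "continuous_on {0..a} (\<lambda>r. l r s)" "continuous_on {0..a} (\<lambda>r. k r t)"
    using local_timeD(4)[OF l] local_timeD(4)[OF k] st by auto
  show "\<And>r. r \<in> {0..a} \<Longrightarrow> 0 \<le> k r t" using local_timeD(2)[OF k] st by auto
  fix c d assume cd: "c < d" "{c..d} \<subseteq> {0..a}" "{c..d} \<subseteq> {r0-\<eta><..<r0+\<eta>}"
  have *: "(\<integral>\<^sup>+ r\<in>{c..d}. ennreal (p r t) \<partial>lborel) = (\<integral>\<^sup>+ s\<in>{0..t}. indicator {c..d} (\<phi> s) \<partial>lborel)"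
    if "is_local_time a \<phi> p" "0 \<le> t" for p t
    by (subst local_timeD(3)[OF that]) (use cd in \<open>auto intro!: nn_integral_cong simp: indicator_def\<close>)
  show "(\<integral>\<^sup>+ r\<in>{c..d}. ennreal (l r s) \<partial>lborel) \<le> (\<integral>\<^sup>+ r\<in>{c..d}. ennreal (k r t) \<partial>lborel)"
    unfolding *[OF l st(1)] *[OF k st(2)]
    using le cd(3) by (intro nn_integral_mono) (auto simp: indicator_def)
qed

lemma local_time_mono:
  assumes "0 < a" "is_local_time a \<phi> l" "r \<in> {0..a}" "0 \<le> s" "s \<le> t"
  shows "l r s \<le> l r t"
  by (rule local_time_le[OF assms(1,2,2,3), of _ _ 1]) (use assms in auto)

lemma local_time_unique:
  assumes "0 < a" "is_local_time a \<phi> l" "is_local_time a \<phi> k" "r \<in> {0..a}" "0 \<le> t"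
  shows "l r t = k r t"
  using local_time_le[OF assms(1,2,3,4), of t t 1] local_time_le[OF assms(1,3,2,4), of t t 1] assms
  by auto

lemma is_local_time_cong:
  assumes "\<And>s. 0 \<le> s \<Longrightarrow> \<phi> s = \<phi>' s"
  shows "is_local_time a \<phi> l \<longleftrightarrow> is_local_time a \<phi>' l"
proof -
  have "(\<integral>\<^sup>+ s\<in>{0..t}. g (\<phi> s) \<partial>lborel) = (\<integral>\<^sup>+ s\<in>{0..t}. g (\<phi>' s) \<partial>lborel)" for g t
    by (intro nn_integral_cong) (auto simp: assms indicator_def)
  then show ?thesis by (simp add: is_local_time_def)
qed

lemma local_time_eq:
  assumes "0 < a" "is_local_time a \<phi> l" "r \<in> {0..a}" "0 \<le> t"
  shows "local_time a \<phi> r t = l r t"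
proof -
  have "is_local_time a \<phi> (SOME l. is_local_time a \<phi> l)"
    using assms(2) by (rule someI[where P="is_local_time a \<phi>"])
  then show ?thesis using local_time_unique[OF assms(1) _ assms(2-4)] assms(2)
    unfolding local_time_def by auto
qed

lemma is_local_time_local_time:
  assumes "is_local_time a \<phi> l" shows "is_local_time a \<phi> (local_time a \<phi>)"
proof -
  have "is_local_time a \<phi> (SOME l. is_local_time a \<phi> l)"
    using assms by (rule someI[where P="is_local_time a \<phi>"])
  moreover have "local_time a \<phi> = (SOME l. is_local_time a \<phi> l)"
    using assms unfolding local_time_def by (auto simp: fun_eq_iff)
  ultimately show ?thesis by simp
qed

lemma local_time_cong:
  assumes "\<And>s. 0 \<le> s \<Longrightarrow> \<phi> s = \<phi>' s"
  shows "local_time a \<phi> = local_time a \<phi>'"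
proof -
  have "is_local_time a \<phi> = is_local_time a \<phi>'"
    using is_local_time_cong[of \<phi> \<phi>' a, OF assms] by (auto simp: fun_eq_iff)
  then show ?thesis by (intro ext) (simp only: local_time_def)
qed

lemma local_time_0:
  assumes a: "0 < a" and l: "is_local_time a \<phi> l" and r: "r \<in> {0..a}"
  shows "l r 0 = 0"
proof -
  have "l r 0 \<le> 0"
  proof (rule continuous_le_of_nn_integral_le[OF a local_timeD(4)[OF l] continuous_on_const _ r zero_less_one])
    fix c d :: real assume cd: "{c..d} \<subseteq> {0..a}"
    have "(\<integral>\<^sup>+ r\<in>{c..d}. ennreal (l r 0) \<partial>lborel) = (\<integral>\<^sup>+ s\<in>{0..0}. indicator {c..d} (\<phi> s) \<partial>lborel)"
      by (subst local_timeD(3)[OF l order.refl]) (use cd in \<open>auto intro!: nn_integral_cong simp: indicator_def\<close>)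
    also have "\<dots> \<le> (\<integral>\<^sup>+ s. indicator {0::real} s \<partial>lborel)"
      by (intro nn_integral_mono) (auto simp: indicator_def)
    also have "\<dots> = 0" by simp
    finally show "(\<integral>\<^sup>+ r\<in>{c..d}. ennreal (l r 0) \<partial>lborel) \<le> (\<integral>\<^sup>+ r\<in>{c..d}. ennreal 0 \<partial>lborel)" by simp
  qed auto
  with local_timeD(2)[OF l r order.refl] show ?thesis by auto
qed

text \<open>On a compact interval strictly inside \<open>{s<..<t}\<close> the path keeps a positive
  distance from \<open>r\<close>, and this distance serves as the radius in
  \<open>local_time_le\<close>. Continuity of the local time in time then reaches the end points,
  where the path may be at \<open>r\<close>.\<close>

lemma local_time_flat:
  assumes a: "0 < a" and l: "is_local_time a \<phi> l" and r: "r \<in> {0..a}" and st: "0 \<le> s" "s \<le> t"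
    and c: "continuous_on {s..t} \<phi>" and ne: "\<And>u. u \<in> {s<..<t} \<Longrightarrow> \<phi> u \<noteq> r"
  shows "l r s = l r t"
proof -
  have cl: "continuous_on {0..} (l r)" by (rule local_timeD(5)[OF l r])
  have eq: "l r s' = l r t'" if s't': "s < s'" "s' \<le> t'" "t' < t" for s' t'
  proof -
    have "continuous_on {s'..t'} (\<lambda>u. \<bar>\<phi> u - r\<bar>)"
      using s't' by (intro continuous_intros continuous_on_subset[OF c]) auto
    then obtain u0 where u0: "u0 \<in> {s'..t'}" "\<And>u. u \<in> {s'..t'} \<Longrightarrow> \<bar>\<phi> u0 - r\<bar> \<le> \<bar>\<phi> u - r\<bar>"
      using continuous_attains_inf[of "{s'..t'}" "\<lambda>u. \<bar>\<phi> u - r\<bar>"] s't' by auto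
    have "0 < \<bar>\<phi> u0 - r\<bar>" using ne[of u0] u0(1) s't' by auto
    then have "l r t' \<le> l r s'"
      by (rule local_time_le[OF a l l r, rotated 2])
         (use u0 s't' st in \<open>force simp: abs_if split: if_splits\<close>)+
    moreover have "l r s' \<le> l r t'" using local_time_mono[OF a l r, of s' t'] s't' st by auto
    ultimately show ?thesis by auto
  qed
  show ?thesis
  proof (cases "s = t")
    case False
    then have lt: "s < t" using st by auto
    define m where "m = (s + t) / 2"
    have m: "s < m" "m < t" using lt by (auto simp: m_def)
    define X where "X n = s + (t - s) / (2 + real n)" for n
    define X' where "X' n = t - (t - s) / (2 + real n)" for n
    have X: "s < X n" "X n \<le> m" "m \<le> X' n" "X' n < t" for n
    proof -
      define z where "z = (t - s) / (2 + real n)"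
      have "z \<le> (t - s) / 2" unfolding z_def using lt by (intro divide_left_mono) auto
      moreover have "0 < z" unfolding z_def using lt by simp
      ultimately show "s < X n" "X n \<le> m" "m \<le> X' n" "X' n < t"
        unfolding X_def X'_def m_def z_def[symmetric] by (simp_all add: field_simps)
    qed
    have "(\<lambda>n. (t - s) / (2 + real n)) \<longlonglongrightarrow> 0"
      by (intro tendsto_divide_0[OF tendsto_const] filterlim_at_top_imp_at_infinity
          filterlim_tendsto_add_at_top[OF tendsto_const] filterlim_real_sequentially)
    then have lim: "X \<longlonglongrightarrow> s" "X' \<longlonglongrightarrow> t"
      unfolding X_def X'_def by (auto intro: tendsto_eq_intros)
    have "(\<lambda>n. l r (X n)) \<longlonglongrightarrow> l r s" "(\<lambda>n. l r (X' n)) \<longlonglongrightarrow> l r t"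
      using X st lt by (auto intro!: continuous_on_tendsto_compose[OF cl] lim always_eventually
          order_trans[OF _ less_imp_le[OF X(1)]] order_trans[OF _ X(3)] simp: m_def)
    moreover have "l r (X n) = l r m" "l r (X' n) = l r m" for n
      using eq[OF X(1,2) m(2)] eq[OF m(1) X(3,4)] by auto
    ultimately show ?thesis by (simp add: LIMSEQ_const_iff)
  qed simp
qed

text \<open>The occupation formula speaks of non-negative functions only; a signed \<open>f\<close>
  is handled by adding a bound \<open>B\<close> of its absolute value and subtracting the constant
  again.\<close>

lemma occupation_integral:
  fixes f :: "real \<Rightarrow> real"
  assumes a: "0 < a" and l: "is_local_time a \<phi> l" and t: "0 \<le> t"
    and c: "continuous_on {0..} \<phi>" and rg: "\<And>s. 0 \<le> s \<Longrightarrow> \<phi> s \<in> {0..a}"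
    and f: "continuous_on {0..a} f"
  shows "integral {0..t} (\<lambda>s. f (\<phi> s)) = integral {0..a} (\<lambda>r. f r * l r t)"
proof -
  have ct: "continuous_on {0..t} \<phi>" by (rule continuous_on_subset[OF c]) auto
  have rg': "\<phi> ` {0..t} \<subseteq> {0..a}" by (intro image_subsetI rg) simp
  have pos: "integral {0..t} (\<lambda>s. f (\<phi> s)) = integral {0..a} (\<lambda>r. f r * l r t)"
    if f: "continuous_on {0..a} f" and f0: "\<And>r. r \<in> {0..a} \<Longrightarrow> 0 \<le> f r" for f :: "real \<Rightarrow> real"
  proof -
    have cf: "continuous_on {0..t} (\<lambda>s. f (\<phi> s))"
      by (rule continuous_on_compose2[OF f ct rg'])
    have cl: "continuous_on {0..a} (\<lambda>r. f r * l r t)"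
      by (intro continuous_intros f local_timeD(4)[OF l t])
    have m: "(\<lambda>r. ennreal (f r) * indicator {0..a} r) \<in> borel_measurable borel"
      using borel_measurable_continuous_on_indicator[OF _ f]
      by (subst ennreal_indicator[symmetric], subst ennreal_mult''[symmetric]) (auto simp: mult.commute)
    have "ennreal (integral {0..t} (\<lambda>s. f (\<phi> s))) = (\<integral>\<^sup>+ s\<in>{0..t}. ennreal (f (\<phi> s)) \<partial>lborel)"
      using f0 rg by (intro nn_integral_has_integral_lebesgue'[symmetric] integrable_integral
        integrable_continuous_real cf) auto
    \<comment> \<open>The indicator is inserted because \<open>f\<close> is continuous only on
      \<open>{0..a}\<close>: with it the integrand is Borel on the whole line, as the occupation
      formula demands.\<close>
    also have "\<dots> = (\<integral>\<^sup>+ s\<in>{0..t}. (ennreal (f (\<phi> s)) * indicator {0..a} (\<phi> s)) \<partial>lborel)"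
      using rg by (intro nn_integral_cong) (auto simp: indicator_def)
    also have "\<dots> = (\<integral>\<^sup>+ r\<in>{0..a}. (ennreal (f r) * indicator {0..a} r) * ennreal (l r t) \<partial>lborel)"
      by (rule local_timeD(3)[OF l t m])
    also have "\<dots> = (\<integral>\<^sup>+ r\<in>{0..a}. ennreal (f r * l r t) \<partial>lborel)"
      using f0 local_timeD(2)[OF l _ t] by (intro nn_integral_cong) (auto simp: indicator_def ennreal_mult)
    also have "\<dots> = ennreal (integral {0..a} (\<lambda>r. f r * l r t))"
      using f0 local_timeD(2)[OF l _ t] by (intro nn_integral_has_integral_lebesgue' integrable_integral
        integrable_continuous_real cl) auto
    finally have *: "ennreal (integral {0..t} (\<lambda>s. f (\<phi> s))) = ennreal (integral {0..a} (\<lambda>r. f r * l r t))" .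
    have "0 \<le> integral {0..t} (\<lambda>s. f (\<phi> s))"
      using f0 rg by (intro integral_nonneg integrable_continuous_real cf) auto
    moreover have "0 \<le> integral {0..a} (\<lambda>r. f r * l r t)"
      using f0 local_timeD(2)[OF l _ t] by (intro integral_nonneg integrable_continuous_real cl) simp
    ultimately show ?thesis using * by simp
  qed
  obtain B where B: "\<And>r. r \<in> {0..a} \<Longrightarrow> \<bar>f r\<bar> \<le> B"
    using compact_continuous_image[OF f] compact_imp_bounded
    by (metis (no_types, lifting) bounded_iff compact_Icc imageI real_norm_def)
  have B0: "0 \<le> B" using B[of 0] a by auto
  have 1: "continuous_on {0..a} (\<lambda>r. f r + B)" by (intro continuous_intros f)
  have cf: "continuous_on {0..t} (\<lambda>s. f (\<phi> s))"
    by (rule continuous_on_compose2[OF f ct rg'])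
  have cl: "continuous_on {0..a} (\<lambda>r. f r * l r t)" "continuous_on {0..a} (\<lambda>r. B * l r t)"
    by (intro continuous_intros f local_timeD(4)[OF l t])+
  have "integral {0..t} (\<lambda>s. f (\<phi> s) + B) = integral {0..a} (\<lambda>r. (f r + B) * l r t)"
  proof (rule pos[OF 1])
    show "0 \<le> f r + B" if "r \<in> {0..a}" for r using B[OF that] by linarith
  qed
  moreover have "integral {0..t} (\<lambda>s. B) = integral {0..a} (\<lambda>r. B * l r t)"
    using pos[OF continuous_on_const] B0 by auto
  moreover have "integral {0..t} (\<lambda>s. f (\<phi> s) + B) = integral {0..t} (\<lambda>s. f (\<phi> s)) + integral {0..t} (\<lambda>s. B)"
    by (intro integral_add integrable_continuous_real cf continuous_on_const)
  moreover have "integral {0..a} (\<lambda>r. (f r + B) * l r t) = integral {0..a} (\<lambda>r. f r * l r t) + integral {0..a} (\<lambda>r. B * l r t)"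
    unfolding distrib_right by (intro integral_add integrable_continuous_real cl)
  ultimately show ?thesis by linarith
qed

section \<open>Gaussian increments\<close>

lemma Int_stable_vimage: "Int_stable {f -` A \<inter> S |A. A \<in> sets N}"
proof (rule Int_stableI)
  fix a b assume "a \<in> {f -` A \<inter> S |A. A \<in> sets N}" "b \<in> {f -` A \<inter> S |A. A \<in> sets N}"
  then obtain A B where "A \<in> sets N" "B \<in> sets N" "a = f -` A \<inter> S" "b = f -` B \<inter> S" by auto
  then show "a \<inter> b \<in> {f -` A \<inter> S |A. A \<in> sets N}"
    by (intro CollectI exI[of _ "A \<inter> B"]) auto
qed

text \<open>Freezing: \<open>X\<close> is independent of \<open>F\<close>, so it can be integrated
  out while the \<open>F\<close>-measurable \<open>U\<close> is held fixed. The joint law is a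
  product measure, and Tonelli does the rest.\<close>

lemma (in prob_space) nn_integral_indep:
  assumes F: "space F = space M" "sets F \<subseteq> sets M"
    and X[measurable]: "X \<in> borel_measurable M" and U: "U \<in> F \<rightarrow>\<^sub>M N"
    and ind: "\<And>A B. A \<in> sets F \<Longrightarrow> B \<in> sets borel \<Longrightarrow>
       prob (A \<inter> (X -` B \<inter> space M)) = prob A * prob (X -` B \<inter> space M)"
    and \<phi>[measurable]: "\<phi> \<in> borel_measurable (N \<Otimes>\<^sub>M (borel :: real measure))"
  shows "(\<integral>\<^sup>+ \<omega>. \<phi> (U \<omega>, X \<omega>) \<partial>M) = (\<integral>\<^sup>+ \<omega>. (\<integral>\<^sup>+ y. \<phi> (U \<omega>, y) \<partial>distr M borel X) \<partial>M)"
proof -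
  have U'[measurable]: "U \<in> M \<rightarrow>\<^sub>M N"
    using U F unfolding measurable_def by auto
  interpret D: prob_space "distr M borel X" by (rule prob_space_distr) auto
  interpret E: prob_space "distr M N U" by (rule prob_space_distr) auto
  have prod: "distr M N U \<Otimes>\<^sub>M distr M borel X = distr M (N \<Otimes>\<^sub>M borel) (\<lambda>\<omega>. (U \<omega>, X \<omega>))"
  proof (rule pair_measure_eqI)
    fix A B assume AB: "A \<in> sets (distr M N U)" "B \<in> sets (distr M borel X)"
    then have [measurable]: "A \<in> sets N" "B \<in> sets borel" by auto
    have "U -` A \<inter> space M \<in> sets F" using measurable_sets[OF U, of A] F(1) by simp
    then have "prob ((U -` A \<inter> space M) \<inter> (X -` B \<inter> space M)) = prob (U -` A \<inter> space M) * prob (X -` B \<inter> space M)"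
      by (rule ind) auto
    moreover have "(\<lambda>\<omega>. (U \<omega>, X \<omega>)) -` (A \<times> B) \<inter> space M = (U -` A \<inter> space M) \<inter> (X -` B \<inter> space M)" by auto
    ultimately show "emeasure (distr M N U) A * emeasure (distr M borel X) B
        = emeasure (distr M (N \<Otimes>\<^sub>M borel) (\<lambda>\<omega>. (U \<omega>, X \<omega>))) (A \<times> B)"
      by (simp add: emeasure_distr emeasure_eq_measure ennreal_mult)
  qed (auto intro: E.sigma_finite_measure_axioms D.sigma_finite_measure_axioms)
  have "(\<integral>\<^sup>+ \<omega>. \<phi> (U \<omega>, X \<omega>) \<partial>M) = (\<integral>\<^sup>+ z. \<phi> z \<partial>distr M (N \<Otimes>\<^sub>M borel) (\<lambda>\<omega>. (U \<omega>, X \<omega>)))"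
    by (simp add: nn_integral_distr)
  also have "\<dots> = (\<integral>\<^sup>+ z. \<phi> z \<partial>(distr M N U \<Otimes>\<^sub>M distr M borel X))"
    by (simp add: prod)
  also have "\<dots> = (\<integral>\<^sup>+ u. (\<integral>\<^sup>+ y. \<phi> (u, y) \<partial>distr M borel X) \<partial>distr M N U)"
    by (subst D.nn_integral_fst[symmetric]) auto
  also have "\<dots> = (\<integral>\<^sup>+ \<omega>. (\<integral>\<^sup>+ y. \<phi> (U \<omega>, y) \<partial>distr M borel X) \<partial>M)"
    by (subst nn_integral_distr) auto
  finally show ?thesis .
qed

lemma gaussian_exp_moment:
  assumes d: "0 < d"
  shows "(\<integral>\<^sup>+ y. ennreal (normal_density 0 (sqrt d) y) * ennreal (exp (s * y - s\<^sup>2 * d / 2)) \<partial>lborel) = 1"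
proof -
  \<comment> \<open>Completing the square: the exponential tilt only moves the mean of the Gaussian
    from 0 to \<open>s * d\<close>.\<close>
  have "normal_density 0 (sqrt d) y * exp (s * y - s\<^sup>2 * d / 2) = normal_density (s * d) (sqrt d) y" for y
  proof -
    have "- y\<^sup>2 / (2 * d) + (s * y - s\<^sup>2 * d / 2) = - (y - s * d)\<^sup>2 / (2 * d)"
      using d by (simp add: field_simps power2_eq_square)
    then show ?thesis using d
      by (simp add: normal_density_def exp_add[symmetric])
  qed
  then have "(\<integral>\<^sup>+ y. ennreal (normal_density 0 (sqrt d) y) * ennreal (exp (s * y - s\<^sup>2 * d / 2)) \<partial>lborel)
      = (\<integral>\<^sup>+ y. ennreal (normal_density (s * d) (sqrt d) y) \<partial>lborel)"
    by (simp add: ennreal_mult[symmetric])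
  also have "\<dots> = ennreal (\<integral>y. normal_density (s * d) (sqrt d) y \<partial>lborel)"
    using d by (intro nn_integral_eq_integral) auto
  finally show ?thesis using d by simp
qed

text \<open>Brownian motion seen along one grid: \<open>X i\<close> is the increment over step
  \<open>i\<close>, of length \<open>d\<close>, and \<open>F i\<close> is what is known when the
  step begins. The index of \<open>F\<close> runs up to \<open>N\<close> included, since the last
  increment belongs to \<open>F N\<close>.\<close>

locale gaussian_steps = prob_space M for M :: "'w measure" +
  fixes F :: "nat \<Rightarrow> 'w measure" and X :: "nat \<Rightarrow> 'w \<Rightarrow> real" and N :: nat and d :: real
  assumes d_pos: "0 < d"
    and space_F: "i \<le> N \<Longrightarrow> space (F i) = space M"
    and sets_F: "i \<le> N \<Longrightarrow> sets (F i) \<subseteq> sets M"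
    and F_Suc: "i < N \<Longrightarrow> sets (F i) \<subseteq> sets (F (Suc i))"
    and X_F: "i < N \<Longrightarrow> X i \<in> borel_measurable (F (Suc i))"
    and X_indep: "i < N \<Longrightarrow> A \<in> sets (F i) \<Longrightarrow> B \<in> sets borel \<Longrightarrow>
       prob (A \<inter> (X i -` B \<inter> space M)) = prob A * prob (X i -` B \<inter> space M)"
    and X_dist: "i < N \<Longrightarrow> distributed M lborel (X i) (normal_density 0 (sqrt d))"
begin

lemma X_meas: "i < N \<Longrightarrow> X i \<in> borel_measurable M"
  using distributed_measurable[OF X_dist] by simp

lemma F_mono: "i \<le> j \<Longrightarrow> j \<le> N \<Longrightarrow> f \<in> F i \<rightarrow>\<^sub>M L \<Longrightarrow> f \<in> F j \<rightarrow>\<^sub>M L"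
proof (induction j rule: dec_induct)
  case (step n)
  then have "f \<in> F n \<rightarrow>\<^sub>M L" by auto
  then show ?case using F_Suc[of n] space_F[of n] space_F[of "Suc n"] step.prems
    unfolding measurable_def by auto
qed

lemma F_M: "i \<le> N \<Longrightarrow> f \<in> F i \<rightarrow>\<^sub>M L \<Longrightarrow> f \<in> M \<rightarrow>\<^sub>M L"
  using sets_F[of i] space_F[of i] unfolding measurable_def by auto

lemma sum_meas:
  assumes "\<And>i. i < k \<Longrightarrow> f i \<in> borel_measurable (F i)" "k \<le> N"
    and "\<And>i. (\<lambda>(s, x). g i s x) \<in> borel_measurable (borel \<Otimes>\<^sub>M borel)"
  shows "(\<lambda>\<omega>. \<Sum>i<k. (g i (f i \<omega>) (X i \<omega>) :: real)) \<in> borel_measurable (F k)"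
proof (rule borel_measurable_sum)
  fix i assume "i \<in> {..<k}"
  then have "f i \<in> borel_measurable (F k)" "X i \<in> borel_measurable (F k)"
    using assms(1)[of i] X_F[of i] assms(2) F_mono[of i k] F_mono[of "Suc i" k] by auto
  from measurable_compose[OF measurable_Pair[OF this] assms(3)[of i]]
  show "(\<lambda>\<omega>. g i (f i \<omega>) (X i \<omega>)) \<in> borel_measurable (F k)" by simp
qed

text \<open>For Gaussian increments the discrete stochastic exponential has mean exactly 1 for every
  step size, so no discretisation error has to be controlled. Given \<open>F k\<close>, the last
  factor integrates to 1 by \<open>gaussian_exp_moment\<close>.\<close>

lemma exp_martingale:
  assumes \<sigma>: "\<And>i. i < N \<Longrightarrow> \<sigma> i \<in> borel_measurable (F i)" and k: "k \<le> N"
  shows "(\<integral>\<^sup>+ \<omega>. ennreal (exp (\<Sum>i<k. \<sigma> i \<omega> * X i \<omega> - (\<sigma> i \<omega>)\<^sup>2 * d / 2)) \<partial>M) = 1"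
  using k
proof (induction k)
  case 0
  then show ?case by (simp add: emeasure_space_1)
next
  case (Suc k)
  then have k: "k < N" by simp
  define U where "U \<omega> = exp (\<Sum>i<k. \<sigma> i \<omega> * X i \<omega> - (\<sigma> i \<omega>)\<^sup>2 * d / 2)" for \<omega>
  have U: "U \<in> borel_measurable (F k)"
    unfolding U_def using sum_meas[of k \<sigma> "\<lambda>_ s x. s * x - s\<^sup>2 * d / 2"] \<sigma> k by simp
  define \<phi> where "\<phi> z = ennreal (fst (fst z)) * ennreal (exp (snd (fst z) * snd z - (snd (fst z))\<^sup>2 * d / 2))" for z :: "(real \<times> real) \<times> real"
  have "(\<integral>\<^sup>+ \<omega>. ennreal (exp (\<Sum>i<Suc k. \<sigma> i \<omega> * X i \<omega> - (\<sigma> i \<omega>)\<^sup>2 * d / 2)) \<partial>M)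
      = (\<integral>\<^sup>+ \<omega>. \<phi> ((U \<omega>, \<sigma> k \<omega>), X k \<omega>) \<partial>M)"
    by (simp add: \<phi>_def U_def exp_add ennreal_mult)
  also have "\<dots> = (\<integral>\<^sup>+ \<omega>. (\<integral>\<^sup>+ y. \<phi> ((U \<omega>, \<sigma> k \<omega>), y) \<partial>distr M borel (X k)) \<partial>M)"
  proof (rule nn_integral_indep[where F="F k" and N="borel \<Otimes>\<^sub>M borel"])
    show "(\<lambda>\<omega>. (U \<omega>, \<sigma> k \<omega>)) \<in> F k \<rightarrow>\<^sub>M borel \<Otimes>\<^sub>M borel" using U \<sigma>[OF k] by measurable
    show "\<phi> \<in> borel_measurable ((borel \<Otimes>\<^sub>M borel) \<Otimes>\<^sub>M borel)" unfolding \<phi>_def by measurable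
  qed (use k space_F sets_F X_meas X_indep in auto)
  also have "\<dots> = (\<integral>\<^sup>+ \<omega>. ennreal (U \<omega>) \<partial>M)"
  proof (rule nn_integral_cong)
    fix \<omega>
    have [measurable]: "X k \<in> borel_measurable M" by (rule X_meas[OF k])
    have "distr M lborel (X k) = density lborel (normal_density 0 (sqrt d))"
      using X_dist[OF k] by (simp add: distributed_def)
    then have "distr M borel (X k) = density lborel (normal_density 0 (sqrt d))"
      by (subst distr_cong[of M M borel lborel "X k" "X k"]) auto
    then have "(\<integral>\<^sup>+ y. \<phi> ((U \<omega>, \<sigma> k \<omega>), y) \<partial>distr M borel (X k))
        = (\<integral>\<^sup>+ y. ennreal (normal_density 0 (sqrt d) y) * \<phi> ((U \<omega>, \<sigma> k \<omega>), y) \<partial>lborel)"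
      by (simp add: nn_integral_density \<phi>_def)
    also have "\<dots> = (\<integral>\<^sup>+ y. ennreal (U \<omega>) * (ennreal (normal_density 0 (sqrt d) y) * ennreal (exp (\<sigma> k \<omega> * y - (\<sigma> k \<omega>)\<^sup>2 * d / 2))) \<partial>lborel)"
      by (intro nn_integral_cong) (simp add: \<phi>_def mult_ac)
    also have "\<dots> = ennreal (U \<omega>)"
      by (subst nn_integral_cmult) (auto simp: gaussian_exp_moment[OF d_pos])
    finally show "(\<integral>\<^sup>+ y. \<phi> ((U \<omega>, \<sigma> k \<omega>), y) \<partial>distr M borel (X k)) = ennreal (U \<omega>)" .
  qed
  also have "\<dots> = 1" using Suc by (simp add: U_def)
  finally show ?case .
qed

text \<open>The square of the exponential of \<sigma> is the exponential of 2 \<sigma> times the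
  exponential of the sum of the \<open>\<sigma>\<^sup>2 * d\<close>. The bound depends on
  \<open>N\<close> and \<open>d\<close> only through the total time \<open>N * d\<close>, so it is
  uniform over all grids with the same horizon.\<close>

lemma exp_martingale_square:
  assumes \<sigma>: "\<And>i. i < N \<Longrightarrow> \<sigma> i \<in> borel_measurable (F i)"
    and C: "\<And>i \<omega>. i < N \<Longrightarrow> \<omega> \<in> space M \<Longrightarrow> \<bar>\<sigma> i \<omega>\<bar> \<le> C"
  shows "(\<integral>\<^sup>+ \<omega>. ennreal ((exp (\<Sum>i<N. \<sigma> i \<omega> * X i \<omega> - (\<sigma> i \<omega>)\<^sup>2 * d / 2))\<^sup>2) \<partial>M) \<le> ennreal (exp (real N * (C\<^sup>2 * d)))"
proof -
  have "(\<integral>\<^sup>+ \<omega>. ennreal ((exp (\<Sum>i<N. \<sigma> i \<omega> * X i \<omega> - (\<sigma> i \<omega>)\<^sup>2 * d / 2))\<^sup>2) \<partial>M)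
     \<le> (\<integral>\<^sup>+ \<omega>. ennreal (exp (real N * (C\<^sup>2 * d))) * ennreal (exp (\<Sum>i<N. (2 * \<sigma> i \<omega>) * X i \<omega> - (2 * \<sigma> i \<omega>)\<^sup>2 * d / 2)) \<partial>M)"
  proof (rule nn_integral_mono)
    fix \<omega> assume w: "\<omega> \<in> space M"
    have "(\<Sum>i<N. (\<sigma> i \<omega>)\<^sup>2 * d) \<le> (\<Sum>i<N. C\<^sup>2 * d)"
    proof (rule sum_mono)
      fix i assume "i \<in> {..<N}"
      then have "\<bar>\<sigma> i \<omega>\<bar> \<le> \<bar>C\<bar>" using C[of i \<omega>] w by auto
      then show "(\<sigma> i \<omega>)\<^sup>2 * d \<le> C\<^sup>2 * d" using d_pos by (simp add: abs_le_square_iff)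
    qed
    moreover have "2 * (\<Sum>i<N. \<sigma> i \<omega> * X i \<omega> - (\<sigma> i \<omega>)\<^sup>2 * d / 2)
        = (\<Sum>i<N. (\<sigma> i \<omega>)\<^sup>2 * d) + (\<Sum>i<N. (2 * \<sigma> i \<omega>) * X i \<omega> - (2 * \<sigma> i \<omega>)\<^sup>2 * d / 2)"
      unfolding sum_distrib_left sum.distrib[symmetric] by (intro sum.cong) (auto simp: algebra_simps power2_eq_square)
    moreover have "(exp x)\<^sup>2 = exp (2 * x)" for x :: real by (simp add: exp_double)
    ultimately show "ennreal ((exp (\<Sum>i<N. \<sigma> i \<omega> * X i \<omega> - (\<sigma> i \<omega>)\<^sup>2 * d / 2))\<^sup>2)
       \<le> ennreal (exp (real N * (C\<^sup>2 * d))) * ennreal (exp (\<Sum>i<N. (2 * \<sigma> i \<omega>) * X i \<omega> - (2 * \<sigma> i \<omega>)\<^sup>2 * d / 2))"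
      by (simp add: ennreal_mult[symmetric] exp_add[symmetric])
  qed
  also have "\<dots> = ennreal (exp (real N * (C\<^sup>2 * d))) * 1"
  proof (subst nn_integral_cmult)
    show "(\<lambda>\<omega>. ennreal (exp (\<Sum>i<N. (2 * \<sigma> i \<omega>) * X i \<omega> - (2 * \<sigma> i \<omega>)\<^sup>2 * d / 2))) \<in> borel_measurable M"
      using F_M[OF order.refl sum_meas[of N \<sigma> "\<lambda>_ s x. (2 * s) * x - (2 * s)\<^sup>2 * d / 2"]] \<sigma> by simp
    show "ennreal (exp (real N * (C\<^sup>2 * d))) * (\<integral>\<^sup>+ \<omega>. ennreal (exp (\<Sum>i<N. (2 * \<sigma> i \<omega>) * X i \<omega> - (2 * \<sigma> i \<omega>)\<^sup>2 * d / 2)) \<partial>M) = ennreal (exp (real N * (C\<^sup>2 * d))) * 1"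
      by (subst exp_martingale) (use \<sigma> in auto)
  qed
  finally show ?thesis by simp
qed

lemma step_square_moments:
  assumes i: "i < N"
  shows "integrable M (\<lambda>\<omega>. (X i \<omega>)\<^sup>2 - d)" "expectation (\<lambda>\<omega>. (X i \<omega>)\<^sup>2 - d) = 0"
    "integrable M (\<lambda>\<omega>. ((X i \<omega>)\<^sup>2 - d)\<^sup>2)" "expectation (\<lambda>\<omega>. ((X i \<omega>)\<^sup>2 - d)\<^sup>2) = 2 * d\<^sup>2"
proof -
  have s: "0 < sqrt d" using d_pos by simp
  have f3: "fact 4 = (24::real)" by (simp add: fact_numeral)
  have 2: "has_bochner_integral lborel (\<lambda>x. normal_density 0 (sqrt d) x * x\<^sup>2) d"
    using normal_moment_even[OF s, of 0 1] d_pos by (simp add: fact_numeral)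
  have 4: "has_bochner_integral lborel (\<lambda>x. normal_density 0 (sqrt d) x * x ^ 4) (3 * d\<^sup>2)"
    using normal_moment_even[OF s, of 0 2] d_pos by (simp add: f3 fact_numeral power_divide field_simps)
  have 0: "has_bochner_integral lborel (\<lambda>x. normal_density 0 (sqrt d) x) 1"
    using s by (simp add: has_bochner_integral_iff)
  have 1: "has_bochner_integral lborel (\<lambda>x. normal_density 0 (sqrt d) x * (x\<^sup>2 - d)) (d - 1 * d)"
    unfolding right_diff_distrib
    by (intro has_bochner_integral_diff 2 has_bochner_integral_mult_left 0)
  have 3: "has_bochner_integral lborel (\<lambda>x. normal_density 0 (sqrt d) x * x ^ 4 - (normal_density 0 (sqrt d) x * x\<^sup>2) * (2 * d) + normal_density 0 (sqrt d) x * d\<^sup>2)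
     (3 * d\<^sup>2 - d * (2 * d) + 1 * d\<^sup>2)"
    by (intro has_bochner_integral_add has_bochner_integral_diff 2 4 has_bochner_integral_mult_left 0)
  have eq: "normal_density 0 (sqrt d) x * x ^ 4 - (normal_density 0 (sqrt d) x * x\<^sup>2) * (2 * d) + normal_density 0 (sqrt d) x * d\<^sup>2
      = normal_density 0 (sqrt d) x * (x\<^sup>2 - d)\<^sup>2" for x
    by (simp add: algebra_simps power2_eq_square power4_eq_xxxx)
  have 3: "has_bochner_integral lborel (\<lambda>x. normal_density 0 (sqrt d) x * (x\<^sup>2 - d)\<^sup>2) (2 * d\<^sup>2)"
    using 3 unfolding eq by (simp add: power2_eq_square)
  show "integrable M (\<lambda>\<omega>. (X i \<omega>)\<^sup>2 - d)"
    using 1 by (subst distributed_integrable[OF X_dist[OF i], symmetric]) (auto simp: has_bochner_integral_iff)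
  show "expectation (\<lambda>\<omega>. (X i \<omega>)\<^sup>2 - d) = 0"
    using 1 by (subst distributed_integral[OF X_dist[OF i], symmetric]) (auto simp: has_bochner_integral_iff)
  show "integrable M (\<lambda>\<omega>. ((X i \<omega>)\<^sup>2 - d)\<^sup>2)"
    using 3 by (subst distributed_integrable[OF X_dist[OF i], symmetric]) (auto simp: has_bochner_integral_iff)
  show "expectation (\<lambda>\<omega>. ((X i \<omega>)\<^sup>2 - d)\<^sup>2) = 2 * d\<^sup>2"
    using 3 by (subst distributed_integral[OF X_dist[OF i], symmetric]) (auto simp: has_bochner_integral_iff)
qed

lemma indep_prod:
  assumes i: "i < N" and U: "U \<in> borel_measurable (F i)" and g[measurable]: "g \<in> borel_measurable borel"
    and int: "integrable M U" "integrable M (\<lambda>\<omega>. g (X i \<omega>))"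
  shows "integrable M (\<lambda>\<omega>. U \<omega> * (g (X i \<omega>) :: real))"
    and "expectation (\<lambda>\<omega>. U \<omega> * g (X i \<omega>)) = expectation U * expectation (\<lambda>\<omega>. g (X i \<omega>))"
proof -
  have [measurable]: "X i \<in> borel_measurable M" "U \<in> borel_measurable M"
    using X_meas[OF i] F_M[OF _ U] i by auto
  have iv: "indep_var borel U borel (\<lambda>\<omega>. g (X i \<omega>))"
    unfolding indep_var_eq
  proof (intro conjI indep_set_sigma_sets indep_setI)
    show "{U -` A \<inter> space M |A. A \<in> sets borel} \<subseteq> events" "{(\<lambda>\<omega>. g (X i \<omega>)) -` A \<inter> space M |A. A \<in> sets borel} \<subseteq> events"
      by auto
    show "Int_stable {U -` A \<inter> space M |A. A \<in> sets borel}"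
      by (rule Int_stable_vimage)
    show "Int_stable {(\<lambda>\<omega>. g (X i \<omega>)) -` A \<inter> space M |A. A \<in> sets borel}"
      by (rule Int_stable_vimage)
    fix a b assume "a \<in> {U -` A \<inter> space M |A. A \<in> sets borel}" "b \<in> {(\<lambda>\<omega>. g (X i \<omega>)) -` A \<inter> space M |A. A \<in> sets borel}"
    then obtain A B where AB: "A \<in> sets borel" "B \<in> sets borel" "a = U -` A \<inter> space M" "b = X i -` (g -` B) \<inter> space M"
      by auto
    have "a \<in> sets (F i)" using measurable_sets[OF U AB(1)] space_F[of i] i AB(3) by simp
    moreover have "g -` B \<in> sets borel" using measurable_sets[OF g AB(2)] by simp
    ultimately show "prob (a \<inter> b) = prob a * prob b" unfolding AB(4) by (rule X_indep[OF i])
  qed auto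
  show "integrable M (\<lambda>\<omega>. U \<omega> * g (X i \<omega>))"
    by (rule indep_var_integrable[OF iv int])
  show "expectation (\<lambda>\<omega>. U \<omega> * g (X i \<omega>)) = expectation U * expectation (\<lambda>\<omega>. g (X i \<omega>))"
    by (rule indep_var_lebesgue_integral[OF iv int])
qed

text \<open>The summands are orthogonal martingale differences of variance at most
  \<open>C\<^sup>2 * 2 * d\<^sup>2\<close>. With \<open>N = 2 ^ n\<close> and
  \<open>d = t / 2 ^ n\<close> the bound is of order \<open>2 ^ (- n)\<close>, hence summable over
  the grids.\<close>

lemma quadratic_variation:
  assumes w: "\<And>i. i < N \<Longrightarrow> w i \<in> borel_measurable (F i)"
    and C: "\<And>i \<omega>. i < N \<Longrightarrow> \<omega> \<in> space M \<Longrightarrow> \<bar>w i \<omega>\<bar> \<le> C" and k: "k \<le> N"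
  shows "integrable M (\<lambda>\<omega>. (\<Sum>i<k. w i \<omega> * ((X i \<omega>)\<^sup>2 - d))\<^sup>2)
     \<and> expectation (\<lambda>\<omega>. (\<Sum>i<k. w i \<omega> * ((X i \<omega>)\<^sup>2 - d))\<^sup>2) \<le> real k * (2 * C\<^sup>2 * d\<^sup>2)"
  using k
proof (induction k)
  case (Suc k)
  then have k: "k < N" "k \<le> N" by auto
  define S where "S \<omega> = (\<Sum>i<k. w i \<omega> * ((X i \<omega>)\<^sup>2 - d))" for \<omega>
  have S: "S \<in> borel_measurable (F k)"
    unfolding S_def using sum_meas[of k w "\<lambda>_ s x. s * (x\<^sup>2 - d)"] w k by simp
  have [measurable]: "S \<in> borel_measurable M" "w k \<in> borel_measurable M" "X k \<in> borel_measurable M"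
    using F_M[OF k(2) S] F_M[OF k(2) w[OF k(1)]] X_meas[OF k(1)] by auto
  have S2: "integrable M (\<lambda>\<omega>. (S \<omega>)\<^sup>2)" "expectation (\<lambda>\<omega>. (S \<omega>)\<^sup>2) \<le> real k * (2 * C\<^sup>2 * d\<^sup>2)"
    using Suc.IH k by (auto simp: S_def)
  have S1: "integrable M S" by (rule square_integrable_imp_integrable[OF _ S2(1)]) simp
  have Sw: "integrable M (\<lambda>\<omega>. S \<omega> * w k \<omega>)"
  proof (rule Bochner_Integration.integrable_bound[of _ "\<lambda>\<omega>. S \<omega> * C"])
    show "AE \<omega> in M. norm (S \<omega> * w k \<omega>) \<le> norm (S \<omega> * C)"
    proof (intro AE_I2)
      fix \<omega> assume "\<omega> \<in> space M"
      then have "\<bar>w k \<omega>\<bar> \<le> \<bar>C\<bar>" using C[OF k(1)] abs_ge_self[of C] order_trans by blast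
      then show "norm (S \<omega> * w k \<omega>) \<le> norm (S \<omega> * C)" by (simp add: abs_mult mult_left_mono)
    qed
  qed (use S1 in auto)
  have w2: "integrable M (\<lambda>\<omega>. (w k \<omega>)\<^sup>2)" and w2C: "expectation (\<lambda>\<omega>. (w k \<omega>)\<^sup>2) \<le> C\<^sup>2"
  proof -
    have b: "\<And>\<omega>. \<omega> \<in> space M \<Longrightarrow> (w k \<omega>)\<^sup>2 \<le> C\<^sup>2"
      using C[OF k(1)] by (metis abs_ge_self abs_le_square_iff order_trans)
    show i: "integrable M (\<lambda>\<omega>. (w k \<omega>)\<^sup>2)"
      by (rule integrable_const_bound[of _ "C\<^sup>2"]) (auto intro!: AE_I2 b)
    have "expectation (\<lambda>\<omega>. (w k \<omega>)\<^sup>2) \<le> expectation (\<lambda>\<omega>. C\<^sup>2)"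
      by (rule integral_mono[OF i]) (auto intro: b)
    then show "expectation (\<lambda>\<omega>. (w k \<omega>)\<^sup>2) \<le> C\<^sup>2" by (simp add: prob_space)
  qed
  note m = step_square_moments[OF k(1)]
  \<comment> \<open>The cross term: the factor \<open>(X k)\<^sup>2 - d\<close> is independent of
    the past and centred, so its expectation vanishes.\<close>
  have 1: "integrable M (\<lambda>\<omega>. (S \<omega> * w k \<omega>) * ((X k \<omega>)\<^sup>2 - d))"
      "expectation (\<lambda>\<omega>. (S \<omega> * w k \<omega>) * ((X k \<omega>)\<^sup>2 - d)) = expectation (\<lambda>\<omega>. S \<omega> * w k \<omega>) * expectation (\<lambda>\<omega>. (X k \<omega>)\<^sup>2 - d)"
    using indep_prod[OF k(1) borel_measurable_times[OF S w[OF k(1)]], of "\<lambda>x. x\<^sup>2 - d"] Sw m(1) by auto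
  have 2: "integrable M (\<lambda>\<omega>. (w k \<omega>)\<^sup>2 * ((X k \<omega>)\<^sup>2 - d)\<^sup>2)"
      "expectation (\<lambda>\<omega>. (w k \<omega>)\<^sup>2 * ((X k \<omega>)\<^sup>2 - d)\<^sup>2) = expectation (\<lambda>\<omega>. (w k \<omega>)\<^sup>2) * expectation (\<lambda>\<omega>. ((X k \<omega>)\<^sup>2 - d)\<^sup>2)"
    using indep_prod[OF k(1) borel_measurable_power[OF w[OF k(1)]], of "\<lambda>x. (x\<^sup>2 - d)\<^sup>2" 2] w2 m(3) by auto
  have eq: "(\<Sum>i<Suc k. w i \<omega> * ((X i \<omega>)\<^sup>2 - d))\<^sup>2
      = (S \<omega>)\<^sup>2 + 2 * ((S \<omega> * w k \<omega>) * ((X k \<omega>)\<^sup>2 - d)) + (w k \<omega>)\<^sup>2 * ((X k \<omega>)\<^sup>2 - d)\<^sup>2" for \<omega>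
    by (simp add: S_def[symmetric] power2_sum power_mult_distrib)
  have "expectation (\<lambda>\<omega>. (\<Sum>i<Suc k. w i \<omega> * ((X i \<omega>)\<^sup>2 - d))\<^sup>2)
      = expectation (\<lambda>\<omega>. (S \<omega>)\<^sup>2) + expectation (\<lambda>\<omega>. (w k \<omega>)\<^sup>2) * (2 * d\<^sup>2)"
    unfolding eq using 1 2 S2(1) m by simp
  also have "\<dots> \<le> real k * (2 * C\<^sup>2 * d\<^sup>2) + C\<^sup>2 * (2 * d\<^sup>2)"
    by (intro add_mono S2 mult_right_mono w2C) auto
  finally have "expectation (\<lambda>\<omega>. (\<Sum>i<Suc k. w i \<omega> * ((X i \<omega>)\<^sup>2 - d))\<^sup>2) \<le> real (Suc k) * (2 * C\<^sup>2 * d\<^sup>2)"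
    by (simp add: algebra_simps)
  moreover have "integrable M (\<lambda>\<omega>. (\<Sum>i<Suc k. w i \<omega> * ((X i \<omega>)\<^sup>2 - d))\<^sup>2)"
    unfolding eq using 1(1) 2(1) S2(1) by (intro Bochner_Integration.integrable_add integrable_mult_right)
  ultimately show ?case by blast
qed simp

end

text \<open>Fatou's lemma gives the upper bound. For the lower one,
  \<open>Y <= min Y c + Y\<^sup>2 / c\<close>: the truncated part converges by dominated
  convergence, and the rest is at most \<open>\<bar>K\<bar> / c\<close>, uniformly in
  \<open>n\<close>, with \<open>c\<close> arbitrarily large.\<close>

lemma (in prob_space) nn_integral_tendsto_L2_bounded:
  assumes [measurable]: "\<And>n. Y n \<in> borel_measurable M" "Z \<in> borel_measurable M"
    and lim: "AE \<omega> in M. (\<lambda>n. Y n \<omega> :: real) \<longlonglongrightarrow> Z \<omega>"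
    and nn: "\<And>n \<omega>. \<omega> \<in> space M \<Longrightarrow> 0 \<le> Y n \<omega>"
    and 1: "\<And>n. (\<integral>\<^sup>+ \<omega>. ennreal (Y n \<omega>) \<partial>M) = 1"
    and K: "\<And>n. (\<integral>\<^sup>+ \<omega>. ennreal ((Y n \<omega>)\<^sup>2) \<partial>M) \<le> ennreal K"
  shows "(\<integral>\<^sup>+ \<omega>. ennreal (Z \<omega>) \<partial>M) = 1"
proof (rule antisym)
  have lim': "AE \<omega> in M. (\<lambda>n. ennreal (Y n \<omega>)) \<longlonglongrightarrow> ennreal (Z \<omega>)"
    using lim by eventually_elim (auto intro: tendsto_ennrealI)
  have "(\<integral>\<^sup>+ \<omega>. ennreal (Z \<omega>) \<partial>M) = (\<integral>\<^sup>+ \<omega>. liminf (\<lambda>n. ennreal (Y n \<omega>)) \<partial>M)"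
    by (intro nn_integral_cong_AE) (use lim' in \<open>eventually_elim, auto simp: lim_imp_Liminf\<close>)
  also have "\<dots> \<le> liminf (\<lambda>n. \<integral>\<^sup>+ \<omega>. ennreal (Y n \<omega>) \<partial>M)" by (rule nn_integral_liminf) simp
  also have "\<dots> = 1" by (simp add: 1 Liminf_const)
  finally show "(\<integral>\<^sup>+ \<omega>. ennreal (Z \<omega>) \<partial>M) \<le> 1" .
  have "1 \<le> (\<integral>\<^sup>+ \<omega>. ennreal (Z \<omega>) \<partial>M) + ennreal (\<bar>K\<bar> / c)" if c: "0 < c" for c :: real
  proof -
    have "(\<lambda>n. \<integral>\<^sup>+ \<omega>. ennreal (min (Y n \<omega>) c) \<partial>M) \<longlonglongrightarrow> (\<integral>\<^sup>+ \<omega>. ennreal (min (Z \<omega>) c) \<partial>M)"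
    proof (rule nn_integral_dominated_convergence[where w="\<lambda>_. ennreal c"])
      show "AE \<omega> in M. (\<lambda>n. ennreal (min (Y n \<omega>) c)) \<longlonglongrightarrow> ennreal (min (Z \<omega>) c)"
        using lim by eventually_elim (auto intro!: tendsto_ennrealI tendsto_min)
    qed (auto simp: emeasure_space_1 intro!: AE_I2 ennreal_leI)
    then have "(\<lambda>n. (\<integral>\<^sup>+ \<omega>. ennreal (min (Y n \<omega>) c) \<partial>M) + ennreal (\<bar>K\<bar> / c)) \<longlonglongrightarrow> (\<integral>\<^sup>+ \<omega>. ennreal (min (Z \<omega>) c) \<partial>M) + ennreal (\<bar>K\<bar> / c)"
      by (intro tendsto_intros)
    moreover have "1 \<le> (\<integral>\<^sup>+ \<omega>. ennreal (min (Y n \<omega>) c) \<partial>M) + ennreal (\<bar>K\<bar> / c)" for n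
    proof -
      have "1 = (\<integral>\<^sup>+ \<omega>. ennreal (Y n \<omega>) \<partial>M)" using 1 by simp
      also have "\<dots> \<le> (\<integral>\<^sup>+ \<omega>. ennreal (min (Y n \<omega>) c) + ennreal (1 / c) * ennreal ((Y n \<omega>)\<^sup>2) \<partial>M)"
      proof (rule nn_integral_mono)
        fix \<omega> assume w: "\<omega> \<in> space M"
        have "Y n \<omega> \<le> min (Y n \<omega>) c + 1 / c * (Y n \<omega>)\<^sup>2"
        proof (cases "Y n \<omega> \<le> c")
          case False
          then have "c * Y n \<omega> \<le> (Y n \<omega>)\<^sup>2" using nn[OF w] by (simp add: power2_eq_square mult_right_mono)
          then have "Y n \<omega> \<le> 1 / c * (Y n \<omega>)\<^sup>2" using c by (simp add: field_simps)
          then show ?thesis using c False by simp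
        qed (use c in simp)
        then show "ennreal (Y n \<omega>) \<le> ennreal (min (Y n \<omega>) c) + ennreal (1 / c) * ennreal ((Y n \<omega>)\<^sup>2)"
          using nn[OF w] c by (simp add: ennreal_mult[symmetric] ennreal_plus[symmetric] ennreal_leI del: ennreal_plus)
      qed
      also have "\<dots> = (\<integral>\<^sup>+ \<omega>. ennreal (min (Y n \<omega>) c) \<partial>M) + ennreal (1 / c) * (\<integral>\<^sup>+ \<omega>. ennreal ((Y n \<omega>)\<^sup>2) \<partial>M)"
        by (subst nn_integral_add) (auto simp: nn_integral_cmult)
      also have "\<dots> \<le> (\<integral>\<^sup>+ \<omega>. ennreal (min (Y n \<omega>) c) \<partial>M) + ennreal (1 / c) * ennreal \<bar>K\<bar>"
        using order_trans[OF K ennreal_leI[OF abs_ge_self]] by (intro add_left_mono mult_left_mono) auto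
      finally show ?thesis using c by (simp add: ennreal_mult[symmetric])
    qed
    ultimately have "1 \<le> (\<integral>\<^sup>+ \<omega>. ennreal (min (Z \<omega>) c) \<partial>M) + ennreal (\<bar>K\<bar> / c)"
      using LIMSEQ_le_const[where a="1::ennreal"] by presburger
    also have "\<dots> \<le> (\<integral>\<^sup>+ \<omega>. ennreal (Z \<omega>) \<partial>M) + ennreal (\<bar>K\<bar> / c)"
      by (intro add_right_mono nn_integral_mono ennreal_leI) auto
    finally show ?thesis .
  qed
  note * = this
  have "(\<lambda>n. \<bar>K\<bar> / real (Suc n)) \<longlonglongrightarrow> 0"
    using tendsto_mult_right[OF LIMSEQ_inverse_real_of_nat, of "\<bar>K\<bar>"] by (simp add: divide_inverse mult.commute)
  then have "(\<lambda>n. (\<integral>\<^sup>+ \<omega>. ennreal (Z \<omega>) \<partial>M) + ennreal (\<bar>K\<bar> / real (Suc n))) \<longlonglongrightarrow> (\<integral>\<^sup>+ \<omega>. ennreal (Z \<omega>) \<partial>M) + ennreal 0"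
    by (intro tendsto_intros)
  then show "1 \<le> (\<integral>\<^sup>+ \<omega>. ennreal (Z \<omega>) \<partial>M)"
    using LIMSEQ_le_const[where a="1::ennreal"] *[of "real (Suc n)" for n] by fastforce
qed

section \<open>Laplace transforms\<close>

text \<open>With \<open>u = exp (- y)\<close> the Laplace transform at the integers gives the moments of a measure on
  \<open>{0..1}\<close>; approximate the indicator of \<open>u \<ge> exp (- c)\<close> by polynomials.\<close>

lemma laplace_inversion:
  fixes c :: real
  obtains a :: "nat \<Rightarrow> nat \<Rightarrow> real" and d :: "nat \<Rightarrow> nat" where
    "\<And>\<mu>. finite_measure \<mu> \<Longrightarrow> sets \<mu> = sets borel \<Longrightarrow> (AE y in \<mu>. 0 \<le> y) \<Longrightarrow>
      (\<lambda>k. \<Sum>i\<le>d k. a k i * (\<integral>y. exp (- (real i * y)) \<partial>\<mu>)) \<longlonglongrightarrow> measure \<mu> {..c}"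
proof -
  \<comment> \<open>A continuous ramp: it is 1 for \<open>x >= exp (- c)\<close> and 0 for
    \<open>x <= exp (- c) - 1 / k\<close>. The polynomials that approximate it are fixed before any
    measure is given, so the same coefficients serve all measures.\<close>
  define g where "g k x = min 1 (max 0 (1 + real k * (x - exp (- c))))" for k :: nat and x :: real
  have "\<exists>a d. \<forall>x\<in>{0..1}. \<bar>g k x - (\<Sum>i\<le>d. a i * x ^ i)\<bar> < 1 / real (Suc k)" for k
  proof -
    have "continuous_on {0..1} (g k)" unfolding g_def by (intro continuous_intros)
    then obtain p where p: "real_polynomial_function p" "\<And>x. x \<in> {0..1} \<Longrightarrow> \<bar>g k x - p x\<bar> < 1 / real (Suc k)"
      using Stone_Weierstrass_real_polynomial_function[of "{0..1}" "g k" "1 / real (Suc k)"] by auto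
    obtain a d where "p = (\<lambda>x. \<Sum>i\<le>d. a i * x ^ i)"
      using p(1) by (auto simp: real_polynomial_function_iff_sum)
    with p(2) show ?thesis by blast
  qed
  then obtain a d where ad: "\<And>k x. x \<in> {0..1} \<Longrightarrow> \<bar>g k x - (\<Sum>i\<le>d k. a k i * x ^ i)\<bar> < 1 / real (Suc k)"
    by metis
  show thesis
  proof (rule that)
    fix \<mu> :: "real measure"
    assume fin: "finite_measure \<mu>" and sets[measurable_cong]: "sets \<mu> = sets borel" and nn: "AE y in \<mu>. 0 \<le> y"
    interpret finite_measure \<mu> by fact
    have sp: "space \<mu> = UNIV" using sets_eq_imp_space_eq[OF sets] by simp
    have pw: "exp (- (real i * y)) = exp (- y) ^ i" for i y
      by (simp add: exp_of_nat_mult[symmetric])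
    have int: "integrable \<mu> (\<lambda>y. exp (- (real i * y)))" for i
      using nn by (intro integrable_const_bound[of _ 1]) auto
    have "(\<lambda>k. \<integral>y. (\<Sum>i\<le>d k. a k i * exp (- (real i * y))) \<partial>\<mu>) \<longlonglongrightarrow> (\<integral>y. indicator {..c} y \<partial>\<mu>)"
    \<comment> \<open>The constant 2 dominates: \<open>g k\<close> is at most 1 and the polynomial
      differs from it by at most \<open>1 / Suc k\<close>.\<close>
    proof (rule integral_dominated_convergence[where w="\<lambda>_. 2"])
      show "AE y in \<mu>. (\<lambda>k. \<Sum>i\<le>d k. a k i * exp (- (real i * y))) \<longlonglongrightarrow> indicator {..c} y"
        using nn
      proof eventually_elim
        fix y :: real assume "0 \<le> y"
        then have x: "exp (- y) \<in> {0..1}" by auto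
        have "(\<lambda>k. g k (exp (- y))) \<longlonglongrightarrow> indicator {..c} y"
        proof (cases "y \<le> c")
          case True
          then have "0 \<le> exp (- y) - exp (- c)" by simp
          then have "g k (exp (- y)) = 1" for k by (simp add: g_def)
          then show ?thesis using True by simp
        next
          case False
          then have e: "exp (- y) - exp (- c) < 0" by simp
          then obtain K :: nat where K: "1 < real K * - (exp (- y) - exp (- c))"
            using reals_Archimedean3[of "- (exp (- y) - exp (- c))"] by auto
          have "eventually (\<lambda>k. g k (exp (- y)) = 0) sequentially"
            using eventually_ge_at_top[of K]
          proof eventually_elim
            fix k assume "K \<le> k"
            then have "real K * - (exp (- y) - exp (- c)) \<le> real k * - (exp (- y) - exp (- c))"
              using e by (intro mult_right_mono) auto
            with K have "1 + real k * (exp (- y) - exp (- c)) \<le> 0" by linarith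
            then show "g k (exp (- y)) = 0" by (simp add: g_def)
          qed
          then show ?thesis using False by (simp add: tendsto_eventually)
        qed
        moreover have "(\<lambda>k. g k (exp (- y)) - (\<Sum>i\<le>d k. a k i * exp (- y) ^ i)) \<longlonglongrightarrow> 0"
          by (rule Lim_null_comparison[OF _ LIMSEQ_Suc[OF lim_inverse_n']])
             (use ad[OF x] in \<open>auto intro!: always_eventually less_imp_le\<close>)
        ultimately have "(\<lambda>k. g k (exp (- y)) - (g k (exp (- y)) - (\<Sum>i\<le>d k. a k i * exp (- y) ^ i))) \<longlonglongrightarrow> indicator {..c} y - 0"
          by (rule tendsto_diff)
        then show "(\<lambda>k. \<Sum>i\<le>d k. a k i * exp (- (real i * y))) \<longlonglongrightarrow> indicator {..c} y" by (simp add: pw)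
      qed
      show "AE y in \<mu>. norm (\<Sum>i\<le>d k. a k i * exp (- (real i * y))) \<le> 2" for k
        using nn
      proof eventually_elim
        fix y :: real assume "0 \<le> y"
        then have x: "exp (- y) \<in> {0..1}" by auto
        have "1 / real (Suc k) \<le> 1" "\<bar>g k (exp (- y))\<bar> \<le> 1" by (auto simp: g_def)
        with ad[OF x, of k] show "norm (\<Sum>i\<le>d k. a k i * exp (- (real i * y))) \<le> 2"
          unfolding pw real_norm_def by linarith
      qed
    qed (auto simp: sp)
    moreover have "(\<integral>y. (\<Sum>i\<le>d k. a k i * exp (- (real i * y))) \<partial>\<mu>) = (\<Sum>i\<le>d k. a k i * (\<integral>y. exp (- (real i * y)) \<partial>\<mu>))" for k
      by (subst Bochner_Integration.integral_sum) (auto intro: int)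
    ultimately show "(\<lambda>k. \<Sum>i\<le>d k. a k i * (\<integral>y. exp (- (real i * y)) \<partial>\<mu>)) \<longlonglongrightarrow> measure \<mu> {..c}"
      by (simp add: sp)
  qed
qed

lemma laplace_unique:
  assumes "finite_measure \<mu>" "sets \<mu> = sets borel" "AE y in \<mu>. 0 \<le> y"
    and "finite_measure \<nu>" "sets \<nu> = sets borel" "AE y in \<nu>. 0 \<le> y"
    and eq: "\<And>n::nat. (\<integral>y. exp (- (real n * y)) \<partial>\<mu>) = (\<integral>y. exp (- (real n * y)) \<partial>\<nu>)"
  shows "\<mu> = \<nu>"
proof (rule cdf_unique')
  show "finite_borel_measure \<mu>" "finite_borel_measure \<nu>"
    using assms by (auto intro!: finite_borel_measure.intro finite_borel_measure_axioms.intro)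
  show "cdf \<mu> = cdf \<nu>"
  proof
    fix c
    obtain a d where ad: "\<And>\<mu>. finite_measure \<mu> \<Longrightarrow> sets \<mu> = sets borel \<Longrightarrow> (AE y in \<mu>. 0 \<le> y) \<Longrightarrow>
      (\<lambda>k. \<Sum>i\<le>d k. a k i * (\<integral>y. exp (- (real i * y)) \<partial>\<mu>)) \<longlonglongrightarrow> measure \<mu> {..c}"
      by (rule laplace_inversion[where c=c]) blast
    show "cdf \<mu> c = cdf \<nu> c" unfolding cdf_def
      by (rule LIMSEQ_unique[OF ad[OF assms(1-3)]]) (simp add: eq ad[OF assms(4-6)])
  qed
qed

text \<open>By \<open>laplace_inversion\<close> the distribution function of \<open>K z\<close> at
  \<open>c\<close> is a limit of linear combinations of Laplace transforms whose coefficients do not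
  depend on \<open>z\<close>; so it inherits their measurability, and half-lines generate the Borel
  sets.\<close>

lemma measurable_kernel_laplace:
  assumes K: "\<And>z. z \<in> space N \<Longrightarrow> prob_space (K z)" "\<And>z. z \<in> space N \<Longrightarrow> sets (K z) = sets borel"
    "\<And>z. z \<in> space N \<Longrightarrow> AE y in K z. 0 \<le> y"
    and L: "\<And>n::nat. (\<lambda>z. \<integral>y. exp (- (real n * y)) \<partial>K z) \<in> borel_measurable N"
  shows "K \<in> N \<rightarrow>\<^sub>M prob_algebra (borel :: real measure)"
proof (rule measurable_prob_algebra_generated[where G="range atMost" and \<Omega>=UNIV])
  show "sets (borel :: real measure) = sigma_sets UNIV (range atMost)"
    by (subst borel_eq_atMost) simp
  show "Int_stable (range (atMost :: real \<Rightarrow> _))"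
    by (auto simp: Int_stable_def)
  fix A :: "real set" assume "A \<in> range atMost"
  then obtain c where c: "A = {..c}" by auto
  obtain a d where ad: "\<And>\<mu>. finite_measure \<mu> \<Longrightarrow> sets \<mu> = sets borel \<Longrightarrow> (AE y in \<mu>. 0 \<le> y) \<Longrightarrow>
    (\<lambda>k. \<Sum>i\<le>d k. a k i * (\<integral>y. exp (- (real i * y)) \<partial>\<mu>)) \<longlonglongrightarrow> measure \<mu> {..c}"
    by (rule laplace_inversion[where c=c]) blast
  have "(\<lambda>z. measure (K z) {..c}) \<in> borel_measurable N"
    by (rule borel_measurable_LIMSEQ_real[OF ad[OF prob_space.finite_measure]])
       (use K L in \<open>auto intro!: borel_measurable_sum borel_measurable_times\<close>)
  moreover have "emeasure (K z) A = ennreal (measure (K z) {..c})" if "z \<in> space N" for z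
    unfolding c using prob_space.finite_measure[OF K(1)[OF that]] by (rule finite_measure.emeasure_eq_measure)
  ultimately show "(\<lambda>z. emeasure (K z) A) \<in> borel_measurable N"
    by (simp cong: measurable_cong)
qed (use K in auto)

section \<open>The flow of the branching mechanism\<close>

text \<open>This is the integral of exp (- 4 \<theta> s) over s from 0 to r; the case \<theta> = 0
  is the limit of the other formula.\<close>

definition feller_clock :: "real \<Rightarrow> real \<Rightarrow> real" where
  "feller_clock \<theta> r = (if \<theta> = 0 then r else (1 - exp (- (4 * \<theta> * r))) / (4 * \<theta>))"

text \<open>The explicit solution \<open>u\<^sup>\<theta>(q, r)\<close> of the equation \<open>u' + \<psi>\<^sub>\<theta>(u) = 0\<close> with \<open>u(0) = q\<close>, found by
  linearising with \<open>1 / u\<close>.\<close>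

definition feller_flow :: "real \<Rightarrow> real \<Rightarrow> real \<Rightarrow> real" where
  "feller_flow \<theta> q r = q * exp (- (4 * \<theta> * r)) / (1 + 2 * q * feller_clock \<theta> r)"

abbreviation (input) branching :: "real \<Rightarrow> real \<Rightarrow> real" where
  "branching \<theta> u \<equiv> 2 * u\<^sup>2 + 4 * \<theta> * u"

lemma feller_clock_deriv: "(feller_clock \<theta> has_real_derivative exp (- (4 * \<theta> * r))) (at r within S)"
proof (cases "\<theta> = 0")
  case True
  have "feller_clock \<theta> = (\<lambda>r. r)" using True by (simp add: feller_clock_def fun_eq_iff)
  then show ?thesis using True by simp
next
  case False
  have "feller_clock \<theta> = (\<lambda>r. (1 - exp (- (4 * \<theta> * r))) / (4 * \<theta>))"
    using False by (simp add: feller_clock_def fun_eq_iff)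
  then show ?thesis using False by (auto intro!: derivative_eq_intros simp: field_simps)
qed

lemma feller_clock_0 [simp]: "feller_clock \<theta> 0 = 0"
  by (simp add: feller_clock_def)

lemma feller_clock_nonneg: "0 \<le> r \<Longrightarrow> 0 \<le> feller_clock \<theta> r"
proof -
  assume r: "0 \<le> r"
  have "feller_clock \<theta> 0 \<le> feller_clock \<theta> r"
    by (rule DERIV_nonneg_imp_nondecreasing[OF r])
       (use feller_clock_deriv in \<open>auto intro!: exI[of _ "exp (- (4 * \<theta> * _))"]\<close>)
  then show ?thesis by simp
qed

lemma feller_clock_add:
  "feller_clock \<theta> (r + s) = feller_clock \<theta> r + exp (- (4 * \<theta> * r)) * feller_clock \<theta> s"
proof -
  have "exp (- (4 * \<theta> * (r + s))) = exp (- (4 * \<theta> * r)) * exp (- (4 * \<theta> * s))"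
    by (simp add: exp_add[symmetric] algebra_simps)
  then show ?thesis by (auto simp: feller_clock_def field_simps)
qed

lemma feller_flow_denom: "0 \<le> q \<Longrightarrow> 0 \<le> r \<Longrightarrow> 0 < 1 + 2 * q * feller_clock \<theta> r"
  by (intro add_pos_nonneg mult_nonneg_nonneg feller_clock_nonneg) auto

lemma feller_flow_0 [simp]: "feller_flow \<theta> q 0 = q"
  by (simp add: feller_flow_def)

lemma feller_flow_nonneg: "0 \<le> q \<Longrightarrow> 0 \<le> r \<Longrightarrow> 0 \<le> feller_flow \<theta> q r"
  unfolding feller_flow_def using feller_flow_denom[of q r \<theta>] by (intro divide_nonneg_pos) auto

text \<open>Behind the Chapman-Kolmogorov equation and the Markov property below. It follows from
  the addition rule of the clock: the denominator of the outer flow, multiplied by that of the inner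
  one, is the denominator at time \<open>r + s\<close>.\<close>

lemma feller_flow_add:
  assumes "0 \<le> q" "0 \<le> r" "0 \<le> s"
  shows "feller_flow \<theta> (feller_flow \<theta> q r) s = feller_flow \<theta> q (r + s)"
proof -
  have 1: "1 + 2 * q * feller_clock \<theta> r \<noteq> 0" using feller_flow_denom[OF assms(1,2), of \<theta>] by simp
  have 2: "1 + 2 * q * feller_clock \<theta> (r + s) \<noteq> 0" using feller_flow_denom[of q "r + s" \<theta>] assms by simp
  have E: "exp (- (4 * \<theta> * (r + s))) = exp (- (4 * \<theta> * r)) * exp (- (4 * \<theta> * s))"
    by (simp add: exp_add[symmetric] algebra_simps)
  define D where "D = 1 + 2 * q * feller_clock \<theta> r"
  define e where "e = exp (- (4 * \<theta> * r))"
  have "1 + 2 * (q * e / D) * feller_clock \<theta> s = (D + 2 * q * e * feller_clock \<theta> s) / D"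
    using 1 by (simp add: D_def field_simps)
  also have "D + 2 * q * e * feller_clock \<theta> s = 1 + 2 * q * feller_clock \<theta> (r + s)"
    unfolding feller_clock_add D_def e_def by (simp add: algebra_simps)
  finally have "feller_flow \<theta> (feller_flow \<theta> q r) s
      = q * e / D * exp (- (4 * \<theta> * s)) / ((1 + 2 * q * feller_clock \<theta> (r + s)) / D)"
    unfolding feller_flow_def[of \<theta> "feller_flow \<theta> q r"] by (simp add: feller_flow_def D_def[symmetric] e_def[symmetric])
  also have "\<dots> = feller_flow \<theta> q (r + s)"
    using 1 2 unfolding feller_flow_def[of _ _ "r + s"] E e_def[symmetric] D_def[symmetric]
    by (simp add: field_simps)
  finally show ?thesis .
qed

lemma feller_flow_deriv:
  assumes "0 \<le> q" "0 \<le> r"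
  shows "(feller_flow \<theta> q has_real_derivative - branching \<theta> (feller_flow \<theta> q r)) (at r within S)"
proof -
  have 1: "1 + 2 * q * feller_clock \<theta> r \<noteq> 0" using feller_flow_denom[OF assms, of \<theta>] by simp
  have "((\<lambda>r. q * exp (- (4 * \<theta> * r)) / (1 + 2 * q * feller_clock \<theta> r)) has_real_derivative
     (q * (exp (- (4 * \<theta> * r)) * (- (4 * \<theta>))) * (1 + 2 * q * feller_clock \<theta> r) - q * exp (- (4 * \<theta> * r)) * (2 * q * exp (- (4 * \<theta> * r))))
       / ((1 + 2 * q * feller_clock \<theta> r) * (1 + 2 * q * feller_clock \<theta> r))) (at r within S)"
    using 1 by (auto intro!: derivative_eq_intros feller_clock_deriv simp: algebra_simps)
  moreover have "(q * (exp (- (4 * \<theta> * r)) * (- (4 * \<theta>))) * (1 + 2 * q * feller_clock \<theta> r) - q * exp (- (4 * \<theta> * r)) * (2 * q * exp (- (4 * \<theta> * r))))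
       / ((1 + 2 * q * feller_clock \<theta> r) * (1 + 2 * q * feller_clock \<theta> r)) = - branching \<theta> (feller_flow \<theta> q r)"
    unfolding feller_flow_def using 1 by (simp add: divide_simps power2_eq_square)
  ultimately show ?thesis unfolding feller_flow_def[abs_def] by simp
qed

text \<open>For non-negative arguments the squared difference has derivative
  \<open>- (u - w)\<^sup>2 * (4 * (u + w) + 8 * \<theta>)\<close>, at most 8 |\<theta>| times
  itself. The weight \<open>exp (- (8 * \<bar>\<theta>\<bar> * r))\<close> absorbs this, so
  \<open>D\<close> is nonincreasing and starts at 0.\<close>

lemma cb_ode_solution_unique:
  assumes u: "cb_ode_solution (branching \<theta>) q u" and w: "cb_ode_solution (branching \<theta>) q w" and r: "0 \<le> r"
  shows "u r = w r"
proof -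
  define D where "D r = (u r - w r)\<^sup>2 * exp (- (8 * \<bar>\<theta>\<bar> * r))" for r
  have ud: "(u has_real_derivative - branching \<theta> (u s)) (at s within {0..r})"
    and wd: "(w has_real_derivative - branching \<theta> (w s)) (at s within {0..r})"
    and nn: "0 \<le> u s" "0 \<le> w s" if "s \<in> {0..r}" for s
    using u w that unfolding cb_ode_solution_def by (auto intro: DERIV_subset)
  have Dd: "(D has_real_derivative
      (2 * (u s - w s) * (- branching \<theta> (u s) + branching \<theta> (w s)) - 8 * \<bar>\<theta>\<bar> * (u s - w s)\<^sup>2) * exp (- (8 * \<bar>\<theta>\<bar> * s)))
      (at s within {0..r})" if "s \<in> {0..r}" for s
    unfolding D_def[abs_def]
    by (rule derivative_eq_intros ud wd that refl)+ (simp add: algebra_simps power2_eq_square)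
  have neg: "(2 * (u s - w s) * (- branching \<theta> (u s) + branching \<theta> (w s)) - 8 * \<bar>\<theta>\<bar> * (u s - w s)\<^sup>2) * exp (- (8 * \<bar>\<theta>\<bar> * s)) \<le> 0"
    if "s \<in> {0..r}" for s
  proof -
    have "2 * (u s - w s) * (- branching \<theta> (u s) + branching \<theta> (w s)) - 8 * \<bar>\<theta>\<bar> * (u s - w s)\<^sup>2
        = - ((u s - w s)\<^sup>2 * (4 * (u s + w s) + 8 * (\<theta> + \<bar>\<theta>\<bar>)))"
      by (simp add: algebra_simps power2_eq_square)
    moreover have "0 \<le> (u s - w s)\<^sup>2 * (4 * (u s + w s) + 8 * (\<theta> + \<bar>\<theta>\<bar>))"
    proof (intro mult_nonneg_nonneg)
      have "0 \<le> 4 * (u s + w s)" "0 \<le> \<theta> + \<bar>\<theta>\<bar>" using nn[OF that] by auto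
      then show "0 \<le> 4 * (u s + w s) + 8 * (\<theta> + \<bar>\<theta>\<bar>)"
        using mult_nonneg_nonneg[of 8 "\<theta> + \<bar>\<theta>\<bar>"] by (simp only: add_nonneg_nonneg zero_le_numeral)
    qed simp
    ultimately show ?thesis by (intro mult_nonpos_nonneg) auto
  qed
  have "D r \<le> D 0"
  proof (cases "r = 0")
    case False
    then have "0 < r" using r by simp
    have c: "continuous_on {0..r} D"
      unfolding continuous_on_eq_continuous_within using Dd DERIV_continuous by blast
    obtain z where z: "0 < z" "z < r" "D r - D 0 = (r - 0) *
       ((2 * (u z - w z) * (- branching \<theta> (u z) + branching \<theta> (w z)) - 8 * \<bar>\<theta>\<bar> * (u z - w z)\<^sup>2) * exp (- (8 * \<bar>\<theta>\<bar> * z)))"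
    proof (rule MVT[OF \<open>0 < r\<close> c, THEN exE])
      fix x assume "0 < x" "x < r"
      then show "D differentiable (at x)"
        using Dd[of x] at_within_Icc_at[of 0 x r] by (auto simp: real_differentiable_def)
    next
      fix l assume "\<exists>z>0. z < r \<and> (D has_real_derivative l) (at z) \<and> D r - D 0 = (r - 0) * l"
      then obtain z where z: "0 < z" "z < r" "(D has_real_derivative l) (at z)" "D r - D 0 = (r - 0) * l" by blast
      have "l = (2 * (u z - w z) * (- branching \<theta> (u z) + branching \<theta> (w z)) - 8 * \<bar>\<theta>\<bar> * (u z - w z)\<^sup>2) * exp (- (8 * \<bar>\<theta>\<bar> * z))"
        using Dd[of z] z at_within_Icc_at[of 0 z r] by (intro DERIV_unique[OF z(3)]) auto
      with z that show thesis by blast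
    qed
    have "D r - D 0 \<le> 0"
      unfolding z(3) using z(1,2) by (intro mult_nonneg_nonpos neg) auto
    then show ?thesis by simp
  qed simp
  also have "D 0 = 0" using u w by (simp add: D_def cb_ode_solution_def)
  finally have "D r = 0" by (simp add: D_def mult_le_0_iff)
  then show ?thesis by (simp add: D_def)
qed

lemma cb_exponent_eq:
  assumes "0 \<le> q" "0 \<le> r"
  shows "cb_exponent (branching \<theta>) q r = feller_flow \<theta> q r"
proof -
  have s: "cb_ode_solution (branching \<theta>) q (feller_flow \<theta> q)"
    unfolding cb_ode_solution_def using assms feller_flow_deriv[OF assms(1)] feller_flow_nonneg[OF assms(1)] by simp
  show ?thesis unfolding cb_exponent_def
    by (rule the_equality) (use s cb_ode_solution_unique[OF _ s assms(2)] in blast)+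
qed

text \<open>The equation run downwards from level \<open>r0\<close>, in integrated form. Unlike the
  differential equation this form survives the jumps of \<open>level_exponent\<close>, and it is the
  form in which \<open>jump_exponential\<close> receives its function.\<close>

lemma feller_flow_integral:
  assumes q: "0 \<le> q" and r: "r \<le> r0"
  shows "feller_flow \<theta> q (r0 - r) = q - integral {r..r0} (\<lambda>s. branching \<theta> (feller_flow \<theta> q (r0 - s)))"
proof -
  have "((\<lambda>s. branching \<theta> (feller_flow \<theta> q (r0 - s))) has_integral
      feller_flow \<theta> q (r0 - r0) - feller_flow \<theta> q (r0 - r)) {r..r0}"
  proof (rule fundamental_theorem_of_calculus[OF r])
    fix s assume s: "s \<in> {r..r0}"
    have "((\<lambda>s. feller_flow \<theta> q (r0 - s)) has_real_derivative (- branching \<theta> (feller_flow \<theta> q (r0 - s))) * (- 1)) (at s within {r..r0})"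
      by (rule DERIV_chain2[OF feller_flow_deriv[OF q]]) (use s in \<open>auto intro!: derivative_eq_intros\<close>)
    then have "((\<lambda>s. feller_flow \<theta> q (r0 - s)) has_real_derivative branching \<theta> (feller_flow \<theta> q (r0 - s))) (at s within {r..r0})"
      by (simp add: algebra_simps)
    then show "((\<lambda>s. feller_flow \<theta> q (r0 - s)) has_vector_derivative branching \<theta> (feller_flow \<theta> q (r0 - s))) (at s within {r..r0})"
      by (simp only: has_real_derivative_iff_has_vector_derivative)
  qed
  then show ?thesis by (simp add: integral_unique)
qed

section \<open>Ito's formula along dyadic grids\<close>

lemma divide_mult_cancel_real: "c \<noteq> 0 \<Longrightarrow> z / c * c = (z :: real)"
  by simp

definition grid :: "real \<Rightarrow> nat \<Rightarrow> nat \<Rightarrow> real" where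
  "grid t n i = t * real i / 2 ^ n"

lemma grid_simps: "grid t n 0 = 0" "grid t n (2 ^ n) = t" "grid t n (Suc i) = grid t n i + t / 2 ^ n"
  by (auto simp: grid_def field_simps)

lemma grid_refine: "n \<le> m \<Longrightarrow> grid t m (i * 2 ^ (m - n)) = grid t n i"
proof -
  assume "n \<le> m"
  then have "(2::real) ^ m = 2 ^ n * 2 ^ (m - n)" by (simp add: power_add[symmetric])
  then show ?thesis by (simp add: grid_def)
qed

lemma grid_mono: "0 \<le> t \<Longrightarrow> i \<le> j \<Longrightarrow> grid t n i \<le> grid t n j"
  by (auto simp: grid_def intro!: divide_right_mono mult_left_mono)

lemma grid_bounds: "0 \<le> t \<Longrightarrow> 0 \<le> grid t n i" "0 \<le> t \<Longrightarrow> i \<le> 2 ^ n \<Longrightarrow> grid t n i \<le> t"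
  using grid_mono[of t 0 i n] grid_mono[of t i "2 ^ n" n] by (auto simp: grid_simps)

lemma mesh_tendsto: "(\<lambda>n. t / 2 ^ n :: real) \<longlonglongrightarrow> 0"
  using tendsto_mult_right[OF LIMSEQ_realpow_zero[of "1/2"], of t] by (simp add: power_divide)

lemma mesh_uniform:
  fixes w :: "real \<Rightarrow> real"
  assumes w: "continuous_on {0..t} w" and e: "0 < e"
  shows "\<exists>N. \<forall>n\<ge>N. \<forall>s\<in>{0..t}. \<forall>s'\<in>{0..t}. \<bar>s - s'\<bar> \<le> t / 2 ^ n \<longrightarrow> \<bar>w s - w s'\<bar> < e"
proof -
  have "uniformly_continuous_on {0..t} w" using compact_uniformly_continuous[OF w] by simp
  then obtain d where d: "0 < d" "\<And>s s'. s \<in> {0..t} \<Longrightarrow> s' \<in> {0..t} \<Longrightarrow> dist s' s < d \<Longrightarrow> dist (w s') (w s) < e"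
    using e unfolding uniformly_continuous_on_def by meson
  obtain N where N: "\<And>n. N \<le> n \<Longrightarrow> \<bar>t / 2 ^ n\<bar> < d"
    using LIMSEQ_D[OF mesh_tendsto d(1), of t] by auto
  show ?thesis
  proof (intro exI[of _ N] allI impI ballI)
    fix n s s' assume "N \<le> n" "s \<in> {0..t}" "s' \<in> {0..t}" "\<bar>s - s'\<bar> \<le> t / 2 ^ n"
    then show "\<bar>w s - w s'\<bar> < e" using N[of n] d(2)[of s' s] by (auto simp: dist_real_def)
  qed
qed

text \<open>The number of terms is allowed to vary with \<open>n\<close> because the sums will be
  cut at the first grid point after a stopping time.\<close>

lemma riemann_grid:
  fixes w :: "real \<Rightarrow> real"
  assumes t: "0 \<le> t" and w: "continuous_on {0..t} w" and k: "\<And>n. k n \<le> 2 ^ n"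
    and lim: "(\<lambda>n. grid t n (k n)) \<longlonglongrightarrow> S"
  shows "(\<lambda>n. \<Sum>i<k n. w (grid t n i) * (t / 2 ^ n)) \<longlonglongrightarrow> integral {0..S} w"
proof -
  have tau: "grid t n (k n) \<in> {0..t}" for n using grid_bounds[OF t] k by auto
  then have S: "S \<in> {0..t}" using closed_sequentially[OF closed_atLeastAtMost _ lim] by blast
  have int: "w integrable_on {0..t}" by (rule integrable_continuous_real[OF w])
  have "continuous_on {0..t} (\<lambda>x. integral {0..x} w)" by (rule indefinite_integral_continuous_1[OF int])
  from continuous_on_tendsto_compose[OF this lim S] tau
  have 1: "(\<lambda>n. integral {0..grid t n (k n)} w) \<longlonglongrightarrow> integral {0..S} w" by auto
  have 2: "(\<lambda>n. (\<Sum>i<k n. w (grid t n i) * (t / 2 ^ n)) - integral {0..grid t n (k n)} w) \<longlonglongrightarrow> 0"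
  proof (rule LIMSEQ_I)
    fix r :: real assume r: "0 < r"
    define e where "e = r / 2 / (t + 1)"
    have e: "0 < e" using r t by (simp add: e_def)
    obtain N where N: "\<And>n s s'. N \<le> n \<Longrightarrow> s \<in> {0..t} \<Longrightarrow> s' \<in> {0..t} \<Longrightarrow> \<bar>s - s'\<bar> \<le> t / 2 ^ n \<Longrightarrow> \<bar>w s - w s'\<bar> < e"
      using mesh_uniform[OF w e] by blast
    \<comment> \<open>An error bound proportional to the elapsed time passes through the induction
      cell by cell and holds for all \<open>j\<close> at once, so the varying \<open>k n\<close>
      does no harm.\<close>
    have "\<bar>(\<Sum>i<j. w (grid t n i) * (t / 2 ^ n)) - integral {0..grid t n j} w\<bar> \<le> e * grid t n j"
      if n: "N \<le> n" and "j \<le> 2 ^ n" for n j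
      using that(2)
    proof (induction j)
      case (Suc j)
      define p where "p = grid t n j"
      define q where "q = grid t n (Suc j)"
      have pq: "0 \<le> p" "p \<le> q" "q \<le> t" "q = p + t / 2 ^ n"
        using grid_bounds(1)[OF t, of n j] grid_bounds(2)[OF t Suc.prems] grid_mono[OF t, of j "Suc j" n]
        by (auto simp: p_def q_def grid_simps)
      have cpq: "continuous_on {p..q} w" by (rule continuous_on_subset[OF w]) (use pq in auto)
      have "integral {0..p} w + integral {p..q} w = integral {0..q} w"
        by (rule Henstock_Kurzweil_Integration.integral_combine)
          (use pq in \<open>auto intro!: integrable_continuous_real continuous_on_subset[OF w]\<close>)
      moreover have "integral {p..q} (\<lambda>s. w s - w p) = integral {p..q} w - w p * (t / 2 ^ n)"
      proof -
        have "integral {p..q} (\<lambda>s. w s - w p) = integral {p..q} w - integral {p..q} (\<lambda>s. w p)"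
          by (rule integral_diff) (intro integrable_continuous_real cpq continuous_on_const)+
        then show ?thesis using pq by simp
      qed
      moreover have "norm (integral {p..q} (\<lambda>s. w s - w p)) \<le> e * (q - p)"
      proof (rule integral_bound[OF pq(2)])
        show "continuous_on {p..q} (\<lambda>s. w s - w p)" by (rule continuous_on_diff[OF cpq continuous_on_const])
        show "norm (w s - w p) \<le> e" if "s \<in> {p..q}" for s
          using less_imp_le[OF N[OF n, of s p]] pq that by auto
      qed
      moreover have "\<bar>(\<Sum>i<j. w (grid t n i) * (t / 2 ^ n)) - integral {0..p} w\<bar> \<le> e * p"
        using Suc by (simp add: p_def)
      ultimately have "\<bar>(\<Sum>i<j. w (grid t n i) * (t / 2 ^ n)) + w p * (t / 2 ^ n) - integral {0..q} w\<bar> \<le> e * p + e * (q - p)"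
        unfolding real_norm_def by linarith
      then show ?case by (simp add: p_def q_def right_diff_distrib)
    qed (simp add: grid_simps)
    then have "\<bar>(\<Sum>i<k n. w (grid t n i) * (t / 2 ^ n)) - integral {0..grid t n (k n)} w\<bar> < r" if "N \<le> n" for n
    proof -
      have "e * grid t n (k n) \<le> e * (t + 1)" using tau[of n] e by (intro mult_left_mono) auto
      also have "\<dots> = r / 2" unfolding e_def by (rule divide_mult_cancel_real) (use t in simp)
      finally show ?thesis using r \<open>\<And>n j. N \<le> n \<Longrightarrow> j \<le> 2 ^ n \<Longrightarrow> _\<close>[OF that k[of n]] by linarith
    qed
    then show "\<exists>no. \<forall>n\<ge>no. norm ((\<Sum>i<k n. w (grid t n i) * (t / 2 ^ n)) - integral {0..grid t n (k n)} w - 0) < r"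
      by auto
  qed
  from tendsto_add[OF 2 1] show ?thesis by simp
qed

section \<open>Potentials and Taylor's formula\<close>

locale potential =
  fixes a \<theta> :: real and g :: "real \<Rightarrow> real"
  assumes a: "0 < a" and g: "continuous_on {0..a} g"
begin

definition v :: "real \<Rightarrow> real" where "v r = integral {r..a} g"
definition h :: "real \<Rightarrow> real" where "h r = 2 * integral {r..a} v"
definition f :: "real \<Rightarrow> real" where "f r = 2 * (v r)\<^sup>2 + 4 * \<theta> * v r + g r"

lemma v_deriv: "r \<in> {0..a} \<Longrightarrow> (v has_real_derivative - g r) (at r within {0..a})"
  unfolding v_def[abs_def] by (rule integral_has_real_derivative'[OF g])

lemma v_cont: "continuous_on {0..a} v"
  unfolding continuous_on_eq_continuous_within using v_deriv DERIV_continuous by blast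

lemma h_deriv: "r \<in> {0..a} \<Longrightarrow> (h has_real_derivative - 2 * v r) (at r within {0..a})"
  unfolding h_def[abs_def] using DERIV_cmult[OF integral_has_real_derivative'[OF v_cont], of r 2] by simp

lemma h_cont: "continuous_on {0..a} h"
  unfolding continuous_on_eq_continuous_within using h_deriv DERIV_continuous by blast

lemma f_cont: "continuous_on {0..a} f"
  unfolding f_def[abs_def] by (intro continuous_intros v_cont g)

lemma v_a: "v a = 0" by (simp add: v_def)

text \<open>Second order Taylor formula with h' = - 2 v and h'' = 2 g. Since \<open>g\<close> is
  merely continuous, the remainder is measured by its oscillation on the segment; the mean value
  bound is applied to \<open>v\<close> and then to \<open>h\<close>.\<close>

lemma h_taylor:
  assumes yz: "y \<in> {0..a}" "z \<in> {0..a}" and e: "\<And>s. s \<in> closed_segment y z \<Longrightarrow> \<bar>g s - g y\<bar> \<le> e"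
  shows "\<bar>h z - h y + 2 * v y * (z - y) - g y * (z - y)\<^sup>2\<bar> \<le> 2 * e * (z - y)\<^sup>2"
proof -
  let ?S = "closed_segment y z"
  have S: "?S \<subseteq> {0..a}" using yz by (intro closed_segment_subset) auto
  have ne: "0 \<le> e" using e[of y] by auto
  have seg: "\<bar>s - y\<bar> \<le> \<bar>z - y\<bar>" if "s \<in> ?S" for s
    using that by (auto simp: closed_segment_eq_real_ivl split: if_splits)
  have 1: "\<bar>v s - v y + g y * (s - y)\<bar> \<le> e * \<bar>z - y\<bar>" if s: "s \<in> ?S" for s
  proof -
    have "norm ((v s + g y * s) - (v y + g y * y)) \<le> e * norm (s - y)"
    proof (rule field_differentiable_bound[where S="?S" and f'="\<lambda>r. - g r + g y"])
      fix r assume r: "r \<in> ?S"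
      show "((\<lambda>s. v s + g y * s) has_real_derivative - g r + g y) (at r within ?S)"
        using r S by (auto intro!: derivative_eq_intros DERIV_subset[OF v_deriv])
      show "norm (- g r + g y) \<le> e" using e[OF r] by simp
    qed (use s in auto)
    also have "\<dots> \<le> e * \<bar>z - y\<bar>" using seg[OF s] ne by (intro mult_left_mono) auto
    finally show ?thesis by (simp add: algebra_simps)
  qed
  have "norm ((h z + 2 * v y * z - g y * (z - y)\<^sup>2) - (h y + 2 * v y * y - g y * (y - y)\<^sup>2)) \<le> (2 * (e * \<bar>z - y\<bar>)) * norm (z - y)"
  proof (rule field_differentiable_bound[where S="?S" and f'="\<lambda>r. - 2 * (v r - v y + g y * (r - y))"])
    fix r assume r: "r \<in> ?S"
    show "((\<lambda>s. h s + 2 * v y * s - g y * (s - y)\<^sup>2) has_real_derivative - 2 * (v r - v y + g y * (r - y))) (at r within ?S)"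
      using r S by (auto intro!: derivative_eq_intros DERIV_subset[OF h_deriv] simp: algebra_simps)
    show "norm (- 2 * (v r - v y + g y * (r - y))) \<le> 2 * (e * \<bar>z - y\<bar>)" using 1[OF r] by (simp add: abs_mult)
  qed auto
  moreover have "(2 * (e * \<bar>z - y\<bar>)) * norm (z - y) = 2 * e * (z - y)\<^sup>2"
    by (simp add: power2_eq_square)
  moreover have "(h z + 2 * v y * z - g y * (z - y)\<^sup>2) - (h y + 2 * v y * y - g y * (y - y)\<^sup>2)
     = h z - h y + 2 * v y * (z - y) - g y * (z - y)\<^sup>2" by (simp add: algebra_simps)
  ultimately show ?thesis by (simp only: real_norm_def)
qed

end

text \<open>The scheme converges to the reflected path, so that the position at time \<open>t\<close> is a limit of
  functionals of the increments of \<open>b\<close> before \<open>t\<close>. This replaces adaptedness, as the definition of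
  reflected Brownian motion mentions no filtration.\<close>

primrec euler :: "real \<Rightarrow> real \<Rightarrow> (real \<Rightarrow> real) \<Rightarrow> real \<Rightarrow> nat \<Rightarrow> nat \<Rightarrow> real" where
  "euler a \<theta> b t n 0 = 0"
| "euler a \<theta> b t n (Suc i) =
     max 0 (min a (euler a \<theta> b t n i + (b (grid t n (Suc i)) - b (grid t n i)) - 2 * \<theta> * (t / 2 ^ n)))"

text \<open>The Skorokhod problem in \<open>{0..a}\<close> for a single sample path, without
  probability. Of the local times only regularity and the fact that they grow while the path sits at
  their level are kept.\<close>

locale reflected_path =
  fixes a \<theta> :: real and y b l0 la :: "real \<Rightarrow> real"
  assumes a_pos: "0 < a"
    and y_range: "\<And>s. 0 \<le> s \<Longrightarrow> y s \<in> {0..a}" and y_cont: "continuous_on {0..} y" and y_0: "y 0 = 0"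
    and b_cont: "continuous_on {0..} b"
    and l0_mono: "\<And>s s'. 0 \<le> s \<Longrightarrow> s \<le> s' \<Longrightarrow> l0 s \<le> l0 s'"
    and la_mono: "\<And>s s'. 0 \<le> s \<Longrightarrow> s \<le> s' \<Longrightarrow> la s \<le> la s'"
    and l0_0: "l0 0 = 0" and la_0: "la 0 = 0" and l0_cont: "continuous_on {0..} l0"
    and l0_flat: "\<And>s s'. 0 \<le> s \<Longrightarrow> s \<le> s' \<Longrightarrow> (\<And>u. u \<in> {s<..<s'} \<Longrightarrow> y u \<noteq> 0) \<Longrightarrow> l0 s = l0 s'"
    and la_flat: "\<And>s s'. 0 \<le> s \<Longrightarrow> s \<le> s' \<Longrightarrow> (\<And>u. u \<in> {s<..<s'} \<Longrightarrow> y u \<noteq> a) \<Longrightarrow> la s = la s'"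
    and eq: "\<And>s. 0 \<le> s \<Longrightarrow> y s = b s - 2 * \<theta> * s + 1/2 * l0 s - 1/2 * la s"
begin

text \<open>Ito's formula for one path. The increments of \<open>h\<close> telescope, the drift and
  the compensator form Riemann sums of \<open>f\<close>, and \<open>v a = 0\<close> leaves
  \<open>v 0 * l0\<close> as the only boundary term. The two probabilistic inputs are
  \<open>Q\<close>, a bound on the sums of squared increments, and \<open>WQ\<close>, which replaces
  squared increments by the mesh. The varying \<open>k n\<close> incorporates stopping.\<close>

lemma ito_limit:
  assumes g: "continuous_on {0..a} g" and t: "0 < t" and k: "\<And>n. k n \<le> 2 ^ n"
    and lim: "(\<lambda>n. grid t n (k n)) \<longlonglongrightarrow> S"
    and Q: "\<And>n. (\<Sum>i<2 ^ n. (b (grid t n (Suc i)) - b (grid t n i))\<^sup>2) \<le> Q"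
    and WQ: "(\<lambda>n. \<Sum>i<k n. g (y (grid t n i)) * ((b (grid t n (Suc i)) - b (grid t n i))\<^sup>2 - t / 2 ^ n)) \<longlonglongrightarrow> 0"
  shows "(\<lambda>n. \<Sum>i<k n. (- 2 * potential.v a g (y (grid t n i))) * (b (grid t n (Suc i)) - b (grid t n i))
         - (- 2 * potential.v a g (y (grid t n i)))\<^sup>2 * (t / 2 ^ n) / 2)
       \<longlonglongrightarrow> potential.h a g (y S) - potential.h a g 0 + potential.v a g 0 * l0 S
         - integral {0..S} (\<lambda>s. potential.f a \<theta> g (y s))"
proof -
  interpret potential a \<theta> g by unfold_locales (use a_pos g in auto)
  have t0: "0 \<le> t" using t by simp
  have tau: "grid t n (k n) \<in> {0..t}" for n using grid_bounds[OF t0] k by auto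
  then have S: "S \<in> {0..t}" using closed_sequentially[OF closed_atLeastAtMost _ lim] by blast
  have yt: "continuous_on {0..t} y" and bt: "continuous_on {0..t} b"
    using y_cont b_cont by (auto intro: continuous_on_subset)
  have yr: "y ` {0..t} \<subseteq> {0..a}" by (intro image_subsetI y_range) simp
  have vy: "continuous_on {0..t} (\<lambda>s. v (y s))" by (rule continuous_on_compose2[OF v_cont yt yr])
  have fy: "continuous_on {0..t} (\<lambda>s. f (y s))" by (rule continuous_on_compose2[OF f_cont yt yr])
  have hy: "continuous_on {0..t} (\<lambda>s. h (y s))" by (rule continuous_on_compose2[OF h_cont yt yr])
  define db where "db n i = b (grid t n (Suc i)) - b (grid t n i)" for n i
  define dy where "dy n i = y (grid t n (Suc i)) - y (grid t n i)" for n i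
  define d0 where "d0 n i = l0 (grid t n (Suc i)) - l0 (grid t n i)" for n i
  define da where "da n i = la (grid t n (Suc i)) - la (grid t n i)" for n i
  define Y where "Y n i = y (grid t n i)" for n i
  define E where "E n i = h (Y n (Suc i)) - h (Y n i) + 2 * v (Y n i) * dy n i - g (Y n i) * (dy n i)\<^sup>2" for n i
  \<comment> \<open>All errors of one step: \<open>v\<close> at the left end point instead of at the
    boundary, Taylor's remainder, and \<open>(dy)\<^sup>2\<close> in place of
    \<open>(db)\<^sup>2\<close>.\<close>
  define R where "R n i = (v (Y n i) - v 0) * d0 n i - v (Y n i) * da n i - E n i - g (Y n i) * ((dy n i)\<^sup>2 - (db n i)\<^sup>2)" for n i
  have gr: "0 \<le> grid t n i" "grid t n i \<le> grid t n (Suc i)" for n i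
    using grid_bounds[OF t0] grid_mono[OF t0] by auto
  have dyb: "dy n i = db n i - 2 * \<theta> * (t / 2 ^ n) + 1/2 * d0 n i - 1/2 * da n i" for n i
    unfolding dy_def db_def d0_def da_def using eq[OF gr(1)[of n i]] eq[OF gr(1)[of n "Suc i"]]
    by (simp add: grid_simps(3) algebra_simps)
  have d0_nn: "0 \<le> d0 n i" and da_nn: "0 \<le> da n i" for n i
    using l0_mono[OF gr] la_mono[OF gr] by (auto simp: d0_def da_def)
  \<comment> \<open>Exact, by inserting the equation of \<open>y\<close> for \<open>db\<close>: the
    factor 2 in front of \<open>v\<close> cancels the 1/2 in front of the local times.\<close>
  have term_eq: "(- 2 * v (Y n i)) * db n i - (- 2 * v (Y n i))\<^sup>2 * (t / 2 ^ n) / 2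
      = (h (Y n (Suc i)) - h (Y n i)) - f (Y n i) * (t / 2 ^ n) + v 0 * d0 n i + R n i
        - g (Y n i) * ((db n i)\<^sup>2 - t / 2 ^ n)" for n i
  proof -
    have "db n i = dy n i + 2 * \<theta> * (t / 2 ^ n) - 1/2 * d0 n i + 1/2 * da n i" using dyb[of n i] by simp
    then have "(- 2 * v (Y n i)) * db n i = (- 2 * v (Y n i)) * dy n i - 4 * \<theta> * v (Y n i) * (t / 2 ^ n) + v (Y n i) * d0 n i - v (Y n i) * da n i"
      by (simp only: right_diff_distrib distrib_left) (simp add: mult_ac)
    then show ?thesis unfolding R_def E_def f_def by (simp add: algebra_simps power2_eq_square)
  qed
  \<comment> \<open>Bounds the total variation on \<open>{0..t}\<close> of the part of
    \<open>y\<close> other than \<open>b\<close>.\<close>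
  define V where "V = 2 * \<bar>\<theta>\<bar> * t + 1/2 * (l0 t + la t)"
  have l0t: "0 \<le> l0 t" "0 \<le> la t" using l0_mono[of 0 t] la_mono[of 0 t] l0_0 la_0 t by auto
  have V0: "0 \<le> V" using l0t t by (simp add: V_def)
  have Q0: "0 \<le> Q" using order_trans[OF sum_nonneg Q[of 0]] by auto
  obtain G where G: "\<And>r. r \<in> {0..a} \<Longrightarrow> \<bar>g r\<bar> \<le> G" and G0: "0 \<le> G"
  proof -
    have "bounded (g ` {0..a})" using compact_continuous_image[OF g] compact_imp_bounded by blast
    then obtain B where "\<And>r. r \<in> {0..a} \<Longrightarrow> \<bar>g r\<bar> \<le> B" unfolding bounded_iff by fastforce
    moreover have "0 \<le> B" using calculation[of 0] a_pos by auto
    ultimately show ?thesis using that by blast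
  qed
  have R0: "(\<lambda>n. \<Sum>i<k n. R n i) \<longlonglongrightarrow> 0"
  proof (rule LIMSEQ_I)
    fix r :: real assume r: "0 < r"
    \<comment> \<open>Collected from the summed step bounds, so that \<open>e * K\<close> dominates
      the sum of all errors. The cap \<open>e <= 1\<close> below allows \<open>(dy)\<^sup>2\<close>
      to be replaced by \<open>(db)\<^sup>2 + 2 * W\<close>.\<close>
    define K where "K = (l0 t + la t) + 2 * (2 * V + Q) + 2 * G * V"
    have K0: "0 \<le> K" using V0 Q0 G0 l0t by (auto simp: K_def)
    define e where "e = min 1 (r / 2 / (K + 1))"
    have e: "0 < e" "e \<le> 1" using r K0 by (auto simp: e_def)
    have "e * K < r"
    proof -
      have "e * K \<le> r / 2 / (K + 1) * (K + 1)" using K0 r by (intro mult_mono) (auto simp: e_def)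
      also have "\<dots> = r / 2" by (rule divide_mult_cancel_real) (use K0 in simp)
      also have "\<dots> < r" using r by simp
      finally show ?thesis .
    qed
    obtain dg where dg: "0 < dg" "\<And>s s'. s \<in> {0..a} \<Longrightarrow> s' \<in> {0..a} \<Longrightarrow> \<bar>s' - s\<bar> < dg \<Longrightarrow> \<bar>g s' - g s\<bar> < e"
      using compact_uniformly_continuous[OF g] e(1) unfolding uniformly_continuous_on_def dist_real_def by auto
    have m: "0 < min e dg" using e dg by simp
    obtain N1 where N1: "\<And>n s s'. N1 \<le> n \<Longrightarrow> s \<in> {0..t} \<Longrightarrow> s' \<in> {0..t} \<Longrightarrow> \<bar>s - s'\<bar> \<le> t / 2 ^ n \<Longrightarrow> \<bar>y s - y s'\<bar> < min e dg"
      using mesh_uniform[OF yt m] by blast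
    obtain N2 where N2: "\<And>n s s'. N2 \<le> n \<Longrightarrow> s \<in> {0..t} \<Longrightarrow> s' \<in> {0..t} \<Longrightarrow> \<bar>s - s'\<bar> \<le> t / 2 ^ n \<Longrightarrow> \<bar>b s - b s'\<bar> < e"
      using mesh_uniform[OF bt e(1)] by blast
    obtain N3 where N3: "\<And>n s s'. N3 \<le> n \<Longrightarrow> s \<in> {0..t} \<Longrightarrow> s' \<in> {0..t} \<Longrightarrow> \<bar>s - s'\<bar> \<le> t / 2 ^ n \<Longrightarrow> \<bar>v (y s) - v (y s')\<bar> < e"
      using mesh_uniform[OF vy e(1)] by blast
    have bound: "norm ((\<Sum>i<k n. R n i) - 0) < r" if n: "max N1 (max N2 N3) \<le> n" for n
    proof -
      have nN: "N1 \<le> n" "N2 \<le> n" "N3 \<le> n" using n by auto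
      have step: "\<bar>R n i\<bar> \<le> e * (d0 n i + da n i) + 2 * e * ((db n i)\<^sup>2 + 2 * (2 * \<bar>\<theta>\<bar> * (t / 2 ^ n) + 1/2 * (d0 n i + da n i)))
          + G * (2 * e * (2 * \<bar>\<theta>\<bar> * (t / 2 ^ n) + 1/2 * (d0 n i + da n i)))" if i: "i < 2 ^ n" for i
      proof -
        let ?p = "grid t n i" and ?q = "grid t n (Suc i)"
        have pq: "?p \<in> {0..t}" "?q \<in> {0..t}" "?p \<le> ?q" "?q - ?p = t / 2 ^ n"
          using grid_bounds(1)[OF t0, of n] grid_bounds(2)[OF t0, of i n] grid_bounds(2)[OF t0, of "Suc i" n] gr[of n i] i
          by (auto simp: grid_simps(3))
        have yr': "Y n i \<in> {0..a}" "Y n (Suc i) \<in> {0..a}" using y_range gr(1) by (auto simp: Y_def)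
        \<comment> \<open>If \<open>l0\<close> grows during the step, the path visits 0 in it, so
          \<open>v\<close> at the left end point is within \<open>e\<close> of \<open>v 0\<close>.
          The same argument at \<open>a\<close>, with \<open>v a = 0\<close>, gives the next
          bound.\<close>
        have 1: "\<bar>(v (Y n i) - v 0) * d0 n i\<bar> \<le> e * d0 n i"
        proof (cases "d0 n i = 0")
          case False
          then obtain u where u: "u \<in> {?p<..<?q}" "y u = 0"
            using l0_flat[OF gr(1)[of n i] gr(2)[of n i]] unfolding d0_def by fastforce
          have "\<bar>v (y ?p) - v (y u)\<bar> < e" using pq u by (intro N3[OF nN(3)]) auto
          then show ?thesis using d0_nn[of n i] u by (simp add: abs_mult Y_def mult_right_mono)
        qed simp
        have 2: "\<bar>v (Y n i) * da n i\<bar> \<le> e * da n i"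
        proof (cases "da n i = 0")
          case False
          then obtain u where u: "u \<in> {?p<..<?q}" "y u = a"
            using la_flat[OF gr(1)[of n i] gr(2)[of n i]] unfolding da_def by fastforce
          have "\<bar>v (y ?p) - v (y u)\<bar> < e" using pq u by (intro N3[OF nN(3)]) auto
          then show ?thesis using da_nn[of n i] u by (simp add: abs_mult Y_def mult_right_mono v_a)
        qed simp
        have dy_e: "\<bar>dy n i\<bar> < min e dg" using N1[OF nN(1) pq(2,1)] pq by (simp add: dy_def)
        have db_e: "\<bar>db n i\<bar> < e" using N2[OF nN(2) pq(2,1)] pq by (simp add: db_def)
        have 3: "\<bar>E n i\<bar> \<le> 2 * e * (dy n i)\<^sup>2"
        proof -
          have "\<bar>h (Y n (Suc i)) - h (Y n i) + 2 * v (Y n i) * (Y n (Suc i) - Y n i) - g (Y n i) * (Y n (Suc i) - Y n i)\<^sup>2\<bar>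
              \<le> 2 * e * (Y n (Suc i) - Y n i)\<^sup>2"
          proof (rule h_taylor[OF yr'])
            fix s assume s: "s \<in> closed_segment (Y n i) (Y n (Suc i))"
            have "s \<in> {0..a}" using closed_segment_subset[OF yr'] s by auto
            moreover have "\<bar>s - Y n i\<bar> < dg" using s dy_e
              by (auto simp: closed_segment_eq_real_ivl dy_def Y_def split: if_splits)
            ultimately show "\<bar>g s - g (Y n i)\<bar> \<le> e" using dg(2)[OF yr'(1), of s] by simp
          qed
          then show ?thesis by (simp add: E_def dy_def Y_def)
        qed
        \<comment> \<open>Factor the difference of squares: the sum \<open>dy + db\<close> is small
          by uniform continuity, and the differences \<open>dy - db\<close> add up to at most
          \<open>V\<close>.\<close>
        have 4: "\<bar>(dy n i)\<^sup>2 - (db n i)\<^sup>2\<bar> \<le> 2 * e * (2 * \<bar>\<theta>\<bar> * (t / 2 ^ n) + 1/2 * (d0 n i + da n i))"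
        proof -
          define x where "x = 2 * \<theta> * (t / 2 ^ n)"
          have x: "\<bar>x\<bar> = 2 * \<bar>\<theta>\<bar> * (t / 2 ^ n)" using t by (simp add: x_def abs_mult)
          have "dy n i - db n i = - x + 1/2 * d0 n i - 1/2 * da n i" using dyb[of n i] by (simp add: x_def)
          then have "\<bar>dy n i - db n i\<bar> \<le> \<bar>x\<bar> + 1/2 * (d0 n i + da n i)"
            using d0_nn[of n i] da_nn[of n i] abs_ge_self[of x] abs_ge_minus_self[of x]
            unfolding abs_le_iff distrib_left by (intro conjI) linarith+
          then have "\<bar>dy n i - db n i\<bar> \<le> 2 * \<bar>\<theta>\<bar> * (t / 2 ^ n) + 1/2 * (d0 n i + da n i)"
            unfolding x .
          moreover have "\<bar>dy n i + db n i\<bar> \<le> 2 * e" using dy_e db_e by linarith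
          ultimately have "\<bar>dy n i + db n i\<bar> * \<bar>dy n i - db n i\<bar> \<le> (2 * e) * (2 * \<bar>\<theta>\<bar> * (t / 2 ^ n) + 1/2 * (d0 n i + da n i))"
            using e by (intro mult_mono) auto
          then show ?thesis by (simp add: abs_mult[symmetric] power2_eq_square algebra_simps)
        qed
        define W where "W = 2 * \<bar>\<theta>\<bar> * (t / 2 ^ n) + 1/2 * (d0 n i + da n i)"
        have W0: "0 \<le> W" using d0_nn[of n i] da_nn[of n i] t by (simp add: W_def)
        have "(dy n i)\<^sup>2 \<le> (db n i)\<^sup>2 + 2 * e * W"
          using 4 abs_ge_self[of "(dy n i)\<^sup>2 - (db n i)\<^sup>2"] unfolding W_def[symmetric] by linarith
        also have "\<dots> \<le> (db n i)\<^sup>2 + 2 * W" using mult_right_mono[OF e(2) W0] by simp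
        finally have 5: "2 * e * (dy n i)\<^sup>2 \<le> 2 * e * ((db n i)\<^sup>2 + 2 * W)" using e by (intro mult_left_mono) auto
        have 6: "\<bar>g (Y n i) * ((dy n i)\<^sup>2 - (db n i)\<^sup>2)\<bar> \<le> G * (2 * e * W)"
          unfolding abs_mult using G[OF yr'(1)] 4 G0 by (intro mult_mono) (auto simp: W_def)
        have "\<bar>R n i\<bar> \<le> \<bar>(v (Y n i) - v 0) * d0 n i\<bar> + \<bar>v (Y n i) * da n i\<bar> + \<bar>E n i\<bar> + \<bar>g (Y n i) * ((dy n i)\<^sup>2 - (db n i)\<^sup>2)\<bar>"
          unfolding R_def by linarith
        also have "\<dots> \<le> e * d0 n i + e * da n i + 2 * e * ((db n i)\<^sup>2 + 2 * W) + G * (2 * e * W)"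
          using 1 2 3 5 6 by linarith
        finally show ?thesis by (simp add: W_def distrib_left)
      qed
      have tele: "(\<Sum>i<2 ^ n. d0 n i) = l0 t" "(\<Sum>i<2 ^ n. da n i) = la t"
        unfolding d0_def da_def sum_lessThan_telescope[of "\<lambda>i. l0 (grid t n i)"]
          sum_lessThan_telescope[of "\<lambda>i. la (grid t n i)"] by (simp_all add: grid_simps(1,2) l0_0 la_0)
      have sW: "(\<Sum>i<2 ^ n. 2 * \<bar>\<theta>\<bar> * (t / 2 ^ n) + 1/2 * (d0 n i + da n i)) = V"
        by (simp add: sum.distrib sum_divide_distrib[symmetric] tele V_def)
      have "\<bar>\<Sum>i<k n. R n i\<bar> \<le> (\<Sum>i<k n. \<bar>R n i\<bar>)" by (rule sum_abs)
      also have "\<dots> \<le> (\<Sum>i<2 ^ n. \<bar>R n i\<bar>)" using k[of n] by (intro sum_mono2) auto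
      also have "\<dots> \<le> (\<Sum>i<2 ^ n. e * (d0 n i + da n i) + 2 * e * ((db n i)\<^sup>2 + 2 * (2 * \<bar>\<theta>\<bar> * (t / 2 ^ n) + 1/2 * (d0 n i + da n i)))
          + G * (2 * e * (2 * \<bar>\<theta>\<bar> * (t / 2 ^ n) + 1/2 * (d0 n i + da n i))))"
        by (intro sum_mono step) auto
      also have "\<dots> = e * (l0 t + la t) + 2 * e * ((\<Sum>i<2 ^ n. (db n i)\<^sup>2) + 2 * V) + G * (2 * e * V)"
      proof -
        define Wf where "Wf i = 2 * \<bar>\<theta>\<bar> * (t / 2 ^ n) + 1/2 * (d0 n i + da n i)" for i
        have "sum Wf {..<2 ^ n} = V" using sW by (simp add: Wf_def)
        then show ?thesis unfolding Wf_def[symmetric]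
          by (simp add: sum.distrib sum_distrib_left[symmetric] tele)
      qed
      also have "\<dots> \<le> e * (l0 t + la t) + 2 * e * (Q + 2 * V) + G * (2 * e * V)"
        using Q[of n] e by (simp add: db_def)
      also have "\<dots> = e * K" by (simp add: K_def algebra_simps)
      finally show ?thesis using \<open>e * K < r\<close> by simp
    qed
    show "\<exists>no. \<forall>n\<ge>no. norm ((\<Sum>i<k n. R n i) - 0) < r" using bound by blast
  qed
  have main: "(\<Sum>i<k n. (- 2 * v (Y n i)) * db n i - (- 2 * v (Y n i))\<^sup>2 * (t / 2 ^ n) / 2)
      = h (y (grid t n (k n))) - h 0 - (\<Sum>i<k n. f (y (grid t n i)) * (t / 2 ^ n)) + v 0 * l0 (grid t n (k n))
       + (\<Sum>i<k n. R n i) - (\<Sum>i<k n. g (Y n i) * ((db n i)\<^sup>2 - t / 2 ^ n))" for n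
  proof -
    have "(\<Sum>i<k n. h (Y n (Suc i)) - h (Y n i)) = h (y (grid t n (k n))) - h 0"
      unfolding sum_lessThan_telescope[of "\<lambda>i. h (Y n i)"] by (simp add: Y_def grid_simps(1) y_0)
    moreover have "(\<Sum>i<k n. d0 n i) = l0 (grid t n (k n))"
      unfolding d0_def sum_lessThan_telescope[of "\<lambda>i. l0 (grid t n i)"] by (simp add: grid_simps(1) l0_0)
    ultimately show ?thesis
      unfolding term_eq sum.distrib sum_subtractf sum_distrib_left[symmetric] by (simp add: Y_def)
  qed
  have "(\<lambda>n. h (y (grid t n (k n)))) \<longlonglongrightarrow> h (y S)"
    using continuous_on_tendsto_compose[OF hy lim S] tau by auto
  moreover have "(\<lambda>n. l0 (grid t n (k n))) \<longlonglongrightarrow> l0 S"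
    using continuous_on_tendsto_compose[OF l0_cont lim] S tau by auto
  ultimately have "(\<lambda>n. h (y (grid t n (k n))) - h 0 - (\<Sum>i<k n. f (y (grid t n i)) * (t / 2 ^ n)) + v 0 * l0 (grid t n (k n))
       + (\<Sum>i<k n. R n i) - (\<Sum>i<k n. g (Y n i) * ((db n i)\<^sup>2 - t / 2 ^ n))) \<longlonglongrightarrow>
      h (y S) - h 0 - integral {0..S} (\<lambda>s. f (y s)) + v 0 * l0 S + 0 - 0"
    by (intro tendsto_intros R0 riemann_grid[OF t0 fy k lim] WQ[folded db_def Y_def])
  then show ?thesis unfolding main[symmetric] by (simp add: Y_def db_def algebra_simps)
qed

lemma euler_range: "euler a \<theta> b t n i \<in> {0..a}"
  using a_pos by (cases i) auto

text \<open>An energy estimate. The projection of the scheme always acts against the error, and the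
  local times push only in steps where \<open>y\<close> is within \<open>e\<close> of the boundary,
  where the error in the direction of the push is at most \<open>e\<close>. So the squared error
  grows by at most \<open>e\<close> times the local time spent.\<close>

lemma euler_error:
  assumes t: "0 \<le> t" and i: "i \<le> 2 ^ n" and e: "0 \<le> e"
    and m: "\<And>s s'. s \<in> {0..t} \<Longrightarrow> s' \<in> {0..t} \<Longrightarrow> \<bar>s - s'\<bar> \<le> t / 2 ^ n \<Longrightarrow> \<bar>y s - y s'\<bar> \<le> e"
  shows "(y (grid t n i) - euler a \<theta> b t n i)\<^sup>2 \<le> e * (l0 (grid t n i) + la (grid t n i))"
  using i
proof (induction i)
  case 0
  then show ?case by (simp add: grid_simps y_0 l0_0 la_0)
next
  case (Suc i)
  let ?p = "grid t n i" and ?q = "grid t n (Suc i)"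
  have pq: "0 \<le> ?p" "?p \<le> ?q" "?q \<le> t" "?q - ?p = t / 2 ^ n"
    using grid_bounds(1)[OF t, of n i] grid_bounds(2)[OF t Suc.prems] grid_mono[OF t, of i "Suc i" n]
    by (auto simp: grid_simps(3))
  define d0 where "d0 = l0 ?q - l0 ?p"
  define da where "da = la ?q - la ?p"
  have nn: "0 \<le> d0" "0 \<le> da" using l0_mono[OF pq(1,2)] la_mono[OF pq(1,2)] by (auto simp: d0_def da_def)
  define \<rho> where "\<rho> = euler a \<theta> b t n (Suc i) - (euler a \<theta> b t n i + (b ?q - b ?p) - 2 * \<theta> * (t / 2 ^ n))"
  define D where "D = y ?p - euler a \<theta> b t n i"
  define D' where "D' = y ?q - euler a \<theta> b t n (Suc i)"
  have yq: "y ?q \<in> {0..a}" using y_range pq by auto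
  have DD: "D' = D + (1/2 * d0 - 1/2 * da) - \<rho>"
    unfolding D'_def D_def \<rho>_def d0_def da_def using eq[OF pq(1)] eq[of ?q] pq
    by (simp add: algebra_simps grid_simps(3))
  \<comment> \<open>The correction is positive only if the scheme is clamped at 0, where
    \<open>y\<close> lies above it, and negative only if it is clamped at \<open>a\<close>, where
    \<open>y\<close> lies below it.\<close>
  have r: "0 \<le> D' * \<rho>"
  proof -
    have "\<rho> \<le> 0 \<or> euler a \<theta> b t n (Suc i) = 0" "0 \<le> \<rho> \<or> euler a \<theta> b t n (Suc i) = a" unfolding \<rho>_def using a_pos by auto
    then show ?thesis using yq euler_range[of t n "Suc i"] unfolding D'_def
      by (cases "\<rho> \<le> 0"; cases "0 \<le> \<rho>") (auto simp: mult_nonpos_nonpos)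
  qed
  have 1: "D' * d0 \<le> e * d0"
  proof (cases "d0 = 0")
    case False
    then obtain u where u: "u \<in> {?p<..<?q}" "y u = 0" using l0_flat[OF pq(1,2)] unfolding d0_def by fastforce
    have "\<bar>y ?q - y u\<bar> \<le> e" using u pq by (intro m) auto
    then have "D' \<le> e" using u euler_range[of t n "Suc i"] by (auto simp: D'_def)
    then show ?thesis using nn(1) by (rule mult_right_mono)
  qed simp
  have 2: "- D' * da \<le> e * da"
  proof (cases "da = 0")
    case False
    then obtain u where u: "u \<in> {?p<..<?q}" "y u = a" using la_flat[OF pq(1,2)] unfolding da_def by fastforce
    have "\<bar>y ?q - y u\<bar> \<le> e" using u pq by (intro m) auto
    then have "- D' \<le> e" using u euler_range[of t n "Suc i"] by (auto simp: D'_def)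
    then show ?thesis using nn(2) by (rule mult_right_mono)
  qed simp
  \<comment> \<open>Expanding around the new error \<open>D'\<close> instead of the old one gives
    the quadratic remainder the favourable sign, so it can simply be dropped.\<close>
  have "D\<^sup>2 = (D' - ((1/2 * d0 - 1/2 * da) - \<rho>))\<^sup>2" using DD by simp
  also have "\<dots> = D'\<^sup>2 - 2 * D' * ((1/2 * d0 - 1/2 * da) - \<rho>) + ((1/2 * d0 - 1/2 * da) - \<rho>)\<^sup>2" by (rule power2_diff[THEN trans]) simp
  finally have "D'\<^sup>2 \<le> D\<^sup>2 + 2 * D' * ((1/2 * d0 - 1/2 * da) - \<rho>)" using zero_le_power2[of "(1/2 * d0 - 1/2 * da) - \<rho>"] by linarith
  also have "\<dots> = D\<^sup>2 + D' * d0 + (- D' * da) - 2 * (D' * \<rho>)" by (simp add: algebra_simps)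
  also have "\<dots> \<le> e * (l0 ?p + la ?p) + e * d0 + e * da" using Suc 1 2 r by (simp add: D_def)
  also have "\<dots> = e * (l0 ?q + la ?q)" by (simp add: d0_def da_def algebra_simps)
  finally show ?case by (simp add: D'_def)
qed

text \<open>The index \<open>i * 2 ^ m\<close> names the same time on every refinement. In
  \<open>euler_error\<close> the modulus of continuity of \<open>y\<close> over one mesh tends to 0,
  while the local times up to \<open>t\<close> stay bounded.\<close>

lemma euler_tendsto:
  assumes t: "0 \<le> t" and i: "i \<le> 2 ^ n"
  shows "(\<lambda>m. euler a \<theta> b t (n + m) (i * 2 ^ m)) \<longlonglongrightarrow> y (grid t n i)"
proof (rule LIMSEQ_I)
  fix r :: real assume r: "0 < r"
  have yt: "continuous_on {0..t} y" using y_cont by (auto intro: continuous_on_subset)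
  define L where "L = l0 t + la t"
  have L0: "0 \<le> L" using l0_mono[OF order.refl t] la_mono[OF order.refl t] l0_0 la_0 by (simp add: L_def)
  define e where "e = r\<^sup>2 / 2 / (L + 1)"
  have e: "0 < e" using r L0 by (simp add: e_def)
  obtain N where N: "\<And>n s s'. N \<le> n \<Longrightarrow> s \<in> {0..t} \<Longrightarrow> s' \<in> {0..t} \<Longrightarrow> \<bar>s - s'\<bar> \<le> t / 2 ^ n \<Longrightarrow> \<bar>y s - y s'\<bar> < e"
    using mesh_uniform[OF yt e] by blast
  show "\<exists>no. \<forall>m\<ge>no. norm (euler a \<theta> b t (n + m) (i * 2 ^ m) - y (grid t n i)) < r"
  proof (intro exI[of _ N] allI impI)
    fix m assume "N \<le> m"
    have i': "i * 2 ^ m \<le> 2 ^ (n + m)" using i by (simp add: power_add)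
    have g: "grid t (n + m) (i * 2 ^ m) = grid t n i" using grid_refine[of n "n + m" t i] by simp
    have "(y (grid t n i) - euler a \<theta> b t (n + m) (i * 2 ^ m))\<^sup>2 \<le> e * (l0 (grid t n i) + la (grid t n i))"
      using euler_error[OF t i' less_imp_le[OF e] less_imp_le[OF N[of "n + m"]]] \<open>N \<le> m\<close> unfolding g by simp
    also have "\<dots> \<le> e * (L + 1)"
      using e l0_mono[of "grid t n i" t] la_mono[of "grid t n i" t] grid_bounds[OF t] i
      by (intro mult_left_mono) (auto simp: L_def intro: add_mono)
    also have "\<dots> = r\<^sup>2 / 2" unfolding e_def by (rule divide_mult_cancel_real) (use L0 in simp)
    also have "\<dots> < r\<^sup>2" using r by simp
    finally show "norm (euler a \<theta> b t (n + m) (i * 2 ^ m) - y (grid t n i)) < r"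
      using r by (simp add: power2_commute[of "euler a \<theta> b t (n + m) (i * 2 ^ m)"] abs_minus_commute abs_less_iff power2_less_imp_less)
  qed
qed

end

section \<open>Approximation of local times\<close>

lemma abs_divide_diff_le:
  fixes m :: real assumes "0 < m" "\<bar>x - c * m\<bar> \<le> e * m" shows "\<bar>x / m - c\<bar> \<le> e"
proof -
  have "x / m - c = (x - c * m) / m" using assms by (simp add: field_simps)
  then show ?thesis using assms by (simp add: abs_divide pos_divide_le_eq)
qed

lemma integral_nonneg_everywhere:
  fixes f :: "real \<Rightarrow> real" assumes "\<And>x. 0 \<le> f x" shows "0 \<le> integral S f"
  by (cases "f integrable_on S") (auto intro: integral_nonneg assms simp: not_integrable_integral)

definition tent :: "real \<Rightarrow> real \<Rightarrow> real \<Rightarrow> real" where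
  "tent h r y = max 0 (1 - \<bar>r - y\<bar> / h)"

definition tent_mass :: "real \<Rightarrow> real \<Rightarrow> real \<Rightarrow> real" where
  "tent_mass a h r = integral {0..a} (tent h r)"

text \<open>Dividing by \<open>tent_mass\<close> keeps the convergence to the local time uniform up to the
  end points 0 and \<open>a\<close>, where half of the tent lies outside the interval.\<close>

definition density_approx :: "real \<Rightarrow> (real \<Rightarrow> real) \<Rightarrow> nat \<Rightarrow> real \<Rightarrow> real \<Rightarrow> real" where
  "density_approx a \<phi> n r t =
     integral {0..t} (\<lambda>s. tent (a / real (n + 2)) r (\<phi> s)) / tent_mass a (a / real (n + 2)) r"

lemma tent_bounds: "0 \<le> tent h r y" "0 < h \<Longrightarrow> tent h r y \<le> 1"
  by (auto simp: tent_def)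

lemma tent_eq_0: "0 < h \<Longrightarrow> h \<le> \<bar>r - y\<bar> \<Longrightarrow> tent h r y = 0"
  by (simp add: tent_def)

lemma tent_cont: "continuous_on S (\<lambda>(r, y). tent h r y)" "continuous_on T (tent h r)"
  unfolding tent_def case_prod_unfold divide_inverse by (intro continuous_intros)+

lemma tent_half:
  assumes h: "0 < h"
  shows "integral {r..r + h} (tent h r) = h / 2" "integral {r - h..r} (tent h r) = h / 2"
proof -
  have "((\<lambda>y. 1 - (y - r) / h) has_integral ((r + h) - ((r + h) - r)\<^sup>2 / (2 * h)) - (r - (r - r)\<^sup>2 / (2 * h))) {r..r + h}"
    by (rule fundamental_theorem_of_calculus)
       (use h in \<open>auto intro!: derivative_eq_intros simp: has_real_derivative_iff_has_vector_derivative[symmetric] field_simps\<close>)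
  also have "((r + h) - ((r + h) - r)\<^sup>2 / (2 * h)) - (r - (r - r)\<^sup>2 / (2 * h)) = h / 2"
    using h by (simp add: power2_eq_square)
  finally have "integral {r..r + h} (\<lambda>y. 1 - (y - r) / h) = h / 2" by (rule integral_unique)
  moreover have "integral {r..r + h} (tent h r) = integral {r..r + h} (\<lambda>y. 1 - (y - r) / h)"
    by (rule integral_cong) (use h in \<open>auto simp: tent_def\<close>)
  ultimately show "integral {r..r + h} (tent h r) = h / 2" by simp
  have "((\<lambda>y. 1 + (y - r) / h) has_integral (r + (r - r)\<^sup>2 / (2 * h)) - ((r - h) + ((r - h) - r)\<^sup>2 / (2 * h))) {r - h..r}"
    by (rule fundamental_theorem_of_calculus)
       (use h in \<open>auto intro!: derivative_eq_intros simp: has_real_derivative_iff_has_vector_derivative[symmetric] field_simps\<close>)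
  also have "(r + (r - r)\<^sup>2 / (2 * h)) - ((r - h) + ((r - h) - r)\<^sup>2 / (2 * h)) = h / 2"
    using h by (simp add: power2_eq_square)
  finally have "integral {r - h..r} (\<lambda>y. 1 + (y - r) / h) = h / 2" by (rule integral_unique)
  moreover have "integral {r - h..r} (tent h r) = integral {r - h..r} (\<lambda>y. 1 + (y - r) / h)"
    by (rule integral_cong) (use h in \<open>auto simp: tent_def field_simps\<close>)
  ultimately show "integral {r - h..r} (tent h r) = h / 2" by simp
qed

lemma tent_int: "tent h r integrable_on {c..d}"
  by (intro integrable_continuous_real tent_cont)

lemma tent_full: "0 < h \<Longrightarrow> integral {r - h..r + h} (tent h r) = h"
  using tent_half[of h r] Henstock_Kurzweil_Integration.integral_combine[of "r - h" r "r + h" "tent h r"] tent_int by simp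

text \<open>As \<open>h <= a / 2\<close>, at least one of the two halves of the tent lies inside
  \<open>{0..a}\<close>, wherever its centre is.\<close>

lemma tent_mass_lower:
  assumes "0 < h" "h \<le> a / 2" "r \<in> {0..a}" shows "h / 2 \<le> tent_mass a h r"
proof (cases "r \<le> a / 2")
  case True
  have "integral {r..r + h} (tent h r) \<le> integral {0..a} (tent h r)"
    by (intro integral_subset_le tent_int) (use assms True tent_bounds in auto)
  then show ?thesis using tent_half[OF assms(1)] by (simp add: tent_mass_def)
next
  case False
  have "integral {r - h..r} (tent h r) \<le> integral {0..a} (tent h r)"
    by (intro integral_subset_le tent_int) (use assms False tent_bounds in auto)
  then show ?thesis using tent_half[OF assms(1)] by (simp add: tent_mass_def)
qed

lemma tent_mass_pos: "0 < h \<Longrightarrow> h \<le> a / 2 \<Longrightarrow> r \<in> {0..a} \<Longrightarrow> 0 < tent_mass a h r"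
  using tent_mass_lower[of h a r] by linarith

lemma tent_mass_upper:
  assumes "0 < h" "r \<in> {0..a}" shows "tent_mass a h r \<le> h"
proof -
  have "integral {0..a} (tent h r) = integral ({0..a} \<inter> {r - h..r + h}) (tent h r)"
    by (rule integral_spike_set) (use assms tent_eq_0[of h r] in \<open>auto intro!: negligible_subset[OF negligible_empty]\<close>)
  also have "\<dots> \<le> integral {r - h..r + h} (tent h r)"
    by (intro integral_subset_le) (use assms tent_bounds in \<open>auto simp: tent_int\<close>)
  finally show ?thesis using tent_full[OF assms(1)] by (simp add: tent_mass_def)
qed

lemma tent_mass_interior:
  assumes "0 < h" "h \<le> r" "r \<le> a - h" shows "tent_mass a h r = h"
proof (rule antisym)
  show "tent_mass a h r \<le> h" using assms by (intro tent_mass_upper) auto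
  have "integral {r - h..r + h} (tent h r) \<le> integral {0..a} (tent h r)"
    by (intro integral_subset_le tent_int) (use assms tent_bounds in auto)
  then show "h \<le> tent_mass a h r" using tent_full[OF assms(1)] by (simp add: tent_mass_def)
qed

lemma tent_average:
  assumes h: "0 < h" and f: "continuous_on {0..a} f" and r: "r \<in> {0..a}"
    and e: "\<And>y. y \<in> {0..a} \<Longrightarrow> \<bar>r - y\<bar> < h \<Longrightarrow> \<bar>f y - c\<bar> \<le> e"
  shows "\<bar>integral {0..a} (\<lambda>y. tent h r y * f y) - c * tent_mass a h r\<bar> \<le> e * tent_mass a h r"
proof -
  have 1: "continuous_on {0..a} (\<lambda>y. tent h r y * f y)" "continuous_on {0..a} (\<lambda>y. tent h r y * (f y - c))"
    by (intro continuous_intros f tent_cont)+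
  have "integral {0..a} (\<lambda>y. tent h r y * (f y - c)) = integral {0..a} (\<lambda>y. tent h r y * f y - c * tent h r y)"
    by (simp add: algebra_simps)
  also have "\<dots> = integral {0..a} (\<lambda>y. tent h r y * f y) - c * tent_mass a h r"
    unfolding tent_mass_def
    by (subst integral_diff) (simp_all add: integrable_continuous_real 1 continuous_on_mult_left tent_cont)
  finally have "\<bar>integral {0..a} (\<lambda>y. tent h r y * f y) - c * tent_mass a h r\<bar> = norm (integral {0..a} (\<lambda>y. tent h r y * (f y - c)))"
    by simp
  also have "\<dots> \<le> integral {0..a} (\<lambda>y. tent h r y * e)"
  proof (rule integral_norm_bound_integral)
    show "(\<lambda>y. tent h r y * (f y - c)) integrable_on {0..a}" by (intro integrable_continuous_real 1)
    show "(\<lambda>y. tent h r y * e) integrable_on {0..a}" by (intro integrable_continuous_real continuous_intros tent_cont)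
    fix y assume y: "y \<in> {0..a}"
    show "norm (tent h r y * (f y - c)) \<le> tent h r y * e"
    proof (cases "\<bar>r - y\<bar> < h")
      case True
      then show ?thesis using e[OF y] tent_bounds(1)[of h r y] by (simp add: abs_mult mult_left_mono)
    qed (use tent_eq_0[OF h, of r y] in simp)
  qed
  finally show ?thesis by (simp add: tent_mass_def mult.commute)
qed

text \<open>The offset in \<open>n + 2\<close> is what keeps the width at most \<open>a / 2\<close>,
  as \<open>tent_mass_lower\<close> requires.\<close>

lemma mesh_pos:
  assumes "0 < a"
  shows "0 < a / real (n + 2)" "a / real (n + 2) \<le> a / 2" "(\<lambda>n. a / real (n + 2)) \<longlonglongrightarrow> 0"
proof -
  show "0 < a / real (n + 2)" "a / real (n + 2) \<le> a / 2"
    using assms divide_left_mono[of 2 "real (n + 2)" a] by simp_all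
  have "(\<lambda>n. a / real n) \<longlonglongrightarrow> 0" by (rule lim_const_over_n)
  from LIMSEQ_ignore_initial_segment[OF this, of 2] show "(\<lambda>n. a / real (n + 2)) \<longlonglongrightarrow> 0" .
qed

context
  fixes a :: real and \<phi> :: "real \<Rightarrow> real"
  assumes a: "0 < a" and \<phi>: "continuous_on {0..} \<phi>" and rg: "\<And>s. 0 \<le> s \<Longrightarrow> \<phi> s \<in> {0..a}"
begin

text \<open>By the occupation formula the approximation is a weighted average of the local time over
  nearby levels, and the local time is uniformly continuous on a compact rectangle.\<close>

lemma density_approx_uniform:
  assumes l: "is_local_time a \<phi> l" and e: "0 < e" and T: "0 \<le> T"
  shows "\<exists>n0. \<forall>n\<ge>n0. \<forall>r\<in>{0..a}. \<forall>t\<in>{0..T}. \<bar>density_approx a \<phi> n r t - l r t\<bar> \<le> e"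
proof -
  have "compact ({0..a} \<times> {0..T})" by (intro compact_Times) auto
  moreover have "continuous_on ({0..a} \<times> {0..T}) (\<lambda>(r, t). l r t)"
    by (rule continuous_on_subset[OF local_timeD(1)[OF l]]) auto
  ultimately have "uniformly_continuous_on ({0..a} \<times> {0..T}) (\<lambda>(r, t). l r t)"
    by (rule compact_uniformly_continuous[rotated])
  then obtain d where d: "0 < d" "\<And>p p'. p \<in> {0..a} \<times> {0..T} \<Longrightarrow> p' \<in> {0..a} \<times> {0..T} \<Longrightarrow> dist p' p < d \<Longrightarrow>
     dist ((\<lambda>(r, t). l r t) p') ((\<lambda>(r, t). l r t) p) < e"
    using e unfolding uniformly_continuous_on_def by meson
  obtain n0 where n0: "\<And>n. n0 \<le> n \<Longrightarrow> a / real (n + 2) < d"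
  proof -
    obtain n0 where "\<forall>n\<ge>n0. norm (a / real (n + 2) - 0) < d" using LIMSEQ_D[OF mesh_pos(3)[OF a] d(1)] by blast
    then have "a / real (n + 2) < d" if "n0 \<le> n" for n using that abs_ge_self[of "a / real (n + 2)"] by force
    then show ?thesis using that by blast
  qed
  show ?thesis
  proof (intro exI[of _ n0] allI impI ballI)
    fix n r t assume n: "n0 \<le> n" and r: "r \<in> {0..a}" and t: "t \<in> {0..T}"
    define h where "h = a / real (n + 2)"
    have h: "0 < h" "h \<le> a / 2" unfolding h_def by (rule mesh_pos[OF a])+
    have m: "0 < tent_mass a h r" by (rule tent_mass_pos[OF h r])
    have t0: "0 \<le> t" using t by simp
    have occ: "integral {0..t} (\<lambda>s. tent h r (\<phi> s)) = integral {0..a} (\<lambda>y. tent h r y * l y t)"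
      by (rule occupation_integral[OF a l t0 \<phi> rg]) (simp_all add: tent_cont)
    have "density_approx a \<phi> n r t = integral {0..a} (\<lambda>y. tent h r y * l y t) / tent_mass a h r"
      unfolding density_approx_def h_def[symmetric] occ ..
    moreover have "\<bar>integral {0..a} (\<lambda>y. tent h r y * l y t) - l r t * tent_mass a h r\<bar> \<le> e * tent_mass a h r"
    proof (rule tent_average[OF h(1) local_timeD(4)[OF l t0] r])
      fix y assume "y \<in> {0..a}" "\<bar>r - y\<bar> < h"
      then show "\<bar>l y t - l r t\<bar> \<le> e"
        using d(2)[of "(r, t)" "(y, t)"] r t n0[OF n, folded h_def]
        by (auto simp: dist_Pair_Pair dist_real_def abs_minus_commute[of y r])
    qed
    ultimately show "\<bar>density_approx a \<phi> n r t - l r t\<bar> \<le> e"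
      using abs_divide_diff_le[OF m] by simp
  qed
qed

text \<open>The numerator is Lipschitz in the level, with constant proportional to
  \<open>1 / h\<close>, and 1-Lipschitz in time; the denominator is continuous and bounded away from
  0.\<close>

lemma density_approx_cont:
  "continuous_on ({0..a} \<times> {0..}) (\<lambda>(r, t). density_approx a \<phi> n r t)"
proof -
  define h where "h = a / real (n + 2)"
  have h: "0 < h" "h \<le> a / 2" unfolding h_def by (rule mesh_pos[OF a])+
  have lip: "\<bar>tent h r y - tent h r' y\<bar> \<le> \<bar>r - r'\<bar> / h" for r r' y
  proof -
    have "\<bar>max 0 p - max 0 q\<bar> \<le> \<bar>p - q\<bar>" for p q :: real by (auto simp: max_def)
    from this[of "1 - \<bar>r - y\<bar> / h" "1 - \<bar>r' - y\<bar> / h"]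
    have "\<bar>tent h r y - tent h r' y\<bar> \<le> \<bar>\<bar>r' - y\<bar> / h - \<bar>r - y\<bar> / h\<bar>"
      unfolding tent_def by (simp only: diff_diff_eq2 add_diff_cancel_left' diff_add_cancel add_diff_eq) simp
    also have "\<dots> = \<bar>\<bar>r' - y\<bar> - \<bar>r - y\<bar>\<bar> / h"
    proof -
      have "\<bar>x / h\<bar> = \<bar>x\<bar> / h" for x using h(1) by (metis abs_divide abs_of_pos)
      then show ?thesis unfolding diff_divide_distrib[symmetric] .
    qed
    also have "\<dots> \<le> \<bar>r - r'\<bar> / h"
      using h(1) by (intro divide_right_mono) auto
    finally show ?thesis .
  qed
  have m: "tent_mass a h r \<noteq> 0" if "r \<in> {0..a}" for r using tent_mass_pos[OF h that] by simp
  have cm: "continuous_on {0..a} (tent_mass a h)"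
    unfolding tent_mass_def[abs_def]
    using integral_continuous_on_param[of "{0..a}" 0 a "\<lambda>r y. tent h r y"] tent_cont(1)[of "{0..a} \<times> cbox 0 a" h]
    by simp
  have ct: "continuous_on ({0..a} \<times> {0..}) (\<lambda>p. integral {0..snd p} (\<lambda>s. tent h (fst p) (\<phi> s)))"
    unfolding continuous_on_iff
  proof (intro ballI allI impI)
    fix p :: "real \<times> real" and e :: real
    assume p: "p \<in> {0..a} \<times> {0..}" and e: "0 < e"
    obtain r t where rt: "p = (r, t)" "r \<in> {0..a}" "0 \<le> t" using p by auto
    \<comment> \<open>A change of level by \<open>d\<close> costs at most
      \<open>d / h * (t + 1)\<close>, a change of time at most \<open>d\<close>. The cap 1 ensures
      \<open>t' <= t + 1\<close>.\<close>
    define d where "d = min 1 (e / 2 / (1 + (t + 1) / h))"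
    have pos: "0 < 1 + (t + 1) / h" using h rt by (intro add_pos_nonneg divide_nonneg_pos) auto
    have "0 < e / 2 / (1 + (t + 1) / h)" by (rule divide_pos_pos[OF half_gt_zero[OF e] pos])
    then have d: "0 < d" "d \<le> 1" by (auto simp: d_def)
    have "d * (1 + (t + 1) / h) < e"
    proof -
      have "d * (1 + (t + 1) / h) \<le> e / 2 / (1 + (t + 1) / h) * (1 + (t + 1) / h)"
        using pos by (intro mult_right_mono) (auto simp: d_def)
      also have "\<dots> = e / 2" by (rule divide_mult_cancel_real) (use pos in simp)
      finally show ?thesis using e by linarith
    qed
    show "\<exists>d>0. \<forall>x'\<in>{0..a} \<times> {0..}. dist x' p < d \<longrightarrow>
       dist (integral {0..snd x'} (\<lambda>s. tent h (fst x') (\<phi> s))) (integral {0..snd p} (\<lambda>s. tent h (fst p) (\<phi> s))) < e"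
    proof (intro exI[of _ d] conjI ballI impI d)
      fix p' assume p': "p' \<in> {0..a} \<times> {0..}" and dd: "dist p' p < d"
      obtain r' t' where rt': "p' = (r', t')" "r' \<in> {0..a}" "0 \<le> t'" using p' by auto
      have rd: "\<bar>r' - r\<bar> \<le> d" and td: "\<bar>t' - t\<bar> \<le> d"
        using dd dist_fst_le[of p' p] dist_snd_le[of p' p] by (auto simp: rt rt' dist_real_def)
      have cs: "continuous_on {c..d} (\<lambda>s. tent h r (\<phi> s))" if "0 \<le> c" for r c d
        by (rule continuous_on_compose2[OF tent_cont(2)[of UNIV] continuous_on_subset[OF \<phi>]]) (use that in auto)
      have "norm (integral {0..t'} (\<lambda>s. tent h r' (\<phi> s) - tent h r (\<phi> s))) \<le> d / h * (t' - 0)"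
      proof (rule integral_bound)
        show "continuous_on {0..t'} (\<lambda>s. tent h r' (\<phi> s) - tent h r (\<phi> s))" by (intro continuous_on_diff cs order.refl)
        fix s
        show "norm (tent h r' (\<phi> s) - tent h r (\<phi> s)) \<le> d / h"
          using order_trans[OF lip[of r' "\<phi> s" r] divide_right_mono[OF rd]] h by simp
      qed (use rt' in auto)
      also have "\<dots> \<le> d / h * (t + 1)"
      proof (rule mult_left_mono)
        show "t' - 0 \<le> t + 1" using td d by linarith
        show "0 \<le> d / h" by (rule divide_nonneg_pos[OF less_imp_le[OF d(1)] h(1)])
      qed
      finally have 1: "\<bar>integral {0..t'} (\<lambda>s. tent h r' (\<phi> s)) - integral {0..t'} (\<lambda>s. tent h r (\<phi> s))\<bar> \<le> d / h * (t + 1)"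
        by (subst (asm) integral_diff) (auto intro!: integrable_continuous_real cs)
      have 2: "\<bar>integral {0..t'} (\<lambda>s. tent h r (\<phi> s)) - integral {0..t} (\<lambda>s. tent h r (\<phi> s))\<bar> \<le> d"
      proof -
        have *: "\<bar>integral {0..q} (\<lambda>s. tent h r (\<phi> s)) - integral {0..p} (\<lambda>s. tent h r (\<phi> s))\<bar> \<le> q - p" if "0 \<le> p" "p \<le> q" for p q
        proof -
          have "integral {0..p} (\<lambda>s. tent h r (\<phi> s)) + integral {p..q} (\<lambda>s. tent h r (\<phi> s)) = integral {0..q} (\<lambda>s. tent h r (\<phi> s))"
            by (rule Henstock_Kurzweil_Integration.integral_combine) (use that in \<open>auto intro!: integrable_continuous_real cs\<close>)
          moreover have "norm (integral {p..q} (\<lambda>s. tent h r (\<phi> s))) \<le> 1 * (q - p)"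
            by (rule integral_bound) (use that tent_bounds[of h r] h in \<open>auto intro!: cs\<close>)
          ultimately show ?thesis by simp
        qed
        show ?thesis using *[of t t'] *[of t' t] rt rt' td by (cases "t \<le> t'") (auto simp: abs_le_iff)
      qed
      have "d / h * (t + 1) + d = d * (1 + (t + 1) / h)" by (simp add: distrib_left add_divide_distrib)
      then show "dist (integral {0..snd p'} (\<lambda>s. tent h (fst p') (\<phi> s))) (integral {0..snd p} (\<lambda>s. tent h (fst p) (\<phi> s))) < e"
        using 1 2 \<open>d * (1 + (t + 1) / h) < e\<close> unfolding rt rt' dist_real_def fst_conv snd_conv by linarith
    qed
  qed
  show ?thesis unfolding density_approx_def case_prod_unfold h_def[symmetric]
    by (intro continuous_on_divide ct continuous_on_compose2[OF cm]) (auto intro!: continuous_intros m)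
qed

text \<open>The converse of \<open>density_approx_uniform\<close>. Together they replace the
  existence of a local time, a statement about all functions of level and time, by a Cauchy
  condition on explicit functionals of the path, which is what makes that event measurable.\<close>

lemma local_time_from_cauchy:
  assumes C: "\<And>T e. 0 \<le> T \<Longrightarrow> 0 < e \<Longrightarrow> \<exists>n0. \<forall>m\<ge>n0. \<forall>n\<ge>n0. \<forall>r\<in>{0..a}. \<forall>t\<in>{0..T}.
      \<bar>density_approx a \<phi> m r t - density_approx a \<phi> n r t\<bar> \<le> e"
  shows "is_local_time a \<phi> (\<lambda>r t. lim (\<lambda>n. density_approx a \<phi> n r t))"
proof -
  define D where "D n r t = density_approx a \<phi> n r t" for n r t
  define l where "l r t = lim (\<lambda>n. D n r t)" for r t
  have conv: "(\<lambda>n. D n r t) \<longlonglongrightarrow> l r t" if "r \<in> {0..a}" "0 \<le> t" for r t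
  proof -
    have "Cauchy (\<lambda>n. D n r t)"
    proof (rule CauchyI)
      fix e :: real assume "0 < e"
      then obtain n0 where "\<And>m n. n0 \<le> m \<Longrightarrow> n0 \<le> n \<Longrightarrow> \<bar>D m r t - D n r t\<bar> \<le> e / 2"
      proof -
        obtain n0 where "\<forall>m\<ge>n0. \<forall>n\<ge>n0. \<forall>r\<in>{0..a}. \<forall>s\<in>{0..t}. \<bar>density_approx a \<phi> m r s - density_approx a \<phi> n r s\<bar> \<le> e / 2"
          using C[of t "e / 2"] \<open>0 < e\<close> \<open>0 \<le> t\<close> by auto
        with \<open>r \<in> {0..a}\<close> \<open>0 \<le> t\<close> show ?thesis by (intro that[of n0]) (auto simp: D_def)
      qed
      then show "\<exists>M. \<forall>m\<ge>M. \<forall>n\<ge>M. norm (D m r t - D n r t) < e"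
        using \<open>0 < e\<close> by (intro exI[of _ n0]) fastforce
    qed
    then show ?thesis by (simp add: l_def Cauchy_convergent convergent_LIMSEQ_iff[symmetric])
  qed
  have unif: "\<exists>n0. \<forall>n\<ge>n0. \<forall>r\<in>{0..a}. \<forall>t\<in>{0..T}. \<bar>D n r t - l r t\<bar> \<le> e" if "0 \<le> T" "0 < e" for T e
  proof -
    obtain n0 where n0: "\<And>m n r t. n0 \<le> m \<Longrightarrow> n0 \<le> n \<Longrightarrow> r \<in> {0..a} \<Longrightarrow> t \<in> {0..T} \<Longrightarrow> \<bar>D m r t - D n r t\<bar> \<le> e"
      using C[OF \<open>0 \<le> T\<close> \<open>0 < e\<close>] unfolding D_def by blast
    show ?thesis
    proof (intro exI[of _ n0] allI impI ballI)
      fix n r t assume n: "n0 \<le> n" "r \<in> {0..a}" "t \<in> {0..T}"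
      have "(\<lambda>m. \<bar>D n r t - D m r t\<bar>) \<longlonglongrightarrow> \<bar>D n r t - l r t\<bar>"
        using n by (intro tendsto_intros conv) auto
      then show "\<bar>D n r t - l r t\<bar> \<le> e"
        by (rule LIMSEQ_le_const2) (use n0[OF n(1) _ n(2,3)] in blast)
    qed
  qed
  have cont: "continuous_on ({0..a} \<times> {0..}) (\<lambda>(r, t). l r t)"
    unfolding continuous_on_eq_continuous_within
  proof
    fix p :: "real \<times> real" assume p: "p \<in> {0..a} \<times> {0..}"
    define T where "T = snd p + 1"
    have T: "0 \<le> T" using p by (auto simp: T_def)
    have "continuous_on ({0..a} \<times> {0..T}) (\<lambda>(r, t). l r t)"
    proof (rule uniform_limit_theorem[where F=sequentially and f="\<lambda>n (r, t). D n r t"])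
      show "\<forall>\<^sub>F n in sequentially. continuous_on ({0..a} \<times> {0..T}) (\<lambda>(r, t). D n r t)"
        unfolding D_def by (intro always_eventually allI continuous_on_subset[OF density_approx_cont]) auto
      show "uniform_limit ({0..a} \<times> {0..T}) (\<lambda>n (r, t). D n r t) (\<lambda>(r, t). l r t) sequentially"
      proof (rule uniform_limitI)
        fix e :: real assume "0 < e"
        then obtain n0 where "\<And>n r t. n0 \<le> n \<Longrightarrow> r \<in> {0..a} \<Longrightarrow> t \<in> {0..T} \<Longrightarrow> \<bar>D n r t - l r t\<bar> \<le> e / 2"
          using unif[OF T half_gt_zero[OF \<open>0 < e\<close>]] by blast
        then show "\<forall>\<^sub>F n in sequentially. \<forall>x\<in>{0..a} \<times> {0..T}. dist ((\<lambda>(r, t). D n r t) x) ((\<lambda>(r, t). l r t) x) < e"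
          using \<open>0 < e\<close> unfolding eventually_sequentially dist_real_def by (intro exI[of _ n0]) fastforce
      qed
    qed simp
    moreover have "p \<in> {0..a} \<times> {0..T}" using p by (auto simp: T_def)
    ultimately have "continuous (at p within ({0..a} \<times> {0..T})) (\<lambda>(r, t). l r t)"
      by (auto simp: continuous_on_eq_continuous_within)
    moreover have "at p within ({0..a} \<times> {0..T}) = at p within ({0..a} \<times> {0..})"
      by (rule at_within_nhd[of _ "UNIV \<times> {..<T}"]) (use p in \<open>auto simp: T_def open_Times\<close>)
    ultimately show "continuous (at p within ({0..a} \<times> {0..})) (\<lambda>(r, t). l r t)" by simp
  qed
  have D0: "0 \<le> D n r t" for n r t
    unfolding D_def density_approx_def tent_mass_def
    by (intro divide_nonneg_nonneg integral_nonneg_everywhere tent_bounds)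
  have l0: "0 \<le> l r t" if "r \<in> {0..a}" "0 \<le> t" for r t
    by (rule LIMSEQ_le_const[OF conv[OF that]]) (use D0 in auto)
  have cl: "continuous_on {0..a} (\<lambda>r. l r t)" if "0 \<le> t" for t
    using continuous_on_compose2[OF cont, of "{0..a}" "\<lambda>r. (r, t)"] that
    by (simp add: continuous_on_Pair image_subset_iff)
  have cD: "continuous_on {0..a} (\<lambda>r. D n r t)" if "0 \<le> t" for t n
    using continuous_on_compose2[OF density_approx_cont, of "{0..a}" "\<lambda>r. (r, t)" n] that
    by (simp add: continuous_on_Pair image_subset_iff D_def)
  have c\<phi>: "continuous_on {0..t} \<phi>" for t by (rule continuous_on_subset[OF \<phi>]) auto
  have occ: "integral {0..t} (\<lambda>s. f (\<phi> s)) = integral {0..a} (\<lambda>r. f r * l r t)"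
    if t: "0 \<le> t" and f: "continuous_on {0..a} f" for t f
  proof -
    define h where "h n = a / real (n + 2)" for n
    have h: "0 < h n" "h n \<le> a / 2" "h \<longlonglongrightarrow> 0" for n using mesh_pos[OF a] by (auto simp: h_def[abs_def])
    define m where "m n = tent_mass a (h n)" for n
    have m: "h n / 2 \<le> m n r" "m n r \<le> h n" "0 < m n r" if "r \<in> {0..a}" for n r
      using tent_mass_lower[OF h(1,2) that] tent_mass_upper[OF h(1) that] h(1)[of n] by (auto simp: m_def) (smt (verit) half_gt_zero)
    have D_eq: "m n r * D n r t = integral {0..t} (\<lambda>s. tent (h n) r (\<phi> s))" if "r \<in> {0..a}" for n r
      using m(3)[OF that, of n] by (simp add: D_def density_approx_def h_def m_def)
    obtain B where B: "\<And>r. r \<in> {0..a} \<Longrightarrow> \<bar>f r\<bar> \<le> B"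
    proof -
      have "bounded (f ` {0..a})" using compact_continuous_image[OF f] compact_imp_bounded by blast
      then show ?thesis using that unfolding bounded_iff by fastforce
    qed
    have B0: "0 \<le> B" using B[of 0] a by auto
    \<comment> \<open>From \<open>n1\<close> on the approximations are within 1 of \<open>l\<close>,
      so \<open>L + 1\<close> bounds them; the sequences below are shifted by \<open>n1\<close> to
      be dominated throughout.\<close>
    obtain n1 where n1: "\<And>n r. n1 \<le> n \<Longrightarrow> r \<in> {0..a} \<Longrightarrow> \<bar>D n r t - l r t\<bar> \<le> 1"
      using unif[OF t, of 1] t by force
    obtain L where L: "\<And>r. r \<in> {0..a} \<Longrightarrow> l r t \<le> L"
    proof -
      have "bounded ((\<lambda>r. l r t) ` {0..a})" using compact_continuous_image[OF cl[OF t]] compact_imp_bounded by blast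
      then obtain L where "\<And>r. r \<in> {0..a} \<Longrightarrow> \<bar>l r t\<bar> \<le> L" unfolding bounded_iff by fastforce
      then show ?thesis using that abs_le_D1 by blast
    qed
    have L0: "0 \<le> L" using L[of 0] l0[of 0 t] a t by auto
    have DL: "D n r t \<le> L + 1" if "n1 \<le> n" "r \<in> {0..a}" for n r using n1[OF that] L[OF that(2)] by linarith
    \<comment> \<open>\<open>f\<close> averaged over the tent around the current position of the
      path. In the interior this tends to \<open>f y\<close>, but at 0 and \<open>a\<close> half of
      the tent is missing and the limit is \<open>f y / 2\<close>; this is why the time spent at the
      two end points must be shown to be null.\<close>
    define k where "k n y = integral {0..a} (\<lambda>r. f r * tent (h n) r y) / h n" for n y
    have tsym: "tent (h n) r y = tent (h n) y r" for n r y by (simp add: tent_def abs_minus_commute)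
    have kb: "\<bar>k n y\<bar> \<le> B" if y: "y \<in> {0..a}" for n y
    proof -
      have "\<bar>integral {0..a} (\<lambda>r. tent (h n) y r * f r) - 0 * m n y\<bar> \<le> B * m n y"
        unfolding m_def by (rule tent_average[OF h(1) f y]) (use B in auto)
      also have "\<dots> \<le> B * h n" using m(2)[OF y] B0 by (rule mult_left_mono)
      finally show ?thesis using h(1)[of n] by (simp add: k_def tsym[of n _ y] mult.commute abs_divide field_simps)
    qed
    have kl: "(\<lambda>n. k n y) \<longlonglongrightarrow> f y" if y: "0 < y" "y < a" for y
    proof (rule LIMSEQ_I)
      fix e :: real assume e: "0 < e"
      obtain d where d: "0 < d" "\<And>r. r \<in> {0..a} \<Longrightarrow> \<bar>r - y\<bar> < d \<Longrightarrow> \<bar>f r - f y\<bar> < e / 2"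
        using f y e unfolding continuous_on_iff dist_real_def by (metis atLeastAtMost_iff half_gt_zero less_imp_le)
      obtain n0 where n0: "\<And>n. n0 \<le> n \<Longrightarrow> h n < min d (min y (a - y))"
        using LIMSEQ_D[OF h(3), of "min d (min y (a - y))"] d y by (auto simp: abs_less_iff)
      show "\<exists>no. \<forall>n\<ge>no. norm (k n y - f y) < e"
      proof (intro exI[of _ n0] allI impI)
        fix n assume n: "n0 \<le> n"
        have y': "y \<in> {0..a}" using y by auto
        have mm: "m n y = h n" unfolding m_def using n0[OF n] by (intro tent_mass_interior h) auto
        have "\<bar>integral {0..a} (\<lambda>r. tent (h n) y r * f r) - f y * m n y\<bar> \<le> (e / 2) * m n y"
          unfolding m_def
        proof (rule tent_average[OF h(1) f y'])
          fix r assume "r \<in> {0..a}" "\<bar>y - r\<bar> < h n"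
          then show "\<bar>f r - f y\<bar> \<le> e / 2" using d(2)[of r] n0[OF n] by (auto simp: abs_minus_commute)
        qed
        from abs_divide_diff_le[OF h(1)[of n] this[unfolded mm]]
        have "\<bar>k n y - f y\<bar> \<le> e / 2"
          by (simp add: k_def tsym[of n _ y] mult.commute)
        then show "norm (k n y - f y) < e" using e by simp
      qed
    qed
    \<comment> \<open>Tonelli in continuous form: the approximate density tested against
      \<open>f\<close> is the time integral of the smoothed \<open>f\<close> along the path.\<close>
    have swap: "integral {0..a} (\<lambda>r. f r * (m n r * D n r t) / h n) = integral {0..t} (\<lambda>s. k n (\<phi> s))" for n
    proof -
      have "integral {0..a} (\<lambda>r. f r * (m n r * D n r t) / h n) = integral {0..a} (\<lambda>r. integral {0..t} (\<lambda>s. f r * tent (h n) r (\<phi> s) / h n))"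
        by (rule integral_cong) (simp add: D_eq)
      also have "\<dots> = integral {0..t} (\<lambda>s. integral {0..a} (\<lambda>r. f r * tent (h n) r (\<phi> s) / h n))"
      proof -
        have "continuous_on (cbox (0, 0) (a, t)) (\<lambda>p. f (fst p) * tent (h n) (fst p) (\<phi> (snd p)) / h n)"
          using h(1)[of n]
          by (intro continuous_intros continuous_on_compose2[OF f] continuous_on_compose2[OF tent_cont(1)[of UNIV], where f="\<lambda>p. (fst p, \<phi> (snd p))", simplified]
              continuous_on_compose2[OF c\<phi>[of t]]) auto
        then show ?thesis
          using integral_swap_continuous[of 0 0 a t "\<lambda>r s. f r * tent (h n) r (\<phi> s) / h n"] by (simp add: case_prod_unfold)
      qed
      also have "\<dots> = integral {0..t} (\<lambda>s. k n (\<phi> s))" by (simp add: k_def)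
      finally show ?thesis .
    qed
    \<comment> \<open>On the open interval, since \<open>m n r / h n\<close> tends to 1 only at
      interior levels.\<close>
    have lhs: "(\<lambda>n. integral {0<..<a} (\<lambda>r. f r * (m (n + n1) r * D (n + n1) r t) / h (n + n1))) \<longlonglongrightarrow> integral {0<..<a} (\<lambda>r. f r * l r t)"
    proof (rule dominated_convergence(2)[where h="\<lambda>_. B * (L + 1)"])
      have "continuous_on {0..a} (\<lambda>r. f r * (m n r * D n r t) / h n)" for n
      proof -
        have "continuous_on {0..a} (m n)"
          unfolding m_def tent_mass_def[abs_def]
          using integral_continuous_on_param[of "{0..a}" 0 a "\<lambda>r y. tent (h n) r y"] tent_cont(1)[of "{0..a} \<times> cbox 0 a" "h n"]
          by simp
        then show ?thesis using h(1)[of n] by (intro continuous_intros f cD t) auto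
      qed
      then show "(\<lambda>r. f r * (m (n + n1) r * D (n + n1) r t) / h (n + n1)) integrable_on {0<..<a}" for n
        using integrable_continuous_real integrable_on_Icc_iff_Ioo by blast
      show "(\<lambda>_. B * (L + 1)) integrable_on {0<..<a}" using integrable_on_Icc_iff_Ioo integrable_const_ivl by blast
      fix n r assume "r \<in> {0<..<a}"
      then have r: "r \<in> {0..a}" by auto
      have "\<bar>f r * (m (n + n1) r * D (n + n1) r t) / h (n + n1)\<bar> = \<bar>f r\<bar> * ((m (n + n1) r / h (n + n1)) * D (n + n1) r t)"
        using m(3)[OF r, of "n + n1"] h(1)[of "n + n1"] D0 by (simp add: abs_mult)
      also have "\<dots> \<le> B * (1 * (L + 1))"
        using B[OF r] m[OF r, of "n + n1"] h(1)[of "n + n1"] D0 DL[OF _ r, of "n + n1"] L0 B0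
        by (intro mult_mono mult_nonneg_nonneg divide_nonneg_pos) auto
      finally show "norm (f r * (m (n + n1) r * D (n + n1) r t) / h (n + n1)) \<le> B * (L + 1)" by simp
    next
      fix r assume r: "r \<in> {0<..<a}"
      have "eventually (\<lambda>n. h n < min r (a - r)) sequentially"
        using r by (intro order_tendstoD[OF h(3)]) auto
      then have "eventually (\<lambda>n. f r * (m n r * D n r t) / h n = f r * D n r t) sequentially"
      proof eventually_elim
        fix n assume "h n < min r (a - r)"
        then have "m n r = h n" unfolding m_def by (intro tent_mass_interior h) auto
        then show "f r * (m n r * D n r t) / h n = f r * D n r t" using h(1)[of n] by simp
      qed
      moreover have "(\<lambda>n. f r * D n r t) \<longlonglongrightarrow> f r * l r t" using r t by (intro tendsto_intros conv) auto
      ultimately have "(\<lambda>n. f r * (m n r * D n r t) / h n) \<longlonglongrightarrow> f r * l r t" by (simp add: tendsto_cong)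
      then show "(\<lambda>n. f r * (m (n + n1) r * D (n + n1) r t) / h (n + n1)) \<longlonglongrightarrow> f r * l r t"
        by (rule LIMSEQ_ignore_initial_segment)
    qed
    have sets\<phi>: "{s \<in> {0..t}. \<phi> s = c} \<in> sets lborel" for c
    proof -
      have "closed ({0..t} \<inter> \<phi> -` {c})"
        by (rule continuous_closed_preimage[OF c\<phi>]) auto
      then show ?thesis by (simp add: Int_def vimage_def)
    qed
    \<comment> \<open>The tent at \<open>c\<close> equals 1 at \<open>c\<close>, so the time spent
      there is at most \<open>m * D\<close>, which is bounded by \<open>h * (L + 1)\<close> and
      tends to 0.\<close>
    have null: "emeasure lborel {s \<in> {0..t}. \<phi> s = c} = 0" if c: "c = 0 \<or> c = a" for c
    proof -
      have c': "c \<in> {0..a}" using c a by auto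
      define Sc where "Sc = {s \<in> {0..t}. \<phi> s = c}"
      have "emeasure lborel Sc \<le> emeasure lborel {0..t}"
        by (rule emeasure_mono) (auto simp: Sc_def)
      also have "\<dots> < \<infinity>" using t by simp
      finally have "Sc \<in> lmeasurable"
        using sets\<phi>[of c, folded Sc_def] by (intro fmeasurableI) simp_all
      then have lm: "{s \<in> {0..t}. \<phi> s = c} \<in> lmeasurable" by (simp add: Sc_def)
      have *: "measure lebesgue {s \<in> {0..t}. \<phi> s = c} \<le> h (n + n1) * (L + 1)" for n
      proof -
        have "measure lebesgue {s \<in> {0..t}. \<phi> s = c} = integral {s \<in> {0..t}. \<phi> s = c} (\<lambda>_. 1)"
          using lm by (simp add: lmeasure_integral)
        also have "\<dots> = integral {s \<in> {0..t}. \<phi> s = c} (\<lambda>s. tent (h (n + n1)) c (\<phi> s))"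
          by (rule integral_cong) (simp add: tent_def)
        also have "\<dots> \<le> integral {0..t} (\<lambda>s. tent (h (n + n1)) c (\<phi> s))"
        proof (rule integral_subset_le)
          have "(\<lambda>_. 1::real) integrable_on {s \<in> {0..t}. \<phi> s = c}" using lm by (simp add: lmeasurable_iff_integrable_on[symmetric])
          then show "(\<lambda>s. tent (h (n + n1)) c (\<phi> s)) integrable_on {s \<in> {0..t}. \<phi> s = c}"
            by (rule integrable_eq) (simp add: tent_def)
          show "(\<lambda>s. tent (h (n + n1)) c (\<phi> s)) integrable_on {0..t}"
            by (intro integrable_continuous_real continuous_on_compose2[OF tent_cont(2)[of UNIV] c\<phi>]) auto
        qed (auto simp: tent_bounds)
        also have "\<dots> = m (n + n1) c * D (n + n1) c t" using D_eq[OF c'] by simp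
        also have "\<dots> \<le> h (n + n1) * (L + 1)"
          using m[OF c', of "n + n1"] DL[of "n + n1", OF _ c'] D0 L0 h(1)[of "n + n1"] by (intro mult_mono) auto
        finally show ?thesis .
      qed
      have "(\<lambda>n. h (n + n1) * (L + 1)) \<longlonglongrightarrow> 0 * (L + 1)"
        by (intro tendsto_intros LIMSEQ_ignore_initial_segment[OF h(3)])
      then have "measure lebesgue {s \<in> {0..t}. \<phi> s = c} \<le> 0"
        using LIMSEQ_le_const[of _ _ "measure lebesgue {s \<in> {0..t}. \<phi> s = c}"] * by force
      then have "measure lebesgue {s \<in> {0..t}. \<phi> s = c} = 0" by (simp add: measure_le_0_iff)
      then have "emeasure lebesgue {s \<in> {0..t}. \<phi> s = c} = 0" using lm by (simp add: emeasure_eq_measure2)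
      then show ?thesis using sets\<phi>[of c] by simp
    qed
    define Nul where "Nul = {s \<in> {0..t}. \<phi> s = 0} \<union> {s \<in> {0..t}. \<phi> s = a}"
    have neg: "negligible Nul"
      unfolding Nul_def using null sets\<phi> by (intro negligible_Un) (auto simp: negligible_iff_null_sets null_sets_def)
    have rhs: "(\<lambda>n. integral ({0..t} - Nul) (\<lambda>s. k (n + n1) (\<phi> s))) \<longlonglongrightarrow> integral ({0..t} - Nul) (\<lambda>s. f (\<phi> s))"
    proof (rule dominated_convergence(2)[where h="\<lambda>_. B"])
      have kc: "continuous_on {0..a} (k n)" for n
        unfolding k_def[abs_def]
      proof (intro continuous_intros)
        have "continuous_on ({0..a} \<times> cbox 0 a) (\<lambda>(y, r). f r * tent (h n) r y)"
          unfolding case_prod_unfold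
          by (intro continuous_intros continuous_on_compose2[OF f] continuous_on_compose2[OF tent_cont(1)[of UNIV], where f="\<lambda>p. (snd p, fst p)", simplified]) auto
        then show "continuous_on {0..a} (\<lambda>y. integral {0..a} (\<lambda>r. f r * tent (h n) r y))"
          using integral_continuous_on_param[of "{0..a}" 0 a "\<lambda>y r. f r * tent (h n) r y"] by simp
      qed (use h(1)[of n] in auto)
      have "continuous_on {0..t} (\<lambda>s. k n (\<phi> s))" for n
        by (rule continuous_on_compose2[OF kc c\<phi>]) (use rg in force)
      then show "(\<lambda>s. k (n + n1) (\<phi> s)) integrable_on ({0..t} - Nul)" for n
        using integrable_spike_set[OF integrable_continuous_real, of 0 t "\<lambda>s. k (n + n1) (\<phi> s)" "{0..t} - Nul"] neg
        by (auto intro: negligible_subset)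
      show "(\<lambda>_. B) integrable_on ({0..t} - Nul)"
        using integrable_spike_set[OF integrable_continuous_real[OF continuous_on_const], of 0 t "{0..t} - Nul" B] neg
        by (auto intro: negligible_subset)
      show "norm (k (n + n1) (\<phi> s)) \<le> B" if "s \<in> {0..t} - Nul" for n s
        using kb[OF rg[of s]] that by auto
      show "(\<lambda>n. k (n + n1) (\<phi> s)) \<longlonglongrightarrow> f (\<phi> s)" if s: "s \<in> {0..t} - Nul" for s
      proof (rule LIMSEQ_ignore_initial_segment[OF kl])
        show "0 < \<phi> s" "\<phi> s < a" using s rg[of s] by (auto simp: Nul_def less_le)
      qed
    qed
    have eqI: "integral ({0..t} - Nul) w = integral {0..t} w" for w :: "real \<Rightarrow> real"
      by (rule integral_spike_set) (use neg in \<open>auto intro: negligible_subset\<close>)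
    have "(\<lambda>n. integral {0..t} (\<lambda>s. k (n + n1) (\<phi> s))) \<longlonglongrightarrow> integral {0..a} (\<lambda>r. f r * l r t)"
    proof -
      have oi: "integral {0<..<a} w = integral {0..a} w" for w :: "real \<Rightarrow> real"
        by (simp add: integral_open_interval_real)
      show ?thesis using lhs unfolding oi swap .
    qed
    moreover have "(\<lambda>n. integral {0..t} (\<lambda>s. k (n + n1) (\<phi> s))) \<longlonglongrightarrow> integral {0..t} (\<lambda>s. f (\<phi> s))"
      using rhs unfolding eqI .
    ultimately show ?thesis by (rule LIMSEQ_unique[symmetric])
  qed
  have main: "(\<integral>\<^sup>+ s\<in>{0..t}. g (\<phi> s) \<partial>lborel) = (\<integral>\<^sup>+ r\<in>{0..a}. g r * ennreal (l r t) \<partial>lborel)"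
    if t: "0 \<le> t" and g[measurable]: "g \<in> borel_measurable borel" for t and g :: "real \<Rightarrow> ennreal"
  proof -
    \<comment> \<open>Freezing the path at negative times makes it Borel on the whole line without
      changing it on \<open>{0..}\<close>.\<close>
    define \<phi>' where "\<phi>' s = \<phi> (max 0 s)" for s
    have "continuous_on UNIV \<phi>'" unfolding \<phi>'_def by (rule continuous_on_compose2[OF \<phi>]) (auto intro!: continuous_intros)
    then have [measurable]: "\<phi>' \<in> borel_measurable borel" by (rule borel_measurable_continuous_onI)
    define l' where "l' r = indicator {0..a} r * l r t" for r
    have l'[measurable]: "l' \<in> borel_measurable borel"
      unfolding l'_def using borel_measurable_continuous_on_indicator[OF _ cl[OF t]] by simp
    define \<nu> where "\<nu> = distr (density lborel (\<lambda>s. ennreal (indicator {0..t} s))) borel \<phi>'"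
    define \<mu> where "\<mu> = density lborel (\<lambda>r. ennreal (l' r))"
    have n\<nu>: "(\<integral>\<^sup>+ r. q r \<partial>\<nu>) = (\<integral>\<^sup>+ s\<in>{0..t}. q (\<phi> s) \<partial>lborel)" if [measurable]: "q \<in> borel_measurable borel" for q :: "real \<Rightarrow> ennreal"
      unfolding \<nu>_def by (simp add: nn_integral_distr nn_integral_density)
        (auto intro!: nn_integral_cong simp: indicator_def \<phi>'_def)
    have n\<mu>: "(\<integral>\<^sup>+ r. q r \<partial>\<mu>) = (\<integral>\<^sup>+ r\<in>{0..a}. q r * ennreal (l r t) \<partial>lborel)" if [measurable]: "q \<in> borel_measurable borel" for q :: "real \<Rightarrow> ennreal"
      unfolding \<mu>_def by (simp add: nn_integral_density)
        (auto intro!: nn_integral_cong simp: indicator_def l'_def mult.commute)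
    have c1: "(\<integral>\<^sup>+ s\<in>{0..t}. ennreal (f (\<phi> s)) \<partial>lborel) = ennreal (integral {0..t} (\<lambda>s. f (\<phi> s)))"
      "(\<integral>\<^sup>+ r\<in>{0..a}. ennreal (f r) * ennreal (l r t) \<partial>lborel) = ennreal (integral {0..a} (\<lambda>r. f r * l r t))"
      if f: "continuous_on {0..a} f" "\<And>r. r \<in> {0..a} \<Longrightarrow> 0 \<le> f r" for f
    proof -
      show "(\<integral>\<^sup>+ s\<in>{0..t}. ennreal (f (\<phi> s)) \<partial>lborel) = ennreal (integral {0..t} (\<lambda>s. f (\<phi> s)))"
        using f rg by (intro nn_integral_has_integral_lebesgue' integrable_integral integrable_continuous_real
            continuous_on_compose2[OF f(1) c\<phi>]) force+
      have "(\<integral>\<^sup>+ r\<in>{0..a}. ennreal (f r) * ennreal (l r t) \<partial>lborel) = (\<integral>\<^sup>+ r\<in>{0..a}. ennreal (f r * l r t) \<partial>lborel)"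
        using f l0 t by (intro nn_integral_cong) (auto simp: indicator_def ennreal_mult)
      also have "\<dots> = ennreal (integral {0..a} (\<lambda>r. f r * l r t))"
        using f l0 t by (intro nn_integral_has_integral_lebesgue' integrable_integral integrable_continuous_real
            continuous_intros cl) auto
      finally show "(\<integral>\<^sup>+ r\<in>{0..a}. ennreal (f r) * ennreal (l r t) \<partial>lborel) = ennreal (integral {0..a} (\<lambda>r. f r * l r t))" .
    qed
    have eqf: "(\<integral>\<^sup>+ r. ennreal (f r) \<partial>\<nu>) = (\<integral>\<^sup>+ r. ennreal (f r) \<partial>\<mu>)" "(\<integral>\<^sup>+ r. ennreal (f r) \<partial>\<nu>) < \<infinity>"
      if f: "continuous_on UNIV f" "\<And>r. 0 \<le> f r" for f
    proof -
      have [measurable]: "f \<in> borel_measurable borel" by (rule borel_measurable_continuous_onI[OF f(1)])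
      have f': "continuous_on {0..a} f" using f(1) continuous_on_subset by blast
      show "(\<integral>\<^sup>+ r. ennreal (f r) \<partial>\<nu>) = (\<integral>\<^sup>+ r. ennreal (f r) \<partial>\<mu>)" "(\<integral>\<^sup>+ r. ennreal (f r) \<partial>\<nu>) < \<infinity>"
        using c1[OF f' f(2)] occ[OF t f'] by (simp_all add: n\<nu> n\<mu>)
    qed
    \<comment> \<open>The occupation measure and the measure with density \<open>l\<close> agree on
      continuous functions, in particular on exponentials; uniqueness of Laplace transforms extends
      this to all Borel functions.\<close>
    have "\<nu> = \<mu>"
    proof (rule laplace_unique)
      have fin: "emeasure \<nu> (space \<nu>) < \<infinity>" "emeasure \<mu> (space \<mu>) < \<infinity>"
        using eqf[of "\<lambda>_. 1"] by auto
      show "finite_measure \<nu>" "finite_measure \<mu>" using fin by (auto intro!: finite_measureI)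
      show "sets \<nu> = sets borel" "sets \<mu> = sets borel" by (auto simp: \<nu>_def \<mu>_def)
      show "AE y in \<nu>. 0 \<le> y"
        unfolding \<nu>_def by (subst AE_distr_iff) (auto intro!: AE_I2 simp: \<phi>'_def rg[THEN conjunct1[OF iffD1[OF atLeastAtMost_iff]]])
      show "AE y in \<mu>. 0 \<le> y"
        unfolding \<mu>_def
      proof (subst AE_density)
        show "AE x in lborel. 0 < ennreal (l' x) \<longrightarrow> 0 \<le> x"
          by (intro AE_I2) (auto simp: l'_def indicator_def)
      qed simp
      show "(\<integral>y. exp (- (real n * y)) \<partial>\<nu>) = (\<integral>y. exp (- (real n * y)) \<partial>\<mu>)" for n :: nat
      proof -
        have [measurable]: "(\<lambda>y. exp (- (real n * y))) \<in> borel_measurable \<nu>" "(\<lambda>y. exp (- (real n * y))) \<in> borel_measurable \<mu>"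
          by (auto simp: \<nu>_def \<mu>_def)
        show ?thesis
        proof -
          have "(\<integral>\<^sup>+ y. ennreal (exp (- (real n * y))) \<partial>\<nu>) = (\<integral>\<^sup>+ y. ennreal (exp (- (real n * y))) \<partial>\<mu>)"
            by (rule eqf(1)) (auto intro!: continuous_intros)
          then show ?thesis by (subst (1 2) integral_eq_nn_integral) auto
        qed
      qed
    qed
    then show ?thesis using n\<nu>[OF g] n\<mu>[OF g] by simp
  qed
  have "is_local_time a \<phi> l"
    unfolding is_local_time_def using cont l0 main by blast
  then show ?thesis by (simp add: l_def[abs_def] D_def)
qed

end

section \<open>Measurability of local times\<close>

lemma abs_diff_le_add: "\<bar>x - c\<bar> \<le> e \<Longrightarrow> \<bar>y - c\<bar> \<le> e' \<Longrightarrow> e + e' = d \<Longrightarrow> \<bar>x - y\<bar> \<le> (d :: real)"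
  by linarith

text \<open>Only the values at dyadic grid points before \<open>t\<close> enter. So \<open>N\<close>
  can be a small sigma-algebra such as \<open>past\<close>, which knows nothing of the path beyond
  \<open>t\<close>.\<close>

lemma measurable_integral_path:
  fixes Y :: "real \<Rightarrow> 'w \<Rightarrow> real" and f :: "real \<Rightarrow> real"
  assumes t: "0 \<le> t" and cont: "\<And>\<omega>. \<omega> \<in> space N \<Longrightarrow> continuous_on {0..t} (\<lambda>s. Y s \<omega>)"
    and meas: "\<And>n i. i < 2 ^ n \<Longrightarrow> Y (grid t n i) \<in> borel_measurable N"
    and f: "continuous_on UNIV f"
  shows "(\<lambda>\<omega>. integral {0..t} (\<lambda>s. f (Y s \<omega>))) \<in> borel_measurable N"
proof (rule borel_measurable_LIMSEQ_real[where u="\<lambda>n \<omega>. \<Sum>i<2 ^ n. f (Y (grid t n i) \<omega>) * (t / 2 ^ n)"])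
  show "(\<lambda>n. \<Sum>i<2 ^ n. f (Y (grid t n i) \<omega>) * (t / 2 ^ n)) \<longlonglongrightarrow> integral {0..t} (\<lambda>s. f (Y s \<omega>))"
    if "\<omega> \<in> space N" for \<omega>
    by (rule riemann_grid[OF t continuous_on_compose2[OF f cont[OF that]]]) (auto simp: grid_simps)
  have [measurable]: "f \<in> borel_measurable borel" by (rule borel_measurable_continuous_onI[OF f])
  show "(\<lambda>\<omega>. \<Sum>i<2 ^ n. f (Y (grid t n i) \<omega>) * (t / 2 ^ n)) \<in> borel_measurable N" for n
    by (intro borel_measurable_sum borel_measurable_times borel_measurable_const)
       (use meas[of _ n] in \<open>auto intro: measurable_compose\<close>)
qed

lemma measurable_density_approx:
  fixes Y :: "real \<Rightarrow> 'w \<Rightarrow> real"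
  assumes "0 \<le> t" "\<And>\<omega>. \<omega> \<in> space N \<Longrightarrow> continuous_on {0..t} (\<lambda>s. Y s \<omega>)"
    "\<And>n i. i < 2 ^ n \<Longrightarrow> Y (grid t n i) \<in> borel_measurable N"
  shows "(\<lambda>\<omega>. density_approx a (\<lambda>s. Y s \<omega>) n r t) \<in> borel_measurable N"
  unfolding density_approx_def
  by (intro borel_measurable_divide borel_measurable_const measurable_integral_path assms tent_cont)

lemma floor_quotient_tendsto:
  fixes x :: real
  shows "(\<lambda>k. of_int \<lfloor>real (Suc k) * x\<rfloor> / real (Suc k)) \<longlonglongrightarrow> x"
    and "of_int \<lfloor>real (Suc k) * x\<rfloor> / real (Suc k) \<le> x"
proof -
  have b: "x - 1 / real (Suc k) \<le> of_int \<lfloor>real (Suc k) * x\<rfloor> / real (Suc k)"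
    "of_int \<lfloor>real (Suc k) * x\<rfloor> / real (Suc k) \<le> x" for k
  proof -
    have "real (Suc k) * x - 1 \<le> of_int \<lfloor>real (Suc k) * x\<rfloor>" "of_int \<lfloor>real (Suc k) * x\<rfloor> \<le> real (Suc k) * x" by linarith+
    from this[THEN divide_right_mono, of "real (Suc k)"]
    show "x - 1 / real (Suc k) \<le> of_int \<lfloor>real (Suc k) * x\<rfloor> / real (Suc k)"
      "of_int \<lfloor>real (Suc k) * x\<rfloor> / real (Suc k) \<le> x" by (simp_all add: diff_divide_distrib del: of_nat_Suc)
  qed
  then show "of_int \<lfloor>real (Suc k) * x\<rfloor> / real (Suc k) \<le> x" by blast
  have "(\<lambda>k. x - 1 / real (Suc k)) \<longlonglongrightarrow> x - 0"
    by (intro tendsto_intros LIMSEQ_Suc[OF lim_inverse_n'])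
  then have l: "(\<lambda>k. x - 1 / real (Suc k)) \<longlonglongrightarrow> x" unfolding diff_zero .
  show "(\<lambda>k. of_int \<lfloor>real (Suc k) * x\<rfloor> / real (Suc k)) \<longlonglongrightarrow> x"
    by (rule tendsto_sandwich[OF _ _ l tendsto_const]; rule always_eventually; rule allI; rule b)
qed

lemma floor_quotient_nonneg:
  "0 \<le> (x :: real) \<Longrightarrow> 0 \<le> (of_int \<lfloor>real (Suc k) * x\<rfloor> / of_nat (Suc k) :: rat)"
  by (intro divide_nonneg_nonneg) (simp_all add: mult_nonneg_nonneg del: of_nat_Suc)

text \<open>Round the random time down to a multiple of \<open>1 / Suc k\<close>: it then takes
  countably many values, and continuity of the paths gives the limit.\<close>

lemma measurable_at_random_time:
  fixes X :: "real \<Rightarrow> 'w \<Rightarrow> real"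
  assumes X: "\<And>t. 0 \<le> t \<Longrightarrow> X t \<in> borel_measurable N"
    and cont: "\<And>\<omega>. \<omega> \<in> space N \<Longrightarrow> continuous_on {0..} (\<lambda>t. X t \<omega>)"
    and S[measurable]: "S \<in> borel_measurable N" and S0: "\<And>\<omega>. \<omega> \<in> space N \<Longrightarrow> 0 \<le> S \<omega>"
  shows "(\<lambda>\<omega>. X (S \<omega>) \<omega>) \<in> borel_measurable N"
proof (rule borel_measurable_LIMSEQ_real[where u="\<lambda>k \<omega>. X (real (nat \<lfloor>real (Suc k) * S \<omega>\<rfloor>) / real (Suc k)) \<omega>"])
  fix \<omega> assume w: "\<omega> \<in> space N"
  have eq: "real (nat \<lfloor>real (Suc k) * S \<omega>\<rfloor>) = of_int \<lfloor>real (Suc k) * S \<omega>\<rfloor>" for k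
    using S0[OF w] by (simp del: of_nat_Suc)
  show "(\<lambda>k. X (real (nat \<lfloor>real (Suc k) * S \<omega>\<rfloor>) / real (Suc k)) \<omega>) \<longlonglongrightarrow> X (S \<omega>) \<omega>"
  proof (rule continuous_on_tendsto_compose[OF cont[OF w]])
    show "(\<lambda>k. real (nat \<lfloor>real (Suc k) * S \<omega>\<rfloor>) / real (Suc k)) \<longlonglongrightarrow> S \<omega>"
      unfolding eq by (rule floor_quotient_tendsto)
  qed (use S0[OF w] in auto)
next
  fix k
  have "(\<lambda>\<omega>. (\<lambda>i \<omega>. X (real i / real (Suc k)) \<omega>) (nat \<lfloor>real (Suc k) * S \<omega>\<rfloor>) \<omega>) \<in> borel_measurable N"
    by (rule measurable_compose_countable[where f="\<lambda>i \<omega>. X (real i / real (Suc k)) \<omega>"]) (auto intro!: X)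
  then show "(\<lambda>\<omega>. X (real (nat \<lfloor>real (Suc k) * S \<omega>\<rfloor>) / real (Suc k)) \<omega>) \<in> borel_measurable N" by simp
qed

text \<open>Shared by the inverse local time and by the clock of the projection. The strict
  inequality in the definition of \<open>T\<close> makes it the right end of the stretch where
  \<open>L\<close> equals \<open>x\<close>, which yields the equivalence in the second
  claim.\<close>

lemma first_passage:
  fixes L :: "real \<Rightarrow> real"
  assumes mono: "\<And>s t. 0 \<le> s \<Longrightarrow> s \<le> t \<Longrightarrow> L s \<le> L t" and cont: "continuous_on {0..} L"
    and L0: "L 0 = 0" and x: "0 \<le> x"
  defines "T \<equiv> (INF t\<in>{t. 0 \<le> t \<and> x < L t}. ereal t)"
  shows "0 \<le> T" "0 \<le> t \<Longrightarrow> T < ereal t \<longleftrightarrow> x < L t" "T \<noteq> \<infinity> \<Longrightarrow> L (real_of_ereal T) = x"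
proof -
  show T0: "0 \<le> T" unfolding T_def by (intro INF_greatest) simp
  have *: "T < ereal t \<longleftrightarrow> x < L t" if t: "0 \<le> t" for t
  proof
    assume "T < ereal t"
    then obtain s where "0 \<le> s" "x < L s" "ereal s < ereal t" unfolding T_def INF_less_iff by auto
    then show "x < L t" using mono[of s t] by simp
  next
    assume xt: "x < L t"
    then have "0 < t" using t L0 x by (cases "t = 0") auto
    \<comment> \<open>A sequence strictly below \<open>t\<close>: by continuity \<open>L\<close>
      exceeds \<open>x\<close> already at one of its members, and this makes the inequality for
      \<open>T\<close> strict.\<close>
    define e where "e n = t * (1 - 1 / real (Suc n))" for n
    have e: "0 \<le> e n" "e n < t" for n
    proof -
      have "0 \<le> 1 - 1 / real (Suc n)" by simp
      then show "0 \<le> e n" unfolding e_def using t by (rule mult_nonneg_nonneg[rotated])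
      show "e n < t" unfolding e_def using \<open>0 < t\<close> by (simp add: algebra_simps)
    qed
    have "e \<longlonglongrightarrow> t * (1 - 0)" unfolding e_def by (intro tendsto_intros LIMSEQ_Suc[OF lim_inverse_n'])
    then have "(\<lambda>n. L (e n)) \<longlonglongrightarrow> L t"
      using t e by (intro continuous_on_tendsto_compose[OF cont]) auto
    then have "eventually (\<lambda>n. x < L (e n)) sequentially" using xt by (rule order_tendstoD)
    then obtain n where "x < L (e n)" by (auto simp: eventually_sequentially)
    then have "T \<le> ereal (e n)" unfolding T_def using e by (intro INF_lower) auto
    also have "\<dots> < ereal t" using e by simp
    finally show "T < ereal t" .
  qed
  then show "0 \<le> t \<Longrightarrow> T < ereal t \<longleftrightarrow> x < L t" .
  assume "T \<noteq> \<infinity>"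
  then obtain t where t: "T = ereal t" "0 \<le> t" using T0 by (cases T) auto
  have "L t \<le> x" using *[OF t(2)] t by simp
  moreover have "x \<le> L t"
  proof -
    have "(\<lambda>n. t + 1 / real (Suc n)) \<longlonglongrightarrow> t + 0" by (intro tendsto_intros LIMSEQ_Suc[OF lim_inverse_n'])
    then have "(\<lambda>n. L (t + 1 / real (Suc n))) \<longlonglongrightarrow> L t"
      using t by (intro continuous_on_tendsto_compose[OF cont]) (auto intro!: always_eventually add_nonneg_nonneg)
    moreover have "x \<le> L (t + 1 / real (Suc n))" for n
      using *[of "t + 1 / real (Suc n)"] t by (simp add: less_imp_le)
    ultimately show ?thesis using LIMSEQ_le_const by blast
  qed
  ultimately show "L (real_of_ereal T) = x" using t by simp
qed

text \<open>True of every path: where no local time exists, \<open>local_time\<close> is constantly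
  0. Hence passage times need no exceptional null set.\<close>

lemma local_time_regular:
  assumes "0 < a" "r \<in> {0..a}"
  shows "continuous_on {0..} (local_time a \<phi> r)" "0 \<le> s \<Longrightarrow> s \<le> t \<Longrightarrow> local_time a \<phi> r s \<le> local_time a \<phi> r t"
    "local_time a \<phi> r 0 = 0" "0 \<le> t \<Longrightarrow> 0 \<le> local_time a \<phi> r t"
proof -
  consider l where "is_local_time a \<phi> l" | "\<nexists>l. is_local_time a \<phi> l" by blast
  then have "continuous_on {0..} (local_time a \<phi> r) \<and> (0 \<le> s \<longrightarrow> s \<le> t \<longrightarrow> local_time a \<phi> r s \<le> local_time a \<phi> r t)
    \<and> local_time a \<phi> r 0 = 0 \<and> (0 \<le> t \<longrightarrow> 0 \<le> local_time a \<phi> r t)"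
  proof cases
    case 1
    then have l: "is_local_time a \<phi> (local_time a \<phi>)" by (rule is_local_time_local_time)
    show ?thesis
      using local_timeD(5)[OF l assms(2)] local_time_mono[OF assms(1) l assms(2)]
        local_time_0[OF assms(1) l assms(2)] local_timeD(2)[OF l assms(2)] by blast
  next
    case 2
    then have "local_time a \<phi> = (\<lambda>r t. 0)" by (auto simp: local_time_def fun_eq_iff)
    then show ?thesis by simp
  qed
  then show "continuous_on {0..} (local_time a \<phi> r)" "0 \<le> s \<Longrightarrow> s \<le> t \<Longrightarrow> local_time a \<phi> r s \<le> local_time a \<phi> r t"
    "local_time a \<phi> r 0 = 0" "0 \<le> t \<Longrightarrow> 0 \<le> local_time a \<phi> r t" by auto
qed

lemma inverse_local_time_passage:
  assumes "0 < a" "0 \<le> x"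
  shows "0 \<le> inverse_local_time a \<phi> x"
    "0 \<le> t \<Longrightarrow> inverse_local_time a \<phi> x < ereal t \<longleftrightarrow> x < local_time a \<phi> 0 t"
    "inverse_local_time a \<phi> x \<noteq> \<infinity> \<Longrightarrow> local_time a \<phi> 0 (real_of_ereal (inverse_local_time a \<phi> x)) = x"
proof -
  have 0: "0 \<in> {0..a}" using assms by simp
  note p = first_passage[of "local_time a \<phi> 0", OF local_time_regular(2)[OF assms(1) 0] local_time_regular(1)[OF assms(1) 0]
      local_time_regular(3)[OF assms(1) 0] assms(2), folded inverse_local_time_def]
  show "0 \<le> inverse_local_time a \<phi> x"
    "0 \<le> t \<Longrightarrow> inverse_local_time a \<phi> x < ereal t \<longleftrightarrow> x < local_time a \<phi> 0 t"
    "inverse_local_time a \<phi> x \<noteq> \<infinity> \<Longrightarrow> local_time a \<phi> 0 (real_of_ereal (inverse_local_time a \<phi> x)) = x"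
    using p by auto
qed

locale interval_process =
  fixes N :: "'w measure" and a :: real and Y :: "real \<Rightarrow> 'w \<Rightarrow> real"
  assumes a: "0 < a" and Y_meas: "\<And>t. 0 \<le> t \<Longrightarrow> Y t \<in> borel_measurable N"
    and Y_cont: "\<And>\<omega>. \<omega> \<in> space N \<Longrightarrow> continuous_on {0..} (\<lambda>t. Y t \<omega>)"
    and Y_range: "\<And>\<omega> t. \<omega> \<in> space N \<Longrightarrow> 0 \<le> t \<Longrightarrow> Y t \<omega> \<in> {0..a}"
begin

abbreviation L :: "real \<Rightarrow> real \<Rightarrow> 'w \<Rightarrow> real" where
  "L r t \<omega> \<equiv> local_time a (\<lambda>s. Y s \<omega>) r t"

lemma D_meas: "0 \<le> t \<Longrightarrow> (\<lambda>\<omega>. density_approx a (\<lambda>s. Y s \<omega>) n r t) \<in> borel_measurable N"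
  by (intro measurable_density_approx Y_meas grid_bounds continuous_on_subset[OF Y_cont]) auto

text \<open>The Cauchy criterion over rational levels and times, a countable condition; continuity
  of \<open>density_approx\<close> carries it over to real ones. The \<open>max 0\<close> makes each
  single inequality a measurable event for every rational \<open>p\<close>.\<close>

lemma exists_local_time_iff:
  assumes w: "\<omega> \<in> space N"
  shows "(\<exists>l. is_local_time a (\<lambda>s. Y s \<omega>) l) \<longleftrightarrow>
    (\<forall>T::nat. \<forall>j::nat. \<exists>n0. \<forall>m n. n0 \<le> m \<longrightarrow> n0 \<le> n \<longrightarrow> (\<forall>q p :: rat. 0 \<le> q \<and> q \<le> 1 \<and> 0 \<le> p \<and> real_of_rat p \<le> real T \<longrightarrow>
       \<bar>density_approx a (\<lambda>s. Y s \<omega>) m (a * real_of_rat q) (max 0 (real_of_rat p))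
        - density_approx a (\<lambda>s. Y s \<omega>) n (a * real_of_rat q) (max 0 (real_of_rat p))\<bar> \<le> 1 / real (Suc j)))"
    (is "?L \<longleftrightarrow> ?R")
proof
  let ?D = "density_approx a (\<lambda>s. Y s \<omega>)"
  note p = a Y_cont[OF w] Y_range[OF w]
  {
    assume ?L
    then obtain l where l: "is_local_time a (\<lambda>s. Y s \<omega>) l" by blast
    show ?R
    proof (intro allI)
      fix T j :: nat
      have "0 < 1 / (2 * real (Suc j))" by simp
      then obtain n0 where n0: "\<And>n r t. n0 \<le> n \<Longrightarrow> r \<in> {0..a} \<Longrightarrow> t \<in> {0..real T} \<Longrightarrow> \<bar>?D n r t - l r t\<bar> \<le> 1 / (2 * real (Suc j))"
        using density_approx_uniform[OF p l _ of_nat_0_le_iff] by blast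
      show "\<exists>n0. \<forall>m n. n0 \<le> m \<longrightarrow> n0 \<le> n \<longrightarrow> (\<forall>q p :: rat. 0 \<le> q \<and> q \<le> 1 \<and> 0 \<le> p \<and> real_of_rat p \<le> real T \<longrightarrow>
       \<bar>?D m (a * real_of_rat q) (max 0 (real_of_rat p)) - ?D n (a * real_of_rat q) (max 0 (real_of_rat p))\<bar> \<le> 1 / real (Suc j))"
      proof (intro exI[of _ n0] allI impI)
        fix m n and q p :: rat
        assume mn: "n0 \<le> m" "n0 \<le> n" and qp: "0 \<le> q \<and> q \<le> 1 \<and> 0 \<le> p \<and> real_of_rat p \<le> real T"
        have r: "a * real_of_rat q \<in> {0..a}" using qp a by (auto simp: mult_left_le)
        have t: "max 0 (real_of_rat p) \<in> {0..real T}" using qp by auto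
        have "1 / (2 * real (Suc j)) + 1 / (2 * real (Suc j)) = 1 / real (Suc j)" by (simp add: field_simps)
        then show "\<bar>?D m (a * real_of_rat q) (max 0 (real_of_rat p)) - ?D n (a * real_of_rat q) (max 0 (real_of_rat p))\<bar> \<le> 1 / real (Suc j)"
          by (rule abs_diff_le_add[OF n0[OF mn(1) r t] n0[OF mn(2) r t]])
      qed
    qed
  next
    assume R: ?R
    have "is_local_time a (\<lambda>s. Y s \<omega>) (\<lambda>r t. lim (\<lambda>n. ?D n r t))"
    proof (rule local_time_from_cauchy[OF p])
      fix T e :: real assume T: "0 \<le> T" and e: "0 < e"
      obtain T' :: nat where T': "T \<le> real T'" using real_arch_simple by blast
      obtain j :: nat where j: "1 / real (Suc j) < e" using nat_approx_posE[OF e] by auto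
      from R obtain n0 where n0: "\<And>m n (q::rat) (p::rat). n0 \<le> m \<Longrightarrow> n0 \<le> n \<Longrightarrow> 0 \<le> q \<and> q \<le> 1 \<and> 0 \<le> p \<and> real_of_rat p \<le> real T' \<Longrightarrow>
       \<bar>?D m (a * real_of_rat q) (max 0 (real_of_rat p)) - ?D n (a * real_of_rat q) (max 0 (real_of_rat p))\<bar> \<le> 1 / real (Suc j)" by blast
      have "\<bar>?D m r t - ?D n r t\<bar> \<le> e" if mn: "n0 \<le> m" "n0 \<le> n" and r: "r \<in> {0..a}" and t: "t \<in> {0..T}" for m n r t
      proof -
        \<comment> \<open>Rounding down keeps the approximating rationals within the ranges in which
          the Cauchy bound is available.\<close>
        define q where "q k = (of_int \<lfloor>real (Suc k) * (r / a)\<rfloor> / of_nat (Suc k) :: rat)" for k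
        define p where "p k = (of_int \<lfloor>real (Suc k) * t\<rfloor> / of_nat (Suc k) :: rat)" for k
        have qr: "real_of_rat (q k) = of_int \<lfloor>real (Suc k) * (r / a)\<rfloor> / real (Suc k)" for k
          unfolding q_def of_rat_divide of_rat_of_int_eq of_rat_of_nat_eq ..
        have pr: "real_of_rat (p k) = of_int \<lfloor>real (Suc k) * t\<rfloor> / real (Suc k)" for k
          unfolding p_def of_rat_divide of_rat_of_int_eq of_rat_of_nat_eq ..
        have ra: "0 \<le> r / a" "r / a \<le> 1" using r a by auto
        have q0: "0 \<le> q k" and p0: "0 \<le> p k" for k
          unfolding q_def p_def using ra t by (intro floor_quotient_nonneg; simp)+
        have "real_of_rat (q k) \<le> real_of_rat 1" for k
          unfolding qr of_rat_1 by (rule order_trans[OF floor_quotient_tendsto(2) ra(2)])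
        then have q1: "q k \<le> 1" for k unfolding of_rat_less_eq .
        have p1: "real_of_rat (p k) \<le> T" for k
          unfolding pr using t by (intro order_trans[OF floor_quotient_tendsto(2)]) simp
        have "(\<lambda>k. a * real_of_rat (q k)) \<longlonglongrightarrow> a * (r / a)"
          unfolding qr by (intro tendsto_intros floor_quotient_tendsto)
        then have ql: "(\<lambda>k. a * real_of_rat (q k)) \<longlonglongrightarrow> r" using a by simp
        have "(\<lambda>k. max 0 (real_of_rat (p k))) \<longlonglongrightarrow> max 0 t"
          unfolding pr by (intro tendsto_max tendsto_const floor_quotient_tendsto)
        then have pl: "(\<lambda>k. max 0 (real_of_rat (p k))) \<longlonglongrightarrow> t" using t by simp
        have lim: "(\<lambda>k. ?D n (a * real_of_rat (q k)) (max 0 (real_of_rat (p k)))) \<longlonglongrightarrow> ?D n r t" for n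
        proof -
          have "(\<lambda>k. (\<lambda>(r, t). ?D n r t) (a * real_of_rat (q k), max 0 (real_of_rat (p k)))) \<longlonglongrightarrow> (\<lambda>(r, t). ?D n r t) (r, t)"
            using q0 q1 a r t by (intro continuous_on_tendsto_compose[OF density_approx_cont[OF \<open>0 < a\<close> Y_cont[OF w] Y_range[OF w]]] tendsto_Pair ql pl)
              (auto simp: mult_left_le)
          then show ?thesis by simp
        qed
        have "(\<lambda>k. \<bar>?D m (a * real_of_rat (q k)) (max 0 (real_of_rat (p k))) - ?D n (a * real_of_rat (q k)) (max 0 (real_of_rat (p k)))\<bar>) \<longlonglongrightarrow> \<bar>?D m r t - ?D n r t\<bar>"
          by (intro tendsto_intros lim)
        then have "\<bar>?D m r t - ?D n r t\<bar> \<le> 1 / real (Suc j)"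
          by (rule LIMSEQ_le_const2) (use n0[OF mn] q0 q1 p0 order_trans[OF p1 T'] in blast)
        then show ?thesis using j by simp
      qed
      then show "\<exists>n0. \<forall>m\<ge>n0. \<forall>n\<ge>n0. \<forall>r\<in>{0..a}. \<forall>t\<in>{0..T}. \<bar>?D m r t - ?D n r t\<bar> \<le> e" by blast
    qed
    then show ?L by blast
  }
qed

lemma exists_local_time_meas: "{\<omega> \<in> space N. \<exists>l. is_local_time a (\<lambda>s. Y s \<omega>) l} \<in> sets N"
proof -
  have [measurable]: "(\<lambda>\<omega>. density_approx a (\<lambda>s. Y s \<omega>) n r (max 0 p)) \<in> borel_measurable N" for n r p
    by (rule D_meas) simp
  have "{\<omega> \<in> space N. \<forall>T::nat. \<forall>j::nat. \<exists>n0. \<forall>m n. n0 \<le> m \<longrightarrow> n0 \<le> n \<longrightarrow> (\<forall>q p :: rat. 0 \<le> q \<and> q \<le> 1 \<and> 0 \<le> p \<and> real_of_rat p \<le> real T \<longrightarrow>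
       \<bar>density_approx a (\<lambda>s. Y s \<omega>) m (a * real_of_rat q) (max 0 (real_of_rat p))
        - density_approx a (\<lambda>s. Y s \<omega>) n (a * real_of_rat q) (max 0 (real_of_rat p))\<bar> \<le> 1 / real (Suc j))} \<in> sets N"
    by (intro sets.sets_Collect_countable_All sets.sets_Collect_countable_Ex sets.sets_Collect_imp sets.sets_Collect_const) measurable
  then show ?thesis
    by (rule back_subst[where P="\<lambda>S. S \<in> sets N"], intro Collect_cong conj_cong[OF refl] exists_local_time_iff[symmetric])
qed

lemma density_approx_tendsto:
  assumes "\<omega> \<in> space N" "\<exists>l. is_local_time a (\<lambda>s. Y s \<omega>) l" "r \<in> {0..a}" "0 \<le> t"
  shows "(\<lambda>n. density_approx a (\<lambda>s. Y s \<omega>) n r t) \<longlonglongrightarrow> L r t \<omega>"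
proof -
  obtain l where l: "is_local_time a (\<lambda>s. Y s \<omega>) l" using assms by blast
  show ?thesis unfolding local_time_eq[OF a l assms(3,4)]
  proof (rule LIMSEQ_I)
    fix e :: real assume "0 < e"
    then obtain n0 where n0: "\<forall>n\<ge>n0. \<forall>r\<in>{0..a}. \<forall>s\<in>{0..t}. \<bar>density_approx a (\<lambda>s. Y s \<omega>) n r s - l r s\<bar> \<le> e / 2"
      using density_approx_uniform[OF a Y_cont[OF assms(1)] Y_range[OF assms(1)] l half_gt_zero assms(4)] by blast
    have "norm (density_approx a (\<lambda>s. Y s \<omega>) n r t - l r t) < e" if "n0 \<le> n" for n
    proof -
      have "\<bar>density_approx a (\<lambda>s. Y s \<omega>) n r t - l r t\<bar> \<le> e / 2" using n0 that assms(3,4) by simp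
      then show ?thesis using \<open>0 < e\<close> unfolding real_norm_def by linarith
    qed
    then show "\<exists>no. \<forall>n\<ge>no. norm (density_approx a (\<lambda>s. Y s \<omega>) n r t - l r t) < e" by blast
  qed
qed

text \<open>Although \<open>local_time\<close> is defined by choice, uniqueness identifies it with
  the limit of \<open>density_approx\<close> wherever a local time exists, and this set is
  measurable; elsewhere it is 0.\<close>

lemma L_meas:
  assumes r: "r \<in> {0..a}" and t: "0 \<le> t"
  shows "(\<lambda>\<omega>. L r t \<omega>) \<in> borel_measurable N"
proof -
  have [measurable]: "{\<omega> \<in> space N. \<exists>l. is_local_time a (\<lambda>s. Y s \<omega>) l} \<in> sets N" by (rule exists_local_time_meas)
  have [measurable]: "(\<lambda>\<omega>. density_approx a (\<lambda>s. Y s \<omega>) n r t) \<in> borel_measurable N" for n by (rule D_meas[OF t])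
  have "(\<lambda>\<omega>. if \<exists>l. is_local_time a (\<lambda>s. Y s \<omega>) l then lim (\<lambda>n. density_approx a (\<lambda>s. Y s \<omega>) n r t) else 0) \<in> borel_measurable N"
    by (intro measurable_If borel_measurable_lim_metric borel_measurable_const D_meas t exists_local_time_meas)
  moreover have "(if \<exists>l. is_local_time a (\<lambda>s. Y s \<omega>) l then lim (\<lambda>n. density_approx a (\<lambda>s. Y s \<omega>) n r t) else 0) = L r t \<omega>"
    if "\<omega> \<in> space N" for \<omega>
    using limI[OF density_approx_tendsto[OF that _ r t]] by (auto simp: local_time_def)
  ultimately show ?thesis by (simp cong: measurable_cong)
qed

lemma inverse_meas:
  assumes x: "0 \<le> x"
  shows "(\<lambda>\<omega>. inverse_local_time a (\<lambda>s. Y s \<omega>) x) \<in> borel_measurable N"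
proof (rule borel_measurableI_less)
  fix y :: ereal
  note T = inverse_local_time_passage[OF a x]
  have fin: "{\<omega> \<in> space N. inverse_local_time a (\<lambda>s. Y s \<omega>) x < ereal t} \<in> sets N" for t
  proof (cases "0 \<le> t")
    case True
    have [measurable]: "(\<lambda>\<omega>. L 0 t \<omega>) \<in> borel_measurable N" using a by (intro L_meas True) auto
    show ?thesis unfolding T(2)[OF True] by measurable
  next
    case False
    have "\<not> inverse_local_time a (\<lambda>s. Y s \<omega>) x < ereal t" for \<omega>
    proof
      assume "inverse_local_time a (\<lambda>s. Y s \<omega>) x < ereal t"
      with T(1) have "0 < ereal t" by (rule le_less_trans)
      then show False using False by simp
    qed
    then show ?thesis by simp
  qed
  show "{\<omega> \<in> space N. inverse_local_time a (\<lambda>s. Y s \<omega>) x < y} \<in> sets N"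
  proof (cases y)
    case PInf
    have "{\<omega> \<in> space N. inverse_local_time a (\<lambda>s. Y s \<omega>) x < y} = (\<Union>n. {\<omega> \<in> space N. inverse_local_time a (\<lambda>s. Y s \<omega>) x < ereal (real n)})"
    proof safe
      fix \<omega> assume "\<omega> \<in> space N" "inverse_local_time a (\<lambda>s. Y s \<omega>) x < y"
      then obtain t where "inverse_local_time a (\<lambda>s. Y s \<omega>) x = ereal t"
        using T(1)[of "\<lambda>s. Y s \<omega>"] PInf by (cases "inverse_local_time a (\<lambda>s. Y s \<omega>) x") auto
      moreover obtain n :: nat where "t < real n" using reals_Archimedean2 by blast
      ultimately show "\<omega> \<in> (\<Union>n. {\<omega> \<in> space N. inverse_local_time a (\<lambda>s. Y s \<omega>) x < ereal (real n)})"
        using \<open>\<omega> \<in> space N\<close> by auto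
    next
      fix \<omega> n assume "inverse_local_time a (\<lambda>s. Y s \<omega>) x < ereal (real n)"
      also have "\<dots> < y" using PInf by simp
      finally show "inverse_local_time a (\<lambda>s. Y s \<omega>) x < y" .
    qed
    then show ?thesis using fin by auto
  qed (use fin in auto)
qed

lemma L_random_time_meas:
  assumes "r \<in> {0..a}" "S \<in> borel_measurable N" "\<And>\<omega>. \<omega> \<in> space N \<Longrightarrow> 0 \<le> S \<omega>"
  shows "(\<lambda>\<omega>. L r (S \<omega>) \<omega>) \<in> borel_measurable N"
  by (rule measurable_at_random_time[where X="L r", OF L_meas[OF assms(1)] local_time_regular(1)[OF a assms(1)] assms(2,3)])

lemma local_time_at_inverse_meas:
  assumes "r \<in> {0..a}" "0 \<le> x"
  shows "(\<lambda>\<omega>. local_time_at_inverse a (\<lambda>s. Y s \<omega>) x r) \<in> borel_measurable N"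
  unfolding local_time_at_inverse_def
  using inverse_meas[OF assms(2)] inverse_local_time_passage(1)[OF a assms(2)]
  by (intro L_random_time_meas assms(1)) (auto simp: real_of_ereal_pos)

end

lemma local_time_at_inverse_nonneg:
  assumes "0 < a" "r \<in> {0..a}" "0 \<le> x"
  shows "0 \<le> local_time_at_inverse a \<phi> x r"
  unfolding local_time_at_inverse_def
  using inverse_local_time_passage(1)[OF assms(1,3)] by (intro local_time_regular(4) assms) (auto simp: real_of_ereal_pos)

section \<open>Reflected Brownian motion\<close>

lemma clamp_id: "y \<in> {0..a} \<Longrightarrow> max 0 (min a y) = (y :: real)"
  by auto

lemma measurable_eq_on_space:
  assumes "f \<in> M \<rightarrow>\<^sub>M N" "\<And>w. w \<in> space M \<Longrightarrow> f w = g w" shows "g \<in> M \<rightarrow>\<^sub>M N"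
  using assms measurable_cong by blast

text \<open>The sum of all squares has finite expectation, so it is finite almost surely and its
  terms tend to 0. This avoids passing to subsequences of grids.\<close>

lemma AE_tendsto_zero_of_summable_squares:
  assumes M: "prob_space M"
    and X: "\<And>n. integrable M (\<lambda>\<omega>. (X n \<omega>)\<^sup>2)" and meas: "\<And>n. X n \<in> borel_measurable M"
    and le: "\<And>n. (\<integral>\<omega>. (X n \<omega>)\<^sup>2 \<partial>M) \<le> c n" and c: "summable c"
  shows "AE \<omega> in M. (\<lambda>n. X n \<omega> :: real) \<longlonglongrightarrow> 0"
proof -
  interpret prob_space M by fact
  have c0: "0 \<le> c n" for n by (rule order_trans[OF _ le]) simp
  have m2: "(\<lambda>\<omega>. ennreal ((X n \<omega>)\<^sup>2)) \<in> borel_measurable M" for n using meas by measurable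
  have "(\<integral>\<^sup>+ \<omega>. (\<Sum>n. ennreal ((X n \<omega>)\<^sup>2)) \<partial>M) = (\<Sum>n. \<integral>\<^sup>+ \<omega>. ennreal ((X n \<omega>)\<^sup>2) \<partial>M)"
    by (rule nn_integral_suminf) (rule m2)
  also have "\<dots> = (\<Sum>n. ennreal (\<integral>\<omega>. (X n \<omega>)\<^sup>2 \<partial>M))"
    by (intro suminf_cong nn_integral_eq_integral X) simp
  also have "\<dots> \<le> (\<Sum>n. ennreal (c n))"
    by (intro suminf_le ennreal_leI le) auto
  also have "\<dots> = ennreal (suminf c)" by (rule suminf_ennreal2[OF c0 c])
  finally have fin: "(\<integral>\<^sup>+ \<omega>. (\<Sum>n. ennreal ((X n \<omega>)\<^sup>2)) \<partial>M) \<noteq> \<infinity>" by (auto simp: top_unique)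
  have "(\<lambda>\<omega>. \<Sum>n. ennreal ((X n \<omega>)\<^sup>2)) \<in> borel_measurable M" using m2 by measurable
  from nn_integral_PInf_AE[OF this fin]
  have "AE \<omega> in M. (\<Sum>n. ennreal ((X n \<omega>)\<^sup>2)) \<noteq> \<infinity>" .
  then show ?thesis
  proof eventually_elim
    fix \<omega> assume "(\<Sum>n. ennreal ((X n \<omega>)\<^sup>2)) \<noteq> \<infinity>"
    then have "summable (\<lambda>n. (X n \<omega>)\<^sup>2)" by (intro summable_suminf_not_top) auto
    then have "(\<lambda>n. (X n \<omega>)\<^sup>2) \<longlonglongrightarrow> 0" by (rule summable_LIMSEQ_zero)
    then have "(\<lambda>n. sqrt ((X n \<omega>)\<^sup>2)) \<longlonglongrightarrow> sqrt 0" by (rule tendsto_real_sqrt)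
    then show "(\<lambda>n. X n \<omega>) \<longlonglongrightarrow> 0" by (simp add: tendsto_rabs_zero_iff)
  qed
qed

locale reflected_bm = prob_space M for M :: "'w measure" +
  fixes \<theta> a :: real and Y \<beta> :: "real \<Rightarrow> 'w \<Rightarrow> real"
  assumes a: "0 < a" and Y_meas: "\<And>t. 0 \<le> t \<Longrightarrow> Y t \<in> borel_measurable M"
    and Y_cont: "\<And>\<omega>. \<omega> \<in> space M \<Longrightarrow> continuous_on {0..} (\<lambda>t. Y t \<omega>)"
    and Y_range: "\<And>\<omega> t. \<omega> \<in> space M \<Longrightarrow> 0 \<le> t \<Longrightarrow> Y t \<omega> \<in> {0..a}"
    and Y_0: "\<And>\<omega>. \<omega> \<in> space M \<Longrightarrow> Y 0 \<omega> = 0"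
    and bm: "brownian_motion M \<beta>"
    and eq: "AE \<omega> in M. (\<exists>l. is_local_time a (\<lambda>s. Y s \<omega>) l) \<and>
           (\<forall>t\<ge>0. Y t \<omega> = \<beta> t \<omega> - 2 * \<theta> * t
              + 1/2 * local_time a (\<lambda>s. Y s \<omega>) 0 t
              - 1/2 * local_time a (\<lambda>s. Y s \<omega>) a t)"
begin

sublocale interval_process M a Y
  by unfold_locales (use a Y_meas Y_cont Y_range in auto)

lemma AE_local_time: "AE \<omega> in M. \<exists>l. is_local_time a (\<lambda>s. Y s \<omega>) l"
  using eq by eventually_elim blast

lemma AE_path: "AE \<omega> in M. reflected_path a \<theta> (\<lambda>s. Y s \<omega>) (\<lambda>s. \<beta> s \<omega>) (\<lambda>t. L 0 t \<omega>) (\<lambda>t. L a t \<omega>)"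
proof -
  have "AE \<omega> in M. continuous_on {0..} (\<lambda>t. \<beta> t \<omega>)" using bm by (simp add: brownian_motion_def)
  then show ?thesis using eq AE_space
  proof eventually_elim
    case (elim \<omega>)
    then obtain l where l: "is_local_time a (\<lambda>s. Y s \<omega>) l" by blast
    then have l': "is_local_time a (\<lambda>s. Y s \<omega>) (local_time a (\<lambda>s. Y s \<omega>))" by (rule is_local_time_local_time)
    have 0: "0 \<in> {0..a}" "a \<in> {0..a}" using a by auto
    have c: "continuous_on {s..s'} (\<lambda>s. Y s \<omega>)" if "0 \<le> s" for s s'
      by (rule continuous_on_subset[OF Y_cont[OF elim(3)]]) (use that in auto)
    show ?case
    proof
      show "0 < a" by (rule a)
      show "Y s \<omega> \<in> {0..a}" if "0 \<le> s" for s by (rule Y_range[OF elim(3) that])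
      show "continuous_on {0..} (\<lambda>s. Y s \<omega>)" by (rule Y_cont[OF elim(3)])
      show "Y 0 \<omega> = 0" by (rule Y_0[OF elim(3)])
      show "continuous_on {0..} (\<lambda>s. \<beta> s \<omega>)" by (rule elim(1))
      show "L 0 s \<omega> \<le> L 0 s' \<omega>" "L a s \<omega> \<le> L a s' \<omega>" if "0 \<le> s" "s \<le> s'" for s s'
        using local_time_regular(2)[OF a _ that] 0 by auto
      show "L 0 0 \<omega> = 0" "L a 0 \<omega> = 0" "continuous_on {0..} (\<lambda>t. L 0 t \<omega>)"
        using local_time_regular(1,3)[OF a] 0 by auto
      show "L 0 s \<omega> = L 0 s' \<omega>" if "0 \<le> s" "s \<le> s'" "\<And>u. u \<in> {s<..<s'} \<Longrightarrow> Y u \<omega> \<noteq> 0" for s s'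
        by (rule local_time_flat[OF a l' 0(1) that(1,2) c[OF that(1)] that(3)])
      show "L a s \<omega> = L a s' \<omega>" if "0 \<le> s" "s \<le> s'" "\<And>u. u \<in> {s<..<s'} \<Longrightarrow> Y u \<omega> \<noteq> a" for s s'
        by (rule local_time_flat[OF a l' 0(2) that(1,2) c[OF that(1)] that(3)])
      show "Y s \<omega> = \<beta> s \<omega> - 2 * \<theta> * s + 1/2 * L 0 s \<omega> - 1/2 * L a s \<omega>" if "0 \<le> s" for s
        using elim(2) that by blast
    qed
  qed
qed

section \<open>The filtration generated by past increments\<close>

definition incr :: "real \<Rightarrow> nat \<Rightarrow> nat \<Rightarrow> 'w \<Rightarrow> real" where
  "incr t n i \<omega> = \<beta> (grid t n (Suc i)) \<omega> - \<beta> (grid t n i) \<omega>"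

text \<open>The past of \<open>\<beta>\<close> up to \<open>grid t n k\<close>, generated by increments over dyadic refinements of the
  grid; it is closed under changes on null sets, so that it also sees almost sure limits.\<close>

definition past_gen :: "real \<Rightarrow> nat \<Rightarrow> nat \<Rightarrow> 'w set set" where
  "past_gen t n k = {A \<in> sets M. \<exists>m. \<exists>B\<in>sets (PiM {..<k * 2 ^ m} (\<lambda>_. borel :: real measure)).
      AE \<omega> in M. \<omega> \<in> A \<longleftrightarrow> restrict (\<lambda>i. incr t (n + m) i \<omega>) {..<k * 2 ^ m} \<in> B}"

definition past :: "real \<Rightarrow> nat \<Rightarrow> nat \<Rightarrow> 'w measure" where
  "past t n k = sigma (space M) (past_gen t n k)"

lemma past_gen_sets: "past_gen t n k \<subseteq> sets M" "past_gen t n k \<subseteq> Pow (space M)"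
  using sets.space_closed by (auto simp: past_gen_def)

lemma space_past [simp]: "space (past t n k) = space M"
  by (simp add: past_def past_gen_sets)

lemma sets_past: "sets (past t n k) = sigma_sets (space M) (past_gen t n k)"
  by (simp add: past_def past_gen_sets)

lemma sets_past_subset: "sets (past t n k) \<subseteq> sets M"
  unfolding sets_past by (rule sets.sigma_sets_subset[OF past_gen_sets(1)])

lemma incr_refine: "incr t n i \<omega> = (\<Sum>j<2 ^ m. incr t (n + m) (i * 2 ^ m + j) \<omega>)"
proof -
  have "(\<Sum>j<2 ^ m. incr t (n + m) (i * 2 ^ m + j) \<omega>)
      = (\<Sum>j<2 ^ m. \<beta> (grid t (n + m) (i * 2 ^ m + Suc j)) \<omega> - \<beta> (grid t (n + m) (i * 2 ^ m + j)) \<omega>)"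
    by (simp add: incr_def)
  also have "\<dots> = \<beta> (grid t (n + m) (i * 2 ^ m + 2 ^ m)) \<omega> - \<beta> (grid t (n + m) (i * 2 ^ m + 0)) \<omega>"
    by (rule sum_lessThan_telescope)
  also have "grid t (n + m) (i * 2 ^ m + 2 ^ m) = grid t n (Suc i)"
    using grid_refine[of n "n + m" t "Suc i"] by (simp add: add.commute)
  also have "grid t (n + m) (i * 2 ^ m + 0) = grid t n i"
    using grid_refine[of n "n + m" t i] by simp
  finally show ?thesis by (simp add: incr_def)
qed

text \<open>A coarse increment is a sum of fine ones, so an event of one refinement is an event of
  every finer one. Two generators of different refinements thus meet on a common grid, which gives
  stability under intersection.\<close>

lemma past_gen_lift:
  assumes B: "B \<in> sets (PiM {..<k * 2 ^ m} (\<lambda>_. borel :: real measure))"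
  shows "\<exists>B'\<in>sets (PiM {..<k * 2 ^ (m + p)} (\<lambda>_. borel :: real measure)). \<forall>\<omega>.
    restrict (\<lambda>i. incr t (n + m) i \<omega>) {..<k * 2 ^ m} \<in> B \<longleftrightarrow>
    restrict (\<lambda>i. incr t (n + (m + p)) i \<omega>) {..<k * 2 ^ (m + p)} \<in> B'"
proof -
  define \<rho> where "\<rho> x = restrict (\<lambda>i. \<Sum>j<2 ^ p. (x (i * 2 ^ p + j) :: real)) {..<k * 2 ^ m}" for x :: "nat \<Rightarrow> real"
  have idx: "i * 2 ^ p + j < k * 2 ^ (m + p)" if "i < k * 2 ^ m" "j < 2 ^ p" for i j
  proof -
    have "i * 2 ^ p + j < Suc i * 2 ^ p" using that by simp
    also have "\<dots> \<le> k * 2 ^ m * 2 ^ p" using that by (intro mult_right_mono) auto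
    finally show ?thesis by (simp add: power_add mult.assoc)
  qed
  have \<rho>: "\<rho> \<in> PiM {..<k * 2 ^ (m + p)} (\<lambda>_. borel) \<rightarrow>\<^sub>M PiM {..<k * 2 ^ m} (\<lambda>_. borel)"
    unfolding \<rho>_def by (intro measurable_restrict borel_measurable_sum measurable_component_singleton) (use idx in auto)
  let ?B' = "\<rho> -` B \<inter> space (PiM {..<k * 2 ^ (m + p)} (\<lambda>_. borel :: real measure))"
  have "restrict (\<lambda>i. incr t (n + m) i \<omega>) {..<k * 2 ^ m}
      = \<rho> (restrict (\<lambda>i. incr t (n + (m + p)) i \<omega>) {..<k * 2 ^ (m + p)})" for \<omega>
    unfolding \<rho>_def by (rule restrict_ext) (use idx in \<open>auto simp: incr_refine[of t "n + m" _ \<omega> p] add.assoc intro!: sum.cong\<close>)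
  then show ?thesis
    by (intro bexI[of _ ?B'] measurable_sets[OF \<rho> B]) (auto simp: space_PiM)
qed

lemma Int_stable_past_gen: "Int_stable (past_gen t n k)"
proof (rule Int_stableI)
  fix A1 A2 assume "A1 \<in> past_gen t n k" "A2 \<in> past_gen t n k"
  then obtain m1 B1 m2 B2 where A: "A1 \<in> sets M" "A2 \<in> sets M"
    and B: "B1 \<in> sets (PiM {..<k * 2 ^ m1} (\<lambda>_. borel :: real measure))" "B2 \<in> sets (PiM {..<k * 2 ^ m2} (\<lambda>_. borel :: real measure))"
    and AE: "AE \<omega> in M. \<omega> \<in> A1 \<longleftrightarrow> restrict (\<lambda>i. incr t (n + m1) i \<omega>) {..<k * 2 ^ m1} \<in> B1"
      "AE \<omega> in M. \<omega> \<in> A2 \<longleftrightarrow> restrict (\<lambda>i. incr t (n + m2) i \<omega>) {..<k * 2 ^ m2} \<in> B2"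
    unfolding past_gen_def by blast
  obtain B1' where B1': "B1' \<in> sets (PiM {..<k * 2 ^ (m1 + m2)} (\<lambda>_. borel :: real measure))"
    "\<And>\<omega>. restrict (\<lambda>i. incr t (n + m1) i \<omega>) {..<k * 2 ^ m1} \<in> B1 \<longleftrightarrow>
    restrict (\<lambda>i. incr t (n + (m1 + m2)) i \<omega>) {..<k * 2 ^ (m1 + m2)} \<in> B1'"
    using past_gen_lift[OF B(1), of m2 t n] by blast
  obtain B2' where B2': "B2' \<in> sets (PiM {..<k * 2 ^ (m2 + m1)} (\<lambda>_. borel :: real measure))"
    "\<And>\<omega>. restrict (\<lambda>i. incr t (n + m2) i \<omega>) {..<k * 2 ^ m2} \<in> B2 \<longleftrightarrow>
    restrict (\<lambda>i. incr t (n + (m2 + m1)) i \<omega>) {..<k * 2 ^ (m2 + m1)} \<in> B2'"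
    using past_gen_lift[OF B(2), of m1 t n] by blast
  have "AE \<omega> in M. \<omega> \<in> A1 \<inter> A2 \<longleftrightarrow> restrict (\<lambda>i. incr t (n + (m1 + m2)) i \<omega>) {..<k * 2 ^ (m1 + m2)} \<in> B1' \<inter> B2'"
    using AE by eventually_elim (use B1'(2) B2'(2) in \<open>simp add: add.commute\<close>)
  moreover have "B1' \<inter> B2' \<in> sets (PiM {..<k * 2 ^ (m1 + m2)} (\<lambda>_. borel :: real measure))"
    using B1'(1) B2'(1) by (simp add: add.commute sets.Int)
  ultimately show "A1 \<inter> A2 \<in> past_gen t n k"
    unfolding past_gen_def using A by blast
qed

lemma \<beta>_meas: "0 \<le> t \<Longrightarrow> \<beta> t \<in> borel_measurable M"
  using bm by (simp add: brownian_motion_def)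

lemma incr_meas: "0 \<le> t \<Longrightarrow> incr t n i \<in> borel_measurable M"
  unfolding incr_def by (intro borel_measurable_diff \<beta>_meas grid_bounds)

lemma incr_indep_vars:
  assumes t: "0 < t"
  shows "indep_vars (\<lambda>_. borel) (\<lambda>i. incr t n i) {..<2 ^ n}"
proof -
  have "0 \<le> grid t n 0 \<and> (\<forall>i<2 ^ n. grid t n i < grid t n (Suc i))"
    using t by (simp add: grid_simps)
  then show ?thesis using bm unfolding brownian_motion_def incr_def[abs_def] by blast
qed

lemma incr_distributed:
  assumes t: "0 < t"
  shows "distributed M lborel (incr t n i) (normal_density 0 (sqrt (t / 2 ^ n)))"
proof -
  have "0 \<le> grid t n i \<and> grid t n i < grid t n (Suc i)" using t grid_bounds[of t n i] by (simp add: grid_simps)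
  then have "distributed M lborel (\<lambda>\<omega>. \<beta> (grid t n (Suc i)) \<omega> - \<beta> (grid t n i) \<omega>) (normal_density 0 (sqrt (grid t n (Suc i) - grid t n i)))"
    using bm unfolding brownian_motion_def by blast
  then show ?thesis by (simp add: incr_def[abs_def] grid_simps)
qed

text \<open>Everything is written on the refined grid of the event: \<open>A\<close> depends on the
  first \<open>k * 2 ^ m\<close> fine increments, while \<open>incr t n k\<close> is the sum of the
  \<open>2 ^ m\<close> that follow.\<close>

lemma past_gen_indep:
  assumes t: "0 < t" and k: "k < 2 ^ n" and A: "A \<in> past_gen t n k" and C: "C \<in> sets borel"
  shows "prob (A \<inter> (incr t n k -` C \<inter> space M)) = prob A * prob (incr t n k -` C \<inter> space M)"
proof -
  obtain m B where A': "A \<in> sets M" and B: "B \<in> sets (PiM {..<k * 2 ^ m} (\<lambda>_. borel :: real measure))"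
    and AE: "AE \<omega> in M. \<omega> \<in> A \<longleftrightarrow> restrict (\<lambda>i. incr t (n + m) i \<omega>) {..<k * 2 ^ m} \<in> B"
    using A unfolding past_gen_def by blast
  define I1 where "I1 = {..<k * 2 ^ m}"
  define I2 where "I2 = {k * 2 ^ m..<Suc k * 2 ^ m}"
  define X1 where "X1 \<omega> = restrict (\<lambda>i. incr t (n + m) i \<omega>) I1" for \<omega>
  define X2 where "X2 \<omega> = restrict (\<lambda>i. incr t (n + m) i \<omega>) I2" for \<omega>
  have le: "Suc k * 2 ^ m \<le> 2 ^ (n + m)" using k by (simp add: power_add Suc_leI mult_right_mono del: mult_Suc)
  have iv: "indep_var (PiM I1 (\<lambda>_. borel)) X1 (PiM I2 (\<lambda>_. borel)) X2"
    unfolding X1_def X2_def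
    by (rule indep_var_restrict[OF incr_indep_vars[OF t, of "n + m"]]) (use le in \<open>auto simp: I1_def I2_def\<close>)
  define s where "s x = (\<Sum>j<2 ^ m. (x (k * 2 ^ m + j) :: real))" for x :: "nat \<Rightarrow> real"
  have s: "s \<in> PiM I2 (\<lambda>_. borel) \<rightarrow>\<^sub>M borel"
    unfolding s_def by (intro borel_measurable_sum measurable_component_singleton) (auto simp: I2_def)
  have inc: "incr t n k \<omega> = s (X2 \<omega>)" for \<omega>
    unfolding s_def X2_def incr_refine[of t n k \<omega> m] by (intro sum.cong) (auto simp: I2_def)
  define D where "D = s -` C \<inter> space (PiM I2 (\<lambda>_. borel :: real measure))"
  have D: "D \<in> sets (PiM I2 (\<lambda>_. borel :: real measure))" unfolding D_def by (rule measurable_sets[OF s C])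
  have X2D: "X2 -` D \<inter> space M = incr t n k -` C \<inter> space M"
    by (auto simp: D_def inc X2_def space_PiM)
  have B': "B \<in> sets (PiM I1 (\<lambda>_. borel :: real measure))" using B by (simp add: I1_def)
  have rv: "X1 \<in> M \<rightarrow>\<^sub>M PiM I1 (\<lambda>_. borel)" using indep_var_rv1[OF iv] .
  have m1: "X1 -` B \<inter> space M \<in> sets M" by (rule measurable_sets[OF rv B'])
  have m2: "incr t n k -` C \<inter> space M \<in> sets M" using incr_meas[of t n k] t C by (auto intro: measurable_sets)
  have e1: "prob A = prob (X1 -` B \<inter> space M)"
  proof (rule finite_measure_eq_AE)
    show "AE x in M. (x \<in> A) = (x \<in> X1 -` B \<inter> space M)"
      using AE AE_space by eventually_elim (auto simp: X1_def I1_def)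
  qed (use A' m1 in auto)
  have "prob (A \<inter> (incr t n k -` C \<inter> space M)) = prob ((X1 -` B \<inter> space M) \<inter> (incr t n k -` C \<inter> space M))"
  proof (rule finite_measure_eq_AE)
    show "AE x in M. (x \<in> A \<inter> (incr t n k -` C \<inter> space M)) = (x \<in> (X1 -` B \<inter> space M) \<inter> (incr t n k -` C \<inter> space M))"
      using AE AE_space by eventually_elim (auto simp: X1_def I1_def)
  qed (use A' m1 m2 in auto)
  also have "\<dots> = prob ((\<lambda>x. (X1 x, X2 x)) -` (B \<times> D) \<inter> space M)"
    unfolding X2D[symmetric] by (rule arg_cong[where f=prob]) auto
  also have "\<dots> = prob (X1 -` B \<inter> space M) * prob (X2 -` D \<inter> space M)"
    by (rule indep_varD[OF iv B' D])
  finally show ?thesis using e1 X2D by simp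
qed

lemma past_indep:
  assumes t: "0 < t" and k: "k < 2 ^ n" and A: "A \<in> sets (past t n k)" and C: "C \<in> sets borel"
  shows "prob (A \<inter> (incr t n k -` C \<inter> space M)) = prob A * prob (incr t n k -` C \<inter> space M)"
proof -
  let ?E = "{incr t n k -` C \<inter> space M |C. C \<in> sets borel}"
  have E: "?E \<subseteq> sets M" using incr_meas[of t n k] t by (auto intro: measurable_sets)
  have "indep_set (past_gen t n k) ?E"
    by (rule indep_setI) (use past_gen_sets E past_gen_indep[OF t k] in auto)
  then have "indep_set (sigma_sets (space M) (past_gen t n k)) (sigma_sets (space M) ?E)"
    by (rule indep_set_sigma_sets[OF _ Int_stable_past_gen Int_stable_vimage])
  from indep_setD[OF this, of A "incr t n k -` C \<inter> space M"] A C
  show ?thesis by (auto simp: sets_past)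
qed

lemma past_mono:
  assumes "k \<le> k'" shows "sets (past t n k) \<subseteq> sets (past t n k')"
proof -
  have "past_gen t n k \<subseteq> past_gen t n k'"
  proof
    fix A assume "A \<in> past_gen t n k"
    then obtain m B where A: "A \<in> sets M" and B: "B \<in> sets (PiM {..<k * 2 ^ m} (\<lambda>_. borel :: real measure))"
      and AE: "AE \<omega> in M. \<omega> \<in> A \<longleftrightarrow> restrict (\<lambda>i. incr t (n + m) i \<omega>) {..<k * 2 ^ m} \<in> B"
      unfolding past_gen_def by blast
    have kk: "x < k * 2 ^ m \<Longrightarrow> x < k' * 2 ^ m" for x
      using assms by (meson less_le_trans mult_le_mono1)
    then have sub: "{..<k * 2 ^ m} \<subseteq> {..<k' * 2 ^ m}" by (intro subsetI) (simp only: lessThan_iff)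
    have r: "(\<lambda>x. restrict x {..<k * 2 ^ m}) \<in> PiM {..<k' * 2 ^ m} (\<lambda>_. borel :: real measure) \<rightarrow>\<^sub>M PiM {..<k * 2 ^ m} (\<lambda>_. borel :: real measure)"
      by (rule measurable_restrict_subset[OF sub])
    let ?B' = "(\<lambda>x. restrict x {..<k * 2 ^ m}) -` B \<inter> space (PiM {..<k' * 2 ^ m} (\<lambda>_. borel :: real measure))"
    have "AE \<omega> in M. \<omega> \<in> A \<longleftrightarrow> restrict (\<lambda>i. incr t (n + m) i \<omega>) {..<k' * 2 ^ m} \<in> ?B'"
      using AE
    proof eventually_elim
      case (elim \<omega>)
      have "restrict (restrict (\<lambda>i. incr t (n + m) i \<omega>) {..<k' * 2 ^ m}) {..<k * 2 ^ m} = restrict (\<lambda>i. incr t (n + m) i \<omega>) {..<k * 2 ^ m}"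
        using kk by (auto simp only: fun_eq_iff restrict_def lessThan_iff split: if_split)
      then show ?case using elim by (auto simp: space_PiM)
    qed
    then show "A \<in> past_gen t n k'" unfolding past_gen_def using A measurable_sets[OF r B] by blast
  qed
  then show ?thesis unfolding sets_past by (rule sigma_sets_mono')
qed

lemma incr_past:
  assumes t: "0 < t" and i: "i < k * 2 ^ m"
  shows "incr t (n + m) i \<in> borel_measurable (past t n k)"
proof (rule measurableI)
  fix C :: "real set" assume C: "C \<in> sets borel"
  have "(\<lambda>x. x i) \<in> PiM {..<k * 2 ^ m} (\<lambda>_. borel :: real measure) \<rightarrow>\<^sub>M borel"
    by (rule measurable_component_singleton) (use i in auto)
  from measurable_sets[OF this C]
  have B: "(\<lambda>x. x i) -` C \<inter> space (PiM {..<k * 2 ^ m} (\<lambda>_. borel :: real measure)) \<in> sets (PiM {..<k * 2 ^ m} (\<lambda>_. borel :: real measure))" .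
  have "incr t (n + m) i -` C \<inter> space M \<in> sets M" using incr_meas[of t "n + m" i] t C by (auto intro: measurable_sets)
  moreover have "AE \<omega> in M. \<omega> \<in> incr t (n + m) i -` C \<inter> space M \<longleftrightarrow> restrict (\<lambda>i. incr t (n + m) i \<omega>) {..<k * 2 ^ m}
      \<in> (\<lambda>x. x i) -` C \<inter> space (PiM {..<k * 2 ^ m} (\<lambda>_. borel :: real measure))"
    using AE_space by eventually_elim (use i in \<open>auto simp: space_PiM\<close>)
  ultimately have "incr t (n + m) i -` C \<inter> space M \<in> past_gen t n k"
    unfolding past_gen_def using B by blast
  then show "incr t (n + m) i -` C \<inter> space (past t n k) \<in> sets (past t n k)"
    by (simp add: sets_past sigma_sets.Basic)
qed auto

lemma past_null:
  assumes "A \<in> sets M" "AE \<omega> in M. \<omega> \<notin> A"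
  shows "A \<in> sets (past t n k)"
proof -
  have "A \<in> past_gen t n k"
    unfolding past_gen_def using assms by (intro CollectI conjI exI[of _ 0] bexI[of _ "{}"]) auto
  then show ?thesis by (simp add: sets_past sigma_sets.Basic)
qed

text \<open>Works because \<open>past\<close> contains every null event of \<open>M\<close>: the two
  preimages differ only by such events.\<close>

lemma past_cong_AE:
  assumes f: "f \<in> borel_measurable (past t n k)" and g: "g \<in> borel_measurable M"
    and fg: "AE \<omega> in M. f \<omega> = (g \<omega> :: real)"
  shows "g \<in> borel_measurable (past t n k)"
proof (rule measurableI)
  fix C :: "real set" assume C: "C \<in> sets borel"
  let ?F = "f -` C \<inter> space M" and ?G = "g -` C \<inter> space M"
  have F: "?F \<in> sets (past t n k)" using measurable_sets[OF f C] by simp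
  have FM: "?F \<in> sets M" using F sets_past_subset by blast
  have GM: "?G \<in> sets M" using g C by (rule measurable_sets)
  have "?F - ?G \<in> sets (past t n k)" "?G - ?F \<in> sets (past t n k)"
    using FM GM by (auto intro!: past_null simp: sets.Diff intro: AE_mp[OF fg])
  then have "(?F - (?F - ?G)) \<union> (?G - ?F) \<in> sets (past t n k)" using F by blast
  moreover have "(?F - (?F - ?G)) \<union> (?G - ?F) = ?G" by blast
  ultimately show "g -` C \<inter> space (past t n k) \<in> sets (past t n k)" by simp
qed auto

text \<open>Adaptedness of the reflected path, from the convergence of the Euler scheme. It is
  stated for all finer grid points up to \<open>grid t n k\<close>, since the local time at that
  point depends on the whole path before it.\<close>

lemma Y_past:
  assumes t: "0 < t" and k: "k \<le> 2 ^ n" and j: "j \<le> k * 2 ^ m"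
  shows "Y (grid t (n + m) j) \<in> borel_measurable (past t n k)"
proof (rule past_cong_AE)
  have e: "(\<lambda>\<omega>. euler a \<theta> (\<lambda>s. \<beta> s \<omega>) t (n + m + p) i) \<in> borel_measurable (past t n k)" if "i \<le> j * 2 ^ p" for p i
    using that
  proof (induction i)
    case (Suc i)
    have "i < j * 2 ^ p" using Suc.prems by simp
    also have "\<dots> \<le> k * 2 ^ m * 2 ^ p" using j by (intro mult_right_mono) auto
    finally have "i < k * 2 ^ (m + p)" by (simp add: power_add mult.assoc)
    from incr_past[OF t this, of n]
    have [measurable]: "(\<lambda>\<omega>. \<beta> (grid t (n + m + p) (Suc i)) \<omega> - \<beta> (grid t (n + m + p) i) \<omega>) \<in> borel_measurable (past t n k)"
      by (simp add: incr_def[abs_def] add.assoc)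
    have [measurable]: "(\<lambda>\<omega>. euler a \<theta> (\<lambda>s. \<beta> s \<omega>) t (n + m + p) i) \<in> borel_measurable (past t n k)"
      using Suc by simp
    show ?case unfolding euler.simps by measurable
  qed simp
  show "(\<lambda>\<omega>. lim (\<lambda>p. euler a \<theta> (\<lambda>s. \<beta> s \<omega>) t (n + m + p) (j * 2 ^ p))) \<in> borel_measurable (past t n k)"
    by (intro borel_measurable_lim_metric e) simp
  have j2: "j \<le> 2 ^ (n + m)"
    using order_trans[OF j mult_right_mono[OF k, of "2 ^ m"]] by (simp add: power_add)
  show "AE \<omega> in M. lim (\<lambda>p. euler a \<theta> (\<lambda>s. \<beta> s \<omega>) t (n + m + p) (j * 2 ^ p)) = Y (grid t (n + m) j) \<omega>"
    using AE_path
  proof eventually_elim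
    case (elim \<omega>)
    then interpret reflected_path a \<theta> "\<lambda>s. Y s \<omega>" "\<lambda>s. \<beta> s \<omega>" "\<lambda>t. L 0 t \<omega>" "\<lambda>t. L a t \<omega>" .
    show ?case using euler_tendsto[OF less_imp_le[OF t] j2] by (rule limI)
  qed
  show "Y (grid t (n + m) j) \<in> borel_measurable M" using t by (intro Y_meas grid_bounds) simp
qed

text \<open>\<open>density_approx\<close> at time \<open>grid t n k\<close> is a limit of Riemann
  sums over dyadic subdivisions of the interval from 0 to that time. Their points are again points
  of refinements of the original grid (\<open>gg\<close>), so \<open>Y_past\<close> applies.\<close>

lemma L_past:
  assumes t: "0 < t" and k: "k \<le> 2 ^ n" and r: "r \<in> {0..a}"
  shows "(\<lambda>\<omega>. L r (grid t n k) \<omega>) \<in> borel_measurable (past t n k)"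
proof (rule past_cong_AE)
  have g0: "0 \<le> grid t n k" using t by (intro grid_bounds) simp
  show "(\<lambda>\<omega>. L r (grid t n k) \<omega>) \<in> borel_measurable M" by (rule L_meas[OF r g0])
  have gg: "grid (grid t n k) p i = grid t (n + p) (k * i)" for p i
    by (simp add: grid_def power_add)
  show "(\<lambda>\<omega>. lim (\<lambda>p. density_approx a (\<lambda>s. Y s \<omega>) p r (grid t n k))) \<in> borel_measurable (past t n k)"
  proof (intro borel_measurable_lim_metric measurable_density_approx g0)
    show "continuous_on {0..grid t n k} (\<lambda>s. Y s \<omega>)" if "\<omega> \<in> space (past t n k)" for \<omega>
      by (rule continuous_on_subset[OF Y_cont]) (use that in auto)
    show "Y (grid (grid t n k) p i) \<in> borel_measurable (past t n k)" if "i < 2 ^ p" for p i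
      unfolding gg by (rule Y_past[OF t k]) (use that in simp)
  qed
  show "AE \<omega> in M. lim (\<lambda>p. density_approx a (\<lambda>s. Y s \<omega>) p r (grid t n k)) = L r (grid t n k) \<omega>"
    using AE_local_time AE_space
    by eventually_elim (rule limI[OF density_approx_tendsto[OF _ _ r g0]])
qed

lemma steps:
  assumes t: "0 < t"
  shows "gaussian_steps M (past t n) (incr t n) (2 ^ n) (t / 2 ^ n)"
proof
  show "incr t n i \<in> borel_measurable (past t n (Suc i))" for i
    using incr_past[OF t, of i "Suc i" 0 n] by simp
qed (use t sets_past_subset past_mono past_indep[OF t] incr_distributed[OF t] in auto)

section \<open>Stopping at the inverse local time\<close>

definition stop :: "real \<Rightarrow> real \<Rightarrow> 'w \<Rightarrow> real" where
  "stop x t \<omega> = real_of_ereal (min (inverse_local_time a (\<lambda>s. Y s \<omega>) x) (ereal t))"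

lemma stop_meas: "0 \<le> x \<Longrightarrow> stop x t \<in> borel_measurable M"
  unfolding stop_def[abs_def] using inverse_meas[of x] by measurable

lemma stop_range:
  assumes "0 \<le> x" "0 \<le> t"
  shows "stop x t \<omega> \<in> {0..t}" "ereal (stop x t \<omega>) = min (inverse_local_time a (\<lambda>s. Y s \<omega>) x) (ereal t)"
proof -
  define T where "T = inverse_local_time a (\<lambda>s. Y s \<omega>) x"
  have "0 \<le> T" unfolding T_def by (rule inverse_local_time_passage[OF a assms(1)])
  then show "stop x t \<omega> \<in> {0..t}" "ereal (stop x t \<omega>) = min (inverse_local_time a (\<lambda>s. Y s \<omega>) x) (ereal t)"
    unfolding stop_def T_def[symmetric] using assms(2) by (cases T; auto simp: min_def)+
qed

lemma L_stop_le:
  assumes "0 \<le> x" "0 \<le> t" shows "L 0 (stop x t \<omega>) \<omega> \<le> x"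
proof -
  have "ereal (stop x t \<omega>) \<le> inverse_local_time a (\<lambda>s. Y s \<omega>) x" using stop_range(2)[OF assms, of \<omega>] by simp
  then have "\<not> inverse_local_time a (\<lambda>s. Y s \<omega>) x < ereal (stop x t \<omega>)" by simp
  moreover have "0 \<le> stop x t \<omega>" using stop_range(1)[OF assms, of \<omega>] by simp
  ultimately show ?thesis
    using inverse_local_time_passage(2)[OF a assms(1), where t="stop x t \<omega>" and \<phi>="\<lambda>s. Y s \<omega>"] by simp
qed

text \<open>The grid version of \<open>stop\<close>. Whether step \<open>i\<close> is still carried
  out depends only on the local time at its beginning, hence on \<open>past t n i\<close>; the cap
  \<open>2 ^ n\<close> is the horizon \<open>t\<close>.\<close>

definition steps_before :: "real \<Rightarrow> real \<Rightarrow> nat \<Rightarrow> 'w \<Rightarrow> nat" where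
  "steps_before x t n \<omega> = (LEAST k. k = 2 ^ n \<or> x < L 0 (grid t n k) \<omega>)"

lemma steps_before:
  assumes x: "0 \<le> x" and t: "0 < t"
  shows "steps_before x t n \<omega> \<le> 2 ^ n"
    "i < steps_before x t n \<omega> \<Longrightarrow> L 0 (grid t n i) \<omega> \<le> x"
    "steps_before x t n \<omega> \<le> i \<Longrightarrow> i < 2 ^ n \<Longrightarrow> x < L 0 (grid t n i) \<omega>"
    "(\<lambda>n. grid t n (steps_before x t n \<omega>)) \<longlonglongrightarrow> stop x t \<omega>"
proof -
  have t0: "0 \<le> t" using t by simp
  define T where "T = inverse_local_time a (\<lambda>s. Y s \<omega>) x"
  have gr: "0 \<le> grid t n k" for n k using t by (intro grid_bounds) simp
  have LT: "x < L 0 (grid t n k) \<omega> \<longleftrightarrow> T < ereal (grid t n k)" for n k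
    unfolding T_def by (rule inverse_local_time_passage(2)[OF a x gr, symmetric])
  show le: "steps_before x t n \<omega> \<le> 2 ^ n" for n unfolding steps_before_def by (rule Least_le) simp
  have P: "steps_before x t n \<omega> = 2 ^ n \<or> x < L 0 (grid t n (steps_before x t n \<omega>)) \<omega>" for n
    unfolding steps_before_def by (rule LeastI[of _ "2 ^ n"]) simp
  have nP: "L 0 (grid t n i) \<omega> \<le> x" if "i < steps_before x t n \<omega>" for n i
    using not_less_Least[OF that[unfolded steps_before_def]] by simp
  then show "i < steps_before x t n \<omega> \<Longrightarrow> L 0 (grid t n i) \<omega> \<le> x" .
  show "x < L 0 (grid t n i) \<omega>" if i: "steps_before x t n \<omega> \<le> i" "i < 2 ^ n"
  proof -
    have "x < L 0 (grid t n (steps_before x t n \<omega>)) \<omega>" using P[of n] i by auto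
    also have "\<dots> \<le> L 0 (grid t n i) \<omega>"
      using a by (intro local_time_regular(2) grid_mono gr t0 i) auto
    finally show ?thesis .
  qed
  define S where "S = stop x t \<omega>"
  have S: "S \<in> {0..t}" "ereal S = min T (ereal t)" unfolding S_def T_def by (rule stop_range[OF x t0])+
  have lower: "S \<le> grid t n (steps_before x t n \<omega>)" for n
  proof -
    have "ereal S \<le> ereal (grid t n (steps_before x t n \<omega>))"
      using P[of n] unfolding LT S(2) by (auto simp: grid_simps min_le_iff_disj)
    then show ?thesis by simp
  qed
  \<comment> \<open>The grid point just before has local time at most \<open>x\<close>, so it does
    not lie beyond the stopping time.\<close>
  have upper: "grid t n (steps_before x t n \<omega>) \<le> S + t / 2 ^ n" for n
  proof (cases "steps_before x t n \<omega>")
    case (Suc j)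
    have "\<not> T < ereal (grid t n j)" using nP[of j n] Suc LT[of n j] by auto
    moreover have "grid t n j \<le> t" using le[of n] Suc by (intro grid_bounds t0) auto
    ultimately have "ereal (grid t n j) \<le> ereal S" unfolding S(2) by simp
    then show ?thesis using Suc by (simp add: grid_simps)
  qed (use S t in \<open>auto simp: grid_simps\<close>)
  have "(\<lambda>n. S + t / 2 ^ n) \<longlonglongrightarrow> S + 0" by (intro tendsto_intros mesh_tendsto)
  then have up: "(\<lambda>n. S + t / 2 ^ n) \<longlonglongrightarrow> S" by simp
  have "(\<lambda>n. grid t n (steps_before x t n \<omega>)) \<longlonglongrightarrow> S"
    by (rule tendsto_sandwich[OF _ _ tendsto_const up]; intro always_eventually allI lower upper)
  then show "(\<lambda>n. grid t n (steps_before x t n \<omega>)) \<longlonglongrightarrow> stop x t \<omega>" by (simp add: S_def)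
qed

text \<open>Stopping is expressed by setting the integrand to 0 afterwards. The number of steps
  stays the deterministic \<open>2 ^ n\<close>, as \<open>gaussian_steps\<close> needs, and the
  integrand remains adapted.\<close>

lemma sum_stopped:
  assumes x: "0 \<le> x" and t: "0 < t" and z: "\<And>y. c 0 y = (0 :: real)"
  shows "(\<Sum>i<2 ^ n. c (if L 0 (grid t n i) \<omega> \<le> x then u i else 0) (y i)) = (\<Sum>i<steps_before x t n \<omega>. c (u i) (y i))"
proof -
  have "(\<Sum>i<steps_before x t n \<omega>. c (u i) (y i)) = (\<Sum>i<steps_before x t n \<omega>. c (if L 0 (grid t n i) \<omega> \<le> x then u i else 0) (y i))"
    using steps_before(2)[OF x t] by (intro sum.cong) auto
  also have "\<dots> = (\<Sum>i<2 ^ n. c (if L 0 (grid t n i) \<omega> \<le> x then u i else 0) (y i))"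
  proof (rule sum.mono_neutral_left)
    show "\<forall>i\<in>{..<2 ^ n} - {..<steps_before x t n \<omega>}. c (if L 0 (grid t n i) \<omega> \<le> x then u i else 0) (y i) = 0"
    proof
      fix i assume "i \<in> {..<2 ^ n} - {..<steps_before x t n \<omega>}"
      then have "x < L 0 (grid t n i) \<omega>" using steps_before(3)[OF x t, of n \<omega> i] by auto
      then show "c (if L 0 (grid t n i) \<omega> \<le> x then u i else 0) (y i) = 0" using z by simp
    qed
  qed (use steps_before(1)[OF x t, of n \<omega>] in auto)
  finally show ?thesis by simp
qed

lemma bounded_of_cont:
  assumes "continuous_on {0..a} g"
  obtains C where "\<And>r. r \<in> {0..a} \<Longrightarrow> \<bar>g r\<bar> \<le> (C :: real)"
proof -
  have "bounded (g ` {0..a})" using compact_continuous_image[OF assms] compact_imp_bounded by blast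
  then show ?thesis using that unfolding bounded_iff by fastforce
qed

lemma stopped_past:
  assumes x: "0 \<le> x" and t: "0 < t" and g: "continuous_on {0..a} g" and i: "i \<le> 2 ^ n"
  shows "(\<lambda>\<omega>. if L 0 (grid t n i) \<omega> \<le> x then g (Y (grid t n i) \<omega>) else (0 :: real)) \<in> borel_measurable (past t n i)"
proof -
  have Y: "Y (grid t n i) \<in> borel_measurable (past t n i)" using Y_past[OF t i, of i 0] by simp
  have [measurable]: "(\<lambda>\<omega>. L 0 (grid t n i) \<omega>) \<in> borel_measurable (past t n i)"
    using a by (intro L_past t i) auto
  \<comment> \<open>\<open>g\<close> is controlled only on \<open>{0..a}\<close>; clamping the
    argument extends it continuously to the line without changing its values along the path.\<close>
  have "continuous_on UNIV (\<lambda>r. g (max 0 (min a r)))"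
    using a by (intro continuous_on_compose2[OF g]) (auto intro!: continuous_intros)
  from measurable_compose[OF Y borel_measurable_continuous_onI[OF this]]
  have "(\<lambda>\<omega>. g (max 0 (min a (Y (grid t n i) \<omega>)))) \<in> borel_measurable (past t n i)" .
  moreover have "g (max 0 (min a (Y (grid t n i) \<omega>))) = g (Y (grid t n i) \<omega>)" if "\<omega> \<in> space (past t n i)" for \<omega>
    using Y_range[of \<omega> "grid t n i"] that grid_bounds(1)[of t n i] t by (auto simp: max_def min_def)
  ultimately have [measurable]: "(\<lambda>\<omega>. g (Y (grid t n i) \<omega>)) \<in> borel_measurable (past t n i)"
    by (rule measurable_eq_on_space)
  show ?thesis by measurable
qed

text \<open>The second moments are of order \<open>2 ^ (- n)\<close>, hence summable. The version
  with weight 1 serves only to bound the unweighted sums of squares, the weighted one is the term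
  that appears in Ito's formula.\<close>

lemma AE_quadratic_variation:
  assumes x: "0 \<le> x" and t: "0 < t" and g: "continuous_on {0..a} g"
  shows "AE \<omega> in M. (\<lambda>n. \<Sum>i<2 ^ n. (if L 0 (grid t n i) \<omega> \<le> x then g (Y (grid t n i) \<omega>) else 0) * ((incr t n i \<omega>)\<^sup>2 - t / 2 ^ n)) \<longlonglongrightarrow> 0"
    and "AE \<omega> in M. (\<lambda>n. \<Sum>i<2 ^ n. 1 * ((incr t n i \<omega>)\<^sup>2 - t / 2 ^ n)) \<longlonglongrightarrow> 0"
proof -
  have gen: "AE \<omega> in M. (\<lambda>n. \<Sum>i<2 ^ n. w n i \<omega> * ((incr t n i \<omega>)\<^sup>2 - t / 2 ^ n)) \<longlonglongrightarrow> 0"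
    if w: "\<And>n i. i < 2 ^ n \<Longrightarrow> w n i \<in> borel_measurable (past t n i)"
      and C: "\<And>n i \<omega>. i < 2 ^ n \<Longrightarrow> \<omega> \<in> space M \<Longrightarrow> \<bar>w n i \<omega>\<bar> \<le> C" for w C
  proof (rule AE_tendsto_zero_of_summable_squares[OF prob_space_axioms])
    fix n
    interpret gaussian_steps M "past t n" "incr t n" "2 ^ n" "t / 2 ^ n" by (rule steps[OF t])
    have q: "integrable M (\<lambda>\<omega>. (\<Sum>i<2 ^ n. w n i \<omega> * ((incr t n i \<omega>)\<^sup>2 - t / 2 ^ n))\<^sup>2)
     \<and> expectation (\<lambda>\<omega>. (\<Sum>i<2 ^ n. w n i \<omega> * ((incr t n i \<omega>)\<^sup>2 - t / 2 ^ n))\<^sup>2) \<le> real (2 ^ n) * (2 * C\<^sup>2 * (t / 2 ^ n)\<^sup>2)"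
      by (rule quadratic_variation[OF w C order.refl])
    show "integrable M (\<lambda>\<omega>. (\<Sum>i<2 ^ n. w n i \<omega> * ((incr t n i \<omega>)\<^sup>2 - t / 2 ^ n))\<^sup>2)" using q by blast
    have e: "real (2 ^ n) * (2 * C\<^sup>2 * (t / 2 ^ n)\<^sup>2) = 2 * C\<^sup>2 * t\<^sup>2 * (1 / 2) ^ n"
      by (simp add: power2_eq_square power_one_over field_simps)
    show "(\<integral>\<omega>. (\<Sum>i<2 ^ n. w n i \<omega> * ((incr t n i \<omega>)\<^sup>2 - t / 2 ^ n))\<^sup>2 \<partial>M) \<le> 2 * C\<^sup>2 * t\<^sup>2 * (1 / 2) ^ n"
      using q unfolding e by blast
    have "w n i \<in> borel_measurable M" if "i < 2 ^ n" for i
      using F_M[OF _ w[OF that]] that by simp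
    then show "(\<lambda>\<omega>. \<Sum>i<2 ^ n. w n i \<omega> * ((incr t n i \<omega>)\<^sup>2 - t / 2 ^ n)) \<in> borel_measurable M"
      using incr_meas[of t n] t by (intro borel_measurable_sum borel_measurable_times borel_measurable_diff borel_measurable_power) auto
  next
    show "summable (\<lambda>n. 2 * C\<^sup>2 * t\<^sup>2 * (1 / 2) ^ n)" by (intro summable_mult summable_geometric) simp
  qed
  obtain C where C: "\<And>r. r \<in> {0..a} \<Longrightarrow> \<bar>g r\<bar> \<le> C" using bounded_of_cont[OF g] by blast
  have C0: "0 \<le> C" using C[of 0] a by auto
  show "AE \<omega> in M. (\<lambda>n. \<Sum>i<2 ^ n. (if L 0 (grid t n i) \<omega> \<le> x then g (Y (grid t n i) \<omega>) else 0) * ((incr t n i \<omega>)\<^sup>2 - t / 2 ^ n)) \<longlonglongrightarrow> 0"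
  proof (rule gen)
    fix n i \<omega> assume "\<omega> \<in> space M"
    then have "Y (grid t n i) \<omega> \<in> {0..a}" using t by (intro Y_range grid_bounds) auto
    then show "\<bar>if L 0 (grid t n i) \<omega> \<le> x then g (Y (grid t n i) \<omega>) else 0\<bar> \<le> C" using C C0 by auto
  qed (use stopped_past[OF x t g] in auto)
  show "AE \<omega> in M. (\<lambda>n. \<Sum>i<2 ^ n. 1 * ((incr t n i \<omega>)\<^sup>2 - t / 2 ^ n)) \<longlonglongrightarrow> 0"
    using gen[of "\<lambda>_ _ _. 1" 1] by simp
qed

lemma path_integral_meas:
  fixes f :: "real \<Rightarrow> real"
  assumes f: "continuous_on {0..a} f" and S: "S \<in> borel_measurable M" "\<And>\<omega>. \<omega> \<in> space M \<Longrightarrow> 0 \<le> S \<omega>"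
  shows "(\<lambda>\<omega>. integral {0..S \<omega>} (\<lambda>s. f (Y s \<omega>))) \<in> borel_measurable M"
proof -
  have cf: "continuous_on UNIV (\<lambda>r. f (max 0 (min a r)))"
    using a by (intro continuous_on_compose2[OF f]) (auto intro!: continuous_intros)
  have eq: "integral {0..t} (\<lambda>s. f (Y s \<omega>)) = integral {0..t} (\<lambda>s. f (max 0 (min a (Y s \<omega>))))" if "\<omega> \<in> space M" for t \<omega>
  proof (rule integral_cong)
    fix s assume "s \<in> {0..t}"
    then have "Y s \<omega> \<in> {0..a}" by (intro Y_range[OF that]) simp
    then show "f (Y s \<omega>) = f (max 0 (min a (Y s \<omega>)))" by (simp only: clamp_id)
  qed
  have "(\<lambda>\<omega>. integral {0..S \<omega>} (\<lambda>s. f (max 0 (min a (Y s \<omega>))))) \<in> borel_measurable M"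
  proof (rule measurable_at_random_time[where X="\<lambda>t \<omega>. integral {0..t} (\<lambda>s. f (max 0 (min a (Y s \<omega>))))", OF _ _ S])
    fix t :: real assume t: "0 \<le> t"
    show "(\<lambda>\<omega>. integral {0..t} (\<lambda>s. f (max 0 (min a (Y s \<omega>))))) \<in> borel_measurable M"
      by (rule measurable_integral_path[OF t continuous_on_subset[OF Y_cont] Y_meas cf]) (auto intro: grid_bounds t)
  next
    fix \<omega> assume w: "\<omega> \<in> space M"
    have c: "continuous_on {0..t} (\<lambda>s. f (max 0 (min a (Y s \<omega>))))" for t
      by (rule continuous_on_compose2[OF cf continuous_on_subset[OF Y_cont[OF w]]]) auto
    show "continuous_on {0..} (\<lambda>t. integral {0..t} (\<lambda>s. f (max 0 (min a (Y s \<omega>)))))"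
      unfolding continuous_on_eq_continuous_within
    proof
      fix u :: real assume u: "u \<in> {0..}"
      have "continuous (at u within {0..u + 1}) (\<lambda>t. integral {0..t} (\<lambda>s. f (max 0 (min a (Y s \<omega>)))))"
        using indefinite_integral_continuous_1[OF integrable_continuous_real[OF c[of "u + 1"]]] u
        by (auto simp: continuous_on_eq_continuous_within)
      moreover have "at u within {0..u + 1} = at u within {0..}"
        by (rule at_within_nhd[of _ "{..<u + 1}"]) auto
      ultimately show "continuous (at u within {0..}) (\<lambda>t. integral {0..t} (\<lambda>s. f (max 0 (min a (Y s \<omega>)))))" by simp
    qed
  qed
  then show ?thesis by (rule measurable_eq_on_space) (rule eq[symmetric])
qed

lemma Y_stop_meas:
  assumes f: "continuous_on {0..a} f" and S: "S \<in> borel_measurable M" "\<And>\<omega>. \<omega> \<in> space M \<Longrightarrow> 0 \<le> S \<omega>"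
  shows "(\<lambda>\<omega>. f (Y (S \<omega>) \<omega>) :: real) \<in> borel_measurable M"
proof -
  have cf: "continuous_on UNIV (\<lambda>r. f (max 0 (min a r)))"
    using a by (intro continuous_on_compose2[OF f]) (auto intro!: continuous_intros)
  have "(\<lambda>\<omega>. Y (S \<omega>) \<omega>) \<in> borel_measurable M" by (rule measurable_at_random_time[OF Y_meas Y_cont S])
  from measurable_compose[OF this borel_measurable_continuous_onI[OF cf]]
  have "(\<lambda>\<omega>. f (max 0 (min a (Y (S \<omega>) \<omega>)))) \<in> borel_measurable M" .
  moreover have "f (max 0 (min a (Y (S \<omega>) \<omega>))) = f (Y (S \<omega>) \<omega>)" if "\<omega> \<in> space M" for \<omega>
    using Y_range[OF that S(2)[OF that]] by (auto simp: max_def min_def)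
  ultimately show ?thesis by (rule measurable_eq_on_space)
qed

text \<open>Ito's formula and optional stopping at \<open>T\<^sub>x\<close> for
  \<open>exp (h (Y\<^sub>t) + v 0 * L\<^sub>0 t - \<integral> f (Y))\<close>, which is the stochastic exponential of \<open>- 2 \<integral> v (Y) d\<beta>\<close>.\<close>

lemma stopped_exponential:
  assumes x: "0 \<le> x" and t: "0 < t" and g: "continuous_on {0..a} g"
  shows "(\<integral>\<^sup>+ \<omega>. ennreal (exp (potential.h a g (Y (stop x t \<omega>) \<omega>) - potential.h a g 0
     + potential.v a g 0 * L 0 (stop x t \<omega>) \<omega> - integral {0..stop x t \<omega>} (\<lambda>s. potential.f a \<theta> g (Y s \<omega>)))) \<partial>M) = 1"
proof -
  interpret potential a \<theta> g by unfold_locales (use a g in auto)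
  have t0: "0 \<le> t" using t by simp
  \<comment> \<open>The integrand - 2 v(Y) of the stochastic exponential, switched off once the
    local time at 0 exceeds \<open>x\<close>.\<close>
  define \<sigma> where "\<sigma> n i \<omega> = (if L 0 (grid t n i) \<omega> \<le> x then - 2 * v (Y (grid t n i) \<omega>) else 0)" for n i \<omega>
  define Z where "Z n \<omega> = exp (\<Sum>i<2 ^ n. \<sigma> n i \<omega> * incr t n i \<omega> - (\<sigma> n i \<omega>)\<^sup>2 * (t / 2 ^ n) / 2)" for n \<omega>
  have cv: "continuous_on {0..a} (\<lambda>r. - 2 * v r)" by (intro continuous_intros v_cont)
  obtain C where C: "\<And>r. r \<in> {0..a} \<Longrightarrow> \<bar>- 2 * v r\<bar> \<le> C" using bounded_of_cont[OF cv] by blast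
  have C0: "0 \<le> C" using C[of 0] a by auto
  have \<sigma>: "\<sigma> n i \<in> borel_measurable (past t n i)" if "i < 2 ^ n" for n i
    unfolding \<sigma>_def[abs_def] using stopped_past[OF x t cv, of i n] that by simp
  have \<sigma>C: "\<bar>\<sigma> n i \<omega>\<bar> \<le> C" if "\<omega> \<in> space M" for n i \<omega>
    using C[OF Y_range[OF that grid_bounds(1)[OF t0]], of n i] C0 by (simp add: \<sigma>_def)
  show ?thesis
  \<comment> \<open>The L2 bound comes from \<open>exp_martingale_square\<close> with
    \<open>2 ^ n\<close> steps of length \<open>t / 2 ^ n\<close>, so the total time is
    \<open>t\<close> on every grid.\<close>
  proof (rule nn_integral_tendsto_L2_bounded[where Y=Z and K="exp (C\<^sup>2 * t)"])
    fix n
    interpret gs: gaussian_steps M "past t n" "incr t n" "2 ^ n" "t / 2 ^ n" by (rule steps[OF t])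
    show "(\<integral>\<^sup>+ \<omega>. ennreal (Z n \<omega>) \<partial>M) = 1"
      unfolding Z_def by (rule gs.exp_martingale[OF \<sigma> order.refl])
    have "(\<integral>\<^sup>+ \<omega>. ennreal ((Z n \<omega>)\<^sup>2) \<partial>M) \<le> ennreal (exp (real (2 ^ n) * (C\<^sup>2 * (t / 2 ^ n))))"
      unfolding Z_def by (rule gs.exp_martingale_square[OF \<sigma> \<sigma>C])
    then show "(\<integral>\<^sup>+ \<omega>. ennreal ((Z n \<omega>)\<^sup>2) \<partial>M) \<le> ennreal (exp (C\<^sup>2 * t))" by simp
    have m: "\<sigma> n i \<in> borel_measurable M" if "i < 2 ^ n" for i using gs.F_M[OF _ \<sigma>[OF that]] that by simp
    show "Z n \<in> borel_measurable M"
      unfolding Z_def[abs_def] using m incr_meas[OF t0, of n]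
      by (intro borel_measurable_exp[THEN measurable_compose[rotated]] measurable_compose[OF _ borel_measurable_exp] borel_measurable_sum
          borel_measurable_diff borel_measurable_times borel_measurable_divide borel_measurable_power borel_measurable_const) auto
    show "0 \<le> Z n \<omega>" for \<omega> by (simp add: Z_def)
  next
    have S: "stop x t \<in> borel_measurable M" "\<And>\<omega>. \<omega> \<in> space M \<Longrightarrow> 0 \<le> stop x t \<omega>"
      using stop_meas[OF x] stop_range(1)[OF x t0] by auto
    have [measurable]: "(\<lambda>\<omega>. h (Y (stop x t \<omega>) \<omega>)) \<in> borel_measurable M" by (rule Y_stop_meas[OF h_cont S])
    have [measurable]: "(\<lambda>\<omega>. L 0 (stop x t \<omega>) \<omega>) \<in> borel_measurable M" using a by (intro L_random_time_meas S) auto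
    have [measurable]: "(\<lambda>\<omega>. integral {0..stop x t \<omega>} (\<lambda>s. f (Y s \<omega>))) \<in> borel_measurable M" by (rule path_integral_meas[OF f_cont S])
    show "(\<lambda>\<omega>. exp (h (Y (stop x t \<omega>) \<omega>) - h 0 + v 0 * L 0 (stop x t \<omega>) \<omega> - integral {0..stop x t \<omega>} (\<lambda>s. f (Y s \<omega>)))) \<in> borel_measurable M"
      by measurable
    show "AE \<omega> in M. (\<lambda>n. Z n \<omega>) \<longlonglongrightarrow> exp (h (Y (stop x t \<omega>) \<omega>) - h 0 + v 0 * L 0 (stop x t \<omega>) \<omega> - integral {0..stop x t \<omega>} (\<lambda>s. f (Y s \<omega>)))"
      using AE_path AE_quadratic_variation[OF x t g]
    proof eventually_elim
      case (elim \<omega>)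
      then interpret reflected_path a \<theta> "\<lambda>s. Y s \<omega>" "\<lambda>s. \<beta> s \<omega>" "\<lambda>t. L 0 t \<omega>" "\<lambda>t. L a t \<omega>" by simp
      let ?k = "\<lambda>n. steps_before x t n \<omega>"
      \<comment> \<open>The compensated sums of squares converge, hence are bounded; adding
        \<open>t\<close> gives the uniform bound on squared increments that \<open>ito_limit\<close>
        asks for.\<close>
      have "Bseq (\<lambda>n. \<Sum>i<2 ^ n. 1 * ((incr t n i \<omega>)\<^sup>2 - t / 2 ^ n))"
        using elim(3) by (intro convergent_imp_Bseq convergentI)
      then obtain Q where Q: "\<And>n. \<bar>\<Sum>i<2 ^ n. 1 * ((incr t n i \<omega>)\<^sup>2 - t / 2 ^ n)\<bar> \<le> Q"
        unfolding Bseq_def by auto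
      have Q': "(\<Sum>i<2 ^ n. (\<beta> (grid t n (Suc i)) \<omega> - \<beta> (grid t n i) \<omega>)\<^sup>2) \<le> Q + t" for n
      proof -
        have "(\<Sum>i<2 ^ n. 1 * ((incr t n i \<omega>)\<^sup>2 - t / 2 ^ n)) = (\<Sum>i<2 ^ n. (incr t n i \<omega>)\<^sup>2) - t"
          by (simp add: sum_subtractf)
        then show ?thesis using Q[of n] by (simp add: incr_def)
      qed
      have "(\<lambda>n. \<Sum>i<2 ^ n. (if L 0 (grid t n i) \<omega> \<le> x then g (Y (grid t n i) \<omega>) else 0) * ((incr t n i \<omega>)\<^sup>2 - t / 2 ^ n))
          = (\<lambda>n. \<Sum>i<?k n. g (Y (grid t n i) \<omega>) * ((incr t n i \<omega>)\<^sup>2 - t / 2 ^ n))"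
        by (intro ext sum_stopped[OF x t, where c="\<lambda>u y. u * y"]) simp
      with elim(2) have WQ: "(\<lambda>n. \<Sum>i<?k n. g (Y (grid t n i) \<omega>) * ((\<beta> (grid t n (Suc i)) \<omega> - \<beta> (grid t n i) \<omega>)\<^sup>2 - t / 2 ^ n)) \<longlonglongrightarrow> 0"
        by (simp add: incr_def)
      have lim: "(\<lambda>n. \<Sum>i<?k n. (- 2 * v (Y (grid t n i) \<omega>)) * (\<beta> (grid t n (Suc i)) \<omega> - \<beta> (grid t n i) \<omega>)
         - (- 2 * v (Y (grid t n i) \<omega>))\<^sup>2 * (t / 2 ^ n) / 2)
       \<longlonglongrightarrow> h (Y (stop x t \<omega>) \<omega>) - h 0 + v 0 * L 0 (stop x t \<omega>) \<omega> - integral {0..stop x t \<omega>} (\<lambda>s. f (Y s \<omega>))"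
        by (rule ito_limit[OF g t steps_before(1)[OF x t] steps_before(4)[OF x t] Q' WQ])
      have "(\<Sum>i<2 ^ n. \<sigma> n i \<omega> * incr t n i \<omega> - (\<sigma> n i \<omega>)\<^sup>2 * (t / 2 ^ n) / 2)
          = (\<Sum>i<?k n. (- 2 * v (Y (grid t n i) \<omega>)) * (\<beta> (grid t n (Suc i)) \<omega> - \<beta> (grid t n i) \<omega>)
         - (- 2 * v (Y (grid t n i) \<omega>))\<^sup>2 * (t / 2 ^ n) / 2)" for n
        unfolding \<sigma>_def incr_def[symmetric]
        by (rule sum_stopped[OF x t, where c="\<lambda>u y. u * y - u\<^sup>2 * (t / 2 ^ n) / 2"]) simp
      then show ?case unfolding Z_def using tendsto_exp[OF lim] by simp
    qed
  qed
qed

end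

section \<open>Local times at the inverse local time\<close>

context reflected_bm
begin

text \<open>Choose \<open>g\<close> so that \<open>f >= \<kappa>\<close> and \<open>v >= 0\<close>.
  The stopped exponential is then at most \<open>exp (\<kappa> * c * x)\<close> times
  \<open>exp (- \<kappa> * stop x t)\<close>, and \<open>stop x t = t\<close> if the inverse local
  time is infinite. Since its mean is 1, letting first \<open>t\<close> grow and then \<kappa> tend
  to 0 shows \<open>P = 1\<close>; the proof does both along one sequence.\<close>

lemma AE_inverse_finite:
  assumes x: "0 \<le> x"
  shows "AE \<omega> in M. inverse_local_time a (\<lambda>s. Y s \<omega>) x \<noteq> \<infinity>"
proof -
  \<comment> \<open>With \<open>v r = \<kappa> * (exp (K * (a - r)) - 1)\<close> one has
    \<open>g = K * v + K * \<kappa>\<close>. As \<open>K - 1 = 4 * \<bar>\<theta>\<bar>\<close>, the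
    drift term of \<open>f\<close> takes away at most \<open>(K - 1) * v\<close>, and at least
    \<kappa> remains. The constant \<open>c\<close> is \<open>v 0 / \<kappa>\<close>.\<close>
  define K where "K = 4 * \<bar>\<theta>\<bar> + 1"
  define c where "c = exp (K * a) - 1"
  have K: "0 < K" "4 * \<bar>\<theta>\<bar> \<le> K - 1" by (auto simp: K_def)
  define P where "P = prob {\<omega> \<in> space M. inverse_local_time a (\<lambda>s. Y s \<omega>) x \<noteq> \<infinity>}"
  have [measurable]: "(\<lambda>\<omega>. inverse_local_time a (\<lambda>s. Y s \<omega>) x) \<in> borel_measurable M" by (rule inverse_meas[OF x])
  have main: "1 \<le> exp (\<kappa> * c * x) * (P + exp (- (\<kappa> * t)))" if \<kappa>: "0 < \<kappa>" and t: "0 < t" for \<kappa> t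
  proof -
    define g where "g r = \<kappa> * K * exp (K * (a - r))" for r
    have g: "continuous_on {0..a} g" unfolding g_def by (intro continuous_intros)
    interpret potential a \<theta> g by unfold_locales (use a g in auto)
    have v: "v r = \<kappa> * (exp (K * (a - r)) - 1)" if "r \<le> a" for r
    proof -
      have "(g has_integral (- \<kappa> * exp (K * (a - a))) - (- \<kappa> * exp (K * (a - r)))) {r..a}"
        unfolding g_def
        by (rule fundamental_theorem_of_calculus[OF that])
           (auto intro!: derivative_eq_intros simp: has_real_derivative_iff_has_vector_derivative[symmetric])
      then show ?thesis unfolding v_def by (simp add: integral_unique algebra_simps)
    qed
    have v0: "0 \<le> v r" if "r \<in> {0..a}" for r
      using v[of r] that \<kappa> K by auto
    have hle: "h r \<le> h 0" if r: "r \<in> {0..a}" for r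
    proof -
      have "integral {r..a} v \<le> integral {0..a} v"
        by (intro integral_subset_le integrable_continuous_real continuous_on_subset[OF v_cont])
           (use r v0 in auto)
      then show ?thesis by (simp add: h_def)
    qed
    have fge: "\<kappa> \<le> f r" if r: "r \<in> {0..a}" for r
    proof -
      define e where "e = exp (K * (a - r))"
      have e: "1 \<le> e" unfolding e_def using r K by simp
      have "- (4 * \<theta> * v r) \<le> 4 * \<bar>\<theta>\<bar> * v r"
      proof -
        have "- (4 * \<theta>) * v r \<le> 4 * \<bar>\<theta>\<bar> * v r" using v0[OF r] by (intro mult_right_mono) auto
        then show ?thesis by simp
      qed
      also have "\<dots> \<le> (K - 1) * v r" using K v0[OF r] by (intro mult_right_mono) auto
      also have "\<dots> = (K - 1) * \<kappa> * (e - 1)" using v[of r] r by (simp add: e_def)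
      finally have 1: "- (4 * \<theta> * v r) \<le> (K - 1) * \<kappa> * (e - 1)" .
      have "\<kappa> * 1 \<le> \<kappa> * e" "0 \<le> (K - 1) * \<kappa>" using e \<kappa> K by auto
      moreover have "g r = \<kappa> * K * e" by (simp add: g_def e_def)
      moreover have "\<kappa> * K * e - (K - 1) * \<kappa> * (e - 1) = \<kappa> * e + (K - 1) * \<kappa>" by (simp add: algebra_simps)
      ultimately have "\<kappa> \<le> 4 * \<theta> * v r + g r" using 1 by linarith
      then show ?thesis unfolding f_def using zero_le_power2[of "v r"] by linarith
    qed
    have t0: "0 \<le> t" using t by simp
    have "1 = (\<integral>\<^sup>+ \<omega>. ennreal (exp (h (Y (stop x t \<omega>) \<omega>) - h 0
       + v 0 * L 0 (stop x t \<omega>) \<omega> - integral {0..stop x t \<omega>} (\<lambda>s. f (Y s \<omega>)))) \<partial>M)"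
      using stopped_exponential[OF x t g] by simp
    also have "\<dots> \<le> (\<integral>\<^sup>+ \<omega>. ennreal (exp (\<kappa> * c * x)) * (indicator {\<omega> \<in> space M. inverse_local_time a (\<lambda>s. Y s \<omega>) x \<noteq> \<infinity>} \<omega> + ennreal (exp (- (\<kappa> * t)))) \<partial>M)"
    proof (rule nn_integral_mono)
      fix \<omega> assume w: "\<omega> \<in> space M"
      define S where "S = stop x t \<omega>"
      have S: "S \<in> {0..t}" unfolding S_def by (rule stop_range[OF x t0])
      have "h (Y S \<omega>) \<le> h 0" using S by (intro hle Y_range[OF w]) auto
      moreover have "v 0 * L 0 S \<omega> \<le> \<kappa> * c * x"
        using v[of 0] a \<kappa> K L_stop_le[OF x t0, of \<omega>] by (auto simp: c_def S_def intro!: mult_left_mono)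
      moreover have "\<kappa> * S \<le> integral {0..S} (\<lambda>s. f (Y s \<omega>))"
      proof -
        have "integral {0..S} (\<lambda>s. \<kappa>) \<le> integral {0..S} (\<lambda>s. f (Y s \<omega>))"
        proof (rule integral_le)
          show "(\<lambda>s. f (Y s \<omega>)) integrable_on {0..S}"
            using Y_range[OF w] by (intro integrable_continuous_real continuous_on_compose2[OF f_cont continuous_on_subset[OF Y_cont[OF w]]] image_subsetI) auto
          show "\<kappa> \<le> f (Y s \<omega>)" if "s \<in> {0..S}" for s using that by (intro fge Y_range[OF w]) auto
        qed auto
        then show ?thesis using S by (simp add: mult.commute)
      qed
      ultimately have "exp (h (Y S \<omega>) - h 0 + v 0 * L 0 S \<omega> - integral {0..S} (\<lambda>s. f (Y s \<omega>))) \<le> exp (\<kappa> * c * x + - (\<kappa> * S))"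
        by simp
      also have "\<dots> = exp (\<kappa> * c * x) * exp (- (\<kappa> * S))" by (rule exp_add)
      also have "\<dots> \<le> exp (\<kappa> * c * x) * (indicator {\<omega> \<in> space M. inverse_local_time a (\<lambda>s. Y s \<omega>) x \<noteq> \<infinity>} \<omega> + exp (- (\<kappa> * t)))"
      proof (rule mult_left_mono)
        show "exp (- (\<kappa> * S)) \<le> indicator {\<omega> \<in> space M. inverse_local_time a (\<lambda>s. Y s \<omega>) x \<noteq> \<infinity>} \<omega> + exp (- (\<kappa> * t))"
        proof (cases "inverse_local_time a (\<lambda>s. Y s \<omega>) x = \<infinity>")
          case True
          then have "S = t" by (simp add: S_def stop_def)
          then show ?thesis by simp
        next
          case False
          have "exp (- (\<kappa> * S)) \<le> 1" using \<kappa> S by simp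
          then show ?thesis using False w by (simp add: add_increasing2)
        qed
      qed simp
      finally have "ennreal (exp (h (Y S \<omega>) - h 0 + v 0 * L 0 S \<omega> - integral {0..S} (\<lambda>s. f (Y s \<omega>))))
        \<le> ennreal (exp (\<kappa> * c * x) * (indicator {\<omega> \<in> space M. inverse_local_time a (\<lambda>s. Y s \<omega>) x \<noteq> \<infinity>} \<omega> + exp (- (\<kappa> * t))))"
        by (rule ennreal_leI)
      also have "\<dots> = ennreal (exp (\<kappa> * c * x)) * (indicator {\<omega> \<in> space M. inverse_local_time a (\<lambda>s. Y s \<omega>) x \<noteq> \<infinity>} \<omega> + ennreal (exp (- (\<kappa> * t))))"
        by (subst ennreal_mult) (auto simp: ennreal_plus indicator_def)
      finally show "ennreal (exp (h (Y (stop x t \<omega>) \<omega>) - h 0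
       + v 0 * L 0 (stop x t \<omega>) \<omega> - integral {0..stop x t \<omega>} (\<lambda>s. f (Y s \<omega>))))
        \<le> ennreal (exp (\<kappa> * c * x)) * (indicator {\<omega> \<in> space M. inverse_local_time a (\<lambda>s. Y s \<omega>) x \<noteq> \<infinity>} \<omega> + ennreal (exp (- (\<kappa> * t))))"
        by (simp add: S_def)
    qed
    also have "\<dots> = ennreal (exp (\<kappa> * c * x)) * (ennreal P + ennreal (exp (- (\<kappa> * t))))"
      unfolding P_def by (subst nn_integral_cmult, measurable) (subst nn_integral_add, auto simp: emeasure_eq_measure prob_space)
    also have "\<dots> = ennreal (exp (\<kappa> * c * x) * (P + exp (- (\<kappa> * t))))"
      by (simp add: ennreal_mult P_def ennreal_plus)
    finally show ?thesis by (simp add: ennreal_ge_1)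
  qed
  \<comment> \<open>Here \<kappa> is \<open>1 / Suc n\<close> and \<open>t\<close> is the square of
    \<open>Suc n\<close>, so that \<kappa> tends to 0 while \<open>\<kappa> * t\<close> tends to
    infinity.\<close>
  have "(\<lambda>n. exp (1 / real (Suc n) * c * x) * (P + exp (- (1 / real (Suc n) * (real (Suc n) * real (Suc n)))))) \<longlonglongrightarrow> exp (0 * c * x) * (P + 0)"
  proof (intro tendsto_intros LIMSEQ_Suc[OF lim_inverse_n'])
    have "(\<lambda>n. exp (- 1) ^ Suc n :: real) \<longlonglongrightarrow> 0" by (intro LIMSEQ_Suc LIMSEQ_realpow_zero) auto
    moreover have "exp (- (1 / real (Suc n) * (real (Suc n) * real (Suc n)))) = exp (- 1) ^ Suc n" for n :: nat
    proof -
      have "1 / real (Suc n) * (real (Suc n) * real (Suc n)) = real (Suc n)" by (simp del: of_nat_Suc)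
      then show ?thesis by (simp only: exp_of_nat_mult[symmetric]) simp
    qed
    ultimately show "(\<lambda>n. exp (- (1 / real (Suc n) * (real (Suc n) * real (Suc n)))) :: real) \<longlonglongrightarrow> 0" by simp
  qed
  then have "1 \<le> exp (0 * c * x) * (P + 0)"
    by (rule LIMSEQ_le_const) (intro exI[of _ 0] allI impI main, auto)
  then have "P = 1" using prob_le_1 by (auto simp: P_def intro: antisym)
  then have "AE \<omega> in M. \<omega> \<in> {\<omega> \<in> space M. inverse_local_time a (\<lambda>s. Y s \<omega>) x \<noteq> \<infinity>}"
    unfolding P_def by (rule AE_prob_1)
  then show ?thesis by eventually_elim simp
qed

lemma stop_eventually:
  assumes "inverse_local_time a (\<lambda>s. Y s \<omega>) x \<noteq> \<infinity>" "0 \<le> x"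
  shows "eventually (\<lambda>n. stop x (real (Suc n)) \<omega> = real_of_ereal (inverse_local_time a (\<lambda>s. Y s \<omega>) x)) sequentially"
proof -
  obtain T where T: "inverse_local_time a (\<lambda>s. Y s \<omega>) x = ereal T"
    using assms inverse_local_time_passage(1)[OF a assms(2), of "\<lambda>s. Y s \<omega>"]
    by (cases "inverse_local_time a (\<lambda>s. Y s \<omega>) x") auto
  obtain N :: nat where "T \<le> real N" using real_arch_simple by blast
  then have "stop x (real (Suc n)) \<omega> = T" if "N \<le> n" for n
    using that by (simp add: stop_def T min_def)
  then show ?thesis unfolding T eventually_sequentially by auto
qed

text \<open>If the path were away from 0 at \<open>T\<close>, the local time at 0 would be flat
  right after \<open>T\<close>; but by \<open>first_passage\<close> it exceeds \<open>x\<close> at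
  every later time.\<close>

lemma Y_at_inverse:
  assumes w: "\<omega> \<in> space M" and l: "\<exists>l. is_local_time a (\<lambda>s. Y s \<omega>) l"
    and fin: "inverse_local_time a (\<lambda>s. Y s \<omega>) x \<noteq> \<infinity>" and x: "0 \<le> x"
  shows "Y (real_of_ereal (inverse_local_time a (\<lambda>s. Y s \<omega>) x)) \<omega> = 0"
proof (rule ccontr)
  define T where "T = real_of_ereal (inverse_local_time a (\<lambda>s. Y s \<omega>) x)"
  note p = inverse_local_time_passage[OF a x, where \<phi>="\<lambda>s. Y s \<omega>"]
  have T: "0 \<le> T" "inverse_local_time a (\<lambda>s. Y s \<omega>) x = ereal T"
    using p(1) fin by (cases "inverse_local_time a (\<lambda>s. Y s \<omega>) x"; simp add: T_def)+
  assume "Y T \<omega> \<noteq> 0"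
  have "continuous (at T within {0..}) (\<lambda>s. Y s \<omega>)"
    using Y_cont[OF w] T by (auto simp: continuous_on_eq_continuous_within)
  then obtain d where d: "0 < d" "\<And>s. 0 \<le> s \<Longrightarrow> dist s T < d \<Longrightarrow> dist (Y s \<omega>) (Y T \<omega>) < \<bar>Y T \<omega>\<bar>"
    using \<open>Y T \<omega> \<noteq> 0\<close> unfolding continuous_within_eps_delta by (metis atLeast_iff zero_less_abs_iff)
  have ne: "Y s \<omega> \<noteq> 0" if "s \<in> {T<..<T + d}" for s
    using d(2)[of s] that T by (auto simp: dist_real_def)
  have l': "is_local_time a (\<lambda>s. Y s \<omega>) (local_time a (\<lambda>s. Y s \<omega>))"
    using l is_local_time_local_time by blast
  have "L 0 T \<omega> = L 0 (T + d) \<omega>"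
    by (rule local_time_flat[OF a l' _ T(1) _ continuous_on_subset[OF Y_cont[OF w]] ne]) (use a d T in auto)
  moreover have "L 0 T \<omega> = x" using p(3)[OF fin] by (simp add: T_def)
  moreover have "x < L 0 (T + d) \<omega>" using p(2)[of "T + d"] T d by simp
  ultimately show False by simp
qed

text \<open>Extends \<open>stopped_exponential\<close> to \<open>v\<close> with jumps by mollifying each jump to its right, which needs
  the margin \<open>r + 1 \<le> a\<close>.\<close>

lemma jump_exponential:
  fixes es :: "(real \<times> real) list" and v :: "real \<Rightarrow> real"
  assumes x: "0 \<le> x" and t: "0 < t"
    and es: "\<And>r q. (r, q) \<in> set es \<Longrightarrow> 0 \<le> r \<and> r + 1 \<le> a \<and> 0 \<le> q"
    and B: "\<And>r. r \<in> {0..a} \<Longrightarrow> \<bar>v r\<bar> \<le> B"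
    and int: "(\<lambda>s. branching \<theta> (v s)) integrable_on {0..a}"
    and v: "\<And>r. r \<in> {0..a} \<Longrightarrow> v r = (\<Sum>(r', q)\<leftarrow>es. if r \<le> r' then q else 0) - integral {r..a} (\<lambda>s. branching \<theta> (v s))"
  shows "(\<lambda>\<omega>. exp (2 * integral {Y (stop x t \<omega>) \<omega>..a} v - 2 * integral {0..a} v
     + v 0 * L 0 (stop x t \<omega>) \<omega> - (\<Sum>(r, q)\<leftarrow>es. q * L r (stop x t \<omega>) \<omega>))) \<in> borel_measurable M"
    and "(\<integral>\<^sup>+ \<omega>. ennreal (exp (2 * integral {Y (stop x t \<omega>) \<omega>..a} v - 2 * integral {0..a} v
     + v 0 * L 0 (stop x t \<omega>) \<omega> - (\<Sum>(r, q)\<leftarrow>es. q * L r (stop x t \<omega>) \<omega>))) \<partial>M) = 1"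
proof -
  define \<psi> where "\<psi> u = branching \<theta> u" for u
  have \<psi>c: "continuous_on S \<psi>" for S unfolding \<psi>_def by (intro continuous_intros)
  have \<psi>b: "\<bar>\<psi> u\<bar> \<le> 2 * b\<^sup>2 + 4 * \<bar>\<theta>\<bar> * b" if "\<bar>u\<bar> \<le> b" for u b
  proof -
    have "u\<^sup>2 \<le> b\<^sup>2" using that by (metis abs_ge_self abs_le_square_iff order_trans)
    moreover have "\<bar>\<theta>\<bar> * \<bar>u\<bar> \<le> \<bar>\<theta>\<bar> * b" using that by (intro mult_left_mono) auto
    moreover have "\<bar>\<psi> u\<bar> \<le> 2 * u\<^sup>2 + 4 * (\<bar>\<theta>\<bar> * \<bar>u\<bar>)"
      unfolding \<psi>_def by (rule order_trans[OF abs_triangle_ineq]) (simp add: abs_mult)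
    ultimately show ?thesis by linarith
  qed
  have t0: "0 \<le> t" using t by simp
  \<comment> \<open>The offset 2 gives \<open>2 * k n <= 1\<close>, so the support
    \<open>{r..r + 2 * k n}\<close> of the mollifier fits into the margin of length 1 below
    \<open>a\<close>.\<close>
  define k where "k n = 1 / real (n + 2)" for n :: nat
  have k: "0 < k n" "2 * k n \<le> 1" for n by (auto simp: k_def field_simps)
  have k0: "k \<longlonglongrightarrow> 0" unfolding k_def[abs_def] using LIMSEQ_ignore_initial_segment[OF lim_const_over_n[of 1], of 2] by simp
  \<comment> \<open>A unit mass immediately to the right of \<open>r\<close>. Its integral over
    \<open>{\<rho>..a}\<close> tends to 1 also for \<rho> = r, in agreement with the non-strict
    inequality \<open>r <= r'\<close> in the equation of \<open>v\<close>.\<close>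
  define p where "p n r s = tent (k n) (r + k n) s / k n" for n r s
  have pc: "continuous_on S (p n r)" for n r S
    unfolding p_def[abs_def] using k(1)[of n] by (intro continuous_intros tent_cont) auto
  have p0: "0 \<le> p n r s" for n r s unfolding p_def using k(1)[of n] tent_bounds by (intro divide_nonneg_pos)
  have ptot: "integral {0..a} (p n r) = 1" if "0 \<le> r" "r + 1 \<le> a" for n r
  proof -
    have "tent_mass a (k n) (r + k n) = k n" using that k[of n] by (intro tent_mass_interior) auto
    then show ?thesis using k(1)[of n] unfolding p_def tent_mass_def by simp
  qed
  have pint: "p n r integrable_on {c..d}" for n r c d by (intro integrable_continuous_real pc)
  have pz: "p n r s = 0" if "s \<le> r \<or> r + 2 * k n \<le> s" for n r s
    unfolding p_def using tent_eq_0[OF k(1)[of n], of "r + k n" s] that k(1)[of n] by (auto simp: abs_if)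
  have pb: "0 \<le> integral {\<rho>..a} (p n r)" "integral {\<rho>..a} (p n r) \<le> 1"
    if "0 \<le> r" "r + 1 \<le> a" "0 \<le> \<rho>" for n r \<rho>
  proof -
    show "0 \<le> integral {\<rho>..a} (p n r)" by (intro integral_nonneg pint p0)
    have "integral {\<rho>..a} (p n r) \<le> integral {0..a} (p n r)"
      by (intro integral_subset_le pint) (use that p0 in auto)
    then show "integral {\<rho>..a} (p n r) \<le> 1" using ptot[OF that(1,2)] by simp
  qed
  have plim: "(\<lambda>n. integral {\<rho>..a} (p n r)) \<longlonglongrightarrow> (if \<rho> \<le> r then 1 else 0)"
    if r: "0 \<le> r" "r + 1 \<le> a" and \<rho>: "0 \<le> \<rho>" "\<rho> \<le> a" for r \<rho>
  proof (cases "\<rho> \<le> r")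
    case True
    have "integral {\<rho>..a} (p n r) = 1" for n
    proof -
      have "integral {0..\<rho>} (p n r) + integral {\<rho>..a} (p n r) = integral {0..a} (p n r)"
        by (rule Henstock_Kurzweil_Integration.integral_combine[OF \<rho> pint])
      moreover have "integral {0..\<rho>} (p n r) = integral {0..\<rho>} (\<lambda>_. 0)"
        by (rule integral_cong) (use True in \<open>auto intro!: pz\<close>)
      ultimately show ?thesis using ptot[OF r, of n] by simp
    qed
    then show ?thesis using True by simp
  next
    case False
    have "eventually (\<lambda>n. k n < (\<rho> - r) / 2) sequentially"
      using False by (intro order_tendstoD[OF k0]) auto
    then have "eventually (\<lambda>n. integral {\<rho>..a} (p n r) = 0) sequentially"
    proof eventually_elim
      case (elim n)
      have "integral {\<rho>..a} (p n r) = integral {\<rho>..a} (\<lambda>_. 0)"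
        by (rule integral_cong) (use elim in \<open>auto intro!: pz\<close>)
      then show ?case by simp
    qed
    then show ?thesis using False by (simp add: tendsto_eventually)
  qed
  define P where "P n s = (\<Sum>(r, q)\<leftarrow>es. q * p n r s)" for n s
  define \<Lambda> where "\<Lambda> \<rho> = (\<Sum>(r, q)\<leftarrow>es. if \<rho> \<le> r then q else 0)" for \<rho>
  define Q where "Q = (\<Sum>(r, q)\<leftarrow>es. q)"
  have listP: "(\<forall>n S. continuous_on S (P n)) \<and> (\<forall>n s. 0 \<le> P n s) \<and> 0 \<le> Q
     \<and> (\<forall>\<rho>\<in>{0..a}. (\<forall>n. integral {\<rho>..a} (P n) \<in> {0..Q}) \<and> (\<lambda>n. integral {\<rho>..a} (P n)) \<longlonglongrightarrow> \<Lambda> \<rho>)"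
    unfolding P_def[abs_def] \<Lambda>_def[abs_def] Q_def using es
  proof (induction es)
    case (Cons e es)
    obtain r q where e: "e = (r, q)" by fastforce
    have rq: "0 \<le> r" "r + 1 \<le> a" "0 \<le> q" using Cons.prems[of r q] e by auto
    have "0 \<le> r \<and> r + 1 \<le> a \<and> 0 \<le> q" if "(r, q) \<in> set es" for r q using Cons.prems[of r q] that by auto
    note IH0 = Cons.IH[OF this]
    define P' where "P' n s = (\<Sum>(r, q)\<leftarrow>es. q * p n r s)" for n s
    have IH: "continuous_on S (P' n)" "0 \<le> P' n s" "0 \<le> (\<Sum>(r, q)\<leftarrow>es. q)"
      "\<rho> \<in> {0..a} \<Longrightarrow> integral {\<rho>..a} (P' n) \<in> {0..\<Sum>(r, q)\<leftarrow>es. q}"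
      "\<rho> \<in> {0..a} \<Longrightarrow> (\<lambda>n. integral {\<rho>..a} (P' n)) \<longlonglongrightarrow> (\<Sum>(r, q)\<leftarrow>es. if \<rho> \<le> r then q else 0)" for \<rho> n s S
      using IH0 unfolding P'_def[abs_def] by blast+
    have I: "integral {\<rho>..a} (\<lambda>s. q * p n r s + P' n s) = q * integral {\<rho>..a} (p n r) + integral {\<rho>..a} (P' n)" for n \<rho>
      by (subst integral_add) (auto intro!: integrable_continuous_real continuous_intros pc IH(1))
    have E: "(\<lambda>s. \<Sum>(r, q)\<leftarrow>e # es. q * p n r s) = (\<lambda>s. q * p n r s + P' n s)" for n
      by (simp add: e P'_def)
    have E': "(\<Sum>(r, q)\<leftarrow>e # es. q * p n r s) = q * p n r s + P' n s" for n s
      by (simp add: e P'_def)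
    show ?case unfolding E' I
    proof (intro conjI ballI allI)
      fix \<rho> n assume \<rho>: "\<rho> \<in> {0..a}"
      have "q * integral {\<rho>..a} (p n r) \<le> q * 1" "0 \<le> q * integral {\<rho>..a} (p n r)"
        using mult_left_mono[OF pb(2)[of r \<rho> n] rq(3)] mult_nonneg_nonneg[OF rq(3) pb(1)[of r \<rho> n]] rq \<rho> by simp_all
      then show "q * integral {\<rho>..a} (p n r) + integral {\<rho>..a} (P' n) \<in> {0..\<Sum>(r, q)\<leftarrow>e # es. q}"
        using IH(4)[of \<rho> n] \<rho> by (auto simp: e)
    next
      fix \<rho> assume \<rho>: "\<rho> \<in> {0..a}"
      have "(\<lambda>n. q * integral {\<rho>..a} (p n r) + integral {\<rho>..a} (P' n)) \<longlonglongrightarrow> q * (if \<rho> \<le> r then 1 else 0) + (\<Sum>(r, q)\<leftarrow>es. if \<rho> \<le> r then q else 0)"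
        using \<rho> rq by (intro tendsto_intros plim IH(5)) auto
      then show "(\<lambda>n. q * integral {\<rho>..a} (p n r) + integral {\<rho>..a} (P' n)) \<longlonglongrightarrow> (\<Sum>(r, q)\<leftarrow>e # es. if \<rho> \<le> r then q else 0)"
        by (cases "\<rho> \<le> r") (simp_all add: e)
    qed (use rq IH p0 in \<open>auto simp: e intro!: continuous_intros pc\<close>)
  qed simp
  have Pc: "continuous_on S (P n)" and P0: "0 \<le> P n s" and Q0: "0 \<le> Q"
    and Pb: "\<rho> \<in> {0..a} \<Longrightarrow> integral {\<rho>..a} (P n) \<in> {0..Q}"
    and Plim: "\<rho> \<in> {0..a} \<Longrightarrow> (\<lambda>n. integral {\<rho>..a} (P n)) \<longlonglongrightarrow> \<Lambda> \<rho>" for n \<rho> s S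
    using listP by auto
  have Pint: "P n integrable_on {c..d}" for n c d by (intro integrable_continuous_real Pc)
  have \<psi>v: "(\<lambda>s. \<psi> (v s)) integrable_on {c..d}" if "0 \<le> c" "d \<le> a" for c d
    by (rule integrable_on_subinterval[OF int[folded \<psi>_def]]) (use that in auto)
  define b where "b = 2 * B\<^sup>2 + 4 * \<bar>\<theta>\<bar> * B"
  have B0: "0 \<le> B" using B[of 0] a by auto
  have b0: "0 \<le> b" using B0 by (simp add: b_def)
  have Ib: "\<bar>integral {\<rho>..a} w\<bar> \<le> c * a" if "w integrable_on {\<rho>..a}" "\<And>s. s \<in> {\<rho>..a} \<Longrightarrow> \<bar>w s\<bar> \<le> c" "\<rho> \<in> {0..a}" "0 \<le> c" for w c \<rho>
  proof -
    have "norm (integral {\<rho>..a} w) \<le> integral {\<rho>..a} (\<lambda>_. c)"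
      by (rule integral_norm_bound_integral) (use that in auto)
    also have "\<dots> = (a - \<rho>) * c" using that by simp
    also have "\<dots> \<le> a * c" using that(3,4) by (intro mult_right_mono) auto
    finally show ?thesis by (simp add: mult.commute)
  qed
  \<comment> \<open>Two Picard steps instead of solving the mollified equation. A
    \<open>potential\<close> needs a continuous \<open>g\<close>, which \<psi>(v) spoils because
    \<open>v\<close> jumps; \<open>v1\<close> is continuous, so \<open>g = P - \<psi>(v1)\<close> is
    admissible, and \<open>v2\<close> is its potential. Both \<open>v1\<close> and \<open>v2\<close>
    converge boundedly to \<open>v\<close>.\<close>
  define v1 where "v1 n \<rho> = integral {\<rho>..a} (P n) - integral {\<rho>..a} (\<lambda>s. \<psi> (v s))" for n \<rho>
  define B1 where "B1 = Q + b * a"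
  have B10: "0 \<le> B1" using Q0 b0 a by (simp add: B1_def)
  have v1b: "\<bar>v1 n \<rho>\<bar> \<le> B1" if \<rho>: "\<rho> \<in> {0..a}" for n \<rho>
  proof -
    have "\<bar>integral {\<rho>..a} (\<lambda>s. \<psi> (v s))\<bar> \<le> b * a"
    proof (rule Ib[OF \<psi>v _ \<rho> b0])
      fix s assume "s \<in> {\<rho>..a}"
      then show "\<bar>\<psi> (v s)\<bar> \<le> b" unfolding b_def using \<rho> by (intro \<psi>b B) auto
    qed (use \<rho> in auto)
    then show ?thesis using Pb[OF \<rho>, of n] by (auto simp: v1_def B1_def)
  qed
  have v1c: "continuous_on {0..a} (v1 n)" for n
    unfolding v1_def[abs_def]
    by (intro continuous_intros indefinite_integral_continuous_1' Pint \<psi>v) auto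
  have v1l: "(\<lambda>n. v1 n \<rho>) \<longlonglongrightarrow> v \<rho>" if \<rho>: "\<rho> \<in> {0..a}" for \<rho>
    using tendsto_diff[OF Plim[OF \<rho>] tendsto_const, of "integral {\<rho>..a} (\<lambda>s. \<psi> (v s))"] v[OF \<rho>]
    by (simp add: v1_def \<psi>_def \<Lambda>_def)
  define b1 where "b1 = 2 * B1\<^sup>2 + 4 * \<bar>\<theta>\<bar> * B1"
  have b10: "0 \<le> b1" using B10 by (simp add: b1_def)
  define g where "g n s = P n s - \<psi> (v1 n s)" for n s
  have \<psi>v1c: "continuous_on {0..a} (\<lambda>s. \<psi> (v1 n s))" for n
    by (rule continuous_on_compose2[OF \<psi>c[of UNIV] v1c]) auto
  have gc: "continuous_on {0..a} (g n)" for n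
    unfolding g_def[abs_def] by (intro continuous_on_diff Pc \<psi>v1c)
  define v2 where "v2 n = potential.v a (g n)" for n
  have pot: "potential a (g n)" for n by unfold_locales (use a gc in auto)
  have \<psi>v1i: "(\<lambda>s. \<psi> (v1 n s)) integrable_on {\<rho>..a}" if "\<rho> \<in> {0..a}" for n \<rho>
    by (intro integrable_continuous_real continuous_on_subset[OF \<psi>v1c]) (use that in auto)
  have v2_eq: "v2 n \<rho> = integral {\<rho>..a} (P n) - integral {\<rho>..a} (\<lambda>s. \<psi> (v1 n s))" if \<rho>: "\<rho> \<in> {0..a}" for n \<rho>
    unfolding v2_def potential.v_def[OF pot] g_def by (rule integral_diff[OF Pint \<psi>v1i[OF \<rho>]])
  define B2 where "B2 = Q + b1 * a"
  have B20: "0 \<le> B2" using Q0 b10 a by (simp add: B2_def)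
  have v2b: "\<bar>v2 n \<rho>\<bar> \<le> B2" if \<rho>: "\<rho> \<in> {0..a}" for n \<rho>
  proof -
    have "\<bar>integral {\<rho>..a} (\<lambda>s. \<psi> (v1 n s))\<bar> \<le> b1 * a"
    proof (rule Ib[OF \<psi>v1i[OF \<rho>] _ \<rho> b10])
      fix s assume "s \<in> {\<rho>..a}"
      then show "\<bar>\<psi> (v1 n s)\<bar> \<le> b1" unfolding b1_def using \<rho> by (intro \<psi>b v1b) auto
    qed
    then show ?thesis using Pb[OF \<rho>, of n] by (auto simp: v2_eq[OF \<rho>] B2_def)
  qed
  have \<psi>lim: "(\<lambda>n. \<psi> (w n)) \<longlonglongrightarrow> \<psi> u" if "w \<longlonglongrightarrow> u" for w u
    unfolding \<psi>_def by (intro tendsto_intros that)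
  have v2l: "(\<lambda>n. v2 n \<rho>) \<longlonglongrightarrow> v \<rho>" if \<rho>: "\<rho> \<in> {0..a}" for \<rho>
  proof -
    have "(\<lambda>n. integral {\<rho>..a} (\<lambda>s. \<psi> (v1 n s))) \<longlonglongrightarrow> integral {\<rho>..a} (\<lambda>s. \<psi> (v s))"
    proof (rule dominated_convergence(2)[where h="\<lambda>_. b1"])
      show "norm (\<psi> (v1 n s)) \<le> b1" if "s \<in> {\<rho>..a}" for n s
        unfolding b1_def real_norm_def using \<rho> that by (intro \<psi>b v1b) auto
      show "(\<lambda>n. \<psi> (v1 n s)) \<longlonglongrightarrow> \<psi> (v s)" if "s \<in> {\<rho>..a}" for s
        using \<rho> that by (intro \<psi>lim v1l) auto
    qed (use \<psi>v1i[OF \<rho>] in auto)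
    from tendsto_diff[OF Plim[OF \<rho>] this] show ?thesis
      using v[OF \<rho>] by (simp add: v2_eq[OF \<rho>] \<psi>_def \<Lambda>_def)
  qed
  have v2c: "continuous_on {0..a} (v2 n)" for n unfolding v2_def by (rule potential.v_cont[OF pot])
  have hl: "(\<lambda>n. potential.h a (g n) y) \<longlonglongrightarrow> 2 * integral {y..a} v" if y: "y \<in> {0..a}" for y
    unfolding potential.h_def[OF pot] v2_def[symmetric]
  proof (intro tendsto_mult_left dominated_convergence(2)[where h="\<lambda>_. B2"])
    show "v2 n integrable_on {y..a}" for n
      by (intro integrable_continuous_real continuous_on_subset[OF v2c]) (use y in auto)
    show "norm (v2 n s) \<le> B2" if "s \<in> {y..a}" for n s using v2b[of s n] y that by auto
    show "(\<lambda>n. v2 n s) \<longlonglongrightarrow> v s" if "s \<in> {y..a}" for s using v2l[of s] y that by auto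
  qed auto
  have hb: "\<bar>potential.h a (g n) y\<bar> \<le> 2 * (B2 * a)" if y: "y \<in> {0..a}" for n y
  proof -
    have "\<bar>integral {y..a} (v2 n)\<bar> \<le> B2 * a"
      by (rule Ib[OF _ _ y B20]) (use y v2b in \<open>auto intro!: integrable_continuous_real continuous_on_subset[OF v2c]\<close>)
    then show ?thesis unfolding potential.h_def[OF pot] v2_def[symmetric] by (simp add: abs_mult)
  qed
  define b2 where "b2 = 2 * B2\<^sup>2 + 4 * \<bar>\<theta>\<bar> * B2"
  have b20: "0 \<le> b2" using B20 by (simp add: b2_def)
  have f_eq: "potential.f a \<theta> (g n) s = (\<psi> (v2 n s) - \<psi> (v1 n s)) + P n s" for n s
    unfolding potential.f_def[OF pot] v2_def[symmetric] g_def \<psi>_def by simp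
  \<comment> \<open>The mollified masses grow without bound as \<open>n\<close> increases, but they
    are non-negative; so \<open>f\<close> is bounded below uniformly in \<open>n\<close>, and that
    is what domination needs.\<close>
  have fge: "- (b1 + b2) \<le> potential.f a \<theta> (g n) s" if s: "s \<in> {0..a}" for n s
  proof -
    have "\<bar>\<psi> (v2 n s)\<bar> \<le> b2" unfolding b2_def by (intro \<psi>b v2b s)
    moreover have "\<bar>\<psi> (v1 n s)\<bar> \<le> b1" unfolding b1_def by (intro \<psi>b v1b s)
    ultimately show ?thesis unfolding f_eq using P0[of n s] by linarith
  qed
  have S: "stop x t \<in> borel_measurable M" "\<And>\<omega>. \<omega> \<in> space M \<Longrightarrow> 0 \<le> stop x t \<omega>"
    using stop_meas[OF x] stop_range(1)[OF x t0] by auto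
  \<comment> \<open>Seen through the occupation formula, the time integral of \<open>f\<close> is an
    integral against the local time in the level. There \<psi>(v2) - \<psi>(v1) vanishes in the
    limit, and the mollifiers pick out the values at the jump levels.\<close>
  have Jlim: "(\<lambda>n. integral {0..a} (\<lambda>r. potential.f a \<theta> (g n) r * l r)) \<longlonglongrightarrow> (\<Sum>(r, q)\<leftarrow>es. q * l r)"
    if l: "continuous_on {0..a} l" for l
  proof -
    obtain C where C: "\<And>r. r \<in> {0..a} \<Longrightarrow> \<bar>l r\<bar> \<le> C" using bounded_of_cont[OF l] by blast
    have \<psi>v2c: "continuous_on {0..a} (\<lambda>s. \<psi> (v2 n s))" for n
      by (rule continuous_on_compose2[OF \<psi>c[of UNIV] v2c]) auto
    have 1: "(\<lambda>n. integral {0..a} (\<lambda>r. (\<psi> (v2 n r) - \<psi> (v1 n r)) * l r)) \<longlonglongrightarrow> integral {0..a} (\<lambda>r. (\<psi> (v r) - \<psi> (v r)) * l r)"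
    proof (rule dominated_convergence(2)[where h="\<lambda>_. (b2 + b1) * C"])
      show "(\<lambda>r. (\<psi> (v2 n r) - \<psi> (v1 n r)) * l r) integrable_on {0..a}" for n
        by (intro integrable_continuous_real continuous_intros \<psi>v2c \<psi>v1c l)
      fix n r assume r: "r \<in> {0..a}"
      have "\<bar>\<psi> (v2 n r)\<bar> \<le> b2" unfolding b2_def by (intro \<psi>b v2b r)
      moreover have "\<bar>\<psi> (v1 n r)\<bar> \<le> b1" unfolding b1_def by (intro \<psi>b v1b r)
      ultimately have "\<bar>\<psi> (v2 n r) - \<psi> (v1 n r)\<bar> \<le> b2 + b1" by linarith
      then show "norm ((\<psi> (v2 n r) - \<psi> (v1 n r)) * l r) \<le> (b2 + b1) * C"
        unfolding real_norm_def abs_mult using C[OF r] by (intro mult_mono) auto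
    next
      fix r assume r: "r \<in> {0..a}"
      show "(\<lambda>n. (\<psi> (v2 n r) - \<psi> (v1 n r)) * l r) \<longlonglongrightarrow> (\<psi> (v r) - \<psi> (v r)) * l r"
        by (intro tendsto_intros \<psi>lim v1l v2l r)
    qed auto
    have pl: "(\<lambda>n. integral {0..a} (\<lambda>s. p n r s * l s)) \<longlonglongrightarrow> l r" if r: "0 \<le> r" "r + 1 \<le> a" for r
    proof (rule LIMSEQ_I)
      fix e :: real assume e: "0 < e"
      have "r \<in> {0..a}" using r by auto
      then obtain d where d: "0 < d" "\<And>s. s \<in> {0..a} \<Longrightarrow> \<bar>s - r\<bar> < d \<Longrightarrow> \<bar>l s - l r\<bar> < e / 2"
        using l half_gt_zero[OF e] unfolding continuous_on_iff dist_real_def by meson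
      have "eventually (\<lambda>n. k n < d / 2) sequentially" using d by (intro order_tendstoD[OF k0]) auto
      then obtain N where N: "\<And>n. N \<le> n \<Longrightarrow> k n < d / 2" by (auto simp: eventually_sequentially)
      show "\<exists>no. \<forall>n\<ge>no. norm (integral {0..a} (\<lambda>s. p n r s * l s) - l r) < e"
      proof (intro exI[of _ N] allI impI)
        fix n assume n: "N \<le> n"
        have c: "r + k n \<in> {0..a}" using r k[of n] by auto
        have mass: "tent_mass a (k n) (r + k n) = k n" using r k[of n] by (intro tent_mass_interior) auto
        have "\<bar>integral {0..a} (\<lambda>s. tent (k n) (r + k n) s * l s) - l r * tent_mass a (k n) (r + k n)\<bar> \<le> (e / 2) * tent_mass a (k n) (r + k n)"
        proof (rule tent_average[OF k(1) l c])
          fix s assume "s \<in> {0..a}" "\<bar>r + k n - s\<bar> < k n"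
          then show "\<bar>l s - l r\<bar> \<le> e / 2" using d(2)[of s] N[OF n] by (auto simp: abs_if split: if_splits)
        qed
        from abs_divide_diff_le[OF k(1)[of n] this[unfolded mass]]
        have "\<bar>integral {0..a} (\<lambda>s. p n r s * l s) - l r\<bar> \<le> e / 2"
          by (simp add: p_def)
        then show "norm (integral {0..a} (\<lambda>s. p n r s * l s) - l r) < e" using e by simp
      qed
    qed
    have Pl: "(\<lambda>n. integral {0..a} (\<lambda>s. P n s * l s)) \<longlonglongrightarrow> (\<Sum>(r, q)\<leftarrow>es. q * l r) \<and> (\<forall>n. continuous_on {0..a} (P n))"
      unfolding P_def[abs_def] using es
    proof (induction es)
      case (Cons e es)
      obtain r q where e: "e = (r, q)" by fastforce
      have rq: "0 \<le> r" "r + 1 \<le> a" "0 \<le> q" using Cons.prems[of r q] e by auto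
    have "0 \<le> r \<and> r + 1 \<le> a \<and> 0 \<le> q" if "(r, q) \<in> set es" for r q using Cons.prems[of r q] that by auto
    note IH0 = Cons.IH[OF this]
      define P' where "P' n s = (\<Sum>(r, q)\<leftarrow>es. q * p n r s)" for n s
      have IH: "(\<lambda>n. integral {0..a} (\<lambda>s. P' n s * l s)) \<longlonglongrightarrow> (\<Sum>(r, q)\<leftarrow>es. q * l r)" "continuous_on {0..a} (P' n)" for n
        using IH0 unfolding P'_def[abs_def] by blast+
      have E: "(\<lambda>s. \<Sum>(r, q)\<leftarrow>e # es. q * p n r s) = (\<lambda>s. q * p n r s + P' n s)" for n
        by (simp add: e P'_def)
      have I: "integral {0..a} (\<lambda>s. (q * p n r s + P' n s) * l s) = q * integral {0..a} (\<lambda>s. p n r s * l s) + integral {0..a} (\<lambda>s. P' n s * l s)" for n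
        unfolding distrib_right mult.assoc
        by (subst integral_add) (auto intro!: integrable_continuous_real continuous_intros pc IH(2) l)
      have E': "(\<Sum>(r, q)\<leftarrow>e # es. q * p n r s) = q * p n r s + P' n s" for n s
        by (simp add: e P'_def)
      show ?case unfolding E' I
        using rq by (auto simp: e intro!: tendsto_intros continuous_intros pl IH pc)
    qed simp
    have "integral {0..a} (\<lambda>r. potential.f a \<theta> (g n) r * l r)
        = integral {0..a} (\<lambda>r. (\<psi> (v2 n r) - \<psi> (v1 n r)) * l r) + integral {0..a} (\<lambda>s. P n s * l s)" for n
      unfolding f_eq distrib_right
      by (intro integral_add integrable_continuous_real continuous_intros \<psi>v2c \<psi>v1c l Pc)
    then show ?thesis using tendsto_add[OF 1 conjunct1[OF Pl]] by simp
  qed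
  define U where "U n \<omega> = exp (potential.h a (g n) (Y (stop x t \<omega>) \<omega>) - potential.h a (g n) 0
     + potential.v a (g n) 0 * L 0 (stop x t \<omega>) \<omega> - integral {0..stop x t \<omega>} (\<lambda>s. potential.f a \<theta> (g n) (Y s \<omega>)))" for n \<omega>
  have U1: "(\<integral>\<^sup>+ \<omega>. ennreal (U n \<omega>) \<partial>M) = 1" for n
    unfolding U_def by (rule stopped_exponential[OF x t gc])
  have Um: "U n \<in> borel_measurable M" for n
  proof -
    have [measurable]: "(\<lambda>\<omega>. potential.h a (g n) (Y (stop x t \<omega>) \<omega>)) \<in> borel_measurable M"
      by (rule Y_stop_meas[OF potential.h_cont[OF pot] S])
    have [measurable]: "(\<lambda>\<omega>. L 0 (stop x t \<omega>) \<omega>) \<in> borel_measurable M" using a by (intro L_random_time_meas S) auto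
    have [measurable]: "(\<lambda>\<omega>. integral {0..stop x t \<omega>} (\<lambda>s. potential.f a \<theta> (g n) (Y s \<omega>))) \<in> borel_measurable M"
      by (rule path_integral_meas[OF potential.f_cont[OF pot] S])
    show ?thesis unfolding U_def[abs_def] by measurable
  qed
  define W where "W \<omega> = exp (2 * integral {Y (stop x t \<omega>) \<omega>..a} v - 2 * integral {0..a} v
     + v 0 * L 0 (stop x t \<omega>) \<omega> - (\<Sum>(r, q)\<leftarrow>es. q * L r (stop x t \<omega>) \<omega>))" for \<omega>
  have lim: "AE \<omega> in M. (\<lambda>n. U n \<omega>) \<longlonglongrightarrow> W \<omega>"
    using AE_local_time AE_space
  proof eventually_elim
    case (elim \<omega>)
    then obtain l where "is_local_time a (\<lambda>s. Y s \<omega>) l" by blast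
    then have l: "is_local_time a (\<lambda>s. Y s \<omega>) (local_time a (\<lambda>s. Y s \<omega>))" by (rule is_local_time_local_time)
    define s where "s = stop x t \<omega>"
    have s: "0 \<le> s" unfolding s_def by (rule S(2)[OF elim(2)])
    have y: "Y s \<omega> \<in> {0..a}" by (rule Y_range[OF elim(2) s])
    have J: "integral {0..s} (\<lambda>u. potential.f a \<theta> (g n) (Y u \<omega>)) = integral {0..a} (\<lambda>r. potential.f a \<theta> (g n) r * L r s \<omega>)" for n
      by (rule occupation_integral[OF a l s Y_cont[OF elim(2)] Y_range[OF elim(2)] potential.f_cont[OF pot]])
    have 0: "0 \<in> {0..a}" using a by auto
    have "(\<lambda>n. potential.h a (g n) (Y s \<omega>) - potential.h a (g n) 0 + potential.v a (g n) 0 * L 0 s \<omega> - integral {0..s} (\<lambda>u. potential.f a \<theta> (g n) (Y u \<omega>)))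
      \<longlonglongrightarrow> 2 * integral {Y s \<omega>..a} v - 2 * integral {0..a} v + v 0 * L 0 s \<omega> - (\<Sum>(r, q)\<leftarrow>es. q * L r s \<omega>)"
      unfolding J by (intro tendsto_intros hl y 0 v2l[OF 0, unfolded v2_def] Jlim local_timeD(4)[OF l s])
    from tendsto_exp[OF this] show ?case unfolding U_def W_def s_def .
  qed
  \<comment> \<open>Two \<open>h\<close> terms of at most \<open>2 * B2 * a\<close> each,
    \<open>v 0 * L 0\<close> with the local time at most \<open>x\<close> before stopping, and the
    lower bound of \<open>f\<close> over a time of at most \<open>t\<close>.\<close>
  define D where "D = exp (4 * (B2 * a) + B2 * x + (b1 + b2) * t)"
  have dom: "U n \<omega> \<le> D" if w: "\<omega> \<in> space M" for n \<omega>
  proof -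
    define s where "s = stop x t \<omega>"
    have s: "s \<in> {0..t}" unfolding s_def by (rule stop_range(1)[OF x t0])
    have 0: "0 \<in> {0..a}" using a by auto
    have y: "Y s \<omega> \<in> {0..a}" using s by (intro Y_range[OF w]) auto
    have 1: "potential.v a (g n) 0 * L 0 s \<omega> \<le> B2 * x"
    proof -
      have L: "0 \<le> L 0 s \<omega>" "L 0 s \<omega> \<le> x"
        using local_time_regular(4)[OF a 0] s L_stop_le[OF x t0, of \<omega>] by (auto simp: s_def)
      have "potential.v a (g n) 0 \<le> B2" using v2b[OF 0, of n] by (simp add: v2_def)
      then show ?thesis using L B20 by (intro mult_mono) auto
    qed
    have 2: "- ((b1 + b2) * t) \<le> integral {0..s} (\<lambda>u. potential.f a \<theta> (g n) (Y u \<omega>))"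
    proof -
      have yr: "(\<lambda>u. Y u \<omega>) ` {0..s} \<subseteq> {0..a}" by (intro image_subsetI Y_range[OF w]) simp
      have "- ((b1 + b2) * t) \<le> - ((b1 + b2) * s)" using s b10 b20 by (auto intro!: mult_left_mono)
      also have "\<dots> = integral {0..s} (\<lambda>_. - (b1 + b2))" using s by (simp add: algebra_simps)
      also have "\<dots> \<le> integral {0..s} (\<lambda>u. potential.f a \<theta> (g n) (Y u \<omega>))"
      proof (rule integral_le)
        show "(\<lambda>u. potential.f a \<theta> (g n) (Y u \<omega>)) integrable_on {0..s}"
          by (intro integrable_continuous_real continuous_on_compose2[OF potential.f_cont[OF pot] continuous_on_subset[OF Y_cont[OF w]] yr]) auto
        show "- (b1 + b2) \<le> potential.f a \<theta> (g n) (Y u \<omega>)" if "u \<in> {0..s}" for u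
          by (rule fge[OF subsetD[OF yr imageI[OF that]]])
      qed auto
      finally show ?thesis .
    qed
    show ?thesis unfolding U_def D_def s_def[symmetric]
      using hb[OF y, of n] hb[OF 0, of n] 1 2 by simp
  qed
  have Wm: "W \<in> borel_measurable M"
  proof -
    have vint: "v integrable_on {y..a}" if "y \<in> {0..a}" for y
    proof (rule dominated_convergence(1)[where h="\<lambda>_. B2" and f=v2])
      show "v2 n integrable_on {y..a}" for n
        by (intro integrable_continuous_real continuous_on_subset[OF v2c]) (use that in auto)
      show "norm (v2 n s) \<le> B2" if "s \<in> {y..a}" for n s using v2b[of s n] \<open>y \<in> {0..a}\<close> that by auto
      show "(\<lambda>n. v2 n s) \<longlonglongrightarrow> v s" if "s \<in> {y..a}" for s using v2l[of s] \<open>y \<in> {0..a}\<close> that by auto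
    qed auto
    have "continuous_on {0..a} (\<lambda>y. 2 * integral {y..a} v)"
      using a by (intro continuous_intros indefinite_integral_continuous_1' vint) auto
    then have [measurable]: "(\<lambda>\<omega>. 2 * integral {Y (stop x t \<omega>) \<omega>..a} v) \<in> borel_measurable M" by (rule Y_stop_meas[OF _ S])
    have [measurable]: "(\<lambda>\<omega>. L 0 (stop x t \<omega>) \<omega>) \<in> borel_measurable M" using a by (intro L_random_time_meas S) auto
    have [measurable]: "(\<lambda>\<omega>. \<Sum>(r, q)\<leftarrow>es. q * L r (stop x t \<omega>) \<omega>) \<in> borel_measurable M"
      using es
    proof (induction es)
      case (Cons e es)
      obtain r q where e: "e = (r, q)" by fastforce
      have [measurable]: "(\<lambda>\<omega>. \<Sum>(r, q)\<leftarrow>es. q * L r (stop x t \<omega>) \<omega>) \<in> borel_measurable M" using Cons by auto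
      have [measurable]: "(\<lambda>\<omega>. L r (stop x t \<omega>) \<omega>) \<in> borel_measurable M"
        using Cons.prems[of r q] e by (intro L_random_time_meas S) auto
      show ?case by (simp add: e)
    qed simp
    show ?thesis unfolding W_def[abs_def] by measurable
  qed
  have "(\<lambda>n. \<integral>\<^sup>+ \<omega>. ennreal (U n \<omega>) \<partial>M) \<longlonglongrightarrow> (\<integral>\<^sup>+ \<omega>. ennreal (W \<omega>) \<partial>M)"
  proof (rule nn_integral_dominated_convergence[where w="\<lambda>_. ennreal D"])
    show "AE \<omega> in M. (\<lambda>n. ennreal (U n \<omega>)) \<longlonglongrightarrow> ennreal (W \<omega>)"
      using lim by eventually_elim (rule tendsto_ennrealI)
    show "AE \<omega> in M. ennreal (U n \<omega>) \<le> ennreal D" for n by (intro AE_I2 ennreal_leI dom)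
  qed (use Um Wm in \<open>auto simp: emeasure_space_1\<close>)
  then show "(\<integral>\<^sup>+ \<omega>. ennreal (exp (2 * integral {Y (stop x t \<omega>) \<omega>..a} v - 2 * integral {0..a} v
     + v 0 * L 0 (stop x t \<omega>) \<omega> - (\<Sum>(r, q)\<leftarrow>es. q * L r (stop x t \<omega>) \<omega>))) \<partial>M) = 1"
    unfolding U1 W_def by (simp add: LIMSEQ_const_iff)
  show "(\<lambda>\<omega>. exp (2 * integral {Y (stop x t \<omega>) \<omega>..a} v - 2 * integral {0..a} v
     + v 0 * L 0 (stop x t \<omega>) \<omega> - (\<Sum>(r, q)\<leftarrow>es. q * L r (stop x t \<omega>) \<omega>))) \<in> borel_measurable M"
    using Wm unfolding W_def[abs_def] .
qed

end

text \<open>As a function of \<open>\<rho>\<close> it solves the equation of the branching mechanism backwards in time and jumps by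
  \<open>q\<close> at each \<open>(r, q)\<close> of a list sorted by \<open>r\<close>.\<close>

fun level_exponent :: "real \<Rightarrow> (real \<times> real) list \<Rightarrow> real \<Rightarrow> real" where
  "level_exponent \<theta> [] \<rho> = 0"
| "level_exponent \<theta> ((r, q) # es) \<rho> =
     (if \<rho> \<le> r then feller_flow \<theta> (q + level_exponent \<theta> es r) (r - \<rho>) else level_exponent \<theta> es \<rho>)"

lemma level_exponent_nonneg:
  "(\<And>r q. (r, q) \<in> set es \<Longrightarrow> 0 \<le> q) \<Longrightarrow> 0 \<le> level_exponent \<theta> es \<rho>"
proof (induction es arbitrary: \<rho>)
  case (Cons e es)
  obtain r q where e: "e = (r, q)" by fastforce
  have q: "0 \<le> q" using Cons.prems[of r q] e by simp
  have IH: "0 \<le> level_exponent \<theta> es \<rho>" for \<rho>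
    by (rule Cons.IH) (use Cons.prems in \<open>meson list.set_intros(2)\<close>)
  show ?case using q IH by (auto simp: e intro!: feller_flow_nonneg)
qed simp

lemma feller_flow_le:
  assumes "0 \<le> q" "0 \<le> s" "s \<le> a" shows "feller_flow \<theta> q s \<le> q * exp (4 * \<bar>\<theta>\<bar> * a)"
proof -
  have d: "1 \<le> 1 + 2 * q * feller_clock \<theta> s"
    using assms feller_clock_nonneg[of s \<theta>] by simp
  have "- (4 * \<theta> * s) \<le> 4 * \<bar>\<theta>\<bar> * s" using mult_right_mono[OF abs_ge_minus_self[of \<theta>] assms(2)] by (simp add: mult.commute)
  also have "\<dots> \<le> 4 * \<bar>\<theta>\<bar> * a" using assms by (intro mult_left_mono) auto
  finally have "exp (- (4 * \<theta> * s)) \<le> exp (4 * \<bar>\<theta>\<bar> * a)" by simp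
  then have "q * exp (- (4 * \<theta> * s)) \<le> q * exp (4 * \<bar>\<theta>\<bar> * a)" using assms by (intro mult_left_mono) auto
  moreover have "feller_flow \<theta> q s \<le> q * exp (- (4 * \<theta> * s))"
  proof -
    have "q * exp (- (4 * \<theta> * s)) / (1 + 2 * q * feller_clock \<theta> s) \<le> q * exp (- (4 * \<theta> * s)) / 1"
      using d assms by (intro divide_left_mono) auto
    then show ?thesis by (simp add: feller_flow_def)
  qed
  ultimately show ?thesis by simp
qed

lemma level_exponent_bounded:
  "(\<And>r q. (r, q) \<in> set es \<Longrightarrow> 0 \<le> q \<and> r \<le> a) \<Longrightarrow> \<exists>B. \<forall>\<rho>\<in>{0..a}. level_exponent \<theta> es \<rho> \<le> B"
proof (induction es)
  case (Cons e es)
  obtain r q where e: "e = (r, q)" by fastforce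
  have q: "0 \<le> q" "r \<le> a" using Cons.prems[of r q] e by auto
  have pr: "0 \<le> q \<and> r \<le> a" if "(r, q) \<in> set es" for r q using Cons.prems[of r q] that by auto
  obtain B where B: "\<And>\<rho>. \<rho> \<in> {0..a} \<Longrightarrow> level_exponent \<theta> es \<rho> \<le> B" using Cons.IH[OF pr] by blast
  have nn: "0 \<le> level_exponent \<theta> es r" by (rule level_exponent_nonneg) (use pr in blast)
  define B' where "B' = max B ((q + level_exponent \<theta> es r) * exp (4 * \<bar>\<theta>\<bar> * a))"
  have "level_exponent \<theta> (e # es) \<rho> \<le> B'" if \<rho>: "\<rho> \<in> {0..a}" for \<rho>
  proof (cases "\<rho> \<le> r")
    case True
    have "feller_flow \<theta> (q + level_exponent \<theta> es r) (r - \<rho>) \<le> (q + level_exponent \<theta> es r) * exp (4 * \<bar>\<theta>\<bar> * a)"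
      by (rule feller_flow_le) (use True q nn \<rho> in auto)
    then show ?thesis using True by (simp add: e B'_def)
  qed (use B[OF \<rho>] in \<open>simp add: e B'_def\<close>)
  then show ?case by blast
qed auto

lemma feller_flow_cont:
  assumes q: "0 \<le> q" shows "continuous_on {..r0} (\<lambda>s. feller_flow \<theta> q (r0 - s))"
proof -
  have "continuous_on {0..} (feller_flow \<theta> q)"
    unfolding continuous_on_eq_continuous_within using feller_flow_deriv[OF q] DERIV_continuous by fastforce
  then show ?thesis by (rule continuous_on_compose2) (auto intro!: continuous_intros)
qed

text \<open>Supplies the hypotheses of \<open>jump_exponential\<close>. Below the first level the
  integrated flow applies; since the list is sorted, the sum over the remaining jumps is the same at
  \<rho> as at \<open>r0\<close>.\<close>

lemma level_exponent_integral:
  assumes "sorted (map fst es)" "\<And>r q. (r, q) \<in> set es \<Longrightarrow> 0 \<le> r \<and> r \<le> a \<and> 0 \<le> q"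
  shows "(\<lambda>s. branching \<theta> (level_exponent \<theta> es s)) integrable_on {0..a} \<and>
    (\<forall>\<rho>\<in>{0..a}. level_exponent \<theta> es \<rho> = (\<Sum>(r, q)\<leftarrow>es. if \<rho> \<le> r then q else 0)
       - integral {\<rho>..a} (\<lambda>s. branching \<theta> (level_exponent \<theta> es s)))"
  using assms
proof (induction es)
  case (Cons e es)
  obtain r0 q where e: "e = (r0, q)" by fastforce
  have q: "0 \<le> q" "0 \<le> r0" "r0 \<le> a" using Cons.prems(2)[of r0 q] e by auto
  have pr: "0 \<le> r \<and> r \<le> a \<and> 0 \<le> q" if "(r, q) \<in> set es" for r q using Cons.prems(2)[of r q] that by auto
  have srt: "r0 \<le> r" if "(r, q) \<in> set es" for r q using Cons.prems(1) that e by auto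
  define W where "W s = branching \<theta> (level_exponent \<theta> es s)" for s
  define W' where "W' s = branching \<theta> (level_exponent \<theta> (e # es) s)" for s
  have IH: "W integrable_on {0..a}"
    "\<rho> \<in> {0..a} \<Longrightarrow> level_exponent \<theta> es \<rho> = (\<Sum>(r, q)\<leftarrow>es. if \<rho> \<le> r then q else 0) - integral {\<rho>..a} W" for \<rho>
    using Cons.IH[OF _ pr] Cons.prems(1) e unfolding W_def[abs_def] by auto
  define Q where "Q = q + level_exponent \<theta> es r0"
  have Q: "0 \<le> Q" unfolding Q_def using q by (intro add_nonneg_nonneg level_exponent_nonneg) (use pr in auto)
  have low: "W' s = branching \<theta> (feller_flow \<theta> Q (r0 - s))" if "s \<le> r0" for s
    using that by (simp add: W'_def e Q_def)
  have cl: "continuous_on {c..r0} (\<lambda>s. branching \<theta> (feller_flow \<theta> Q (r0 - s)))" for c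
    by (intro continuous_intros continuous_on_subset[OF feller_flow_cont[OF Q]]) auto
  have il: "W' integrable_on {c..r0}" for c
    using integrable_continuous_real[OF cl[of c]] by (rule integrable_eq) (simp add: low)
  \<comment> \<open>At \<open>r0\<close> itself the two exponents differ by the jump
    \<open>q\<close>; a single point does not change the integrals.\<close>
  have hi: "W' s = W s" if "s \<in> {r0..a} - {r0}" for s using that by (auto simp: W_def W'_def e)
  have ih: "W' integrable_on {r0..a}"
  proof (rule integrable_spike[where S="{r0}" and f=W])
    show "W integrable_on {r0..a}" by (rule integrable_on_subinterval[OF IH(1)]) (use q in auto)
  qed (use hi in auto)
  have int: "W' integrable_on {0..a}" by (rule Henstock_Kurzweil_Integration.integrable_combine[OF q(2,3) il ih])
  have eqhi: "integral {r0..a} W' = integral {r0..a} W"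
    by (rule integral_spike[where S="{r0}"]) (use hi in auto)
  have main: "level_exponent \<theta> (e # es) \<rho> = (\<Sum>(r, q)\<leftarrow>e # es. if \<rho> \<le> r then q else 0) - integral {\<rho>..a} W'"
    if \<rho>: "\<rho> \<in> {0..a}" for \<rho>
  proof (cases "\<rho> \<le> r0")
    case True
    have "integral {\<rho>..r0} W' + integral {r0..a} W' = integral {\<rho>..a} W'"
      by (rule Henstock_Kurzweil_Integration.integral_combine) (use True q \<rho> in \<open>auto intro!: integrable_on_subinterval[OF int]\<close>)
    moreover have "integral {\<rho>..r0} W' = integral {\<rho>..r0} (\<lambda>s. branching \<theta> (feller_flow \<theta> Q (r0 - s)))"
      by (rule integral_cong) (simp add: low)
    moreover have "feller_flow \<theta> Q (r0 - \<rho>) = Q - integral {\<rho>..r0} (\<lambda>s. branching \<theta> (feller_flow \<theta> Q (r0 - s)))"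
      by (rule feller_flow_integral[OF Q True])
    moreover have "level_exponent \<theta> es r0 = (\<Sum>(r, q)\<leftarrow>es. if r0 \<le> r then q else 0) - integral {r0..a} W"
      using q by (intro IH(2)) auto
    moreover have "(\<Sum>(r, q)\<leftarrow>es. if r0 \<le> r then q else 0) = (\<Sum>(r, q)\<leftarrow>es. if \<rho> \<le> r then q else 0)"
      by (rule arg_cong[where f=sum_list], rule map_cong[OF refl]) (use srt True in force)
    moreover have "level_exponent \<theta> (e # es) \<rho> = feller_flow \<theta> Q (r0 - \<rho>)" using True by (simp add: e Q_def)
    ultimately show ?thesis using True by (simp add: e Q_def eqhi)
  next
    case False
    have "integral {\<rho>..a} W' = integral {\<rho>..a} W"
      by (rule integral_cong) (use False hi in auto)
    then show ?thesis using False IH(2)[OF \<rho>] by (simp add: e)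
  qed
  show ?case using int main unfolding W'_def[abs_def] by blast
qed (auto intro: integrable_0)

text \<open>The Markov property on the side of exponents: a weight \<open>q\<close> at level
  \<open>s + r\<close> acts below \<open>s\<close> like the weight
  \<open>feller_flow \<theta> q r\<close> at level \<open>s\<close>, by
  \<open>feller_flow_add\<close>. No other level may lie between.\<close>

lemma level_exponent_append:
  assumes "sorted (map fst es)" "\<And>r. r \<in> fst ` set es \<Longrightarrow> r \<le> s" "0 \<le> q" "0 \<le> r" "\<rho> \<le> s"
  shows "level_exponent \<theta> (es @ [(s + r, q)]) \<rho> = level_exponent \<theta> (es @ [(s, feller_flow \<theta> q r)]) \<rho>"
  using assms
proof (induction es arbitrary: \<rho>)
  case Nil
  have "feller_flow \<theta> (feller_flow \<theta> q r) (s - \<rho>) = feller_flow \<theta> q (r + (s - \<rho>))"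
    using Nil by (intro feller_flow_add) auto
  then show ?case using Nil by (simp add: algebra_simps)
next
  case (Cons e es)
  obtain r0 q0 where e: "e = (r0, q0)" by fastforce
  have "level_exponent \<theta> (es @ [(s + r, q)]) \<rho> = level_exponent \<theta> (es @ [(s, feller_flow \<theta> q r)]) \<rho>" if "\<rho> \<le> s" for \<rho>
    using Cons.prems that by (intro Cons.IH) auto
  moreover have "r0 \<le> s" using Cons.prems(2) e by auto
  ultimately show ?case using Cons.prems(5) by (simp add: e)
qed

context reflected_bm
begin

text \<open>Let the horizon tend to infinity in \<open>jump_exponential\<close>. At the inverse
  local time the path is at 0, so the two integrals of \<open>v\<close> cancel, and the local time
  at 0 equals \<open>x\<close>; only a constant and the wanted exponential remain.\<close>

lemma joint_laplace:
  fixes es :: "(real \<times> real) list"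
  assumes x: "0 \<le> x" and srt: "sorted (map fst es)"
    and es: "\<And>r q. (r, q) \<in> set es \<Longrightarrow> 0 \<le> r \<and> r + 1 \<le> a \<and> 0 \<le> q"
  shows "(\<integral>\<^sup>+ \<omega>. ennreal (exp (- (\<Sum>(r, q)\<leftarrow>es. q * local_time_at_inverse a (\<lambda>s. Y s \<omega>) x r))) \<partial>M)
    = ennreal (exp (- (x * level_exponent \<theta> es 0)))"
proof -
  define v where "v = level_exponent \<theta> es"
  have es': "0 \<le> r \<and> r \<le> a \<and> 0 \<le> q" if "(r, q) \<in> set es" for r q using es[OF that] by auto
  have v0: "0 \<le> v r" for r unfolding v_def by (rule level_exponent_nonneg) (use es in blast)
  obtain B where B: "\<And>r. r \<in> {0..a} \<Longrightarrow> v r \<le> B"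
    unfolding v_def using level_exponent_bounded[of es a \<theta>] es' by blast
  have Bv: "\<bar>v r\<bar> \<le> B" if "r \<in> {0..a}" for r using B[OF that] v0[of r] by simp
  have B0: "0 \<le> B" using Bv[of 0] a by auto
  note I = level_exponent_integral[OF srt es', of \<theta>, folded v_def]
  have vi: "(\<lambda>s. branching \<theta> (v s)) integrable_on {0..a}"
    and ve: "\<And>r. r \<in> {0..a} \<Longrightarrow> v r = (\<Sum>(r', q)\<leftarrow>es. if r \<le> r' then q else 0) - integral {r..a} (\<lambda>s. branching \<theta> (v s))"
    using I by blast+
  define T where "T \<omega> = real_of_ereal (inverse_local_time a (\<lambda>s. Y s \<omega>) x)" for \<omega>
  define W where "W n \<omega> = exp (2 * integral {Y (stop x (real (Suc n)) \<omega>) \<omega>..a} v - 2 * integral {0..a} v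
     + v 0 * L 0 (stop x (real (Suc n)) \<omega>) \<omega> - (\<Sum>(r, q)\<leftarrow>es. q * L r (stop x (real (Suc n)) \<omega>) \<omega>))" for n \<omega>
  have Wm: "W n \<in> borel_measurable M" for n unfolding W_def[abs_def] by (rule jump_exponential(1)[OF x _ es Bv vi ve]) simp_all
  have W1: "(\<integral>\<^sup>+ \<omega>. ennreal (W n \<omega>) \<partial>M) = 1" for n unfolding W_def by (rule jump_exponential(2)[OF x _ es Bv vi ve]) simp_all
  define R where "R \<omega> = exp (v 0 * x - (\<Sum>(r, q)\<leftarrow>es. q * local_time_at_inverse a (\<lambda>s. Y s \<omega>) x r))" for \<omega>
  have "(\<lambda>\<omega>. \<Sum>(r, q)\<leftarrow>es. q * local_time_at_inverse a (\<lambda>s. Y s \<omega>) x r) \<in> borel_measurable M"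
    using es'
  proof (induction es)
    case (Cons e es)
    obtain r q where e: "e = (r, q)" by fastforce
    have "0 \<le> r \<and> r \<le> a \<and> 0 \<le> q" if "(r, q) \<in> set es" for r q using Cons.prems[of r q] that by auto
    note [measurable] = Cons.IH[OF this]
    have [measurable]: "(\<lambda>\<omega>. local_time_at_inverse a (\<lambda>s. Y s \<omega>) x r) \<in> borel_measurable M"
      using Cons.prems[of r q] e by (intro local_time_at_inverse_meas x) auto
    show ?case by (simp add: e)
  qed simp
  then have Rm: "R \<in> borel_measurable M" unfolding R_def[abs_def] by measurable
  have lim: "AE \<omega> in M. (\<lambda>n. W n \<omega>) \<longlonglongrightarrow> R \<omega>"
    using AE_local_time AE_inverse_finite[OF x] AE_space
  proof eventually_elim
    case (elim \<omega>)
    \<comment> \<open>For each \<omega> the sequence becomes constant as soon as the horizon exceeds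
      the finite inverse local time.\<close>
    have "eventually (\<lambda>n. W n \<omega> = R \<omega>) sequentially"
      using stop_eventually[OF elim(2) x]
    proof eventually_elim
      case (elim n)
      have "Y (T \<omega>) \<omega> = 0" unfolding T_def by (rule Y_at_inverse) fact+
      moreover have "L 0 (T \<omega>) \<omega> = x" unfolding T_def by (rule inverse_local_time_passage(3)[OF a x]) fact
      ultimately show ?case unfolding W_def R_def elim T_def[symmetric] local_time_at_inverse_def by simp
    qed
    then show ?case by (rule tendsto_eventually)
  qed
  have Ib: "\<bar>integral {y..a} v\<bar> \<le> B * a" if y: "y \<in> {0..a}" for y
  proof (cases "v integrable_on {y..a}")
    case True
    have "norm (integral {y..a} v) \<le> integral {y..a} (\<lambda>_. B)"
      by (rule integral_norm_bound_integral) (use True Bv y in auto)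
    also have "\<dots> = (a - y) * B" using y by simp
    also have "\<dots> \<le> a * B" using y B0 by (intro mult_right_mono) auto
    finally show ?thesis by (simp add: mult.commute)
  next
    case False
    then show ?thesis using B0 a by (simp add: not_integrable_integral)
  qed
  \<comment> \<open>No longer dependent on the horizon: \<open>v\<close>, the weights and the local
    times are non-negative, so the sum is bounded below by 0, in contrast to the bound inside
    \<open>jump_exponential\<close>.\<close>
  define D where "D = exp (4 * (B * a) + v 0 * x)"
  have dom: "W n \<omega> \<le> D" if w: "\<omega> \<in> space M" for n \<omega>
  proof -
    define s where "s = stop x (real (Suc n)) \<omega>"
    have s: "s \<in> {0..real (Suc n)}" unfolding s_def by (rule stop_range(1)[OF x]) simp
    have y: "Y s \<omega> \<in> {0..a}" using s by (intro Y_range[OF w]) auto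
    have 1: "v 0 * L 0 s \<omega> \<le> v 0 * x"
      unfolding s_def using L_stop_le[OF x, of "real (Suc n)" \<omega>] v0 by (intro mult_left_mono) auto
    have "0 \<le> (\<Sum>(r, q)\<leftarrow>es. q * L r s \<omega>)"
      using es' s by (intro sum_list_nonneg) (auto intro!: mult_nonneg_nonneg local_time_regular(4)[OF a])
    then show ?thesis unfolding W_def D_def s_def[symmetric]
      using Ib[OF y] Ib[of 0] a 1 by simp
  qed
  have "(\<lambda>n. \<integral>\<^sup>+ \<omega>. ennreal (W n \<omega>) \<partial>M) \<longlonglongrightarrow> (\<integral>\<^sup>+ \<omega>. ennreal (R \<omega>) \<partial>M)"
  proof (rule nn_integral_dominated_convergence[where w="\<lambda>_. ennreal D"])
    show "AE \<omega> in M. (\<lambda>n. ennreal (W n \<omega>)) \<longlonglongrightarrow> ennreal (R \<omega>)"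
      using lim by eventually_elim (rule tendsto_ennrealI)
    show "AE \<omega> in M. ennreal (W n \<omega>) \<le> ennreal D" for n by (intro AE_I2 ennreal_leI dom)
  qed (use Wm Rm in \<open>auto simp: emeasure_space_1\<close>)
  then have R1: "(\<integral>\<^sup>+ \<omega>. ennreal (R \<omega>) \<partial>M) = 1" unfolding W1 by (simp add: LIMSEQ_const_iff)
  have "(\<integral>\<^sup>+ \<omega>. ennreal (exp (- (\<Sum>(r, q)\<leftarrow>es. q * local_time_at_inverse a (\<lambda>s. Y s \<omega>) x r))) \<partial>M)
      = (\<integral>\<^sup>+ \<omega>. ennreal (exp (- (x * v 0))) * ennreal (R \<omega>) \<partial>M)"
    unfolding R_def by (simp add: ennreal_mult[symmetric] exp_add[symmetric] mult.commute)
  also have "\<dots> = ennreal (exp (- (x * v 0)))"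
    using Rm by (subst nn_integral_cmult) (auto simp: R1)
  finally show ?thesis by (simp add: v_def)
qed

end

section \<open>Time change below a level\<close>

locale projected_path =
  fixes A b :: real and \<phi> :: "real \<Rightarrow> real" and l :: "real \<Rightarrow> real \<Rightarrow> real"
  assumes b: "0 < b" "b < A" and \<phi>_cont: "continuous_on {0..} \<phi>" and \<phi>_range: "\<And>s. 0 \<le> s \<Longrightarrow> \<phi> s \<in> {0..A}"
    and l: "is_local_time A \<phi> l"
    and unbounded: "\<And>t. 0 \<le> t \<Longrightarrow> clock_below b \<phi> t \<noteq> \<infinity>"
begin

text \<open>By the occupation formula, the time spent at levels up to \<open>b\<close>. Written
  through \<open>l\<close>, it has its continuity and monotonicity from those of the local
  times.\<close>

definition \<kappa> :: "real \<Rightarrow> real" where "\<kappa> t = integral {0..b} (\<lambda>r. l r t)"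

lemma A_pos: "0 < A" using b by simp

lemma l_cont: "0 \<le> t \<Longrightarrow> continuous_on {0..b} (\<lambda>r. l r t)"
  by (rule continuous_on_subset[OF local_timeD(4)[OF l]]) (use b in auto)

lemma \<kappa>_nn_integral:
  assumes t: "0 \<le> t"
  shows "(\<integral>\<^sup>+ s\<in>{0..t}. indicator {..b} (\<phi> s) \<partial>lborel) = ennreal (\<kappa> t)"
proof -
  have "(\<integral>\<^sup>+ s\<in>{0..t}. indicator {..b} (\<phi> s) \<partial>lborel) = (\<integral>\<^sup>+ r\<in>{0..A}. indicator {..b} r * ennreal (l r t) \<partial>lborel)"
    by (rule local_timeD(3)[OF l t]) simp
  also have "\<dots> = (\<integral>\<^sup>+ r\<in>{0..b}. ennreal (l r t) \<partial>lborel)"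
    by (rule nn_integral_cong) (use b in \<open>auto simp: indicator_def\<close>)
  also have "\<dots> = ennreal (\<kappa> t)"
    unfolding \<kappa>_def using local_timeD(2)[OF l _ t] b
    by (intro nn_integral_has_integral_lebesgue' integrable_integral integrable_continuous_real l_cont t) auto
  finally show ?thesis .
qed

lemma \<kappa>_nonneg: "0 \<le> t \<Longrightarrow> 0 \<le> \<kappa> t"
  unfolding \<kappa>_def using local_timeD(2)[OF l] b
  by (intro integral_nonneg integrable_continuous_real l_cont) auto

lemma below_measurable: "{s \<in> {0..t}. \<phi> s \<le> b} \<in> sets borel"
proof -
  have "closed ({0..t} \<inter> \<phi> -` {..b})"
    by (rule continuous_closed_preimage[OF continuous_on_subset[OF \<phi>_cont]]) auto
  then show ?thesis by (simp add: Int_def vimage_def)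
qed

lemma \<kappa>_LINT:
  assumes t: "0 \<le> t"
  shows "(LINT s:{0..t}|lborel. indicator {..b} (\<phi> s) :: real) = \<kappa> t"
proof -
  have e: "indicator {0..t} s *\<^sub>R (indicator {..b} (\<phi> s) :: real) = indicator {s \<in> {0..t}. \<phi> s \<le> b} s" for s
    by (auto simp: indicator_def)
  have "(LINT s:{0..t}|lborel. indicator {..b} (\<phi> s) :: real) = (\<integral>s. indicator {s \<in> {0..t}. \<phi> s \<le> b} s \<partial>lborel)"
    unfolding set_lebesgue_integral_def e ..
  also have "\<dots> = enn2real (\<integral>\<^sup>+ s. ennreal (indicator {s \<in> {0..t}. \<phi> s \<le> b} s) \<partial>lborel)"
    using below_measurable by (intro integral_eq_nn_integral) auto
  also have "(\<integral>\<^sup>+ s. ennreal (indicator {s \<in> {0..t}. \<phi> s \<le> b} s) \<partial>lborel) = (\<integral>\<^sup>+ s\<in>{0..t}. indicator {..b} (\<phi> s) \<partial>lborel)"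
    by (rule nn_integral_cong) (auto simp: indicator_def)
  finally show ?thesis by (simp add: \<kappa>_nn_integral[OF t] \<kappa>_nonneg[OF t])
qed

lemma clock_eq: "clock_below b \<phi> t = (INF r\<in>{r. 0 \<le> r \<and> t < \<kappa> r}. ereal r)"
proof -
  have "{r. 0 \<le> r \<and> t < (LINT s:{0..r}|lborel. indicator {..b} (\<phi> s))} = {r. 0 \<le> r \<and> t < \<kappa> r}"
    using \<kappa>_LINT by auto
  then show ?thesis unfolding clock_below_def by simp
qed

lemma \<kappa>_mono: "0 \<le> s \<Longrightarrow> s \<le> t \<Longrightarrow> \<kappa> s \<le> \<kappa> t"
  unfolding \<kappa>_def using b
  by (intro integral_le integrable_continuous_real l_cont local_time_mono[OF A_pos l]) auto

lemma \<kappa>_cont: "continuous_on {0..} \<kappa>"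
proof -
  have "continuous_on ({0..} \<times> cbox 0 b) (\<lambda>p. (\<lambda>(r, t). l r t) (snd p, fst p))"
    by (rule continuous_on_compose2[OF local_timeD(1)[OF l]]) (use b in \<open>auto intro!: continuous_intros\<close>)
  then have "continuous_on ({0..} \<times> cbox 0 b) (\<lambda>(t, r). l r t)" by (simp add: case_prod_unfold)
  from integral_continuous_on_param[OF this] show ?thesis by (simp add: \<kappa>_def[abs_def])
qed

lemma \<kappa>_0: "\<kappa> 0 = 0"
proof -
  have "integral {0..b} (\<lambda>r. l r 0) = integral {0..b} (\<lambda>_. 0)"
    by (rule integral_cong) (use local_time_0[OF A_pos l] b in auto)
  then show ?thesis by (simp add: \<kappa>_def)
qed

definition C :: "real \<Rightarrow> real" where "C t = real_of_ereal (clock_below b \<phi> t)"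

lemma C:
  assumes t: "0 \<le> t"
  shows "clock_below b \<phi> t = ereal (C t)" "0 \<le> C t" "0 \<le> s \<Longrightarrow> C t < s \<longleftrightarrow> t < \<kappa> s" "\<kappa> (C t) = t"
proof -
  note p = first_passage[OF \<kappa>_mono \<kappa>_cont \<kappa>_0 t, folded clock_eq]
  show e: "clock_below b \<phi> t = ereal (C t)"
    using p(1) unbounded[OF t] unfolding C_def by (cases "clock_below b \<phi> t") auto
  show "0 \<le> C t" using p(1) by (simp add: e)
  show "0 \<le> s \<Longrightarrow> C t < s \<longleftrightarrow> t < \<kappa> s" using p(2)[of s] by (simp add: e)
  show "\<kappa> (C t) = t" using p(3) unbounded[OF t] by (simp add: C_def)
qed

lemma path_proj_eq: "0 \<le> t \<Longrightarrow> path_proj b \<phi> t = \<phi> (C t)"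
  using unbounded by (simp add: path_proj_def C_def)

text \<open>Since \<open>\<kappa> = \<integral>\<^sub>0\<^sup>b l r dr\<close> with every \<open>l r\<close> nondecreasing, none of them grows while \<open>\<kappa>\<close> is constant.\<close>

lemma l_eq_of_\<kappa>_eq:
  assumes st: "0 \<le> s" "0 \<le> t" and eq: "\<kappa> s = \<kappa> t" and r: "r \<in> {0..b}"
  shows "l r s = l r t"
proof -
  have *: "l r s = l r t" if st: "0 \<le> s" "s \<le> t" and eq: "\<kappa> s = \<kappa> t" for s t
  proof -
    have t: "0 \<le> t" using st by simp
    have c: "continuous_on {0..b} (\<lambda>r. l r t - l r s)" by (intro continuous_intros l_cont t st)
    have z: "integral {0..b} (\<lambda>r. l r t - l r s) = 0"
      using eq unfolding \<kappa>_def by (subst integral_diff) (auto intro!: integrable_continuous_real l_cont t st)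
    have "((\<lambda>r. l r t - l r s) has_integral 0) (cbox 0 b)"
      using integrable_integral[OF integrable_continuous_real[OF c]] unfolding z by simp
    moreover have "\<And>r. r \<in> cbox 0 b \<Longrightarrow> 0 \<le> l r t - l r s"
      using local_time_mono[OF A_pos l _ st] b by auto
    ultimately have "l r t - l r s = 0"
      using has_integral_0_cbox_imp_0[of 0 b "\<lambda>r. l r t - l r s" r] c b r by (auto simp: box_real)
    then show ?thesis by simp
  qed
  show ?thesis
  proof (cases "s \<le> t")
    case True then show ?thesis by (rule *[OF st(1) _ eq])
  next
    case False
    then have "l r t = l r s" by (intro *[OF st(2) _ eq[symmetric]]) simp
    then show ?thesis by simp
  qed
qed

text \<open>\<open>C\<close> may jump, but only across stretches where \<kappa> is constant, and
  there the local times are constant too. On a compact rectangle (r, s) \<mapsto> (r, \<kappa> s) is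
  a quotient map through which \<open>l\<close> factors, and this makes the time-changed local time
  jointly continuous.\<close>

lemma projected_cont: "continuous_on ({0..b} \<times> {0..}) (\<lambda>(r, t). l r (C t))"
proof -
  have fin: "continuous_on ({0..b} \<times> {0..\<kappa> S}) (\<lambda>(r, t). l r (C t))" if S: "0 \<le> S" for S
  proof -
    let ?K = "{0..b} \<times> {0..S}"
    have cl: "continuous_on ?K (\<lambda>(r, t). l r t)"
      by (rule continuous_on_subset[OF local_timeD(1)[OF l]]) (use b in auto)
    have cq: "continuous_on ?K (\<lambda>(r, s). (r, \<kappa> s))"
      unfolding case_prod_unfold
      by (intro continuous_intros continuous_on_compose2[OF \<kappa>_cont]) auto
    \<comment> \<open>The set is the image under the quotient map of a closed subset of the compact
      rectangle \<open>?K\<close>, hence compact.\<close>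
    have "closed (({0..b} \<times> {0..\<kappa> S}) \<inter> (\<lambda>(r, t). l r (C t)) -` F)" if F: "closed F" for F
    proof -
      have "closed (?K \<inter> (\<lambda>(r, t). l r t) -` F)"
        by (rule continuous_closed_preimage[OF cl _ F]) (intro closed_Times closed_atLeastAtMost)
      moreover have "compact ?K" by (intro compact_Times compact_Icc)
      ultimately have "compact (?K \<inter> (\<lambda>(r, t). l r t) -` F)"
        by (metis Int_assoc compact_Int_closed inf.idem)
      then have "compact ((\<lambda>(r, s). (r, \<kappa> s)) ` (?K \<inter> (\<lambda>(r, t). l r t) -` F))"
        by (intro compact_continuous_image continuous_on_subset[OF cq]) auto
      moreover have "(\<lambda>(r, s). (r, \<kappa> s)) ` (?K \<inter> (\<lambda>(r, t). l r t) -` F) = ({0..b} \<times> {0..\<kappa> S}) \<inter> (\<lambda>(r, t). l r (C t)) -` F"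
      proof (intro set_eqI iffI)
        fix p assume "p \<in> (\<lambda>(r, s). (r, \<kappa> s)) ` (?K \<inter> (\<lambda>(r, t). l r t) -` F)"
        then obtain r s where rs: "p = (r, \<kappa> s)" "r \<in> {0..b}" "0 \<le> s" "s \<le> S" "l r s \<in> F" by auto
        have "l r (C (\<kappa> s)) = l r s"
          using rs by (intro l_eq_of_\<kappa>_eq C \<kappa>_nonneg) (auto simp: C(4)[OF \<kappa>_nonneg])
        then show "p \<in> ({0..b} \<times> {0..\<kappa> S}) \<inter> (\<lambda>(r, t). l r (C t)) -` F"
          using rs \<kappa>_mono[of s S] \<kappa>_nonneg[of s] by auto
      next
        fix p assume "p \<in> ({0..b} \<times> {0..\<kappa> S}) \<inter> (\<lambda>(r, t). l r (C t)) -` F"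
        then obtain r u where ru: "p = (r, u)" "r \<in> {0..b}" "0 \<le> u" "u \<le> \<kappa> S" "l r (C u) \<in> F" by auto
        \<comment> \<open>\<open>C u\<close> can lie beyond \<open>S\<close> only if
          \<open>u = \<kappa> S\<close>; then \<open>S\<close> itself is a preimage of
          \<open>u\<close> inside the rectangle.\<close>
        define s where "s = min (C u) S"
        have s: "0 \<le> s" "s \<le> S" using C(2)[OF ru(3)] S by (auto simp: s_def)
        have \<kappa>s: "\<kappa> s = u"
        proof (cases "C u \<le> S")
          case True then show ?thesis using C(4)[OF ru(3)] by (simp add: s_def)
        next
          case False
          then have "\<kappa> S \<le> u" using \<kappa>_mono[of S "C u"] S C(4)[OF ru(3)] by simp
          then show ?thesis using False ru by (simp add: s_def)
        qed
        have "l r s = l r (C u)" using ru s \<kappa>s by (intro l_eq_of_\<kappa>_eq C) (auto simp: C(4))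
        then have "(r, s) \<in> ?K \<inter> (\<lambda>(r, t). l r t) -` F" using ru s by auto
        then show "p \<in> (\<lambda>(r, s). (r, \<kappa> s)) ` (?K \<inter> (\<lambda>(r, t). l r t) -` F)"
          using \<kappa>s ru(1) by (intro image_eqI[of _ _ "(r, s)"]) auto
      qed
      ultimately show ?thesis using compact_imp_closed by simp
    qed
    then show ?thesis
      by (subst continuous_on_closed_vimage) (auto intro!: closed_Times simp: Int_commute)
  qed
  show ?thesis
    unfolding continuous_on_eq_continuous_within
  proof
    fix p :: "real \<times> real" assume p: "p \<in> {0..b} \<times> {0..}"
    \<comment> \<open>Chosen so that \<kappa> S lies 1 beyond the time of \<open>p\<close>, making
      the rectangle a neighbourhood of \<open>p\<close>.\<close>
    define S where "S = C (snd p + 1)"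
    have S: "0 \<le> S" "\<kappa> S = snd p + 1" unfolding S_def using p by (auto intro!: C)
    have "continuous (at p within ({0..b} \<times> {0..\<kappa> S})) (\<lambda>(r, t). l r (C t))"
      using fin[OF S(1)] p S by (auto simp: continuous_on_eq_continuous_within)
    moreover have "at p within ({0..b} \<times> {0..\<kappa> S}) = at p within ({0..b} \<times> {0..})"
      by (rule at_within_nhd[of _ "UNIV \<times> {..<\<kappa> S}"]) (use p S in \<open>auto simp: open_Times\<close>)
    ultimately show "continuous (at p within ({0..b} \<times> {0..})) (\<lambda>(r, t). l r (C t))" by simp
  qed
qed

lemma C_mono: "0 \<le> s \<Longrightarrow> s \<le> t \<Longrightarrow> C s \<le> C t"
  using C(3)[of s "C t"] C[of t] C[of s] \<kappa>_mono[of "C t" "C s"] by force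

text \<open>The image under \<open>C\<close> of Lebesgue measure on \<open>{0..t}\<close> is
  Lebesgue measure restricted to the times up to \<open>C t\<close> spent at levels at most
  \<open>b\<close>; both have the distribution function \<open>min t (\<kappa> s)\<close> for
  \<open>s >= 0\<close>.\<close>

lemma time_change:
  assumes t: "0 \<le> t" and F[measurable]: "F \<in> borel_measurable borel"
  shows "(\<integral>\<^sup>+ u\<in>{0..t}. F (C u) \<partial>lborel) = (\<integral>\<^sup>+ s\<in>{0..C t}. F s * indicator {..b} (\<phi> s) \<partial>lborel)"
proof -
  define C' where "C' u = C (max 0 u)" for u
  have "mono C'" unfolding C'_def by (intro monoI C_mono) auto
  then have [measurable]: "C' \<in> borel_measurable borel" by (rule borel_measurable_mono)
  define E where "E = {s \<in> {0..C t}. \<phi> s \<le> b}"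
  have [measurable]: "E \<in> sets borel" unfolding E_def by (rule below_measurable)
  define m1 where "m1 = distr (density lborel (\<lambda>u. indicator {0..t} u)) borel C'"
  define m2 where "m2 = density lborel (\<lambda>s. indicator E s :: ennreal)"
  have n1: "(\<integral>\<^sup>+ s. f s \<partial>m1) = (\<integral>\<^sup>+ u\<in>{0..t}. f (C u) \<partial>lborel)" if [measurable]: "f \<in> borel_measurable borel" for f :: "real \<Rightarrow> ennreal"
    unfolding m1_def by (simp add: nn_integral_distr nn_integral_density)
      (auto intro!: nn_integral_cong simp: indicator_def C'_def)
  have n2: "(\<integral>\<^sup>+ s. f s \<partial>m2) = (\<integral>\<^sup>+ s\<in>{0..C t}. f s * indicator {..b} (\<phi> s) \<partial>lborel)" if [measurable]: "f \<in> borel_measurable borel" for f :: "real \<Rightarrow> ennreal"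
    unfolding m2_def by (simp add: nn_integral_density)
      (auto intro!: nn_integral_cong simp: indicator_def E_def)
  have e1: "emeasure m1 {..s} = ennreal (if 0 \<le> s then min t (\<kappa> s) else 0)" for s
  proof -
    have "emeasure m1 {..s} = (\<integral>\<^sup>+ u. indicator {..s} u \<partial>m1)" by (simp add: m1_def)
    also have "\<dots> = (\<integral>\<^sup>+ u\<in>{0..t}. indicator {..s} (C u) \<partial>lborel)" by (rule n1) simp
    also have "\<dots> = ennreal (if 0 \<le> s then min t (\<kappa> s) else 0)"
    proof (cases "0 \<le> s")
      case True
      \<comment> \<open>At \<open>u = \<kappa> s\<close> the value \<open>C u\<close> may exceed
        \<open>s\<close>, because \<open>C\<close> is the right-continuous inverse; one point is
        null.\<close>
      have "AE u in lborel. u \<noteq> \<kappa> s" by (rule AE_lborel_singleton)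
      then have "(\<integral>\<^sup>+ u\<in>{0..t}. indicator {..s} (C u) \<partial>lborel) = (\<integral>\<^sup>+ u. indicator {0..min t (\<kappa> s)} u \<partial>lborel)"
      proof (intro nn_integral_cong_AE, eventually_elim)
        case (elim u)
        have "C u \<le> s \<longleftrightarrow> u \<le> \<kappa> s" if "0 \<le> u"
        proof
          assume "C u \<le> s"
          then have "\<kappa> (C u) \<le> \<kappa> s" by (rule \<kappa>_mono[OF C(2)[OF that]])
          then show "u \<le> \<kappa> s" by (simp add: C(4)[OF that])
        next
          assume "u \<le> \<kappa> s"
          then have "u < \<kappa> s" using elim by simp
          then show "C u \<le> s" using C(3)[OF that True] by simp
        qed
        then show ?case by (auto simp: indicator_def)
      qed
      also have "\<dots> = ennreal (min t (\<kappa> s))" using t \<kappa>_nonneg[OF True] by simp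
      finally show ?thesis using True by simp
    next
      case False
      have "(\<integral>\<^sup>+ u\<in>{0..t}. indicator {..s} (C u) \<partial>lborel) = (\<integral>\<^sup>+ u. 0 \<partial>(lborel :: real measure))"
      proof (rule nn_integral_cong)
        fix u show "indicator {..s} (C u) * indicator {0..t} u = (0 :: ennreal)"
          using C(2)[of u] False by (auto simp: indicator_def)
      qed
      then show ?thesis using False by simp
    qed
    finally show ?thesis .
  qed
  have e2: "emeasure m2 {..s} = ennreal (if 0 \<le> s then min t (\<kappa> s) else 0)" for s
  proof -
    have "emeasure m2 {..s} = (\<integral>\<^sup>+ u. indicator {..s} u \<partial>m2)" by (simp add: m2_def)
    also have "\<dots> = (\<integral>\<^sup>+ u\<in>{0..C t}. indicator {..s} u * indicator {..b} (\<phi> u) \<partial>lborel)" by (rule n2) simp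
    also have "\<dots> = ennreal (if 0 \<le> s then min t (\<kappa> s) else 0)"
    proof (cases "0 \<le> s")
      case True
      have "(\<integral>\<^sup>+ u\<in>{0..C t}. indicator {..s} u * indicator {..b} (\<phi> u) \<partial>lborel)
          = (\<integral>\<^sup>+ u\<in>{0..min s (C t)}. indicator {..b} (\<phi> u) \<partial>lborel)"
        by (rule nn_integral_cong) (auto simp: indicator_def)
      also have "\<dots> = ennreal (\<kappa> (min s (C t)))" using True C(2)[OF t] by (intro \<kappa>_nn_integral) simp
      also have "\<kappa> (min s (C t)) = min t (\<kappa> s)"
        using \<kappa>_mono[of s "C t"] \<kappa>_mono[of "C t" s] True C(2,4)[OF t] by (auto simp: min_def)
      finally show ?thesis using True by simp
    next
      case False
      have "(\<integral>\<^sup>+ u\<in>{0..C t}. indicator {..s} u * indicator {..b} (\<phi> u) \<partial>lborel) = (\<integral>\<^sup>+ u. 0 \<partial>(lborel :: real measure))"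
        by (rule nn_integral_cong) (use False in \<open>auto simp: indicator_def\<close>)
      then show ?thesis using False by simp
    qed
    finally show ?thesis .
  qed
  have "m1 = m2"
  proof (rule cdf_unique')
    have "emeasure m1 (space m1) < \<infinity>" "emeasure m2 (space m2) < \<infinity>"
    proof -
      have "(\<integral>\<^sup>+ u. 1 \<partial>m1) = (\<integral>\<^sup>+ u\<in>{0..t}. 1 \<partial>lborel)" by (rule n1) simp
      then have m1: "(\<integral>\<^sup>+ u. 1 \<partial>m1) < \<infinity>" using t by simp
      have sp: "emeasure m1 (space m1) = (\<integral>\<^sup>+ u. 1 \<partial>m1)" "emeasure m2 (space m2) = (\<integral>\<^sup>+ u. 1 \<partial>m2)" by simp_all
      show "emeasure m1 (space m1) < \<infinity>"
        unfolding sp by (rule m1)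
      have "(\<integral>\<^sup>+ u. 1 \<partial>m2) = (\<integral>\<^sup>+ s\<in>{0..C t}. 1 * indicator {..b} (\<phi> s) \<partial>lborel)" by (rule n2) simp
      also have "\<dots> = ennreal (\<kappa> (C t))" using \<kappa>_nn_integral[OF C(2)[OF t]] by simp
      finally have "(\<integral>\<^sup>+ u. 1 \<partial>m2) = ennreal (\<kappa> (C t))" .
      then show "emeasure m2 (space m2) < \<infinity>" unfolding sp by (simp only: ennreal_less_top infinity_ennreal_def)
    qed
    then show "finite_borel_measure m1" "finite_borel_measure m2"
      by (intro finite_borel_measure.intro finite_borel_measure_axioms.intro finite_measureI; simp add: m1_def m2_def)+
    show "cdf m1 = cdf m2"
      by (rule ext) (simp only: cdf_def measure_def e1 e2)
  qed
  then show ?thesis using n1[OF F] n2[OF F] by simp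
qed

lemma projected_local_time: "is_local_time b (path_proj b \<phi>) (\<lambda>r t. l r (C t))"
  unfolding is_local_time_def
proof (intro conjI ballI allI impI)
  show "continuous_on ({0..b} \<times> {0..}) (\<lambda>(r, t). l r (C t))" by (rule projected_cont)
  show "0 \<le> l r (C t)" if "r \<in> {0..b}" "0 \<le> t" for r t
    using that b C(2) by (intro local_timeD(2)[OF l]) auto
  fix t :: real and g :: "real \<Rightarrow> ennreal" assume t: "0 \<le> t" and g[measurable]: "g \<in> borel_measurable borel"
  define \<phi>' where "\<phi>' s = \<phi> (max 0 s)" for s
  have "continuous_on UNIV \<phi>'" unfolding \<phi>'_def by (rule continuous_on_compose2[OF \<phi>_cont]) (auto intro!: continuous_intros)
  then have [measurable]: "\<phi>' \<in> borel_measurable borel" by (rule borel_measurable_continuous_onI)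
  have "(\<integral>\<^sup>+ s\<in>{0..t}. g (path_proj b \<phi> s) \<partial>lborel) = (\<integral>\<^sup>+ u\<in>{0..t}. g (\<phi>' (C u)) \<partial>lborel)"
    by (rule nn_integral_cong) (auto simp: indicator_def path_proj_eq \<phi>'_def C(2))
  also have "\<dots> = (\<integral>\<^sup>+ s\<in>{0..C t}. g (\<phi>' s) * indicator {..b} (\<phi> s) \<partial>lborel)"
    by (rule time_change[OF t, where F="\<lambda>s. g (\<phi>' s)"]) simp
  also have "\<dots> = (\<integral>\<^sup>+ s\<in>{0..C t}. (g (\<phi> s) * indicator {..b} (\<phi> s)) \<partial>lborel)"
    by (rule nn_integral_cong) (auto simp: indicator_def \<phi>'_def)
  also have "\<dots> = (\<integral>\<^sup>+ r\<in>{0..A}. (g r * indicator {..b} r) * ennreal (l r (C t)) \<partial>lborel)"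
    by (rule local_timeD(3)[OF l C(2)[OF t]]) simp
  also have "\<dots> = (\<integral>\<^sup>+ r\<in>{0..b}. g r * ennreal (l r (C t)) \<partial>lborel)"
    by (rule nn_integral_cong) (use b in \<open>auto simp: indicator_def\<close>)
  finally show "(\<integral>\<^sup>+ s\<in>{0..t}. g (path_proj b \<phi> s) \<partial>lborel) = (\<integral>\<^sup>+ r\<in>{0..b}. g r * ennreal (l r (C t)) \<partial>lborel)" .
qed

text \<open>The inverse local time of the projected path is \<kappa> T, the time that the original
  path has spent below \<open>b\<close> by its own inverse local time \<open>T\<close>.\<close>

lemma projected_local_time_at_inverse:
  assumes x: "0 \<le> x" and r: "r \<in> {0..b}" and fin: "inverse_local_time A \<phi> x \<noteq> \<infinity>"
  shows "local_time_at_inverse b (path_proj b \<phi>) x r = local_time_at_inverse A \<phi> x r"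
proof -
  have 0: "0 \<in> {0..b}" "0 \<in> {0..A}" using b by auto
  have rA: "r \<in> {0..A}" using r b by auto
  define T where "T = real_of_ereal (inverse_local_time A \<phi> x)"
  have T: "inverse_local_time A \<phi> x = ereal T" "0 \<le> T"
    using inverse_local_time_passage(1)[OF A_pos x, of \<phi>] fin
    by (cases "inverse_local_time A \<phi> x"; simp add: T_def)+
  define T' where "T' = inverse_local_time b (path_proj b \<phi>) x"
  have T'0: "0 \<le> T'" unfolding T'_def by (rule inverse_local_time_passage(1)[OF b(1) x])
  have lt: "local_time b (path_proj b \<phi>) r t = l r (C t)" if "r \<in> {0..b}" "0 \<le> t" for r t
    by (rule local_time_eq[OF b(1) projected_local_time that])
  have iff: "T' < ereal t \<longleftrightarrow> T < C t" if t: "0 \<le> t" for t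
  proof -
    have "T' < ereal t \<longleftrightarrow> x < l 0 (C t)"
      unfolding T'_def inverse_local_time_passage(2)[OF b(1) x t] lt[OF 0(1) t] ..
    also have "\<dots> \<longleftrightarrow> inverse_local_time A \<phi> x < ereal (C t)"
      unfolding inverse_local_time_passage(2)[OF A_pos x C(2)[OF t]] local_time_eq[OF A_pos l 0(2) C(2)[OF t]] ..
    finally show ?thesis by (simp add: T)
  qed
  have "T' = ereal (\<kappa> T)"
  proof (rule antisym)
    show "T' \<le> ereal (\<kappa> T)"
    proof (rule ccontr)
      assume "\<not> T' \<le> ereal (\<kappa> T)"
      then have "ereal (\<kappa> T) < T'" by simp
      then obtain t where t: "ereal (\<kappa> T) < ereal t" "ereal t < T'" using ereal_dense2 by blast
      then have t0: "0 \<le> t" using \<kappa>_nonneg[OF T(2)] by simp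
      have "C t \<le> T" using iff[OF t0] less_imp_le[OF t(2)] by (auto simp: not_less)
      then have "\<kappa> (C t) \<le> \<kappa> T" by (rule \<kappa>_mono[OF C(2)[OF t0]])
      then show False using t(1) C(4)[OF t0] by simp
    qed
    show "ereal (\<kappa> T) \<le> T'"
    proof (rule ccontr)
      assume "\<not> ereal (\<kappa> T) \<le> T'"
      then obtain t where t: "T' < ereal t" "ereal t < ereal (\<kappa> T)" using ereal_dense2 by (meson not_le)
      have t0: "0 \<le> t" using T'0 t(1) by (metis ereal_less_eq(5) less_imp_le order_trans)
      have "C t < T" using C(3)[OF t0 T(2)] t(2) by simp
      moreover have "T < C t" using iff[OF t0] t(1) by simp
      ultimately show False by simp
    qed
  qed
  \<comment> \<open>\<open>C (\<kappa> T)\<close> can be later than \<open>T\<close>, but \<kappa>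
    agrees at the two times, hence so do the local times up to level \<open>b\<close>.\<close>
  moreover have "l r (C (\<kappa> T)) = l r T"
    using T(2) r by (intro l_eq_of_\<kappa>_eq C \<kappa>_nonneg) (auto simp: C(4)[OF \<kappa>_nonneg])
  ultimately show ?thesis
    unfolding local_time_at_inverse_def T'_def[symmetric] T(1)
    using lt[OF r \<kappa>_nonneg[OF T(2)]] local_time_eq[OF A_pos l rA T(2)] by simp
qed

end

section \<open>The height process\<close>

lemma occupation_below_eq:
  fixes \<phi> :: "real \<Rightarrow> real"
  assumes "continuous_on {0..} \<phi>"
  shows "(LINT s:{0..t}|lborel. indicator {..b} (\<phi> s) :: real) = measure lborel {s \<in> {0..t}. \<phi> s \<le> b}"
    "{s \<in> {0..t}. \<phi> s \<le> b} \<in> sets borel"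
proof -
  have "closed ({0..t} \<inter> \<phi> -` {..b})"
    by (rule continuous_closed_preimage[OF continuous_on_subset[OF assms]]) auto
  then show *: "{s \<in> {0..t}. \<phi> s \<le> b} \<in> sets borel" by (simp add: Int_def vimage_def)
  have e: "indicator {0..t} s *\<^sub>R (indicator {..b} (\<phi> s) :: real) = indicator {s \<in> {0..t}. \<phi> s \<le> b} s" for s
    by (auto simp: indicator_def)
  show "(LINT s:{0..t}|lborel. indicator {..b} (\<phi> s) :: real) = measure lborel {s \<in> {0..t}. \<phi> s \<le> b}"
    unfolding set_lebesgue_integral_def e using * by simp
qed

text \<open>Without this, the projected path would stay at \<open>b\<close> from some time on, which a path with a
  local time cannot do.\<close>

lemma clock_below_finite:
  fixes \<phi> \<phi>' :: "real \<Rightarrow> real"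
  assumes \<phi>: "continuous_on {0..} \<phi>" and t: "0 \<le> t" and c: "0 < c" "c \<le> b"
    and \<phi>': "\<And>s. 0 \<le> s \<Longrightarrow> \<phi>' s = path_proj c \<phi> s" and l: "is_local_time c \<phi>' l"
  shows "clock_below b \<phi> t \<noteq> \<infinity>"
proof
  define occ where "occ b r = (LINT s:{0..r}|lborel. indicator {..b} (\<phi> s) :: real)" for b r
  have mono: "occ c r \<le> occ b r" for r
  proof -
    have "emeasure lborel {s \<in> {0..r}. \<phi> s \<le> b} \<le> emeasure lborel {0..r}"
      by (rule emeasure_mono) auto
    also have "\<dots> < \<infinity>" by (cases "0 \<le> r") auto
    finally show ?thesis unfolding occ_def occupation_below_eq[OF \<phi>]
      using c occupation_below_eq(2)[OF \<phi>] by (intro measure_mono_fmeasurable fmeasurableI) auto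
  qed
  assume inf: "clock_below b \<phi> t = \<infinity>"
  have le: "occ b r \<le> t" if "0 \<le> r" for r
  proof (rule ccontr)
    assume "\<not> occ b r \<le> t"
    then have "clock_below b \<phi> t \<le> ereal r"
      unfolding clock_below_def using that by (intro INF_lower) (auto simp: occ_def)
    then show False using inf by simp
  qed
  have infc: "clock_below c \<phi> u = \<infinity>" if "t \<le> u" for u
  proof -
    have "{r. 0 \<le> r \<and> u < occ c r} = {}" using le mono that by (auto simp: not_less) (meson order_trans)
    then have "clock_below c \<phi> u = Inf (ereal ` {})"
      unfolding clock_below_def occ_def[symmetric] by (simp only:)
    then show ?thesis by (simp add: top_ereal_def)
  qed
  have const: "\<phi>' u = c" if "t \<le> u" for u
    using \<phi>'[of u] infc[OF that] that t by (simp add: path_proj_def)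
  \<comment> \<open>The contradiction: the path would spend the whole interval
    \<open>{t..t + 1}\<close> at the single level \<open>c\<close>, to which an occupation density
    assigns time 0.\<close>
  have "(\<integral>\<^sup>+ s. indicator {t..t + 1} s \<partial>lborel) \<le> (\<integral>\<^sup>+ s\<in>{0..t + 1}. indicator {c} (\<phi>' s) \<partial>lborel)"
    by (rule nn_integral_mono) (use t const in \<open>auto simp: indicator_def\<close>)
  also have "\<dots> = (\<integral>\<^sup>+ r\<in>{0..c}. indicator {c} r * ennreal (l r (t + 1)) \<partial>lborel)"
    by (rule local_timeD(3)[OF l]) (use t in auto)
  also have "\<dots> = (\<integral>\<^sup>+ r. 0 \<partial>(lborel :: real measure))"
  proof (rule nn_integral_cong_AE)
    show "AE r in lborel. indicator {c} r * ennreal (l r (t + 1)) * indicator {0..c} r = 0"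
      using AE_lborel_singleton[of c] by eventually_elim auto
  qed
  finally show False by simp
qed

lemma local_time_at_inverse_cong:
  assumes "\<And>s. 0 \<le> s \<Longrightarrow> \<phi> s = \<phi>' s"
  shows "local_time_at_inverse b \<phi> x r = local_time_at_inverse b \<phi>' x r"
proof -
  have "local_time b \<phi> = local_time b \<phi>'" by (rule local_time_cong[OF assms])
  then show ?thesis by (simp only: local_time_at_inverse_def inverse_local_time_def)
qed

text \<open>Trades exponentials of \<open>X\<close> for indicators under a general bounded weight,
  by comparing the laws of \<open>X\<close> under the densities \<open>G\<close> and
  \<open>G'\<close>. It is applied to one past time after the other.\<close>

lemma laplace_weight_unique:
  assumes M: "prob_space M" and G: "G \<in> borel_measurable M" "\<And>\<omega>. \<omega> \<in> space M \<Longrightarrow> G \<omega> \<le> (1 :: ennreal)"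
    and G': "G' \<in> borel_measurable M" "\<And>\<omega>. \<omega> \<in> space M \<Longrightarrow> G' \<omega> \<le> (1 :: ennreal)"
    and X: "X \<in> borel_measurable M" "\<And>\<omega>. \<omega> \<in> space M \<Longrightarrow> 0 \<le> (X \<omega> :: real)"
    and eq: "\<And>n::nat. (\<integral>\<^sup>+ \<omega>. G \<omega> * ennreal (exp (- (real n * X \<omega>))) \<partial>M) = (\<integral>\<^sup>+ \<omega>. G' \<omega> * ennreal (exp (- (real n * X \<omega>))) \<partial>M)"
    and B: "B \<in> sets borel"
  shows "(\<integral>\<^sup>+ \<omega>. G \<omega> * indicator B (X \<omega>) \<partial>M) = (\<integral>\<^sup>+ \<omega>. G' \<omega> * indicator B (X \<omega>) \<partial>M)"
proof -
  interpret prob_space M by fact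
  note [measurable] = G(1) G'(1) X(1) B
  define m where "m G = distr (density M G) borel X" for G :: "'a \<Rightarrow> ennreal"
  have n: "(\<integral>\<^sup>+ y. f y \<partial>m G) = (\<integral>\<^sup>+ \<omega>. G \<omega> * f (X \<omega>) \<partial>M)"
    if [measurable]: "G \<in> borel_measurable M" "f \<in> borel_measurable borel" for f :: "real \<Rightarrow> ennreal" and G
    unfolding m_def by (simp add: nn_integral_distr nn_integral_density)
  have fin: "finite_measure (m G)" if [measurable]: "G \<in> borel_measurable M" and le: "\<And>\<omega>. \<omega> \<in> space M \<Longrightarrow> G \<omega> \<le> 1" for G
  proof (rule finite_measureI)
    have "emeasure (m G) (space (m G)) = (\<integral>\<^sup>+ \<omega>. G \<omega> \<partial>M)"
      using n[of G "\<lambda>_. 1"] by simp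
    also have "\<dots> \<le> (\<integral>\<^sup>+ \<omega>. 1 \<partial>M)" by (intro nn_integral_mono le)
    also have "\<dots> < \<infinity>" by (simp add: emeasure_space_1)
    finally show "emeasure (m G) (space (m G)) \<noteq> \<infinity>" by simp
  qed
  have AE: "AE y in m G. 0 \<le> y" if [measurable]: "G \<in> borel_measurable M" for G
    unfolding m_def by (subst AE_distr_iff) (auto simp: AE_density X(2) intro!: AE_I2)
  have "m G = m G'"
  proof (rule laplace_unique[OF fin[OF G] _ AE[OF G(1)] fin[OF G'] _ AE[OF G'(1)]])
    fix k :: nat
    have [measurable]: "(\<lambda>y. exp (- (real k * y))) \<in> borel_measurable (m G)" "(\<lambda>y. exp (- (real k * y))) \<in> borel_measurable (m G')"
      by (auto simp: m_def)
    have "(\<integral>\<^sup>+ y. ennreal (exp (- (real k * y))) \<partial>m G) = (\<integral>\<^sup>+ y. ennreal (exp (- (real k * y))) \<partial>m G')"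
      using eq[of k] by (simp add: n G(1) G'(1))
    then show "(\<integral>y. exp (- (real k * y)) \<partial>m G) = (\<integral>y. exp (- (real k * y)) \<partial>m G')"
      by (subst (1 2) integral_eq_nn_integral) auto
  qed (auto simp: m_def)
  then show ?thesis using n[OF G(1), of "indicator B"] n[OF G'(1), of "indicator B"] by simp
qed

lemma borel_nonneg_sets: "sets borel_nonneg = {B \<in> sets borel. B \<subseteq> {0..}}"
  by (auto simp: sets_restrict_space_iff)

lemma borel_nonneg_measurableI:
  assumes "f \<in> borel_measurable M" "\<And>\<omega>. \<omega> \<in> space M \<Longrightarrow> 0 \<le> f \<omega>"
  shows "f \<in> M \<rightarrow>\<^sub>M borel_nonneg"
  using assms by (intro measurable_restrict_space2) auto

lemma max_0_borel_nonneg: "max (0 :: real) \<in> borel \<rightarrow>\<^sub>M borel_nonneg"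
  by (intro borel_nonneg_measurableI) auto

lemma id_borel_nonneg: "(\<lambda>x. x) \<in> borel_nonneg \<rightarrow>\<^sub>M borel"
  by (rule measurable_restrict_space1) simp

lemma laplace_unique_nonneg:
  assumes \<mu>: "prob_space \<mu>" "sets \<mu> = sets borel_nonneg" and \<nu>: "prob_space \<nu>" "sets \<nu> = sets borel_nonneg"
    and eq: "\<And>n::nat. (\<integral>\<^sup>+ y. ennreal (exp (- (real n * y))) \<partial>\<mu>) = (\<integral>\<^sup>+ y. ennreal (exp (- (real n * y))) \<partial>\<nu>)"
  shows "\<mu> = \<nu>"
proof -
  have id: "(\<lambda>x. x) \<in> m \<rightarrow>\<^sub>M borel" if "sets m = sets borel_nonneg" for m :: "real measure"
    using id_borel_nonneg by (simp add: measurable_cong_sets[OF that refl])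
  have sp: "space m = {0..}" if "sets m = sets borel_nonneg" for m :: "real measure"
    using sets_eq_imp_space_eq[OF that] by simp
  \<comment> \<open>Passing to the whole line by the inclusion and back by \<open>max 0\<close>
    loses nothing, so uniqueness on the line transfers to the half-line.\<close>
  have inv: "distr (distr m borel (\<lambda>x. x)) borel_nonneg (max 0) = m" if m: "sets m = sets borel_nonneg" for m
  proof -
    have "distr (distr m borel (\<lambda>x. x)) borel_nonneg (max 0) = distr m borel_nonneg (\<lambda>x. max 0 x)"
      by (subst distr_distr[OF max_0_borel_nonneg id[OF m]]) (simp add: comp_def)
    also have "\<dots> = distr m m (\<lambda>x. x)" by (rule distr_cong) (auto simp: m sp[OF m])
    finally show ?thesis by simp
  qed
  have n: "(\<integral>\<^sup>+ y. ennreal (exp (- (real n * y))) \<partial>distr m borel (\<lambda>x. x)) = (\<integral>\<^sup>+ y. ennreal (exp (- (real n * y))) \<partial>m)"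
    if "sets m = sets borel_nonneg" for m and n :: nat
    by (subst nn_integral_distr[OF id[OF that]]) auto
  have "distr \<mu> borel (\<lambda>x. x) = distr \<nu> borel (\<lambda>x. x)"
  proof (rule laplace_unique)
    show "finite_measure (distr \<mu> borel (\<lambda>x. x))" "finite_measure (distr \<nu> borel (\<lambda>x. x))"
      using prob_space.prob_space_distr[OF \<mu>(1) id[OF \<mu>(2)]] prob_space.prob_space_distr[OF \<nu>(1) id[OF \<nu>(2)]]
      by (auto intro: prob_space.finite_measure)
    show "AE y in distr \<mu> borel (\<lambda>x. x). 0 \<le> y" "AE y in distr \<nu> borel (\<lambda>x. x). 0 \<le> y"
      using id[OF \<mu>(2)] id[OF \<nu>(2)] by (auto simp: AE_distr_iff sp[OF \<mu>(2)] sp[OF \<nu>(2)] intro!: AE_I2)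
    fix k :: nat
    show "(\<integral>y. exp (- (real k * y)) \<partial>distr \<mu> borel (\<lambda>x. x)) = (\<integral>y. exp (- (real k * y)) \<partial>distr \<nu> borel (\<lambda>x. x))"
      using eq[of k] by (subst (1 2) integral_eq_nn_integral) (auto simp: n[OF \<mu>(2)] n[OF \<nu>(2)])
  qed auto
  then show ?thesis using inv[OF \<mu>(2)] inv[OF \<nu>(2)] by metis
qed

section \<open>Compatibility of the heights and the transition kernels\<close>

locale height = prob_space M for M :: "'w measure" +
  fixes \<theta> :: real and H :: "real \<Rightarrow> real \<Rightarrow> 'w \<Rightarrow> real"
  assumes height: "height_process M \<theta> H"
begin

definition Z :: "real \<Rightarrow> real \<Rightarrow> real \<Rightarrow> 'w \<Rightarrow> real" where
  "Z a x r \<omega> = local_time_at_inverse a (\<lambda>s. H a s \<omega>) x r"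

lemma reflected: "0 < a \<Longrightarrow> \<exists>\<beta>. reflected_bm M \<theta> a (H a) \<beta>"
proof -
  assume a: "0 < a"
  then have "reflected_brownian_motion M \<theta> a (H a)" using height by (simp add: height_process_def)
  then show ?thesis
    unfolding reflected_brownian_motion_def reflected_bm_def reflected_bm_axioms_def
    using a prob_space_axioms by blast
qed

lemma Z_meas: "0 < a \<Longrightarrow> r \<in> {0..a} \<Longrightarrow> 0 \<le> x \<Longrightarrow> Z a x r \<in> borel_measurable M"
proof -
  assume *: "0 < a" "r \<in> {0..a}" "0 \<le> x"
  obtain \<beta> where "reflected_bm M \<theta> a (H a) \<beta>" using reflected[OF *(1)] by blast
  then interpret reflected_bm M \<theta> a "H a" \<beta> .
  show ?thesis unfolding Z_def[abs_def] by (rule local_time_at_inverse_meas[OF *(2,3)])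
qed

lemma Z_nonneg: "0 < a \<Longrightarrow> r \<in> {0..a} \<Longrightarrow> 0 \<le> x \<Longrightarrow> 0 \<le> Z a x r \<omega>"
  unfolding Z_def by (rule local_time_at_inverse_nonneg)

lemma Z_laplace:
  assumes "0 < a" "0 \<le> x" "sorted (map fst es)" "\<And>r q. (r, q) \<in> set es \<Longrightarrow> 0 \<le> r \<and> r + 1 \<le> a \<and> 0 \<le> q"
  shows "(\<integral>\<^sup>+ \<omega>. ennreal (exp (- (\<Sum>(r, q)\<leftarrow>es. q * Z a x r \<omega>))) \<partial>M) = ennreal (exp (- (x * level_exponent \<theta> es 0)))"
proof -
  obtain \<beta> where "reflected_bm M \<theta> a (H a) \<beta>" using reflected[OF assms(1)] by blast
  then interpret reflected_bm M \<theta> a "H a" \<beta> .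
  show ?thesis unfolding Z_def by (rule joint_laplace[OF assms(2-)])
qed

text \<open>The heights \<open>b\<close> range over uncountably many reals, so each is compared with
  natural numbers above it. Almost sure properties are then needed for countably many heights only,
  together with the projection property, which holds for all pairs outside one null set.\<close>

lemma AE_compatible:
  assumes x: "0 \<le> x"
  shows "AE \<omega> in M. (\<forall>N::nat. 0 < N \<longrightarrow> continuous_on {0..real N} (\<lambda>r. Z (real N) x r \<omega>)) \<and>
     (\<forall>b>0. \<forall>N::nat. b < real N \<longrightarrow> (\<forall>r\<in>{0..b}. Z b x r \<omega> = Z (real N) x r \<omega>))"
proof -
  have 1: "AE \<omega> in M. \<exists>l. is_local_time a (\<lambda>s. H a s \<omega>) l" "AE \<omega> in M. inverse_local_time a (\<lambda>s. H a s \<omega>) x \<noteq> \<infinity>"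
    and c: "\<omega> \<in> space M \<Longrightarrow> continuous_on {0..} (\<lambda>s. H a s \<omega>)" "\<omega> \<in> space M \<Longrightarrow> 0 \<le> s \<Longrightarrow> H a s \<omega> \<in> {0..a}"
    if pos: "0 < a" for a \<omega> s
  proof -
    obtain \<beta> where "reflected_bm M \<theta> a (H a) \<beta>" using reflected[OF pos] by blast
    then interpret reflected_bm M \<theta> a "H a" \<beta> .
    show "AE \<omega> in M. \<exists>l. is_local_time a (\<lambda>s. H a s \<omega>) l" by (rule AE_local_time)
    show "AE \<omega> in M. inverse_local_time a (\<lambda>s. H a s \<omega>) x \<noteq> \<infinity>" by (rule AE_inverse_finite[OF x])
    show "\<omega> \<in> space M \<Longrightarrow> continuous_on {0..} (\<lambda>s. H a s \<omega>)" "\<omega> \<in> space M \<Longrightarrow> 0 \<le> s \<Longrightarrow> H a s \<omega> \<in> {0..a}"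
      using Y_cont Y_range by auto
  qed
  have "AE \<omega> in M. \<forall>n. \<exists>l. is_local_time (real (Suc n)) (\<lambda>s. H (real (Suc n)) s \<omega>) l"
    "AE \<omega> in M. \<forall>n. inverse_local_time (real (Suc n)) (\<lambda>s. H (real (Suc n)) s \<omega>) x \<noteq> \<infinity>"
    "AE \<omega> in M. \<forall>n. \<exists>l. is_local_time (1 / real (Suc n)) (\<lambda>s. H (1 / real (Suc n)) s \<omega>) l"
    unfolding AE_all_countable by (auto intro!: 1)
  moreover have "AE \<omega> in M. \<forall>a b t. 0 < b \<and> b < a \<and> 0 \<le> t \<longrightarrow> path_proj b (\<lambda>s. H a s \<omega>) t = H b t \<omega>"
    using height by (simp add: height_process_def)
  ultimately show ?thesis using AE_space
  proof eventually_elim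
    case (elim \<omega>)
    have lN: "\<exists>l. is_local_time (real N) (\<lambda>s. H (real N) s \<omega>) l" "inverse_local_time (real N) (\<lambda>s. H (real N) s \<omega>) x \<noteq> \<infinity>" if "0 < N" for N :: nat
      using elim(1)[rule_format, of "N - 1"] elim(2)[rule_format, of "N - 1"] that by simp_all
    have pp: "path_proj b (\<lambda>s. H a s \<omega>) t = H b t \<omega>" if "0 < b" "b < a" "0 \<le> t" for a b t
      using elim(4) that by blast
    show ?case
    proof (intro conjI allI impI ballI)
      fix N :: nat assume N: "0 < N"
      obtain l where l: "is_local_time (real N) (\<lambda>s. H (real N) s \<omega>) l" using lN(1)[OF N] by blast
      have "0 \<le> real_of_ereal (inverse_local_time (real N) (\<lambda>s. H (real N) s \<omega>) x)"
        using inverse_local_time_passage(1)[of "real N" x] N x by (intro real_of_ereal_pos) auto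
      from local_timeD(4)[OF is_local_time_local_time[OF l] this]
      show "continuous_on {0..real N} (\<lambda>r. Z (real N) x r \<omega>)"
        unfolding Z_def local_time_at_inverse_def .
    next
      fix b :: real and N :: nat and r assume b: "0 < b" and N: "b < real N" and r: "r \<in> {0..b}"
      have N0: "0 < N" using b N by (cases N) auto
      obtain l where l: "is_local_time (real N) (\<lambda>s. H (real N) s \<omega>) l" using lN(1)[OF N0] by blast
      \<comment> \<open>A local time of the process at height \<open>b\<close> is not at hand for
        all real \<open>b\<close> simultaneously. A height \<open>1 / Suc m\<close> below
        \<open>b\<close> comes from a countable family and suffices, since an infinite clock at
        \<open>b\<close> forces an infinite clock at every lower level.\<close>
      obtain m :: nat where m: "1 / real (Suc m) < b" using nat_approx_posE[OF b] by auto
      obtain l' where l': "is_local_time (1 / real (Suc m)) (\<lambda>s. H (1 / real (Suc m)) s \<omega>) l'" using elim(3) by blast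
      have cN: "continuous_on {0..} (\<lambda>s. H (real N) s \<omega>)" using N0 by (intro c elim(5)) auto
      interpret projected_path "real N" b "\<lambda>s. H (real N) s \<omega>" l
      proof
        show "H (real N) s \<omega> \<in> {0..real N}" if "0 \<le> s" for s using N0 that by (intro c elim(5)) auto
        show "clock_below b (\<lambda>s. H (real N) s \<omega>) t \<noteq> \<infinity>" if "0 \<le> t" for t
        proof (rule clock_below_finite[OF cN that _ less_imp_le[OF m] _ l'])
          show "H (1 / real (Suc m)) s \<omega> = path_proj (1 / real (Suc m)) (\<lambda>s. H (real N) s \<omega>) s" if "0 \<le> s" for s
            by (rule pp[symmetric]) (use m N that in auto)
        qed simp
      qed (use b N l cN in auto)
      have "Z b x r \<omega> = local_time_at_inverse b (path_proj b (\<lambda>s. H (real N) s \<omega>)) x r"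
        unfolding Z_def by (rule local_time_at_inverse_cong) (rule pp[OF b, symmetric])
      also have "\<dots> = Z (real N) x r \<omega>"
        unfolding Z_def by (rule projected_local_time_at_inverse[OF x r lN(2)[OF N0]])
      finally show "Z b x r \<omega> = Z (real N) x r \<omega>" .
    qed
  qed
qed

text \<open>The same construction with starting mass \<open>z\<close> in place of \<open>x\<close>
  realises the kernel, so no separate existence proof is needed. The height \<open>r + 1\<close>
  leaves the margin that \<open>jump_exponential\<close> requires.\<close>

definition K :: "real \<Rightarrow> real \<Rightarrow> real measure" where
  "K r z = distr M borel_nonneg (Z (r + 1) z r)"

lemma Z_meas_nonneg: "0 \<le> r \<Longrightarrow> 0 \<le> z \<Longrightarrow> Z (r + 1) z r \<in> M \<rightarrow>\<^sub>M borel_nonneg"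
  by (intro borel_nonneg_measurableI Z_meas Z_nonneg) auto

lemma K_prob: "0 \<le> r \<Longrightarrow> 0 \<le> z \<Longrightarrow> prob_space (K r z)"
  unfolding K_def by (intro prob_space_distr Z_meas_nonneg)

lemma K_sets: "sets (K r z) = sets borel_nonneg"
  by (simp add: K_def)

lemma Z_laplace1:
  assumes "0 \<le> r" "0 \<le> z" "0 \<le> q"
  shows "(\<integral>\<^sup>+ \<omega>. ennreal (exp (- (q * Z (r + 1) z r \<omega>))) \<partial>M) = ennreal (exp (- (z * feller_flow \<theta> q r)))"
  using Z_laplace[of "r + 1" z "[(r, q)]"] assms by simp

lemma K_laplace:
  assumes "0 \<le> r" "0 \<le> z" "0 \<le> q"
  shows "(\<integral>\<^sup>+ y. ennreal (exp (- (q * y))) \<partial>K r z) = ennreal (exp (- (z * feller_flow \<theta> q r)))"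
proof -
  have [measurable]: "(\<lambda>y. y) \<in> borel_nonneg \<rightarrow>\<^sub>M borel" by (rule id_borel_nonneg)
  show ?thesis unfolding K_def using Z_laplace1[OF assms]
    by (subst nn_integral_distr[OF Z_meas_nonneg]) (use assms in auto)
qed

text \<open>Joint measurability of the random variables in \<open>z\<close> is never examined: the
  Laplace transform is explicitly \<open>exp (- (z * feller_flow \<theta> n r))\<close>, which is
  measurable in \<open>z\<close>.\<close>

lemma K_measurable:
  assumes r: "0 \<le> r"
  shows "K r \<in> borel_nonneg \<rightarrow>\<^sub>M prob_algebra borel_nonneg"
proof -
  define K' where "K' z = distr M borel (Z (r + 1) z r)" for z
  have Zm[measurable]: "Z (r + 1) z r \<in> borel_measurable M" if "0 \<le> z" for z
    using that r by (intro Z_meas) auto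
  have "K' \<in> borel_nonneg \<rightarrow>\<^sub>M prob_algebra borel"
  proof (rule measurable_kernel_laplace)
    fix z assume "z \<in> space borel_nonneg"
    then have z: "0 \<le> z" by simp
    show "prob_space (K' z)" unfolding K'_def by (rule prob_space_distr[OF Zm[OF z]])
    show "sets (K' z) = sets borel" by (simp add: K'_def)
    show "AE y in K' z. 0 \<le> y" unfolding K'_def using z r
      by (subst AE_distr_iff[OF Zm[OF z]]) (auto intro!: AE_I2 Z_nonneg)
  next
    fix n :: nat
    have "(\<integral>y. exp (- (real n * y)) \<partial>K' z) = exp (- (z * feller_flow \<theta> (real n) r))" if z: "0 \<le> z" for z
    proof -
      have "(\<integral>y. exp (- (real n * y)) \<partial>K' z) = (\<integral>\<omega>. exp (- (real n * Z (r + 1) z r \<omega>)) \<partial>M)"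
        unfolding K'_def by (rule integral_distr[OF Zm[OF z]]) simp
      also have "\<dots> = exp (- (z * feller_flow \<theta> (real n) r))"
        using Zm[OF z] by (subst integral_eq_nn_integral) (auto simp: Z_laplace1[OF r z])
      finally show ?thesis .
    qed
    then have eq: "(\<integral>y. exp (- (real n * y)) \<partial>K' z) = exp (- (z * feller_flow \<theta> (real n) r))" if "z \<in> space borel_nonneg" for z
      using that by simp
    have [measurable]: "(\<lambda>y. y) \<in> borel_nonneg \<rightarrow>\<^sub>M borel" by (rule id_borel_nonneg)
    have "(\<lambda>z. exp (- (z * feller_flow \<theta> (real n) r))) \<in> borel_measurable borel_nonneg" by measurable
    then show "(\<lambda>z. \<integral>y. exp (- (real n * y)) \<partial>K' z) \<in> borel_measurable borel_nonneg"
      by (rule measurable_eq_on_space) (rule eq[symmetric])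
  qed
  from measurable_compose[OF this measurable_distr_prob_space[OF max_0_borel_nonneg]]
  have "(\<lambda>z. distr (K' z) borel_nonneg (max 0)) \<in> borel_nonneg \<rightarrow>\<^sub>M prob_algebra borel_nonneg" .
  then show ?thesis
  proof (rule measurable_eq_on_space)
    fix z assume "z \<in> space borel_nonneg"
    then have z: "0 \<le> z" by simp
    show "distr (K' z) borel_nonneg (max 0) = K r z"
      unfolding K'_def K_def by (subst distr_distr[OF max_0_borel_nonneg Zm[OF z]])
        (use z r in \<open>auto intro!: distr_cong Z_nonneg simp: max_def\<close>)
  qed
qed

text \<open>On Laplace transforms, composing kernels is composing flows, so the Chapman-Kolmogorov
  equation reduces to \<open>feller_flow_add\<close>.\<close>

lemma K_semigroup: "transition_semigroup K"
  unfolding transition_semigroup_def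
proof (intro conjI allI impI)
  show "K r \<in> borel_nonneg \<rightarrow>\<^sub>M prob_algebra borel_nonneg" if "0 \<le> r" for r by (rule K_measurable[OF that])
  show "K 0 z = return borel_nonneg z" if z: "0 \<le> z" for z
  proof (rule laplace_unique_nonneg)
    show "prob_space (return borel_nonneg z)" using z by (intro prob_space_return) simp
    have [measurable]: "(\<lambda>y. y) \<in> borel_nonneg \<rightarrow>\<^sub>M borel" by (rule id_borel_nonneg)
    show "(\<integral>\<^sup>+ y. ennreal (exp (- (real n * y))) \<partial>K 0 z) = (\<integral>\<^sup>+ y. ennreal (exp (- (real n * y))) \<partial>return borel_nonneg z)" for n :: nat
      using z by (subst K_laplace, simp_all) (subst nn_integral_return, auto simp: mult.commute)
  qed (use z K_prob K_sets in auto)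
  fix r s z :: real assume rs: "0 \<le> r" "0 \<le> s" and z: "0 \<le> z"
  have sp: "K r z \<in> space (prob_algebra borel_nonneg)"
    using K_prob[OF rs(1) z] K_sets by (simp add: space_prob_algebra)
  show "K (r + s) z = K r z \<bind> K s"
  proof (rule laplace_unique_nonneg)
    show "prob_space (K (r + s) z)" using rs z by (intro K_prob) auto
    show "prob_space (K r z \<bind> K s)" by (rule prob_space_bind'[OF sp K_measurable[OF rs(2)]])
    show "sets (K r z \<bind> K s) = sets borel_nonneg" by (rule sets_bind'[OF sp K_measurable[OF rs(2)]])
    fix n :: nat
    have Ks: "K s \<in> K r z \<rightarrow>\<^sub>M subprob_algebra borel_nonneg"
      using measurable_prob_algebraD[OF K_measurable[OF rs(2)]] measurable_cong_sets[OF K_sets refl] by blast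
    have [measurable]: "(\<lambda>y. y) \<in> borel_nonneg \<rightarrow>\<^sub>M borel" by (rule id_borel_nonneg)
    have spK: "space (K r z) = {0..}" using sets_eq_imp_space_eq[OF K_sets] by simp
    have "(\<integral>\<^sup>+ y. ennreal (exp (- (real n * y))) \<partial>(K r z \<bind> K s)) = (\<integral>\<^sup>+ x. (\<integral>\<^sup>+ y. ennreal (exp (- (real n * y))) \<partial>K s x) \<partial>K r z)"
      by (rule nn_integral_bind[OF _ Ks]) measurable
    also have "\<dots> = (\<integral>\<^sup>+ x. ennreal (exp (- (feller_flow \<theta> (real n) s * x))) \<partial>K r z)"
      by (rule nn_integral_cong) (use K_laplace[OF rs(2), of _ "real n"] spK in \<open>auto simp: mult.commute\<close>)
    also have "\<dots> = ennreal (exp (- (z * feller_flow \<theta> (feller_flow \<theta> (real n) s) r)))"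
      using rs by (intro K_laplace z feller_flow_nonneg) auto
    also have "feller_flow \<theta> (feller_flow \<theta> (real n) s) r = feller_flow \<theta> (real n) (r + s)"
      using rs by (subst feller_flow_add) (auto simp: add.commute)
    also have "ennreal (exp (- (z * feller_flow \<theta> (real n) (r + s)))) = (\<integral>\<^sup>+ y. ennreal (exp (- (real n * y))) \<partial>K (r + s) z)"
      using rs z by (intro K_laplace[symmetric]) auto
    finally show "(\<integral>\<^sup>+ y. ennreal (exp (- (real n * y))) \<partial>K (r + s) z) = (\<integral>\<^sup>+ y. ennreal (exp (- (real n * y))) \<partial>(K r z \<bind> K s))" ..
  qed (rule K_sets)
qed

end

section \<open>The Markov property in the level\<close>

locale level_process = height M \<theta> H for M :: "'w measure" and \<theta> H +
  fixes x :: real and a :: "real \<Rightarrow> real" and X :: "real \<Rightarrow> 'w \<Rightarrow> real"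
  assumes x: "0 \<le> x" and a: "\<And>r. 0 \<le> r \<Longrightarrow> r \<le> a r \<and> 0 < a r"
    and X: "\<And>r \<omega>. 0 \<le> r \<Longrightarrow> \<omega> \<in> space M \<Longrightarrow> X r \<omega> = Z (a r) x r \<omega>"
begin

lemma X_meas: "0 \<le> r \<Longrightarrow> X r \<in> borel_measurable M"
proof -
  assume r: "0 \<le> r"
  have "Z (a r) x r \<in> borel_measurable M" using a[OF r] r by (intro Z_meas x) auto
  then show ?thesis by (rule measurable_eq_on_space) (rule X[OF r, symmetric])
qed

lemma X_nonneg: "0 \<le> r \<Longrightarrow> \<omega> \<in> space M \<Longrightarrow> 0 \<le> X r \<omega>"
  using a[of r] by (simp add: X Z_nonneg x)

lemma AE_X: "AE \<omega> in M. \<forall>N::nat. \<forall>r\<in>{0..real N}. 0 < N \<longrightarrow> X r \<omega> = Z (real N) x r \<omega>"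
  using AE_compatible[OF x] AE_space
proof eventually_elim
  case (elim \<omega>)
  show ?case
  proof (intro allI ballI impI)
    fix N :: nat and r assume r: "r \<in> {0..real N}" and N: "0 < N"
    then have ar: "r \<le> a r" "0 < a r" using a[of r] by auto
    \<comment> \<open>Neither \<open>a r\<close> nor \<open>N\<close> need be the larger, and
      compatibility is available only towards a strictly larger natural number; \<open>N'\<close>
      lies above both.\<close>
    obtain N' :: nat where N': "max (a r) (real N) < real N'" using reals_Archimedean2 by blast
    have "X r \<omega> = Z (a r) x r \<omega>" using X r elim(2) by simp
    also have "\<dots> = Z (real N') x r \<omega>" using elim(1) ar N' r by auto
    also have "\<dots> = Z (real N) x r \<omega>"
      using conjunct2[OF elim(1), rule_format, of "real N" N' r] N' N r by auto
    finally show "X r \<omega> = Z (real N) x r \<omega>" .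
  qed
qed

lemma AE_X_cont: "AE \<omega> in M. continuous_on {0..} (\<lambda>r. X r \<omega>)"
  using AE_compatible[OF x] AE_X
proof eventually_elim
  case (elim \<omega>)
  show ?case unfolding continuous_on_eq_continuous_within
  proof
    fix r :: real assume r: "r \<in> {0..}"
    obtain N :: nat where N: "r < real N" using reals_Archimedean2 by blast
    then have N0: "0 < N" using r by (cases N) auto
    have "continuous_on {0..real N} (\<lambda>r. Z (real N) x r \<omega>)" using elim(1) N0 by blast
    then have "continuous_on {0..real N} (\<lambda>r. X r \<omega>)"
      by (rule continuous_on_eq) (use elim(2) N0 in auto)
    then have "continuous (at r within {0..real N}) (\<lambda>r. X r \<omega>)"
      using r N by (auto simp: continuous_on_eq_continuous_within)
    moreover have "at r within {0..real N} = at r within {0..}"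
      by (rule at_within_nhd[of _ "{..<real N}"]) (use N in auto)
    ultimately show "continuous (at r within {0..}) (\<lambda>r. X r \<omega>)" by simp
  qed
qed

lemma X_laplace:
  assumes srt: "sorted (map fst es)" and es: "\<And>r q. (r, q) \<in> set es \<Longrightarrow> 0 \<le> r \<and> 0 \<le> q"
  shows "(\<integral>\<^sup>+ \<omega>. ennreal (exp (- (\<Sum>(r, q)\<leftarrow>es. q * X r \<omega>))) \<partial>M) = ennreal (exp (- (x * level_exponent \<theta> es 0)))"
proof -
  have "bdd_above (fst ` set es)" by simp
  then obtain B where B: "\<And>r q. (r, q) \<in> set es \<Longrightarrow> r \<le> B" unfolding bdd_above_def by force
  obtain N :: nat where N: "max 0 B + 1 < real N" using reals_Archimedean2 by blast
  have N0: "0 < N" using N by (cases N) auto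
  have eN: "0 \<le> r \<and> r + 1 \<le> real N \<and> 0 \<le> q" if "(r, q) \<in> set es" for r q
    using es[OF that] B[OF that] N by auto
  have "(\<integral>\<^sup>+ \<omega>. ennreal (exp (- (\<Sum>(r, q)\<leftarrow>es. q * X r \<omega>))) \<partial>M) = (\<integral>\<^sup>+ \<omega>. ennreal (exp (- (\<Sum>(r, q)\<leftarrow>es. q * Z (real N) x r \<omega>))) \<partial>M)"
  proof (rule nn_integral_cong_AE)
    show "AE \<omega> in M. ennreal (exp (- (\<Sum>(r, q)\<leftarrow>es. q * X r \<omega>))) = ennreal (exp (- (\<Sum>(r, q)\<leftarrow>es. q * Z (real N) x r \<omega>)))"
      using AE_X
    proof eventually_elim
      case (elim \<omega>)
      have "(\<Sum>(r, q)\<leftarrow>es. q * X r \<omega>) = (\<Sum>(r, q)\<leftarrow>es. q * Z (real N) x r \<omega>)"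
      proof (rule arg_cong[where f=sum_list], rule map_cong[OF refl])
        fix e assume "e \<in> set es"
        moreover obtain r q where "e = (r, q)" by fastforce
        ultimately have e: "e = (r, q)" "(r, q) \<in> set es" by auto
        have "r \<in> {0..real N}" using eN[OF e(2)] by auto
        then have "X r \<omega> = Z (real N) x r \<omega>" using elim N0 by blast
        then show "(case e of (r, q) \<Rightarrow> q * X r \<omega>) = (case e of (r, q) \<Rightarrow> q * Z (real N) x r \<omega>)" by (simp add: e)
      qed
      then show ?case by simp
    qed
  qed
  also have "\<dots> = ennreal (exp (- (x * level_exponent \<theta> es 0)))"
    using N0 by (intro Z_laplace x srt eN) auto
  finally show ?thesis .
qed

definition W :: "(real \<times> real) list \<Rightarrow> 'w \<Rightarrow> ennreal" where
  "W es \<omega> = ennreal (exp (- (\<Sum>(r, q)\<leftarrow>es. q * X r \<omega>)))"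

lemma W_Cons: "W ((r, q) # es) \<omega> = W es \<omega> * ennreal (exp (- (q * X r \<omega>)))"
  by (simp add: W_def exp_add[symmetric] ennreal_mult[symmetric])

lemma W_meas: "(\<And>r q. (r, q) \<in> set es \<Longrightarrow> 0 \<le> r) \<Longrightarrow> W es \<in> borel_measurable M"
proof (induction es)
  case Nil
  then show ?case by (simp add: W_def[abs_def])
next
  case (Cons e es)
  obtain r q where e: "e = (r, q)" by fastforce
  have "0 \<le> r" if "(r, q) \<in> set es" for r q using Cons.prems[of r q] that by auto
  note [measurable] = Cons.IH[OF this]
  have [measurable]: "X r \<in> borel_measurable M" using Cons.prems[of r q] e by (intro X_meas) auto
  have "(\<lambda>\<omega>. W es \<omega> * ennreal (exp (- (q * X r \<omega>)))) \<in> borel_measurable M" by measurable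
  then show ?case by (simp add: e W_Cons[abs_def])
qed

lemma W_le: "\<omega> \<in> space M \<Longrightarrow> (\<And>r q. (r, q) \<in> set es \<Longrightarrow> 0 \<le> r \<and> 0 \<le> q) \<Longrightarrow> W es \<omega> \<le> 1"
proof -
  assume w: "\<omega> \<in> space M" and es: "\<And>r q. (r, q) \<in> set es \<Longrightarrow> 0 \<le> r \<and> 0 \<le> q"
  have "0 \<le> (\<Sum>(r, q)\<leftarrow>es. q * X r \<omega>)"
    using es X_nonneg[OF _ w] by (intro sum_list_nonneg) (auto intro!: mult_nonneg_nonneg)
  then show ?thesis by (simp add: W_def)
qed

lemma K_X_meas:
  assumes s: "0 \<le> s" and r: "0 \<le> r" and B: "B \<in> sets borel_nonneg" and Xs: "X s \<in> F \<rightarrow>\<^sub>M borel_nonneg"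
  shows "(\<lambda>\<omega>. emeasure (K r (X s \<omega>)) B) \<in> borel_measurable F" "(\<lambda>\<omega>. measure (K r (X s \<omega>)) B) \<in> borel_measurable F"
  using measurable_compose[OF Xs measurable_emeasure_kernel[OF measurable_prob_algebraD[OF K_measurable[OF r]] B]]
    measurable_compose[OF Xs measurable_compose[OF K_measurable[OF r] measurable_measure_prob_algebra[OF B]]] by auto

lemma X_nonneg_meas: "0 \<le> s \<Longrightarrow> X s \<in> M \<rightarrow>\<^sub>M borel_nonneg"
  by (intro borel_nonneg_measurableI X_meas X_nonneg)

text \<open>Both sides are joint Laplace transforms, and \<open>level_exponent_append\<close>
  equates their exponents.\<close>

lemma markov_laplace:
  assumes s: "0 \<le> s" and r: "0 \<le> r" and q: "0 \<le> q"
    and es: "\<And>r q. (r, q) \<in> set es \<Longrightarrow> 0 \<le> r \<and> r \<le> s \<and> 0 \<le> q"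
  shows "(\<integral>\<^sup>+ \<omega>. W es \<omega> * ennreal (exp (- (q * X (s + r) \<omega>))) \<partial>M)
    = (\<integral>\<^sup>+ \<omega>. W es \<omega> * ennreal (exp (- (feller_flow \<theta> q r * X s \<omega>))) \<partial>M)"
proof -
  \<comment> \<open>The list comes in any order, since \<open>markov_cylinder\<close> adds times at
    its front, while the exponents need increasing levels; the weighted sum does not see the
    order.\<close>
  define es' where "es' = sort_key fst es"
  have set': "set es' = set es" by (simp add: es'_def)
  have Wes: "W es \<omega> * ennreal (exp (- (p * X u \<omega>))) = ennreal (exp (- (\<Sum>(r, q)\<leftarrow>es' @ [(u, p)]. q * X r \<omega>)))" for p u \<omega>
  proof -
    have "(\<Sum>(r, q)\<leftarrow>es'. q * X r \<omega>) = (\<Sum>(r, q)\<leftarrow>es. q * X r \<omega>)"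
      unfolding sum_mset_sum_list[symmetric] mset_map es'_def mset_sort ..
    then show ?thesis by (simp add: W_def exp_add[symmetric] ennreal_mult[symmetric])
  qed
  have srt: "sorted (map fst es')" by (simp add: es'_def)
  have sa: "sorted (map fst (es' @ [(u, p)]))" if "s \<le> u" for u p
    using srt es that by (auto simp: sorted_append set' dest!: es)
  have "(\<integral>\<^sup>+ \<omega>. W es \<omega> * ennreal (exp (- (q * X (s + r) \<omega>))) \<partial>M) = ennreal (exp (- (x * level_exponent \<theta> (es' @ [(s + r, q)]) 0)))"
    unfolding Wes by (rule X_laplace[OF sa]) (use es r s q in \<open>auto simp: set'\<close>)
  also have "level_exponent \<theta> (es' @ [(s + r, q)]) 0 = level_exponent \<theta> (es' @ [(s, feller_flow \<theta> q r)]) 0"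
    by (rule level_exponent_append[OF srt _ q r s]) (use es in \<open>auto simp: set'\<close>)
  also have "ennreal (exp (- (x * level_exponent \<theta> (es' @ [(s, feller_flow \<theta> q r)]) 0)))
      = (\<integral>\<^sup>+ \<omega>. W es \<omega> * ennreal (exp (- (feller_flow \<theta> q r * X s \<omega>))) \<partial>M)"
    unfolding Wes by (rule X_laplace[OF sa, symmetric]) (use es r s feller_flow_nonneg[OF q r] in \<open>auto simp: set'\<close>)
  finally show ?thesis .
qed

text \<open>The future is turned from exponentials into indicators: under the weight
  \<open>W es\<close>, the law of \<open>X (s + r)\<close> and the law of \<open>X s\<close>
  followed by the kernel have equal Laplace transforms.\<close>

lemma markov_weight:
  assumes s: "0 \<le> s" and r: "0 \<le> r" and B: "B \<in> sets borel_nonneg"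
    and es: "\<And>r q. (r, q) \<in> set es \<Longrightarrow> 0 \<le> r \<and> r \<le> s \<and> 0 \<le> q"
  shows "(\<integral>\<^sup>+ \<omega>. W es \<omega> * indicator B (X (s + r) \<omega>) \<partial>M) = (\<integral>\<^sup>+ \<omega>. W es \<omega> * emeasure (K r (X s \<omega>)) B \<partial>M)"
proof -
  have Xsr[measurable]: "X (s + r) \<in> M \<rightarrow>\<^sub>M borel_nonneg" and Xs[measurable]: "X s \<in> M \<rightarrow>\<^sub>M borel_nonneg"
    using s r by (auto intro!: X_nonneg_meas)
  have es0: "0 \<le> r" if "(r, q) \<in> set es" for r q using es[OF that] by blast
  have [measurable]: "W es \<in> borel_measurable M" by (rule W_meas[OF es0])
  have [measurable]: "(\<lambda>y. y) \<in> borel_nonneg \<rightarrow>\<^sub>M borel" by (rule id_borel_nonneg)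
  have Wle: "W es \<omega> \<le> 1" if "\<omega> \<in> space M" for \<omega> by (rule W_le[OF that]) (use es in blast)
  define c where "c = (\<integral>\<^sup>+ \<omega>. W es \<omega> \<partial>M)"
  have c1: "c \<le> 1"
  proof -
    have "c \<le> (\<integral>\<^sup>+ \<omega>. 1 \<partial>M)" unfolding c_def by (intro nn_integral_mono Wle)
    then show ?thesis by (simp add: emeasure_space_1)
  qed
  define m1 where "m1 = distr (density M (W es)) borel_nonneg (X (s + r))"
  define m2 where "m2 = distr (density M (W es)) borel_nonneg (X s) \<bind> K r"
  have Kr: "K r \<in> distr (density M (W es)) borel_nonneg (X s) \<rightarrow>\<^sub>M subprob_algebra borel_nonneg"
    using measurable_prob_algebraD[OF K_measurable[OF r]] by simp
  have n1: "(\<integral>\<^sup>+ y. f y \<partial>m1) = (\<integral>\<^sup>+ \<omega>. W es \<omega> * f (X (s + r) \<omega>) \<partial>M)"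
    if [measurable]: "f \<in> borel_measurable borel_nonneg" for f :: "real \<Rightarrow> ennreal"
    unfolding m1_def by (simp add: nn_integral_distr nn_integral_density)
  have n2: "(\<integral>\<^sup>+ y. f y \<partial>m2) = (\<integral>\<^sup>+ \<omega>. W es \<omega> * (\<integral>\<^sup>+ y. f y \<partial>K r (X s \<omega>)) \<partial>M)"
    if f[measurable]: "f \<in> borel_measurable borel_nonneg" for f :: "real \<Rightarrow> ennreal"
  proof -
    have [measurable]: "(\<lambda>z. \<integral>\<^sup>+ y. f y \<partial>K r z) \<in> borel_measurable borel_nonneg"
      by (rule measurable_compose[OF measurable_prob_algebraD[OF K_measurable[OF r]] nn_integral_measurable_subprob_algebra[OF f]])
    show ?thesis unfolding m2_def
      by (subst nn_integral_bind[OF f Kr]) (simp add: nn_integral_distr nn_integral_density)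
  qed
  have nonempty: "space (distr (density M (W es)) borel_nonneg (X s)) \<noteq> {}" by simp
  have sets1: "sets m1 = sets borel_nonneg" and sets2: "sets m2 = sets borel_nonneg"
    using sets_bind_measurable[OF Kr nonempty] by (auto simp: m1_def m2_def)
  have id: "(\<lambda>y. y) \<in> m \<rightarrow>\<^sub>M borel" if "sets m = sets borel_nonneg" for m :: "real measure"
    using id_borel_nonneg by (simp add: measurable_cong_sets[OF that refl])
  have lap: "(\<integral>\<^sup>+ y. ennreal (exp (- (real n * y))) \<partial>m1) = (\<integral>\<^sup>+ y. ennreal (exp (- (real n * y))) \<partial>m2)" for n :: nat
  proof -
    have "(\<integral>\<^sup>+ y. ennreal (exp (- (real n * y))) \<partial>m1) = (\<integral>\<^sup>+ \<omega>. W es \<omega> * ennreal (exp (- (real n * X (s + r) \<omega>))) \<partial>M)"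
      by (rule n1) measurable
    also have "\<dots> = (\<integral>\<^sup>+ \<omega>. W es \<omega> * ennreal (exp (- (feller_flow \<theta> (real n) r * X s \<omega>))) \<partial>M)"
      by (rule markov_laplace[OF s r _ es]) auto
    also have "\<dots> = (\<integral>\<^sup>+ \<omega>. W es \<omega> * (\<integral>\<^sup>+ y. ennreal (exp (- (real n * y))) \<partial>K r (X s \<omega>)) \<partial>M)"
      by (rule nn_integral_cong) (use K_laplace[OF r X_nonneg[OF s], of _ "real n"] in \<open>auto simp: mult.commute\<close>)
    also have "\<dots> = (\<integral>\<^sup>+ y. ennreal (exp (- (real n * y))) \<partial>m2)" by (rule n2[symmetric]) measurable
    finally show ?thesis .
  qed
  have fin: "emeasure m1 (space m1) = c" "emeasure m2 (space m2) = c"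
  proof -
    have "(\<integral>\<^sup>+ y. 1 \<partial>m1) = (\<integral>\<^sup>+ \<omega>. W es \<omega> * 1 \<partial>M)" by (rule n1) simp
    then show 1: "emeasure m1 (space m1) = c" by (simp add: c_def)
    show "emeasure m2 (space m2) = c" using lap[of 0] 1 by simp
  qed
  have eq: "distr m1 borel (\<lambda>y. y) = distr m2 borel (\<lambda>y. y)"
  proof (rule laplace_unique)
    have f: "finite_measure (distr m borel (\<lambda>y. y))" if "sets m = sets borel_nonneg" "emeasure m (space m) = c" for m :: "real measure"
      using c1 that by (intro finite_measureI) (auto simp: emeasure_distr[OF id[OF that(1)]] top_unique)
    show "finite_measure (distr m1 borel (\<lambda>y. y))" "finite_measure (distr m2 borel (\<lambda>y. y))"
      using f sets1 sets2 fin by auto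
    have A: "AE y in distr m borel (\<lambda>y. y). 0 \<le> y" if "sets m = sets borel_nonneg" for m :: "real measure"
      using sets_eq_imp_space_eq[OF that] by (subst AE_distr_iff[OF id[OF that]]) (auto intro!: AE_I2)
    show "AE y in distr m1 borel (\<lambda>y. y). 0 \<le> y" "AE y in distr m2 borel (\<lambda>y. y). 0 \<le> y"
      by (rule A[OF sets1], rule A[OF sets2])
    fix n :: nat
    have L: "(\<integral>\<^sup>+ y. ennreal (exp (- (real n * y))) \<partial>distr m borel (\<lambda>y. y)) = (\<integral>\<^sup>+ y. ennreal (exp (- (real n * y))) \<partial>m)"
      if "sets m = sets borel_nonneg" for m :: "real measure"
      by (subst nn_integral_distr[OF id[OF that]]) auto
    show "(\<integral>y. exp (- (real n * y)) \<partial>distr m1 borel (\<lambda>y. y)) = (\<integral>y. exp (- (real n * y)) \<partial>distr m2 borel (\<lambda>y. y))"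
      using lap[of n] by (subst (1 2) integral_eq_nn_integral) (auto simp: L[OF sets1] L[OF sets2])
  qed auto
  have B': "B \<in> sets borel" "B \<subseteq> {0..}" using B by (auto simp: borel_nonneg_sets)
  have em: "emeasure (distr m borel (\<lambda>y. y)) B = emeasure m B" if "sets m = sets borel_nonneg" for m :: "real measure"
  proof -
    have "B \<inter> space m = B" using sets_eq_imp_space_eq[OF that] B'(2) by auto
    then show ?thesis using emeasure_distr[OF id[OF that] B'(1)] by simp
  qed
  have "emeasure m1 B = emeasure m2 B" using em[OF sets1] em[OF sets2] eq by simp
  then have "(\<integral>\<^sup>+ y. indicator B y \<partial>m1) = (\<integral>\<^sup>+ y. indicator B y \<partial>m2)" using B by (simp add: sets1 sets2)
  moreover have "(\<integral>\<^sup>+ y. indicator B y \<partial>m1) = (\<integral>\<^sup>+ \<omega>. W es \<omega> * indicator B (X (s + r) \<omega>) \<partial>M)"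
    by (rule n1) (use B in measurable)
  moreover have "(\<integral>\<^sup>+ y. indicator B y \<partial>m2) = (\<integral>\<^sup>+ \<omega>. W es \<omega> * (\<integral>\<^sup>+ y. indicator B y \<partial>K r (X s \<omega>)) \<partial>M)"
    by (rule n2) (use B in measurable)
  moreover have "(\<integral>\<^sup>+ y. indicator B y \<partial>K r z) = emeasure (K r z) B" for z using B by (simp add: K_sets)
  ultimately show ?thesis by simp
qed

definition cyl :: "(real \<times> real set) list \<Rightarrow> 'w \<Rightarrow> ennreal" where
  "cyl js \<omega> = (\<Prod>(v, C)\<leftarrow>js. indicator C (X v \<omega>))"

lemma cyl_meas:
  "(\<And>v C. (v, C) \<in> set js \<Longrightarrow> 0 \<le> v \<and> C \<in> sets borel) \<Longrightarrow> cyl js \<in> borel_measurable M"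
proof (induction js)
  case Nil
  then show ?case by (simp add: cyl_def[abs_def])
next
  case (Cons e js)
  obtain v C where e: "e = (v, C)" by fastforce
  have "0 \<le> v \<and> C \<in> sets borel" if "(v, C) \<in> set js" for v C using Cons.prems[of v C] that by auto
  note [measurable] = Cons.IH[OF this]
  have [measurable]: "X v \<in> borel_measurable M" "C \<in> sets borel" using Cons.prems[of v C] e by (auto intro!: X_meas)
  have "(\<lambda>\<omega>. indicator C (X v \<omega>) * cyl js \<omega>) \<in> borel_measurable M" by measurable
  then show ?case by (simp add: e cyl_def[abs_def])
qed

lemma cyl_le: "cyl js \<omega> \<le> 1"
  by (induction js) (auto simp: cyl_def indicator_def)

text \<open>The past is turned from exponentials into indicators, one time per induction step. The
  list \<open>es\<close> is kept general because the step for \<open>v\<close> needs the hypothesis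
  with the additional exponential of \<open>X v\<close>.\<close>

lemma markov_cylinder:
  assumes s: "0 \<le> s" and r: "0 \<le> r" and B: "B \<in> sets borel_nonneg"
    and es: "\<And>r q. (r, q) \<in> set es \<Longrightarrow> 0 \<le> r \<and> r \<le> s \<and> 0 \<le> q"
    and js: "\<And>v C. (v, C) \<in> set js \<Longrightarrow> 0 \<le> v \<and> v \<le> s \<and> C \<in> sets borel"
  shows "(\<integral>\<^sup>+ \<omega>. cyl js \<omega> * W es \<omega> * indicator B (X (s + r) \<omega>) \<partial>M)
    = (\<integral>\<^sup>+ \<omega>. cyl js \<omega> * W es \<omega> * emeasure (K r (X s \<omega>)) B \<partial>M)"
  using es js
proof (induction js arbitrary: es)
  case Nil
  then show ?case using markov_weight[OF s r B Nil.prems(1)] by (simp add: cyl_def)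
next
  case (Cons e js)
  obtain v C where e: "e = (v, C)" by fastforce
  have v: "0 \<le> v" "v \<le> s" "C \<in> sets borel" using Cons.prems(2)[of v C] e by auto
  have js: "0 \<le> v \<and> v \<le> s \<and> C \<in> sets borel" if "(v, C) \<in> set js" for v C using Cons.prems(2)[of v C] that by auto
  have [measurable]: "X (s + r) \<in> M \<rightarrow>\<^sub>M borel_nonneg" "X s \<in> M \<rightarrow>\<^sub>M borel_nonneg" "B \<in> sets borel_nonneg"
    using s r B by (auto intro!: X_nonneg_meas)
  have [measurable]: "W es \<in> borel_measurable M" by (rule W_meas) (use Cons.prems(1) in blast)
  have [measurable]: "cyl js \<in> borel_measurable M" by (rule cyl_meas) (use js in blast)
  have [measurable]: "(\<lambda>\<omega>. emeasure (K r (X s \<omega>)) B) \<in> borel_measurable M"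
    by (rule K_X_meas(1)[OF s r B]) measurable
  have We: "W es \<omega> \<le> 1" if "\<omega> \<in> space M" for \<omega> by (rule W_le[OF that]) (use Cons.prems(1) in blast)
  have Ke: "emeasure (K r (X s \<omega>)) B \<le> 1" if "\<omega> \<in> space M" for \<omega>
    using K_prob[OF r X_nonneg[OF s that]] by (rule prob_space.measure_le_1)
  define G where "G \<omega> = cyl js \<omega> * W es \<omega> * indicator B (X (s + r) \<omega>)" for \<omega>
  define G' where "G' \<omega> = cyl js \<omega> * W es \<omega> * emeasure (K r (X s \<omega>)) B" for \<omega>
  have "(\<integral>\<^sup>+ \<omega>. G \<omega> * indicator C (X v \<omega>) \<partial>M) = (\<integral>\<^sup>+ \<omega>. G' \<omega> * indicator C (X v \<omega>) \<partial>M)"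
  proof (rule laplace_weight_unique[OF prob_space_axioms])
    show "G \<in> borel_measurable M" "G' \<in> borel_measurable M" unfolding G_def[abs_def] G'_def[abs_def] by measurable
    have prod: "p * q * t \<le> 1" if "p \<le> 1" "q \<le> 1" "t \<le> 1" for p q t :: ennreal
      using mult_mono[OF mult_mono[OF that(1,2)] that(3)] by simp
    show "G \<omega> \<le> 1" if "\<omega> \<in> space M" for \<omega>
      unfolding G_def by (intro prod cyl_le We[OF that]) (simp add: indicator_def)
    show "G' \<omega> \<le> 1" if "\<omega> \<in> space M" for \<omega>
      unfolding G'_def by (intro prod cyl_le We[OF that] Ke[OF that])
    show "X v \<in> borel_measurable M" by (rule X_meas[OF v(1)])
    show "0 \<le> X v \<omega>" if "\<omega> \<in> space M" for \<omega> by (rule X_nonneg[OF v(1) that])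
    fix n :: nat
    \<comment> \<open>The exponential at \<open>v\<close> joins the weights, so the induction
      hypothesis provides the Laplace transforms of \<open>X v\<close> under the two weights
      \<open>G\<close> and \<open>G'\<close>.\<close>
    have esn: "0 \<le> r' \<and> r' \<le> s \<and> 0 \<le> q" if "(r', q) \<in> set ((v, real n) # es)" for r' q
      using that v Cons.prems(1)[of r' q] by auto
    show "(\<integral>\<^sup>+ \<omega>. G \<omega> * ennreal (exp (- (real n * X v \<omega>))) \<partial>M) = (\<integral>\<^sup>+ \<omega>. G' \<omega> * ennreal (exp (- (real n * X v \<omega>))) \<partial>M)"
      using Cons.IH[of "(v, real n) # es", OF esn js] unfolding G_def G'_def W_Cons by (simp add: mult_ac)
  qed (rule v(3))
  then show ?case by (simp add: e cyl_def G_def G'_def mult_ac)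
qed

text \<open>Cylinder events are stable under intersection and generate the natural filtration. The
  two sides are finite measures with densities \<open>g1\<close> and \<open>g2\<close> that agree on
  cylinders, hence on the generated sigma-algebra.\<close>

lemma markov_set:
  assumes s: "0 \<le> s" and r: "0 \<le> r" and B: "B \<in> sets borel_nonneg" and A: "A \<in> sets (natural_filtration M X s)"
  shows "(\<integral>\<^sup>+ \<omega>. indicator A \<omega> * indicator B (X (s + r) \<omega>) \<partial>M) = (\<integral>\<^sup>+ \<omega>. indicator A \<omega> * emeasure (K r (X s \<omega>)) B \<partial>M)"
    "A \<in> sets M"
proof -
  define gen where "gen = (\<Union>v\<in>{0..s}. {X v -` B \<inter> space M | B. B \<in> sets borel})"
  have gen: "gen \<subseteq> sets M" unfolding gen_def using X_meas by (auto intro: measurable_sets)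
  have genP: "gen \<subseteq> Pow (space M)" using gen sets.space_closed by blast
  have F: "sets (natural_filtration M X s) = sigma_sets (space M) gen"
    unfolding natural_filtration_def gen_def[symmetric] using genP by simp
  define cs where "cs js = {\<omega> \<in> space M. \<forall>(v, C)\<in>set js. X v \<omega> \<in> C}" for js :: "(real \<times> real set) list"
  define \<C> where "\<C> = {cs js | js. \<forall>(v, C)\<in>set js. 0 \<le> v \<and> v \<le> s \<and> C \<in> sets borel}"
  have csM: "cs js \<in> sets M" if "\<forall>(v, C)\<in>set js. 0 \<le> v \<and> v \<le> s \<and> C \<in> sets borel" for js
    using that
  proof (induction js)
    case Nil
    then show ?case by (simp add: cs_def)
  next
    case (Cons e js)
    obtain v C where e: "e = (v, C)" by fastforce
    have "cs (e # js) = (X v -` C \<inter> space M) \<inter> cs js" by (auto simp: cs_def e)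
    moreover have "X v -` C \<inter> space M \<in> sets M" using Cons.prems e by (intro measurable_sets[OF X_meas]) auto
    ultimately show ?case using Cons by auto
  qed
  have CM: "\<C> \<subseteq> sets M" unfolding \<C>_def using csM by auto
  have "gen \<subseteq> \<C>"
  proof
    fix A assume "A \<in> gen"
    then obtain v C where "v \<in> {0..s}" "C \<in> sets borel" "A = X v -` C \<inter> space M" by (auto simp: gen_def)
    then show "A \<in> \<C>" unfolding \<C>_def cs_def by (intro CollectI exI[of _ "[(v, C)]"]) auto
  qed
  then have AC: "A \<in> sigma_sets (space M) \<C>" using A sigma_sets_mono'[of gen \<C>] unfolding F by blast
  have IC: "Int_stable \<C>"
  proof (rule Int_stableI)
    fix P Q assume "P \<in> \<C>" "Q \<in> \<C>"
    then obtain js ks where "P = cs js" "Q = cs ks" "\<forall>(v, C)\<in>set js. 0 \<le> v \<and> v \<le> s \<and> C \<in> sets borel" "\<forall>(v, C)\<in>set ks. 0 \<le> v \<and> v \<le> s \<and> C \<in> sets borel"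
      by (auto simp: \<C>_def)
    then show "P \<inter> Q \<in> \<C>" unfolding \<C>_def by (intro CollectI exI[of _ "js @ ks"]) (auto simp: cs_def)
  qed
  have [measurable]: "X (s + r) \<in> M \<rightarrow>\<^sub>M borel_nonneg" "X s \<in> M \<rightarrow>\<^sub>M borel_nonneg" "B \<in> sets borel_nonneg"
    using s r B by (auto intro!: X_nonneg_meas)
  define g1 where "g1 \<omega> = (indicator B (X (s + r) \<omega>) :: ennreal)" for \<omega>
  define g2 where "g2 \<omega> = emeasure (K r (X s \<omega>)) B" for \<omega>
  have [measurable]: "g1 \<in> borel_measurable M" "g2 \<in> borel_measurable M"
    unfolding g1_def[abs_def] g2_def[abs_def] using K_X_meas(1)[OF s r B] by measurable
  have cyl: "emeasure (density M g1) (cs js) = emeasure (density M g2) (cs js)"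
    if js: "\<forall>(v, C)\<in>set js. 0 \<le> v \<and> v \<le> s \<and> C \<in> sets borel" for js
  proof -
    have c: "cyl js \<omega> = indicator (cs js) \<omega>" if "\<omega> \<in> space M" for \<omega>
      using that unfolding cyl_def cs_def by (induction js) (auto simp: indicator_def)
    have "(\<integral>\<^sup>+ \<omega>. cyl js \<omega> * W [] \<omega> * indicator B (X (s + r) \<omega>) \<partial>M) = (\<integral>\<^sup>+ \<omega>. cyl js \<omega> * W [] \<omega> * emeasure (K r (X s \<omega>)) B \<partial>M)"
      by (rule markov_cylinder[OF s r B]) (use js in auto)
    then have "(\<integral>\<^sup>+ \<omega>. g1 \<omega> * indicator (cs js) \<omega> \<partial>M) = (\<integral>\<^sup>+ \<omega>. g2 \<omega> * indicator (cs js) \<omega> \<partial>M)"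
      by (simp add: W_def g1_def g2_def c mult.commute cong: nn_integral_cong)
    then show ?thesis using csM[OF js] by (simp add: emeasure_density)
  qed
  have fin: "emeasure (density M g1) (space M) \<noteq> \<infinity>"
  proof -
    have "emeasure (density M g1) (space M) = (\<integral>\<^sup>+ \<omega>. g1 \<omega> * indicator (space M) \<omega> \<partial>M)" by (simp add: emeasure_density)
    also have "\<dots> \<le> (\<integral>\<^sup>+ \<omega>. 1 \<partial>M)" by (rule nn_integral_mono) (simp add: g1_def indicator_def)
    finally show ?thesis by (auto simp: emeasure_space_1 top_unique)
  qed
  have sp: "emeasure (density M g1) (space M) = emeasure (density M g2) (space M)"
    using cyl[of "[]"] by (simp add: cs_def)
  have PM: "\<C> \<subseteq> Pow (space M)" using CM sets.space_closed by blast
  have sub: "sigma_sets (space M) \<C> \<subseteq> sets M" by (rule sets.sigma_sets_subset[OF CM])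
  have "emeasure (density M g1) A = emeasure (density M g2) A"
    using IC PM AC
  proof (induction A rule: sigma_sets_induct_disjoint)
    case (basic A)
    then show ?case using cyl by (auto simp: \<C>_def)
  next
    case (compl A)
    have A: "A \<in> sets M" using compl(1) sub by blast
    have f1: "emeasure (density M g1) A \<noteq> \<infinity>"
      using fin emeasure_mono[of A "space M" "density M g1"] sets.sets_into_space[OF A] by (auto simp: top_unique)
    have "emeasure (density M g1) (space (density M g1) - A) = emeasure (density M g1) (space (density M g1)) - emeasure (density M g1) A"
      using A f1 by (intro emeasure_compl) auto
    moreover have "emeasure (density M g2) (space (density M g2) - A) = emeasure (density M g2) (space (density M g2)) - emeasure (density M g2) A"
      using A f1 compl(2) by (intro emeasure_compl) auto
    ultimately show ?case using compl(2) sp by simp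
  next
    case (union A)
    have "range A \<subseteq> sets M" using union(2) sub by blast
    then show ?case using suminf_emeasure[of A "density M g1"] suminf_emeasure[of A "density M g2"] union by simp
  qed simp
  moreover show AM: "A \<in> sets M" using AC sub by blast
  ultimately show "(\<integral>\<^sup>+ \<omega>. indicator A \<omega> * indicator B (X (s + r) \<omega>) \<partial>M) = (\<integral>\<^sup>+ \<omega>. indicator A \<omega> * emeasure (K r (X s \<omega>)) B \<partial>M)"
    by (simp add: emeasure_density g1_def[symmetric] g2_def[symmetric] mult.commute)
qed

lemma markov: "markov_process M K X"
  unfolding markov_process_def
proof (intro conjI allI impI ballI)
  show "prob_space M" by (rule prob_space_axioms)
  show "transition_semigroup K" by (rule K_semigroup)
  show "X r \<in> M \<rightarrow>\<^sub>M borel_nonneg" if "0 \<le> r" for r by (rule X_nonneg_meas[OF that])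
  fix s r :: real and B assume s: "0 \<le> s" and r: "0 \<le> r" and B: "B \<in> sets borel_nonneg"
  let ?F = "natural_filtration M X s"
  have spF: "space ?F = space M" unfolding natural_filtration_def by (rule space_measure_of) auto
  have sub: "subalgebra M ?F" using markov_set(2)[OF s r B] spF by (auto simp: subalgebra_def)
  interpret finite_measure_subalgebra M ?F by unfold_locales (rule sub)
  have XF: "X s \<in> ?F \<rightarrow>\<^sub>M borel_nonneg"
  proof (rule borel_nonneg_measurableI)
    show "X s \<in> borel_measurable ?F"
    proof (rule measurableI)
      fix C :: "real set" assume C: "C \<in> sets borel"
      have "X s -` C \<inter> space M \<in> (\<Union>v\<in>{0..s}. {X v -` B \<inter> space M | B. B \<in> sets borel})"
        using s C by (intro UN_I[of s]) auto
      then show "X s -` C \<inter> space ?F \<in> sets ?F"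
        unfolding spF unfolding natural_filtration_def by (subst sets_measure_of) (auto intro: sigma_sets.Basic)
    qed auto
    show "0 \<le> X s \<omega>" if "\<omega> \<in> space ?F" for \<omega> using that spF X_nonneg[OF s] by auto
  qed
  have [measurable]: "X (s + r) \<in> M \<rightarrow>\<^sub>M borel_nonneg" "B \<in> sets borel_nonneg" using s r B by (auto intro!: X_nonneg_meas)
  define f where "f \<omega> = (indicator B (X (s + r) \<omega>) :: real)" for \<omega>
  define g where "g \<omega> = measure (K r (X s \<omega>)) B" for \<omega>
  have fm[measurable]: "f \<in> borel_measurable M" unfolding f_def[abs_def] by measurable
  have gF: "g \<in> borel_measurable ?F" unfolding g_def[abs_def] by (rule K_X_meas(2)[OF s r B XF])
  have gm[measurable]: "g \<in> borel_measurable M" by (rule measurable_from_subalg[OF sub gF])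
  have g: "0 \<le> g \<omega>" "g \<omega> \<le> 1" "ennreal (g \<omega>) = emeasure (K r (X s \<omega>)) B" if "\<omega> \<in> space M" for \<omega>
  proof -
    interpret K: prob_space "K r (X s \<omega>)" by (rule K_prob[OF r X_nonneg[OF s that]])
    show "0 \<le> g \<omega>" "g \<omega> \<le> 1" "ennreal (g \<omega>) = emeasure (K r (X s \<omega>)) B"
      by (auto simp: g_def K.emeasure_eq_measure)
  qed
  have "AE \<omega> in M. real_cond_exp M ?F f \<omega> = g \<omega>"
  \<comment> \<open>\<open>g\<close> depends on \<omega> only through \<open>X s\<close>, so it is
    measurable for the natural filtration; equality of the integrals over its events is
    \<open>markov_set\<close>.\<close>
  proof (rule real_cond_exp_charact[OF _ _ _ gF])
    show "integrable M f" by (rule integrable_const_bound[of _ 1]) (auto simp: f_def indicator_def)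
    show "integrable M g" by (rule integrable_const_bound[of _ 1]) (auto intro!: AE_I2 simp: g abs_of_nonneg)
    fix A assume A: "A \<in> sets ?F"
    have [measurable]: "A \<in> sets M" by (rule markov_set(2)[OF s r B A])
    have "(\<integral>\<omega>\<in>A. f \<omega> \<partial>M) = enn2real (\<integral>\<^sup>+ \<omega>. ennreal (indicator A \<omega> * f \<omega>) \<partial>M)"
      unfolding set_lebesgue_integral_def real_scaleR_def by (rule integral_eq_nn_integral) (auto simp: f_def)
    also have "(\<integral>\<^sup>+ \<omega>. ennreal (indicator A \<omega> * f \<omega>) \<partial>M) = (\<integral>\<^sup>+ \<omega>. indicator A \<omega> * indicator B (X (s + r) \<omega>) \<partial>M)"
      by (rule nn_integral_cong) (auto simp: f_def indicator_def)
    also have "\<dots> = (\<integral>\<^sup>+ \<omega>. indicator A \<omega> * emeasure (K r (X s \<omega>)) B \<partial>M)" by (rule markov_set(1)[OF s r B A])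
    also have "\<dots> = (\<integral>\<^sup>+ \<omega>. ennreal (indicator A \<omega> * g \<omega>) \<partial>M)"
      by (rule nn_integral_cong) (auto simp: g(3) indicator_def)
    also have "enn2real \<dots> = (\<integral>\<omega>\<in>A. g \<omega> \<partial>M)"
      unfolding set_lebesgue_integral_def real_scaleR_def by (rule integral_eq_nn_integral[symmetric]) (auto intro!: AE_I2 mult_nonneg_nonneg g(1))
    finally show "(\<integral>\<omega>\<in>A. f \<omega> \<partial>M) = (\<integral>\<omega>\<in>A. g \<omega> \<partial>M)" .
  qed
  then show "AE \<omega> in M. real_cond_exp M ?F (\<lambda>\<omega>. indicator B (X (s + r) \<omega>)) \<omega> = measure (K r (X s \<omega>)) B"
    by (simp add: f_def[abs_def] g_def)
qed

end

theorem theorem3p1: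
  fixes M :: "'w measure"
    and \<theta> x :: real
    and H :: "real \<Rightarrow> real \<Rightarrow> 'w \<Rightarrow> real"
    and a :: "real \<Rightarrow> real"
    and Z :: "real \<Rightarrow> 'w \<Rightarrow> real"
  assumes "prob_space M"
    and "0 < x"
    and "height_process M \<theta> H"
    and "\<And>r. 0 \<le> r \<Longrightarrow> r \<le> a r \<and> 0 < a r"
    and "\<And>r \<omega>. 0 \<le> r \<Longrightarrow> \<omega> \<in> space M \<Longrightarrow>
           Z r \<omega> = local_time_at_inverse (a r) (\<lambda>s. H (a r) s \<omega>) x r"
  shows "cb_process M (\<lambda>u. 2 * u\<^sup>2 + 4 * \<theta> * u) Z"
proof -
  interpret h: height M \<theta> H
    using assms(1,3) by (intro height.intro height_axioms.intro)
  interpret level_process M \<theta> H x a Z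
    by unfold_locales (use assms in \<open>auto simp: h.Z_def\<close>)
  have "(\<integral>y. exp (- q * y) \<partial>h.K r z) = exp (- z * cb_exponent (branching \<theta>) q r)"
    if "0 \<le> r" "0 \<le> q" "0 \<le> z" for r q z
  proof -
    have [measurable]: "(\<lambda>y. y) \<in> borel_measurable (h.K r z)"
      using id_borel_nonneg measurable_cong_sets[OF h.K_sets refl] by blast
    have "(\<integral>y. exp (- q * y) \<partial>h.K r z) = enn2real (\<integral>\<^sup>+ y. ennreal (exp (- (q * y))) \<partial>h.K r z)"
      by (subst integral_eq_nn_integral) auto
    then show ?thesis using h.K_laplace[OF that(1,3,2)] that by (simp add: cb_exponent_eq)
  qed
  then show ?thesis
    unfolding cb_process_def using AE_X_cont markov by blast
qed

end
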